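(* Let $\Omega\subset\mathbb{R}^2$ be non-empty, open and simply connected. (i) If $\lambda(\Omega)>0$, then for all $c>0$, $$w_{\Omega}(x)\le \frac{32}{3}\,d_{\Omega}(x)^{1/2}\lambda(\Omega)^{-3/4}c^{3/2}+\lambda(\Omega)^{-1}2^{9/2}e^{-c},\qquad x\in\Omega.$$ (ii) If $\lambda(\Omega)>0$ and if $x_{w_{\Omega}}$ is a point at which $w_{\Omega}$ attains its maximum, then for any $c\ge\frac92\log 2$, $$d_{\Omega}(x_{w_{\Omega}})\ge \frac{3^2}{2^{10}}\frac{(1-2^{9/2}e^{-c})^2}{c^3}\,\lambda(\Omega)^{-1/2}.$$ Moreover, $$d_{\Omega}(x_{w_{\Omega}})\ge \frac{3^2}{2^{10}}\,\mathfrak{c}_2\,\lambda(\Omega)^{-1/2},\qquad\text{where}\qquad \mathfrak{c}_2=\max_{c\ge\frac92\log 2}\frac{(1-2^{9/2}e^{-c})^2}{c^3}.$$ (iii) If $$|\{x\in\Omega: d_{\Omega}(x)>\varepsilon\}|<\infty\quad\text{for all }\varepsilon>0,$$ then there exists a point $x_{u_{\Omega}}\in\Omega$ such that $u_{\Omega}(x_{u_{\Omega}})=\|u_{\Omega}\|_{\infty}$. Moreover, $$d_{\Omega}(x_{u_{\Omega}})\ge \frac{3^2}{2^{10}}\,\mathfrak{c}_2\,\lambda(\Omega)^{-1/2},$$ with $\mathfrak{c}_2$ as defined in (ii).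
   Context: For a non-empty open set $\Omega\subset\mathbb{R}^2$, $\lambda(\Omega)$ denotes the bottom of the spectrum of the Dirichlet Laplacian acting in $L^2(\Omega)$: $$\lambda(\Omega)=\inf\Big\{\frac{\int_\Omega|\nabla u|^2}{\int_\Omega u^2}: u\in H^1_0(\Omega),\ u\not\equiv 0\Big\}.$$ Let $B_r$ be the open ball of radius $r$ centred at the origin. The torsion function $w_\Omega:\Omega\to[0,+\infty]$ is defined by $w_\Omega(x)=\lim_{r\to+\infty}w_{\Omega\cap B_r}(x)$, where $w_{\Omega\cap B_r}$ is the unique solution of $-\Delta w=1$, $w\in H^1_0(\Omega\cap B_r)$. Pointwise values are given by $w_\Omega(x)=\int_\Omega G_\Omega(x,y)\,dy$, where $G_\Omega(x,y)=\int_0^\infty p_\Omega(x,y;t)\,dt$ is the kernel of the resolvent (Green's function) of the Dirichlet Laplacian and $p_\Omega$ is the Dirichlet heat kernel of $\Omega$. The distance to the boundary is $d_\Omega(x)=\inf\{|x-y|: y\notin\Omega\}$, $x\in\Omega$. $|\cdot|$ applied to a set is Lebesgue measure. $u_\Omega$ denotes the first Dirichlet eigenfunction of $\Omega$ (eigenfunction for the eigenvalue $\lambda(\Omega)$), chosen positive. Its existence is guaranteed when the Dirichlet Laplacian on $L^2(\Omega)$ has compact resolvent, which for simply connected $\Omega\subset\mathbb{R}^2$ is (by a known result) equivalent to the hypothesis in (iii). *)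

theory Defs
  imports "HOL-Analysis.Analysis" "HOL-Probability.Essential_Supremum"
begin

definition partial_deriv :: "2 \<Rightarrow> (real^2 \<Rightarrow> real) \<Rightarrow> real^2 \<Rightarrow> real" where
  "partial_deriv i f x = frechet_derivative f (at x) (axis i 1)"

definition grad :: "(real^2 \<Rightarrow> real) \<Rightarrow> real^2 \<Rightarrow> real^2" where
  "grad f x = (\<chi> i. partial_deriv i f x)"

primrec C_diff :: "nat \<Rightarrow> (real^2 \<Rightarrow> real) \<Rightarrow> bool" where
  "C_diff 0 f \<longleftrightarrow> continuous_on UNIV f"
| "C_diff (Suc k) f \<longleftrightarrow>
     (\<forall>x. f differentiable (at x)) \<and> (\<forall>i. C_diff k (partial_deriv i f))"

text \<open>The space of smooth functions with compact support in \<open>\<Omega>\<close>; its elements are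
  extended by zero to the whole plane.\<close>

definition test_functions :: "(real^2) set \<Rightarrow> (real^2 \<Rightarrow> real) set" where
  "test_functions \<Omega> = {\<phi>. (\<forall>k. C_diff k \<phi>) \<and>
     compact (closure {x. \<phi> x \<noteq> 0}) \<and> closure {x. \<phi> x \<noteq> 0} \<subseteq> \<Omega>}"

text \<open>A Sobolev function on \<open>\<Omega>\<close> is represented by a function on the whole plane, whose values
  outside \<open>\<Omega>\<close> are irrelevant: all integrals are over \<open>\<Omega>\<close>.\<close>

definition square_integrable_on :: "(real^2 \<Rightarrow> 'b::euclidean_space) \<Rightarrow> (real^2) set \<Rightarrow> bool"
    (infixr \<open>square'_integrable'_on\<close> 46) where
  "f square_integrable_on \<Omega> \<longleftrightarrow> f \<in> borel_measurable (lebesgue_on \<Omega>) \<and>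
     integrable (lebesgue_on \<Omega>) (\<lambda>x. (norm (f x))\<^sup>2)"

definition has_weak_gradient ::
    "(real^2) set \<Rightarrow> (real^2 \<Rightarrow> real) \<Rightarrow> (real^2 \<Rightarrow> real^2) \<Rightarrow> bool" where
  "has_weak_gradient \<Omega> u g \<longleftrightarrow>
     (\<forall>\<phi>\<in>test_functions \<Omega>. \<forall>i.
        (LINT x|lebesgue_on \<Omega>. u x * partial_deriv i \<phi> x) =
        - (LINT x|lebesgue_on \<Omega>. g x $ i * \<phi> x))"

definition H1 :: "(real^2) set \<Rightarrow> (real^2 \<Rightarrow> real) set" where
  "H1 \<Omega> = {u. u square_integrable_on \<Omega> \<and>
     (\<exists>g. g square_integrable_on \<Omega> \<and> has_weak_gradient \<Omega> u g)}"

text \<open>The weak gradient is unique up to null sets; for \<open>u \<in> H1 \<Omega>\<close> this is one representative.\<close>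

definition weak_grad :: "(real^2) set \<Rightarrow> (real^2 \<Rightarrow> real) \<Rightarrow> real^2 \<Rightarrow> real^2" where
  "weak_grad \<Omega> u = (SOME g. g square_integrable_on \<Omega> \<and> has_weak_gradient \<Omega> u g)"

text \<open>Closure of the test functions in the \<open>H1\<close> norm.\<close>

definition H10 :: "(real^2) set \<Rightarrow> (real^2 \<Rightarrow> real) set" where
  "H10 \<Omega> = {u \<in> H1 \<Omega>. \<exists>\<phi>. (\<forall>n. \<phi> n \<in> test_functions \<Omega>) \<and>
     (\<lambda>n::nat. (LINT x|lebesgue_on \<Omega>. (u x - \<phi> n x)\<^sup>2) +
        (LINT x|lebesgue_on \<Omega>. (norm (weak_grad \<Omega> u x - grad (\<phi> n) x))\<^sup>2)) \<longlonglongrightarrow> 0}"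

definition dirichlet_bottom :: "(real^2) set \<Rightarrow> real" where
  "dirichlet_bottom \<Omega> =
     (INF u\<in>{u \<in> H10 \<Omega>. \<not> (AE x in lebesgue_on \<Omega>. u x = 0)}.
        (LINT x|lebesgue_on \<Omega>. (norm (weak_grad \<Omega> u x))\<^sup>2) / (LINT x|lebesgue_on \<Omega>. (u x)\<^sup>2))"

text \<open>\<open>u\<close> is in \<open>H10 \<Omega>\<close> and satisfies \<open>- \<Delta>u = f\<close> in \<open>\<Omega>\<close> in the weak sense.\<close>

definition weak_dirichlet_solution ::
    "(real^2) set \<Rightarrow> (real^2 \<Rightarrow> real) \<Rightarrow> (real^2 \<Rightarrow> real) \<Rightarrow> bool" where
  "weak_dirichlet_solution \<Omega> f u \<longleftrightarrow> u \<in> H10 \<Omega> \<and>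
     (\<forall>\<phi>\<in>test_functions \<Omega>.
        (LINT x|lebesgue_on \<Omega>. weak_grad \<Omega> u x \<bullet> grad \<phi> x) =
        (LINT x|lebesgue_on \<Omega>. f x * \<phi> x))"

text \<open>Pointwise values of solutions are those of the representative that is continuous in the
  open set (interior regularity); requiring the value 0 outside makes the description by
  \<open>THE\<close> unique.\<close>

definition torsion_bounded :: "(real^2) set \<Rightarrow> real^2 \<Rightarrow> real" where
  "torsion_bounded D = (THE w. weak_dirichlet_solution D (\<lambda>_. 1) w \<and>
     continuous_on D w \<and> (\<forall>x. x \<notin> D \<longrightarrow> w x = 0))"

definition torsion :: "(real^2) set \<Rightarrow> real^2 \<Rightarrow> ereal" where
  "torsion \<Omega> x = Lim at_top (\<lambda>r::real. ereal (torsion_bounded (\<Omega> \<inter> ball 0 r) x))"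

text \<open>Unlike \<open>infdist x (- \<Omega>)\<close>, this is \<open>\<infinity>\<close> if \<open>\<Omega> = UNIV\<close>.\<close>

definition boundary_dist :: "(real^2) set \<Rightarrow> real^2 \<Rightarrow> ereal" where
  "boundary_dist \<Omega> x = (INF y\<in>- \<Omega>. ereal (dist x y))"

definition first_eigenfunction :: "(real^2) set \<Rightarrow> (real^2 \<Rightarrow> real) \<Rightarrow> bool" where
  "first_eigenfunction \<Omega> u \<longleftrightarrow>
     weak_dirichlet_solution \<Omega> (\<lambda>x. dirichlet_bottom \<Omega> * u x) u \<and>
     continuous_on \<Omega> u \<and> (\<forall>x\<in>\<Omega>. u x > 0)"

definition sup_norm_on :: "(real^2) set \<Rightarrow> (real^2 \<Rightarrow> real) \<Rightarrow> ereal" where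
  "sup_norm_on \<Omega> u = esssup (lebesgue_on \<Omega>) (\<lambda>x. ereal \<bar>u x\<bar>)"

definition c2_const :: real where
  "c2_const = (GREATEST y. \<exists>c\<ge>9/2 * ln 2. y = (1 - 2 powr (9/2) * exp (- c))\<^sup>2 / c ^ 3)"

end

theory Submission
  imports Defs
begin

text \<open>
  Let \<open>z\<close> be a point outside \<open>\<Omega>\<close> at distance \<open>d\<close> from \<open>x\<close>. As \<open>\<Omega>\<close> is simply connected, every circle about \<open>z\<close> leaves \<open>\<Omega>\<close>,
  and Wirtinger's inequality on these circles gives \<open>\<integral> v\<^sup>2 / \<bar>y - z\<bar>\<^sup>2 \<le> 4 \<integral> \<bar>\<nabla>v\<bar>\<^sup>2\<close> on \<open>H10 \<Omega>\<close>. For a solution of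
  \<open>- \<Delta>w = f\<close> with \<open>\<bar>f\<bar> \<le> 1\<close>, Poincare's inequality for \<open>w\<close> times a cutoff gives \<open>\<lambda> \<bar>w\<bar> \<le> 304/81\<close>; the angular inequality
  for \<open>w\<close> times a weight of size \<open>\<bar>y - z\<bar> powr (-1/2)\<close> bounds the integral of \<open>w\<^sup>2\<close> over the ball of radius \<open>3 d\<close> about \<open>z\<close> by
  a multiple of \<open>d\<^sup>3 \<lambda> powr (-3/2)\<close>, and the submean value inequality turns this into \<open>\<lambda> \<bar>w x\<bar> \<le> 72 (d \<lambda> powr (1/2)) powr (1/2)\<close>
  for small \<open>d\<close>. Minimising the right-hand side of (i) over \<open>c\<close> shows that it exceeds the smaller of these bounds.

  For (ii), testing the equation of the torsion function \<open>w\<close> with \<open>\<phi>\<^sup>2 / (w + \<epsilon>)\<close> gives \<open>\<integral> \<phi>\<^sup>2 / (w + \<epsilon>) \<le> \<integral> \<bar>\<nabla>\<phi>\<bar>\<^sup>2\<close>, hence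
  \<open>\<lambda> sup w \<ge> 1\<close>, and (i) applies at the maximum. For (iii), the estimate of (i) holds for \<open>u / (\<lambda> sup u)\<close>, which has
  \<open>f = u / sup u\<close>; it also forces \<open>u\<close> to be small near the boundary, and \<open>u \<in> L\<^sup>2\<close> is small at infinity, so that the supremum
  is attained.
\<close>

subsection \<open>Square-integrable functions\<close>

text \<open>The weight of size \<open>\<bar>y - z\<bar> powr (-1/2)\<close> is the critical one: its
  squared gradient is the squared weight over \<open>4 * \<bar>y - z\<bar>\<^sup>2\<close>, and the
  angular inequality, with its constant 4, supplies exactly that amount. So the regularisation near
  \<open>z\<close> is the only gain and the outer cutoff the only cost. The exponent is that of the
  slit plane, where solutions vanish like the square root of the distance to the tip. The constants
  of (i) leave little room. With \<open>\<sigma> = (d * lam powr (1/2)) powr (1/2)\<close> the two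
  bounds must meet near \<open>\<sigma> = 1/20\<close>: there the right-hand side of (i), times
  \<open>lam\<close>, is at least 304/81 for every \<open>c\<close>, and for smaller
  \<open>\<sigma>\<close> it is at least \<open>75 * \<sigma>\<close>, against the
  \<open>72 * \<sigma>\<close> that is proved up to a term of fourth order. Hence the polynomial
  kernels, whose integrals are explicit. The torsion function is a limit over the truncations of
  \<Omega> by balls, which may be disconnected. Therefore the equation is posed on a subset
  \<open>U\<close> of \<Omega>, while the topology and the Poincare constant are those of
  \<Omega>.\<close>

definition sq_int :: "'a measure \<Rightarrow> ('a \<Rightarrow> 'b::euclidean_space) \<Rightarrow> bool" where
  "sq_int M f \<longleftrightarrow> f \<in> borel_measurable M \<and> integrable M (\<lambda>x. (norm (f x))\<^sup>2)"

text \<open>The square of the L2 norm, not the norm. A Bochner integral that does not exist is 0, so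
  the value has its meaning only together with \<open>sq_int\<close>.\<close>

definition sq_norm :: "'a measure \<Rightarrow> ('a \<Rightarrow> 'b::euclidean_space) \<Rightarrow> real" where
  "sq_norm M f = (LINT x|M. (norm (f x))\<^sup>2)"

definition sq_lim :: "'a measure \<Rightarrow> (nat \<Rightarrow> 'a \<Rightarrow> 'b::euclidean_space) \<Rightarrow> ('a \<Rightarrow> 'b) \<Rightarrow> bool" where
  "sq_lim M F f \<longleftrightarrow> (\<forall>n. sq_int M (F n)) \<and> sq_int M f \<and>
     (\<lambda>n. sq_norm M (\<lambda>x. F n x - f x)) \<longlonglongrightarrow> 0"

lemma sq_int_measurable: "sq_int M f \<Longrightarrow> f \<in> borel_measurable M"
  and sq_int_integrable: "sq_int M f \<Longrightarrow> integrable M (\<lambda>x. (norm (f x))\<^sup>2)"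
  by (auto simp: sq_int_def)

lemma sq_int_bound:
  assumes "sq_int M f" "g \<in> borel_measurable M" "AE x in M. norm (g x) \<le> C * norm (f x)"
  shows "sq_int M g"
  unfolding sq_int_def
proof (intro conjI)
  show "g \<in> borel_measurable M" by fact
  have [measurable]: "g \<in> borel_measurable M" by fact
  show "integrable M (\<lambda>x. (norm (g x))\<^sup>2)"
  proof (rule Bochner_Integration.integrable_bound)
    show "integrable M (\<lambda>x. C\<^sup>2 * (norm (f x))\<^sup>2)"
      using assms(1) by (simp add: sq_int_def)
    show "(\<lambda>x. (norm (g x))\<^sup>2) \<in> borel_measurable M" by measurable
    show "AE x in M. norm ((norm (g x))\<^sup>2) \<le> norm (C\<^sup>2 * (norm (f x))\<^sup>2)"
      using assms(3)
    proof eventually_elim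
      case (elim x)
      then have "(norm (g x))\<^sup>2 \<le> (C * norm (f x))\<^sup>2"
        by (intro power_mono) auto
      then show ?case by (simp add: power_mult_distrib)
    qed
  qed
qed

lemma sq_int_cong_AE:
  assumes "sq_int M f" "g \<in> borel_measurable M" "AE x in M. f x = g x"
  shows "sq_int M g"
  using assms(3) by (intro sq_int_bound[OF assms(1,2), of 1]) auto

lemma norm_add_power2_le: "(norm (a + b))\<^sup>2 \<le> 2 * (norm (a::'a::real_inner))\<^sup>2 + 2 * (norm b)\<^sup>2"
proof -
  have "(norm (a + b))\<^sup>2 + (norm (a - b))\<^sup>2 = 2 * (norm a)\<^sup>2 + 2 * (norm b)\<^sup>2"
    by (simp add: power2_norm_eq_inner inner_simps inner_commute)
  then show ?thesis by (smt (verit) zero_le_power2)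
qed

lemma sq_int_add:
  assumes "sq_int M f" "sq_int M g"
  shows "sq_int M (\<lambda>x. f x + g x)"
  unfolding sq_int_def
proof (intro conjI)
  have [measurable]: "f \<in> borel_measurable M" "g \<in> borel_measurable M"
    using assms by (auto simp: sq_int_def)
  show "(\<lambda>x. f x + g x) \<in> borel_measurable M" by measurable
  show "integrable M (\<lambda>x. (norm (f x + g x))\<^sup>2)"
  proof (rule Bochner_Integration.integrable_bound)
    show "integrable M (\<lambda>x. 2 * (norm (f x))\<^sup>2 + 2 * (norm (g x))\<^sup>2)"
      using assms by (simp add: sq_int_def)
    show "(\<lambda>x. (norm (f x + g x))\<^sup>2) \<in> borel_measurable M" by measurable
    show "AE x in M. norm ((norm (f x + g x))\<^sup>2) \<le> norm (2 * (norm (f x))\<^sup>2 + 2 * (norm (g x))\<^sup>2)"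
      using norm_add_power2_le by auto
  qed
qed

lemma sq_int_mult:
  fixes f :: "'a \<Rightarrow> 'b::euclidean_space" and a :: "'a \<Rightarrow> real"
  assumes "sq_int M f" "a \<in> borel_measurable M" "\<And>x. \<bar>a x\<bar> \<le> C"
  shows "sq_int M (\<lambda>x. a x *\<^sub>R f x)"
proof (rule sq_int_bound[OF assms(1), where C = C])
  have [measurable]: "f \<in> borel_measurable M" "a \<in> borel_measurable M"
    using assms by (auto simp: sq_int_def)
  show "(\<lambda>x. a x *\<^sub>R f x) \<in> borel_measurable M" by measurable
  show "AE x in M. norm (a x *\<^sub>R f x) \<le> C * norm (f x)"
    using assms(3) by (auto intro!: mult_right_mono)
qed

lemma sq_int_mult_real:
  fixes f :: "'a \<Rightarrow> real"
  assumes "sq_int M f" "a \<in> borel_measurable M" "\<And>x. \<bar>a x\<bar> \<le> C"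
  shows "sq_int M (\<lambda>x. a x * f x)"
  using sq_int_mult[OF assms] by simp

lemma sq_int_mult_vec:
  fixes f :: "'a \<Rightarrow> real" and b :: "'a \<Rightarrow> 'b::euclidean_space"
  assumes "sq_int M f" "b \<in> borel_measurable M" "\<And>x. norm (b x) \<le> C"
  shows "sq_int M (\<lambda>x. f x *\<^sub>R b x)"
proof (rule sq_int_bound[OF assms(1), where C = C])
  have [measurable]: "f \<in> borel_measurable M" "b \<in> borel_measurable M"
    using assms by (auto simp: sq_int_def)
  show "(\<lambda>x. f x *\<^sub>R b x) \<in> borel_measurable M" by measurable
  show "AE x in M. norm (f x *\<^sub>R b x) \<le> C * norm (f x)"
    using assms(3) by (auto simp: mult.commute[of C] intro!: mult_left_mono)
qed

lemma sq_int_scaleR: "sq_int M f \<Longrightarrow> sq_int M (\<lambda>x. c *\<^sub>R f x)"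
  by (rule sq_int_mult[where C = "\<bar>c\<bar>"]) auto

lemma sq_int_cmult: "sq_int M (f :: 'a \<Rightarrow> real) \<Longrightarrow> sq_int M (\<lambda>x. c * f x)"
  using sq_int_scaleR[of M f c] by simp

lemma sq_int_diff: "sq_int M f \<Longrightarrow> sq_int M g \<Longrightarrow> sq_int M (\<lambda>x. f x - g x)"
  using sq_int_add[OF _ sq_int_scaleR[of M g "-1"], of f] by simp

lemma sq_int_norm: "sq_int M f \<Longrightarrow> sq_int M (\<lambda>x. norm (f x))"
  by (rule sq_int_bound[where C = 1]) (auto dest: sq_int_measurable)

lemma sq_int_abs: "sq_int M (f :: 'a \<Rightarrow> real) \<Longrightarrow> sq_int M (\<lambda>x. \<bar>f x\<bar>)"
  using sq_int_norm[of M f] by simp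

lemma sq_int_zero [simp]: "sq_int M (\<lambda>x. 0)"
  by (simp add: sq_int_def)

lemma sq_norm_nonneg: "0 \<le> sq_norm M f"
  by (simp add: sq_norm_def)

lemma inner_abs_le_squares: "\<bar>a \<bullet> b\<bar> \<le> ((norm a)\<^sup>2 + (norm b)\<^sup>2)" for a b :: "'a::real_inner"
proof -
  have "\<bar>a \<bullet> b\<bar> \<le> norm a * norm b" by (rule Cauchy_Schwarz_ineq2)
  also have "\<dots> \<le> ((norm a)\<^sup>2 + (norm b)\<^sup>2)"
  proof -
    have "2 * (norm a * norm b) \<le> (norm a)\<^sup>2 + (norm b)\<^sup>2"
      using sum_squares_bound[of "norm a" "norm b"] by (simp add: mult.assoc)
    moreover have "0 \<le> norm a * norm b" by simp
    ultimately show ?thesis by linarith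
  qed
  finally show ?thesis .
qed

lemma integrable_inner_sq_int:
  assumes "sq_int M f" "sq_int M g"
  shows "integrable M (\<lambda>x. f x \<bullet> g x)"
proof (rule Bochner_Integration.integrable_bound)
  have [measurable]: "f \<in> borel_measurable M" "g \<in> borel_measurable M"
    using assms by (auto simp: sq_int_def)
  show "integrable M (\<lambda>x. (norm (f x))\<^sup>2 + (norm (g x))\<^sup>2)"
    using assms by (simp add: sq_int_def)
  show "(\<lambda>x. f x \<bullet> g x) \<in> borel_measurable M" by measurable
  show "AE x in M. norm (f x \<bullet> g x) \<le> norm ((norm (f x))\<^sup>2 + (norm (g x))\<^sup>2)"
    using inner_abs_le_squares by (intro AE_I2) (simp add: abs_of_nonneg)
qed

lemma integrable_mult_sq_int:
  fixes f g :: "'a \<Rightarrow> real"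
  shows "sq_int M f \<Longrightarrow> sq_int M g \<Longrightarrow> integrable M (\<lambda>x. f x * g x)"
  using integrable_inner_sq_int[of M f g] by simp

text \<open>The quadratic in \<open>t\<close> behind the Cauchy-Schwarz inequality. Later its values
  at \<open>t = 1\<close> and \<open>t = -1\<close> give the parallelogram identity for the energy,
  and its linear term the first variation.\<close>

lemma sq_norm_add_scaled:
  assumes "sq_int M f" "sq_int M g"
  shows "sq_norm M (\<lambda>x. f x + t *\<^sub>R g x) =
    sq_norm M f + 2 * t * (LINT x|M. f x \<bullet> g x) + t\<^sup>2 * sq_norm M g"
proof -
  have "sq_norm M (\<lambda>x. f x + t *\<^sub>R g x) =
      (LINT x|M. (norm (f x))\<^sup>2 + 2 * t * (f x \<bullet> g x) + t\<^sup>2 * (norm (g x))\<^sup>2)"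
    unfolding sq_norm_def
    by (intro Bochner_Integration.integral_cong refl)
       (simp only: power2_norm_eq_inner, simp add: inner_simps inner_commute power2_eq_square algebra_simps)
  also have "\<dots> = sq_norm M f + 2 * t * (LINT x|M. f x \<bullet> g x) + t\<^sup>2 * sq_norm M g"
    using integrable_inner_sq_int[OF assms] assms unfolding sq_norm_def
    by (simp add: sq_int_def)
  finally show ?thesis .
qed

lemma quadratic_nonneg_discrim:
  fixes A B C :: real
  assumes "\<And>t. 0 \<le> A + 2 * t * B + t\<^sup>2 * C" "0 \<le> A" "0 \<le> C"
  shows "B\<^sup>2 \<le> A * C"
proof (cases "C = 0")
  case True
  have "B = 0"
  proof (rule ccontr)
    assume "B \<noteq> 0"
    \<comment> \<open>Without the quadratic term the expression is affine in \<open>t\<close>; at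
      this \<open>t\<close> it equals -1.\<close>
    have "0 \<le> A + 2 * (- (A + 1) / (2 * B)) * B + (- (A + 1) / (2 * B))\<^sup>2 * C" by (rule assms)
    then show False using True \<open>B \<noteq> 0\<close> assms(2) by (simp add: field_simps)
  qed
  then show ?thesis using True by simp
next
  case False
  then have "C > 0" using assms by simp
  have "0 \<le> A + 2 * (- B / C) * B + (- B / C)\<^sup>2 * C" by (rule assms)
  also have "\<dots> = A - B\<^sup>2 / C" using \<open>C > 0\<close> by (simp add: field_simps power2_eq_square)
  finally show ?thesis using \<open>C > 0\<close> by (simp add: field_simps)
qed

lemma sq_int_Cauchy_Schwarz:
  assumes "sq_int M f" "sq_int M g"
  shows "(LINT x|M. f x \<bullet> g x)\<^sup>2 \<le> sq_norm M f * sq_norm M g"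
proof (rule quadratic_nonneg_discrim)
  show "0 \<le> sq_norm M f + 2 * t * (LINT x|M. f x \<bullet> g x) + t\<^sup>2 * sq_norm M g" for t
    unfolding sq_norm_add_scaled[OF assms, symmetric] by (rule sq_norm_nonneg)
qed (auto intro: sq_norm_nonneg)

lemma sq_int_Cauchy_Schwarz_abs:
  assumes "sq_int M f" "sq_int M g"
  shows "\<bar>LINT x|M. f x \<bullet> g x\<bar> \<le> sqrt (sq_norm M f) * sqrt (sq_norm M g)"
  using sq_int_Cauchy_Schwarz[OF assms] by (simp add: real_le_rsqrt real_sqrt_mult[symmetric])

lemma sq_norm_add_le:
  assumes "sq_int M f" "sq_int M g"
  shows "sq_norm M (\<lambda>x. f x + g x) \<le> 2 * sq_norm M f + 2 * sq_norm M g"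
proof -
  have "sq_norm M (\<lambda>x. f x + g x) \<le> (LINT x|M. 2 * (norm (f x))\<^sup>2 + 2 * (norm (g x))\<^sup>2)"
    unfolding sq_norm_def
    using sq_int_add[OF assms] assms norm_add_power2_le
    by (intro integral_mono) (auto simp: sq_int_def)
  then show ?thesis using assms by (simp add: sq_int_def sq_norm_def)
qed

lemma sq_norm_bound:
  assumes "sq_int M f" "sq_int M g" "\<And>x. norm (g x) \<le> C * norm (f x)"
  shows "sq_norm M g \<le> C\<^sup>2 * sq_norm M f"
proof -
  have "sq_norm M g \<le> (LINT x|M. C\<^sup>2 * (norm (f x))\<^sup>2)"
    unfolding sq_norm_def
  proof (rule integral_mono)
    show "(norm (g x))\<^sup>2 \<le> C\<^sup>2 * (norm (f x))\<^sup>2" for x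
      using power_mono[OF assms(3), of x 2] by (simp add: power_mult_distrib)
  qed (use assms in \<open>auto simp: sq_int_def\<close>)
  then show ?thesis by (simp add: sq_norm_def)
qed

lemma sq_limD:
  assumes "sq_lim M F f"
  shows "sq_int M (F n)" "sq_int M f" "(\<lambda>n. sq_norm M (\<lambda>x. F n x - f x)) \<longlonglongrightarrow> 0"
  using assms by (auto simp: sq_lim_def)

lemma sq_lim_const: "sq_int M f \<Longrightarrow> sq_lim M (\<lambda>_. f) f"
  by (simp add: sq_lim_def sq_norm_def)

lemma sq_lim_add:
  assumes "sq_lim M F f" "sq_lim M G g"
  shows "sq_lim M (\<lambda>n x. F n x + G n x) (\<lambda>x. f x + g x)"
  unfolding sq_lim_def
proof (intro conjI allI)
  show "sq_int M (\<lambda>x. F n x + G n x)" for n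
    by (intro sq_int_add sq_limD[OF assms(1)] sq_limD[OF assms(2)])
  show "sq_int M (\<lambda>x. f x + g x)"
    by (intro sq_int_add sq_limD[OF assms(1)] sq_limD[OF assms(2)])
  show "(\<lambda>n. sq_norm M (\<lambda>x. F n x + G n x - (f x + g x))) \<longlonglongrightarrow> 0"
  proof (rule tendsto_sandwich[OF _ _ tendsto_const])
    show "\<forall>\<^sub>F n in sequentially. 0 \<le> sq_norm M (\<lambda>x. F n x + G n x - (f x + g x))"
      by (simp add: sq_norm_nonneg)
    show "\<forall>\<^sub>F n in sequentially. sq_norm M (\<lambda>x. F n x + G n x - (f x + g x)) \<le>
        2 * sq_norm M (\<lambda>x. F n x - f x) + 2 * sq_norm M (\<lambda>x. G n x - g x)"
      using sq_norm_add_le[OF sq_int_diff[OF sq_limD(1,2)[OF assms(1)]] sq_int_diff[OF sq_limD(1,2)[OF assms(2)]]]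
      by (simp add: algebra_simps)
    show "(\<lambda>n. 2 * sq_norm M (\<lambda>x. F n x - f x) + 2 * sq_norm M (\<lambda>x. G n x - g x)) \<longlonglongrightarrow> 0"
      using tendsto_add[OF tendsto_mult_left[OF sq_limD(3)[OF assms(1)], of 2] tendsto_mult_left[OF sq_limD(3)[OF assms(2)], of 2]]
      by simp
  qed
qed

text \<open>Pointwise Lipschitz dependence carries L2 convergence over; multiplication by bounded
  functions and composition with Lipschitz functions are instances.\<close>

lemma sq_lim_bounded_map:
  assumes "sq_lim M F f" "\<And>n. sq_int M (G n)" "sq_int M g"
    and "\<And>n x. norm (G n x - g x) \<le> C * norm (F n x - f x)"
  shows "sq_lim M G g"
  unfolding sq_lim_def
proof (intro conjI allI assms(2,3))
  show "(\<lambda>n. sq_norm M (\<lambda>x. G n x - g x)) \<longlonglongrightarrow> 0"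
  proof (rule tendsto_sandwich[OF _ _ tendsto_const])
    show "\<forall>\<^sub>F n in sequentially. 0 \<le> sq_norm M (\<lambda>x. G n x - g x)"
      by (simp add: sq_norm_nonneg)
    show "\<forall>\<^sub>F n in sequentially. sq_norm M (\<lambda>x. G n x - g x) \<le> C\<^sup>2 * sq_norm M (\<lambda>x. F n x - f x)"
      using assms sq_limD[OF assms(1)] by (intro always_eventually allI sq_norm_bound sq_int_diff) auto
    show "(\<lambda>n. C\<^sup>2 * sq_norm M (\<lambda>x. F n x - f x)) \<longlonglongrightarrow> 0"
      using tendsto_mult_left[OF sq_limD(3)[OF assms(1)], of "C\<^sup>2"] by simp
  qed
qed

lemma sq_lim_mult:
  fixes f :: "'a \<Rightarrow> 'b::euclidean_space" and a :: "'a \<Rightarrow> real"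
  assumes "sq_lim M F f" "a \<in> borel_measurable M" "\<And>x. \<bar>a x\<bar> \<le> C"
  shows "sq_lim M (\<lambda>n x. a x *\<^sub>R F n x) (\<lambda>x. a x *\<^sub>R f x)"
proof (rule sq_lim_bounded_map[OF assms(1)])
  show "sq_int M (\<lambda>x. a x *\<^sub>R F n x)" for n using assms sq_limD[OF assms(1)] by (intro sq_int_mult)
  show "sq_int M (\<lambda>x. a x *\<^sub>R f x)" using assms sq_limD[OF assms(1)] by (intro sq_int_mult)
  show "norm (a x *\<^sub>R F n x - a x *\<^sub>R f x) \<le> C * norm (F n x - f x)" for n x
    using assms(3) by (simp flip: scaleR_diff_right add: mult_right_mono)
qed

lemma sq_lim_mult_vec:
  fixes f :: "'a \<Rightarrow> real" and b :: "'a \<Rightarrow> 'b::euclidean_space"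
  assumes "sq_lim M F f" "b \<in> borel_measurable M" "\<And>x. norm (b x) \<le> C"
  shows "sq_lim M (\<lambda>n x. F n x *\<^sub>R b x) (\<lambda>x. f x *\<^sub>R b x)"
proof (rule sq_lim_bounded_map[OF assms(1)])
  show "sq_int M (\<lambda>x. F n x *\<^sub>R b x)" for n using assms sq_limD[OF assms(1)] by (intro sq_int_mult_vec)
  show "sq_int M (\<lambda>x. f x *\<^sub>R b x)" using assms sq_limD[OF assms(1)] by (intro sq_int_mult_vec)
  show "norm (F n x *\<^sub>R b x - f x *\<^sub>R b x) \<le> C * norm (F n x - f x)" for n x
    using assms(3) by (simp flip: scaleR_diff_left add: mult.commute[of C] mult_left_mono)
qed

lemma sq_lim_scaleR: "sq_lim M F f \<Longrightarrow> sq_lim M (\<lambda>n x. c *\<^sub>R F n x) (\<lambda>x. c *\<^sub>R f x)"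
  by (rule sq_lim_mult[where C = "\<bar>c\<bar>"]) auto

text \<open>Expanding around the limits leaves three error terms, each controlled by Cauchy-Schwarz.
  This is the device by which identities for smooth functions pass to Sobolev functions.\<close>

lemma sq_lim_inner:
  assumes "sq_lim M F f" "sq_lim M G g"
  shows "(\<lambda>n. LINT x|M. F n x \<bullet> G n x) \<longlonglongrightarrow> (LINT x|M. f x \<bullet> g x)"
proof -
  note F = sq_limD[OF assms(1)] and G = sq_limD[OF assms(2)]
  define e where "e n = sqrt (sq_norm M (\<lambda>x. F n x - f x))" for n
  define d where "d n = sqrt (sq_norm M (\<lambda>x. G n x - g x))" for n
  have e0: "e \<longlonglongrightarrow> 0" unfolding e_def using tendsto_real_sqrt[OF F(3)] by simp
  have d0: "d \<longlonglongrightarrow> 0" unfolding d_def using tendsto_real_sqrt[OF G(3)] by simp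
  have "\<bar>(LINT x|M. F n x \<bullet> G n x) - (LINT x|M. f x \<bullet> g x)\<bar>
      \<le> e n * d n + e n * sqrt (sq_norm M g) + sqrt (sq_norm M f) * d n" for n
  proof -
    have "(LINT x|M. F n x \<bullet> G n x) = (LINT x|M. (F n x - f x) \<bullet> (G n x - g x)
        + (F n x - f x) \<bullet> g x + f x \<bullet> (G n x - g x) + f x \<bullet> g x)"
      by (intro Bochner_Integration.integral_cong refl) (simp add: inner_simps)
    also have "\<dots> = (LINT x|M. (F n x - f x) \<bullet> (G n x - g x))
        + (LINT x|M. (F n x - f x) \<bullet> g x) + (LINT x|M. f x \<bullet> (G n x - g x)) + (LINT x|M. f x \<bullet> g x)"
      using integrable_inner_sq_int[OF sq_int_diff[OF F(1,2)] sq_int_diff[OF G(1,2)]]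
        integrable_inner_sq_int[OF sq_int_diff[OF F(1,2)] G(2)]
        integrable_inner_sq_int[OF F(2) sq_int_diff[OF G(1,2)]] integrable_inner_sq_int[OF F(2) G(2)]
      by simp
    finally show ?thesis
      using sq_int_Cauchy_Schwarz_abs[OF sq_int_diff[OF F(1,2)] sq_int_diff[OF G(1,2)], of n n]
        sq_int_Cauchy_Schwarz_abs[OF sq_int_diff[OF F(1,2)] G(2), of n]
        sq_int_Cauchy_Schwarz_abs[OF F(2) sq_int_diff[OF G(1,2)], of n]
      unfolding e_def d_def by linarith
  qed
  then have "norm ((LINT x|M. F n x \<bullet> G n x) - (LINT x|M. f x \<bullet> g x))
      \<le> e n * d n + e n * sqrt (sq_norm M g) + sqrt (sq_norm M f) * d n" for n
    by (simp only: real_norm_def)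
  moreover have "(\<lambda>n. e n * d n + e n * sqrt (sq_norm M g) + sqrt (sq_norm M f) * d n) \<longlonglongrightarrow> 0"
    using tendsto_add[OF tendsto_add[OF tendsto_mult[OF e0 d0] tendsto_mult_right[OF e0, of "sqrt (sq_norm M g)"]]
        tendsto_mult_left[OF d0, of "sqrt (sq_norm M f)"]]
    by simp
  ultimately have "(\<lambda>n. (LINT x|M. F n x \<bullet> G n x) - (LINT x|M. f x \<bullet> g x)) \<longlonglongrightarrow> 0"
    by (rule Lim_null_comparison[OF always_eventually[OF allI]])
  then show ?thesis by (simp only: LIM_zero_iff)
qed

lemma sq_lim_norm:
  assumes "sq_lim M F f"
  shows "(\<lambda>n. sq_norm M (F n)) \<longlonglongrightarrow> sq_norm M f"
  using sq_lim_inner[OF assms assms] by (simp add: sq_norm_def power2_norm_eq_inner)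

lemma sq_lim_mult_int:
  fixes f g :: "'a \<Rightarrow> real"
  assumes "sq_lim M F f" "sq_lim M G g"
  shows "(\<lambda>n. LINT x|M. F n x * G n x) \<longlonglongrightarrow> (LINT x|M. f x * g x)"
  using sq_lim_inner[OF assms] by simp

lemma sq_lim_subseq:
  assumes "sq_lim M F f" "strict_mono r"
  shows "sq_lim M (\<lambda>n. F (r n)) f"
  unfolding sq_lim_def
  using sq_limD[OF assms(1)] LIMSEQ_subseq_LIMSEQ[OF sq_limD(3)[OF assms(1)] assms(2), unfolded o_def] by blast

text \<open>The squared distances converge in L1, which yields the subsequence. The chain rule in
  \<open>h10_compose\<close> relies on it, where convergence has to be inserted into a nonlinear
  function.\<close>

lemma sq_lim_AE_subseq:
  assumes "sq_lim M F f"
  shows "\<exists>r::nat\<Rightarrow>nat. strict_mono r \<and> (AE x in M. (\<lambda>n. F (r n) x) \<longlonglongrightarrow> f x)"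
proof -
  note F = sq_limD[OF assms]
  have "\<exists>r::nat\<Rightarrow>nat. strict_mono r \<and> (AE x in M. (\<lambda>n. (norm (F (r n) x - f x))\<^sup>2) \<longlonglongrightarrow> 0)"
  proof (rule tendsto_L1_AE_subseq)
    show "integrable M (\<lambda>x. (norm (F n x - f x))\<^sup>2)" for n
      by (rule sq_int_integrable[OF sq_int_diff[OF F(1,2)]])
    show "(\<lambda>n. LINT x|M. norm ((norm (F n x - f x))\<^sup>2)) \<longlonglongrightarrow> 0"
      using F(3) by (simp add: sq_norm_def)
  qed
  then obtain r :: "nat \<Rightarrow> nat" where r: "strict_mono r"
    "AE x in M. (\<lambda>n. (norm (F (r n) x - f x))\<^sup>2) \<longlonglongrightarrow> 0" by blast
  have "AE x in M. (\<lambda>n. F (r n) x) \<longlonglongrightarrow> f x"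
    using r(2)
  proof eventually_elim
    case (elim x)
    then have "(\<lambda>n. sqrt ((norm (F (r n) x - f x))\<^sup>2)) \<longlonglongrightarrow> sqrt 0" by (rule tendsto_real_sqrt)
    then show ?case by (simp add: tendsto_norm_zero_iff LIM_zero_iff)
  qed
  with r(1) show ?thesis by blast
qed

lemma sq_norm_eq_0:
  assumes "sq_int M f" "sq_norm M f = 0"
  shows "AE x in M. f x = 0"
  using integral_nonneg_eq_0_iff_AE[OF sq_int_integrable[OF assms(1)]] assms(2)
  by (simp add: sq_norm_def)

subsection \<open>Continuously differentiable functions\<close>

text \<open>The gradient is a second argument rather than an operator applied to \<open>f\<close>.
  Product and chain rules then produce explicit vector fields, and pairs of a function and its
  gradient can be carried through L2 limits together.\<close>

definition C1 :: "(real^2 \<Rightarrow> real) \<Rightarrow> (real^2 \<Rightarrow> real^2) \<Rightarrow> bool" where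
  "C1 f G \<longleftrightarrow> (\<forall>x. (f has_derivative (\<lambda>h. G x \<bullet> h)) (at x)) \<and> continuous_on UNIV G"

definition C1c :: "(real^2) set \<Rightarrow> (real^2 \<Rightarrow> real) \<Rightarrow> (real^2 \<Rightarrow> real^2) \<Rightarrow> bool" where
  "C1c U f G \<longleftrightarrow> C1 f G \<and> (\<exists>K. compact K \<and> K \<subseteq> U \<and> (\<forall>x. x \<notin> K \<longrightarrow> f x = 0 \<and> G x = 0))"

lemma C1D: "C1 f G \<Longrightarrow> (f has_derivative (\<lambda>h. G x \<bullet> h)) (at x)" "C1 f G \<Longrightarrow> continuous_on UNIV G"
  by (auto simp: C1_def)

lemma C1_continuous: "C1 f G \<Longrightarrow> continuous_on UNIV f"
  by (meson C1D(1) continuous_at_imp_continuous_on has_derivative_continuous)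

lemma C1c_imp_C1: "C1c U f G \<Longrightarrow> C1 f G"
  by (simp add: C1c_def)

lemma C1_const: "C1 (\<lambda>x. c) (\<lambda>x. 0)"
  by (simp add: C1_def)

lemma C1_add: "C1 f F \<Longrightarrow> C1 g G \<Longrightarrow> C1 (\<lambda>x. f x + g x) (\<lambda>x. F x + G x)"
  unfolding C1_def by (auto intro!: derivative_eq_intros continuous_intros simp: inner_simps)

lemma C1_scale: "C1 f F \<Longrightarrow> C1 (\<lambda>x. c * f x) (\<lambda>x. c *\<^sub>R F x)"
  unfolding C1_def by (auto intro!: derivative_eq_intros continuous_intros simp: inner_simps)

lemma C1_mult:
  assumes "C1 f F" "C1 g G"
  shows "C1 (\<lambda>x. f x * g x) (\<lambda>x. f x *\<^sub>R G x + g x *\<^sub>R F x)"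
  unfolding C1_def
proof (intro conjI allI)
  show "continuous_on UNIV (\<lambda>x. f x *\<^sub>R G x + g x *\<^sub>R F x)"
    by (intro continuous_intros C1_continuous[OF assms(1)] C1_continuous[OF assms(2)] C1D[OF assms(1)] C1D[OF assms(2)])
  show "((\<lambda>x. f x * g x) has_derivative (\<lambda>h. (f x *\<^sub>R G x + g x *\<^sub>R F x) \<bullet> h)) (at x)" for x
    using has_derivative_mult[OF C1D(1)[OF assms(1)] C1D(1)[OF assms(2)], of x]
    by (simp add: inner_simps mult.commute)
qed

lemma C1_compose:
  assumes "C1 f F" "\<And>x. (\<gamma> has_real_derivative \<gamma>' (f x)) (at (f x))" "continuous_on (range f) \<gamma>'"
  shows "C1 (\<lambda>x. \<gamma> (f x)) (\<lambda>x. \<gamma>' (f x) *\<^sub>R F x)"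
  unfolding C1_def
proof (intro conjI allI)
  show "continuous_on UNIV (\<lambda>x. \<gamma>' (f x) *\<^sub>R F x)"
    by (intro continuous_intros C1D(2)[OF assms(1)] continuous_on_compose2[OF assms(3) C1_continuous[OF assms(1)]]) auto
  show "((\<lambda>x. \<gamma> (f x)) has_derivative (\<lambda>h. (\<gamma>' (f x) *\<^sub>R F x) \<bullet> h)) (at x)" for x
    using has_derivative_compose[OF C1D(1)[OF assms(1)] assms(2)[unfolded has_field_derivative_def], of x]
    by simp
qed

lemma C1_norm_sq: "C1 (\<lambda>x. (norm (x - z))\<^sup>2) (\<lambda>x. 2 *\<^sub>R (x - z))"
  unfolding C1_def power2_norm_eq_inner
  by (auto intro!: derivative_eq_intros continuous_intros simp: inner_commute)

lemma C1_coord: "C1 (\<lambda>x. (x - z) $ i) (\<lambda>x. axis i 1)"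
proof -
  have "((\<lambda>x. (x - z) $ i) has_derivative (\<lambda>h. h $ i)) (at x)" for x :: "real^2"
  proof -
    have "((\<lambda>x. (x - z) \<bullet> axis i 1) has_derivative (\<lambda>h. h \<bullet> axis i 1)) (at x)"
      by (auto intro!: derivative_eq_intros)
    then show ?thesis by (simp add: inner_axis)
  qed
  then show ?thesis by (simp add: C1_def inner_axis' inner_axis)
qed

text \<open>Radial functions are written in terms of the squared distance, because that is smooth at
  the centre while the distance is not.\<close>

lemma C1_radial:
  fixes F F' :: "real \<Rightarrow> real"
  assumes "\<And>t. t \<ge> 0 \<Longrightarrow> (F has_real_derivative F' t) (at t)" "continuous_on {0..} F'"
  shows "C1 (\<lambda>x. F ((norm (x - z))\<^sup>2)) (\<lambda>x. (2 * F' ((norm (x - z))\<^sup>2)) *\<^sub>R (x - z))"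
proof -
  have "C1 (\<lambda>x. F ((norm (x - z))\<^sup>2)) (\<lambda>x. F' ((norm (x - z))\<^sup>2) *\<^sub>R 2 *\<^sub>R (x - z))"
    by (rule C1_compose[OF C1_norm_sq]) (auto intro!: assms(1) continuous_on_subset[OF assms(2)])
  then show ?thesis by (simp add: mult.commute)
qed

text \<open>Off a compact set that carries \<open>f\<close>, the function vanishes on an open set,
  so its derivative there is 0. The condition on the gradient in \<open>C1c\<close> is therefore
  automatic.\<close>

lemma C1cI:
  assumes "C1 f F" "compact K" "K \<subseteq> U" "\<And>x. x \<notin> K \<Longrightarrow> f x = 0"
  shows "C1c U f F"
  unfolding C1c_def
proof (intro conjI exI[of _ K] allI impI assms)
  fix x assume "x \<notin> K"
  have op: "open (- K)" using assms(2) by (simp add: compact_imp_closed open_Compl)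
  have "(f has_derivative (\<lambda>h. 0)) (at x)"
    by (rule has_derivative_transform_within_open[OF has_derivative_const op])
       (use \<open>x \<notin> K\<close> assms(4) in auto)
  then have "(\<lambda>h. F x \<bullet> h) = (\<lambda>h. 0)"
    by (rule has_derivative_unique[OF C1D(1)[OF assms(1)]])
  then have "F x \<bullet> F x = 0" by meson
  then show "F x = 0" by simp
qed

lemma C1cE:
  assumes "C1c U f F"
  obtains K where "compact K" "K \<subseteq> U" "\<And>x. x \<notin> K \<Longrightarrow> f x = 0" "\<And>x. x \<notin> K \<Longrightarrow> F x = 0"
  using assms unfolding C1c_def by metis

lemma C1c_mult_left:
  assumes "C1c U f F" "C1 g G"
  shows "C1c U (\<lambda>x. g x * f x) (\<lambda>x. g x *\<^sub>R F x + f x *\<^sub>R G x)"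
  by (rule C1cE[OF assms(1)], rule C1cI[OF C1_mult[OF assms(2) C1c_imp_C1[OF assms(1)]]]) auto

lemma C1c_mono: "C1c U f F \<Longrightarrow> U \<subseteq> V \<Longrightarrow> C1c V f F"
  unfolding C1c_def by blast

lemma C1c_zero: "C1c U (\<lambda>x. 0) (\<lambda>x. 0)"
  unfolding C1c_def using C1_const by (auto intro!: exI[of _ "{}"])

lemma C1c_add:
  assumes "C1c U f F" "C1c U g G"
  shows "C1c U (\<lambda>x. f x + g x) (\<lambda>x. F x + G x)"
proof -
  obtain K L where K: "compact K" "K \<subseteq> U" "\<And>x. x \<notin> K \<Longrightarrow> f x = 0 \<and> F x = 0"
    and L: "compact L" "L \<subseteq> U" "\<And>x. x \<notin> L \<Longrightarrow> g x = 0 \<and> G x = 0"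
    using assms unfolding C1c_def by metis
  show ?thesis
    unfolding C1c_def
    using K L C1_add[OF C1c_imp_C1[OF assms(1)] C1c_imp_C1[OF assms(2)]]
    by (intro conjI exI[of _ "K \<union> L"]) (auto intro: compact_Un)
qed

lemma C1c_scale: "C1c U f F \<Longrightarrow> C1c U (\<lambda>x. c * f x) (\<lambda>x. c *\<^sub>R F x)"
  by (rule C1cE[of U f F], assumption, rule C1cI[OF C1_scale[OF C1c_imp_C1[of U f F]]]) auto

lemma C1c_compose:
  assumes "C1c U f F" "\<And>t. (\<gamma> has_real_derivative \<gamma>' t) (at t)" "continuous_on UNIV \<gamma>'" "\<gamma> 0 = 0"
  shows "C1c U (\<lambda>x. \<gamma> (f x)) (\<lambda>x. \<gamma>' (f x) *\<^sub>R F x)"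
  by (rule C1cE[OF assms(1)],
      rule C1cI[OF C1_compose[OF C1c_imp_C1[OF assms(1)] assms(2) continuous_on_subset[OF assms(3)]]])
     (use assms(4) in auto)

lemma continuous_imp_lebesgue_measurable:
  fixes f :: "'a::euclidean_space \<Rightarrow> 'b::euclidean_space"
  assumes "continuous_on UNIV f"
  shows "f \<in> borel_measurable lebesgue"
  using borel_measurable_continuous_onI[OF assms] by (simp add: measurable_completion)

lemma compact_support_bounded:
  fixes f :: "'a::euclidean_space \<Rightarrow> 'b::euclidean_space"
  assumes "continuous_on UNIV f" "compact K" "\<And>x. x \<notin> K \<Longrightarrow> f x = 0"
  obtains B where "B > 0" "\<And>x. norm (f x) \<le> B"
proof -
  have "bounded (f ` K)"
    by (rule compact_imp_bounded[OF compact_continuous_image[OF continuous_on_subset[OF assms(1) subset_UNIV] assms(2)]])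
  then obtain B where B: "B > 0" "\<And>x. x \<in> K \<Longrightarrow> norm (f x) \<le> B"
    unfolding bounded_pos by blast
  have "norm (f x) \<le> B" for x
    using B assms(3)[of x] by (cases "x \<in> K") auto
  with B(1) show thesis by (rule that)
qed

lemma bounded_support_integrable:
  fixes f :: "'a::euclidean_space \<Rightarrow> 'b::euclidean_space"
  assumes "f \<in> borel_measurable lebesgue" "bounded K" "\<And>x. x \<notin> K \<Longrightarrow> f x = 0" "\<And>x. norm (f x) \<le> B"
  shows "integrable lebesgue f"
proof -
  obtain r where r: "K \<subseteq> ball 0 r" using bounded_subset_ballD[OF assms(2), of 0] by blast
  show ?thesis
  proof (rule Bochner_Integration.integrable_bound)
    show "integrable lebesgue (\<lambda>x. B * indicator (cball (0::'a) r) x)"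
      by (intro integrable_mult_right integrable_real_indicator)
         (use lmeasurable_cball[of "0::'a" r] in \<open>auto simp: fmeasurable_def\<close>)
    show "AE x in lebesgue. norm (f x) \<le> norm (B * indicator (cball 0 r) x)"
    proof (rule AE_I2)
      fix x
      show "norm (f x) \<le> norm (B * indicator (cball 0 r) x)"
        using r assms(3)[of x] assms(4)[of x] by (cases "x \<in> cball 0 r") (force simp: subset_iff)+
    qed
  qed (rule assms)
qed

lemma compact_support_integrable:
  fixes f :: "'a::euclidean_space \<Rightarrow> 'b::euclidean_space"
  assumes "continuous_on UNIV f" "compact K" "\<And>x. x \<notin> K \<Longrightarrow> f x = 0"
  shows "integrable lebesgue f"
  by (rule compact_support_bounded[OF assms], assumption)
    (rule bounded_support_integrable[OF continuous_imp_lebesgue_measurable[OF assms(1)]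
      compact_imp_bounded[OF assms(2)] assms(3)])

lemma compact_support_sq_int:
  fixes f :: "'a::euclidean_space \<Rightarrow> 'b::euclidean_space"
  assumes "continuous_on UNIV f" "compact K" "\<And>x. x \<notin> K \<Longrightarrow> f x = 0"
  shows "sq_int lebesgue f"
  unfolding sq_int_def
  using assms by (intro conjI continuous_imp_lebesgue_measurable compact_support_integrable[where K = K])
    (auto intro!: continuous_intros)

lemma C1c_sq_int:
  assumes "C1c U f F"
  shows "sq_int lebesgue f" "sq_int lebesgue F"
proof -
  obtain K where K: "compact K" "\<And>x. x \<notin> K \<Longrightarrow> f x = 0" "\<And>x. x \<notin> K \<Longrightarrow> F x = 0"
    using C1cE[OF assms] by metis
  show "sq_int lebesgue f" "sq_int lebesgue F"
    by (rule compact_support_sq_int[OF C1_continuous[OF C1c_imp_C1[OF assms]] K(1,2)]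
        compact_support_sq_int[OF C1D(2)[OF C1c_imp_C1[OF assms]] K(1,3)], assumption)+
qed

lemma C1c_bounded:
  assumes "C1c U f F"
  obtains B where "B > 0" "\<And>x. \<bar>f x\<bar> \<le> B" "\<And>x. norm (F x) \<le> B"
proof -
  obtain K where K: "compact K" "\<And>x. x \<notin> K \<Longrightarrow> f x = 0" "\<And>x. x \<notin> K \<Longrightarrow> F x = 0"
    using C1cE[OF assms] by metis
  obtain B1 where B1: "B1 > 0" "\<And>x. norm (f x) \<le> B1"
    using compact_support_bounded[OF C1_continuous[OF C1c_imp_C1[OF assms]] K(1,2)] by blast
  obtain B2 where B2: "B2 > 0" "\<And>x. norm (F x) \<le> B2"
    using compact_support_bounded[OF C1D(2)[OF C1c_imp_C1[OF assms]] K(1,3)] by blast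
  show thesis
  proof (rule that)
    show "max B1 B2 > 0" using B1 by simp
    show "\<bar>f x\<bar> \<le> max B1 B2" for x using B1(2)[of x] by simp
    show "norm (F x) \<le> max B1 B2" for x using B2(2)[of x] by simp
  qed
qed

lemma C1_Lipschitz:
  assumes "C1 f F" "\<And>x. norm (F x) \<le> B"
  shows "\<bar>f x - f y\<bar> \<le> B * norm (x - y)"
proof -
  have "norm (f x - f y) \<le> B * norm (x - y)"
  proof (rule differentiable_bound[of UNIV f "\<lambda>x h. F x \<bullet> h"])
    show "(f has_derivative (\<lambda>h. F x \<bullet> h)) (at x)" for x by (rule C1D(1)[OF assms(1)])
    show "onorm (\<lambda>h. F x \<bullet> h) \<le> B" for x
    proof (rule onorm_le)
      fix h
      show "norm (F x \<bullet> h) \<le> B * norm h"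
        using Cauchy_Schwarz_ineq2[of "F x" h] mult_right_mono[OF assms(2) norm_ge_zero, of x h] by simp
    qed
  qed auto
  then show ?thesis by simp
qed

section \<open>Integration by parts in the plane\<close>

lemma lebesgue_integral_translate:
  fixes f :: "'a::euclidean_space \<Rightarrow> 'b::euclidean_space"
  assumes "f \<in> borel_measurable borel"
  shows "(LINT x|lebesgue. f (a + x)) = (LINT x|lebesgue. f x)"
proof -
  have [measurable]: "f \<in> borel_measurable borel" by fact
  have "(LINT x|lebesgue. f (a + x)) = (LINT x|lborel. f (a + x))"
    by (rule integral_completion) measurable
  also have "\<dots> = (LINT x|distr lborel borel ((+) a). f x)"
    by (subst integral_distr) auto
  also have "\<dots> = (LINT x|lborel. f x)" by (simp add: lborel_distr_plus)
  also have "\<dots> = (LINT x|lebesgue. f x)"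
    by (rule integral_completion[symmetric]) measurable
  finally show ?thesis .
qed

text \<open>By translation invariance the difference quotients have integral 0, and dominated
  convergence passes to the directional derivative. No iterated integrals enter.\<close>

lemma C1c_integral_deriv_0:
  assumes "C1c UNIV f F"
  shows "(LINT x|lebesgue. F x \<bullet> h) = 0"
proof -
  obtain K where K: "compact K" "\<And>x. x \<notin> K \<Longrightarrow> f x = 0" "\<And>x. x \<notin> K \<Longrightarrow> F x = 0"
    using C1cE[OF assms] by metis
  obtain r where r: "r > 0" "K \<subseteq> ball 0 r"
    using bounded_subset_ballD[OF compact_imp_bounded[OF K(1)], of 0] by blast
  obtain B where B: "B > 0" "\<And>x. \<bar>f x\<bar> \<le> B" "\<And>x. norm (F x) \<le> B"
    using C1c_bounded[OF assms] by blast
  note C = C1c_imp_C1[OF assms]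
  define s where "s n = inverse (real (Suc n))" for n
  define q where "q n x = (f (s n *\<^sub>R h + x) - f x) / s n" for n x
  have s0: "s n > 0" "s n \<le> 1" for n by (auto simp: s_def field_simps)
  have [measurable]: "f \<in> borel_measurable borel"
    by (rule borel_measurable_continuous_onI[OF C1_continuous[OF C]])
  have fm: "f \<in> borel_measurable lebesgue"
    by (rule continuous_imp_lebesgue_measurable[OF C1_continuous[OF C]])
  have fi: "integrable lebesgue f"
    by (rule compact_support_integrable[OF C1_continuous[OF C] K(1,2)])
  have shift_c: "continuous_on UNIV (\<lambda>x. f (s n *\<^sub>R h + x))" for n
    by (intro continuous_on_compose2[OF C1_continuous[OF C]] continuous_intros) auto
  have "integrable lebesgue (\<lambda>x. f (s n *\<^sub>R h + x))" for n
  proof (rule compact_support_integrable[OF shift_c])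
    show "compact ((\<lambda>x. - (s n *\<^sub>R h) + x) ` K)" by (rule compact_translation[OF K(1)])
    fix x assume "x \<notin> (\<lambda>x. - (s n *\<^sub>R h) + x) ` K"
    then have "s n *\<^sub>R h + x \<notin> K" by force
    then show "f (s n *\<^sub>R h + x) = 0" using K(2) by blast
  qed
  then have "(LINT x|lebesgue. q n x) = 0" for n
    unfolding q_def using fi lebesgue_integral_translate[of f "s n *\<^sub>R h"] by simp
  moreover have "(\<lambda>n. LINT x|lebesgue. q n x) \<longlonglongrightarrow> (LINT x|lebesgue. F x \<bullet> h)"
  \<comment> \<open>The quotients are bounded by the Lipschitz constant \<open>B\<close> times
    \<open>norm h\<close>, and as the steps \<open>s n\<close> are at most 1 they vanish outside the
    disc of radius \<open>r + norm h\<close>.\<close>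
  proof (rule integral_dominated_convergence[where w = "\<lambda>x. B * norm h * indicator (cball 0 (r + norm h)) x"])
    show "(\<lambda>x. F x \<bullet> h) \<in> borel_measurable lebesgue"
      by (intro continuous_imp_lebesgue_measurable continuous_intros C1D[OF C])
    show "q n \<in> borel_measurable lebesgue" for n
      unfolding q_def using continuous_imp_lebesgue_measurable[OF shift_c[of n]] fm by measurable
    show "integrable lebesgue (\<lambda>x. B * norm h * indicator (cball (0::real^2) (r + norm h)) x)"
      by (intro integrable_mult_right integrable_real_indicator)
         (use lmeasurable_cball[of "0::real^2" "r + norm h"] in \<open>auto simp: fmeasurable_def\<close>)
    show "AE x in lebesgue. (\<lambda>n. q n x) \<longlonglongrightarrow> F x \<bullet> h"
    proof (rule AE_I2)
      fix x
      have "((\<lambda>t. f (x + t *\<^sub>R h)) has_vector_derivative (F x \<bullet> h)) (at 0)"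
      proof -
        have 1: "((\<lambda>t::real. x + t *\<^sub>R h) has_derivative (\<lambda>t. t *\<^sub>R h)) (at 0)"
          by (auto intro!: derivative_eq_intros)
        show ?thesis
          using has_derivative_compose[OF 1, of f "\<lambda>k. F x \<bullet> k"] C1D(1)[OF C, of x]
          by (simp add: has_vector_derivative_def)
      qed
      then have "((\<lambda>t. f (x + t *\<^sub>R h)) has_real_derivative (F x \<bullet> h)) (at 0)"
        by (simp add: has_real_derivative_iff_has_vector_derivative)
      then have lim: "((\<lambda>t. (f (x + t *\<^sub>R h) - f x) / t) \<longlongrightarrow> F x \<bullet> h) (at 0)"
        by (simp add: DERIV_def)
      have "filterlim s (at 0) sequentially"
        unfolding filterlim_at
        using s0(1) LIMSEQ_inverse_real_of_nat by (auto simp: s_def[abs_def] less_imp_neq[symmetric] intro!: always_eventually)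
      from filterlim_compose[OF lim this]
      show "(\<lambda>n. q n x) \<longlonglongrightarrow> F x \<bullet> h"
        by (simp add: q_def add.commute)
    qed
    show "AE x in lebesgue. norm (q n x) \<le> B * norm h * indicator (cball 0 (r + norm h)) x" for n
    proof (rule AE_I2)
      fix x
      show "norm (q n x) \<le> B * norm h * indicator (cball 0 (r + norm h)) x"
      proof (cases "x \<in> cball 0 (r + norm h)")
        case True
        have "\<bar>f (s n *\<^sub>R h + x) - f x\<bar> \<le> B * norm (s n *\<^sub>R h + x - x)"
          by (rule C1_Lipschitz[OF C B(3)])
        also have "\<dots> = s n * (B * norm h)" using s0(1)[of n] by simp
        finally have "\<bar>f (s n *\<^sub>R h + x) - f x\<bar> \<le> s n * (B * norm h)" .
        then have "\<bar>f (s n *\<^sub>R h + x) - f x\<bar> / s n \<le> B * norm h"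
          using s0(1)[of n] by (simp add: divide_le_eq mult.commute)
        then show ?thesis using True s0(1)[of n] by (simp add: q_def)
      next
        case False
        then have nx: "norm x > r + norm h" by simp
        have "norm (s n *\<^sub>R h) \<le> norm h"
          using s0[of n] by (simp add: mult_left_le_one_le)
        then have "norm (s n *\<^sub>R h + x) > r"
          using nx norm_diff_ineq[of x "s n *\<^sub>R h"] by (simp add: add.commute)
        then have "s n *\<^sub>R h + x \<notin> K" "x \<notin> K"
          using subsetD[OF r(2), of x] subsetD[OF r(2), of "s n *\<^sub>R h + x"] nx norm_ge_zero[of h] by auto
        then show ?thesis using K(2) False by (simp add: q_def)
      qed
    qed
  qed
  ultimately show ?thesis by (simp add: LIMSEQ_const_iff)
qed

lemma C1c_integration_by_parts:
  assumes "C1c UNIV f F" "C1 y Y"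
  shows "(LINT x|lebesgue. y x * (F x \<bullet> h)) = - (LINT x|lebesgue. f x * (Y x \<bullet> h))"
proof -
  obtain K where K: "compact K" "\<And>x. x \<notin> K \<Longrightarrow> f x = 0" "\<And>x. x \<notin> K \<Longrightarrow> F x = 0"
    using C1cE[OF assms(1)] by metis
  note cont = C1_continuous[OF C1c_imp_C1[OF assms(1)]] C1_continuous[OF assms(2)] C1D(2)[OF C1c_imp_C1[OF assms(1)]] C1D(2)[OF assms(2)]
  have "integrable lebesgue (\<lambda>x. y x * (F x \<bullet> h))"
    by (rule compact_support_integrable[OF _ K(1)]) (use K(2,3) in \<open>auto intro!: continuous_intros cont\<close>)
  moreover have "integrable lebesgue (\<lambda>x. f x * (Y x \<bullet> h))"
    by (rule compact_support_integrable[OF _ K(1)]) (use K(2,3) in \<open>auto intro!: continuous_intros cont\<close>)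
  moreover have "(LINT x|lebesgue. y x * (F x \<bullet> h) + f x * (Y x \<bullet> h)) = 0"
    using C1c_integral_deriv_0[OF C1c_mult_left[OF assms], of h] by (simp add: inner_simps)
  ultimately show ?thesis by simp
qed

text \<open>\<open>H\<close> is the gradient of \<open>k\<close> and \<open>L\<close> its Laplacian,
  given as the divergence of \<open>H\<close>.\<close>

definition C2 :: "(real^2 \<Rightarrow> real) \<Rightarrow> (real^2 \<Rightarrow> real^2) \<Rightarrow> (real^2 \<Rightarrow> real) \<Rightarrow> bool" where
  "C2 k H L \<longleftrightarrow> C1 k H \<and> (\<exists>D. (\<forall>i. C1 (\<lambda>x. H x $ i) (D i)) \<and> L = (\<lambda>x. \<Sum>i\<in>UNIV. D i x $ i))"

lemma C2_continuous: "C2 k H L \<Longrightarrow> continuous_on UNIV L"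
  unfolding C2_def by (auto intro!: continuous_intros C1D(2))

text \<open>The divergence of \<open>(2 * F') *\<^sub>R (x - z)\<close>, where \<open>x - z\<close>
  itself has divergence 2 in the plane.\<close>

lemma C2_radial:
  fixes F F' F'' :: "real \<Rightarrow> real"
  assumes "\<And>t. t \<ge> 0 \<Longrightarrow> (F has_real_derivative F' t) (at t)"
    and "\<And>t. t \<ge> 0 \<Longrightarrow> (F' has_real_derivative F'' t) (at t)" "continuous_on {0..} F''"
  shows "C2 (\<lambda>x. F ((norm (x - z))\<^sup>2)) (\<lambda>x. (2 * F' ((norm (x - z))\<^sup>2)) *\<^sub>R (x - z))
    (\<lambda>x. 4 * ((norm (x - z))\<^sup>2 * F'' ((norm (x - z))\<^sup>2) + F' ((norm (x - z))\<^sup>2)))"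
proof -
  have c: "continuous_on {0..} F'"
    using assms(2) by (intro continuous_at_imp_continuous_on ballI DERIV_isCont[of _ "F'' _"]) auto
  let ?t = "\<lambda>x::real^2. (norm (x - z))\<^sup>2"
  have "C1 (\<lambda>x. (2 * F' (?t x)) * (x - z) $ i)
     (\<lambda>x. (2 * F' (?t x)) *\<^sub>R axis i 1 + (x - z) $ i *\<^sub>R (2 *\<^sub>R (2 * F'' (?t x)) *\<^sub>R (x - z)))" for i
    by (rule C1_mult[OF C1_scale[OF C1_radial[OF assms(2,3)]] C1_coord])
  moreover have "(\<lambda>x. 4 * (?t x * F'' (?t x) + F' (?t x))) =
      (\<lambda>x. \<Sum>i\<in>UNIV. ((2 * F' (?t x)) *\<^sub>R axis i 1 + (x - z) $ i *\<^sub>R (2 *\<^sub>R (2 * F'' (?t x)) *\<^sub>R (x - z))) $ i)"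
  proof
    fix x
    have "?t x = (\<Sum>i\<in>UNIV. (x - z) $ i * (x - z) $ i)"
      unfolding power2_norm_eq_inner inner_vec_def by simp
    then show "4 * (?t x * F'' (?t x) + F' (?t x)) =
      (\<Sum>i\<in>UNIV. ((2 * F' (?t x)) *\<^sub>R axis i 1 + (x - z) $ i *\<^sub>R (2 *\<^sub>R (2 * F'' (?t x)) *\<^sub>R (x - z))) $ i)"
      by (simp add: sum_2 axis_def distrib_left distrib_right mult_ac)
  qed
  ultimately show ?thesis
    unfolding C2_def using C1_radial[OF assms(1) c, of z]
    by (intro conjI exI[of _ "\<lambda>i x. (2 * F' (?t x)) *\<^sub>R axis i 1 + (x - z) $ i *\<^sub>R (2 *\<^sub>R (2 * F'' (?t x)) *\<^sub>R (x - z))"]) simp_all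
qed

lemma C1c_integration_by_parts_laplace:
  assumes "C1c UNIV f F" "C2 k H L"
  shows "(LINT x|lebesgue. F x \<bullet> H x) = - (LINT x|lebesgue. f x * L x)"
proof -
  obtain D where D: "\<And>i. C1 (\<lambda>x. H x $ i) (D i)" "L = (\<lambda>x. \<Sum>i\<in>UNIV. D i x $ i)"
    using assms(2) unfolding C2_def by blast
  obtain K where K: "compact K" "\<And>x. x \<notin> K \<Longrightarrow> f x = 0" "\<And>x. x \<notin> K \<Longrightarrow> F x = 0"
    using C1cE[OF assms(1)] by metis
  note cont = C1_continuous[OF C1c_imp_C1[OF assms(1)]] C1D(2)[OF C1c_imp_C1[OF assms(1)]] C1_continuous[OF D(1)] C1D(2)[OF D(1)]
  have ax: "v \<bullet> axis i 1 = v $ i" for v :: "real^2" and i by (simp add: inner_axis)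
  have 1: "(LINT x|lebesgue. H x $ i * F x $ i) = - (LINT x|lebesgue. f x * D i x $ i)" for i
    using C1c_integration_by_parts[OF assms(1) D(1), of i "axis i 1"] by (simp add: ax)
  have i1: "integrable lebesgue (\<lambda>x. H x $ i * F x $ i)" for i
    by (rule compact_support_integrable[OF _ K(1)]) (use K(2,3) in \<open>auto intro!: continuous_intros cont\<close>)
  have i2: "integrable lebesgue (\<lambda>x. f x * D i x $ i)" for i
    by (rule compact_support_integrable[OF _ K(1)]) (use K(2,3) in \<open>auto intro!: continuous_intros cont\<close>)
  have "(LINT x|lebesgue. F x \<bullet> H x) = (LINT x|lebesgue. (\<Sum>i\<in>UNIV. H x $ i * F x $ i))"
    by (simp add: inner_vec_def mult.commute)
  also have "\<dots> = (\<Sum>i\<in>UNIV. (LINT x|lebesgue. H x $ i * F x $ i))"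
    using i1 by (intro Bochner_Integration.integral_sum) auto
  also have "\<dots> = - (\<Sum>i\<in>UNIV. (LINT x|lebesgue. f x * D i x $ i))"
    by (simp add: 1 sum_negf)
  also have "(\<Sum>i\<in>UNIV. (LINT x|lebesgue. f x * D i x $ i)) = (LINT x|lebesgue. (\<Sum>i\<in>UNIV. f x * D i x $ i))"
    using i2 by (intro Bochner_Integration.integral_sum[symmetric]) auto
  finally show ?thesis by (simp add: D(2) sum_distrib_left)
qed

subsection \<open>Smooth functions and mollification\<close>

lemma C_diff_Suc_imp: "C_diff (Suc k) f \<Longrightarrow> C_diff k f"
proof (induction k arbitrary: f)
  case 0
  then show ?case
    by (auto intro!: continuous_at_imp_continuous_on differentiable_imp_continuous_within)
next
  case (Suc k)
  then show ?case by (auto simp del: C_diff.simps(1))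
qed

lemma partial_derivI:
  "(f has_derivative D) (at x) \<Longrightarrow> partial_deriv i f x = D (axis i 1)"
  unfolding partial_deriv_def by (simp add: frechet_derivative_at[symmetric])

lemma C_diff_const: "C_diff k (\<lambda>x. c)"
proof (induction k arbitrary: c)
  case (Suc k)
  have "partial_deriv i (\<lambda>x. c) = (\<lambda>x. 0)" for i
    by (rule ext, rule partial_derivI[of _ "\<lambda>h. 0"]) simp
  then show ?case using Suc by simp
qed simp

lemma partial_deriv_add:
  assumes "\<And>x. f differentiable (at x)" "\<And>x. g differentiable (at x)"
  shows "partial_deriv i (\<lambda>x. f x + g x) = (\<lambda>x. partial_deriv i f x + partial_deriv i g x)"
proof
  fix x
  note d = frechet_derivative_works[THEN iffD1, OF assms(1)[of x]] frechet_derivative_works[THEN iffD1, OF assms(2)[of x]]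
  show "partial_deriv i (\<lambda>x. f x + g x) x = partial_deriv i f x + partial_deriv i g x"
    using partial_derivI[OF has_derivative_add[OF d], of i] by (simp add: partial_deriv_def)
qed

lemma partial_deriv_mult:
  assumes "\<And>x. f differentiable (at x)" "\<And>x. g differentiable (at x)"
  shows "partial_deriv i (\<lambda>x. f x * g x) = (\<lambda>x. f x * partial_deriv i g x + partial_deriv i f x * g x)"
proof
  fix x
  note d = frechet_derivative_works[THEN iffD1, OF assms(1)[of x]] frechet_derivative_works[THEN iffD1, OF assms(2)[of x]]
  show "partial_deriv i (\<lambda>x. f x * g x) x = f x * partial_deriv i g x + partial_deriv i f x * g x"
    using partial_derivI[OF has_derivative_mult[OF d], of i] by (simp add: partial_deriv_def)
qed

lemma C_diff_add: "C_diff k f \<Longrightarrow> C_diff k g \<Longrightarrow> C_diff k (\<lambda>x. f x + g x)"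
proof (induction k arbitrary: f g)
  case (Suc k)
  then show ?case by (simp add: partial_deriv_add differentiable_add)
qed (auto intro: continuous_on_add)

lemma C_diff_mult: "C_diff k f \<Longrightarrow> C_diff k g \<Longrightarrow> C_diff k (\<lambda>x. f x * g x)"
proof (induction k arbitrary: f g)
  case (Suc k)
  have "C_diff k f" "C_diff k g" using Suc.prems by (auto intro: C_diff_Suc_imp)
  then show ?case
    using Suc.prems by (auto simp: partial_deriv_mult intro!: differentiable_mult C_diff_add Suc.IH)
qed (auto intro: continuous_on_mult)

lemma C_diff_coord: "C_diff k (\<lambda>x. x $ j)"
proof (induction k)
  case 0
  show ?case by (auto intro!: continuous_intros)
next
  case (Suc k)
  have d: "((\<lambda>x. x $ j) has_derivative (\<lambda>h. h $ j)) (at x)" for x :: "real^2"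
    using C1D(1)[OF C1_coord[of 0 j], of x] by (simp add: inner_axis inner_axis')
  have "partial_deriv i (\<lambda>x. x $ j) = (\<lambda>x. axis i 1 $ j)" for i
    by (rule ext, rule partial_derivI[OF d])
  then show ?case using d by (auto simp: C_diff_const differentiable_def)
qed

section \<open>A smooth function of compact support\<close>

definition bump :: "real poly \<Rightarrow> real \<Rightarrow> real" where
  "bump P t = (if t > 0 then poly P (1 / t) * exp (- (1 / t)) else 0)"

lemma poly_mult_exp_tendsto_0: "((\<lambda>s::real. poly P s * exp (- s)) \<longlongrightarrow> 0) at_top"
proof -
  have "((\<lambda>s::real. \<Sum>i\<le>degree P. coeff P i * (s ^ i / exp s)) \<longlongrightarrow> (\<Sum>i\<le>degree P. coeff P i * 0)) at_top"
    by (intro tendsto_sum tendsto_mult_left tendsto_power_div_exp_0)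
  then show ?thesis
    by (simp add: poly_altdef exp_minus field_simps sum_distrib_left)
qed

lemma bump_tendsto_0: "((\<lambda>t. bump P t) \<longlongrightarrow> 0) (at 0)"
proof -
  have "(bump P \<longlongrightarrow> 0) (at_left 0)"
    by (rule Lim_transform_eventually[OF tendsto_const])
       (auto simp: bump_def eventually_at_left[of "-1"] intro!: exI[of _ "-1"])
  moreover have "(bump P \<longlongrightarrow> 0) (at_right 0)"
  proof (rule Lim_transform_eventually)
    show "((\<lambda>t. poly P (inverse t) * exp (- inverse t)) \<longlongrightarrow> 0) (at_right 0)"
      using filterlim_compose[OF poly_mult_exp_tendsto_0 filterlim_inverse_at_top_right] .
    show "\<forall>\<^sub>F t in at_right 0. poly P (inverse t) * exp (- inverse t) = bump P t"
      by (auto simp: bump_def eventually_at_right[of _ 1] inverse_eq_divide intro!: exI[of _ 1])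
  qed
  ultimately show ?thesis by (simp add: filterlim_at_split)
qed

text \<open>For \<open>P = 1\<close> this is the classical \<open>exp (- (1 / t))\<close>.
  Derivatives are again a polynomial in \<open>1 / t\<close> times the exponential, so carrying
  \<open>P\<close> closes the family under differentiation; the induction in
  \<open>C_diff_bump_radial\<close> runs on this.\<close>

lemma bump_deriv: "(bump P has_real_derivative bump ([:0, 0, 1:] * (P - pderiv P)) t) (at t)"
proof (cases t "0::real" rule: linorder_cases)
  case less
  have "((\<lambda>t. 0) has_real_derivative 0) (at t)" by simp
  then have "(bump P has_real_derivative 0) (at t)"
    by (rule has_field_derivative_transform_within_open[where S = "{..<0}"]) (use less in \<open>auto simp: bump_def\<close>)
  then show ?thesis using less by (simp add: bump_def)
next
  case equal
  \<comment> \<open>At 0 the difference quotient of \<open>bump P\<close> is itself a bump, with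
    \<open>P\<close> multiplied by the variable, and so tends to 0.\<close>
  have "((\<lambda>h. bump ([:0, 1:] * P) h) \<longlongrightarrow> 0) (at 0)" by (rule bump_tendsto_0)
  then have "((\<lambda>h. (bump P (0 + h) - bump P 0) / h) \<longlongrightarrow> 0) (at 0)"
    by (rule Lim_transform_eventually)
       (auto simp: bump_def eventually_at_filter intro!: always_eventually)
  then show ?thesis using equal by (simp add: DERIV_def bump_def)
next
  case greater
  have "((\<lambda>t. poly P (1 / t) * exp (- (1 / t))) has_real_derivative
      bump ([:0, 0, 1:] * (P - pderiv P)) t) (at t)"
    using greater
    by (auto intro!: derivative_eq_intros DERIV_chain2[OF poly_DERIV] simp: bump_def field_simps power2_eq_square)
  then show ?thesis
    by (rule has_field_derivative_transform_within_open[where S = "{0<..}"]) (use greater in \<open>auto simp: bump_def\<close>)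
qed

lemma C_diff_bump_radial: "C_diff k (\<lambda>x. bump P (1 + b * (norm (x::real^2))\<^sup>2))"
proof (induction k arbitrary: P)
  case 0
  have "continuous_on UNIV (bump P)"
    by (intro continuous_at_imp_continuous_on ballI DERIV_isCont[OF bump_deriv])
  then show ?case
    by (auto intro!: continuous_on_compose2[of UNIV "bump P"] continuous_intros)
next
  case (Suc k)
  let ?Q = "[:0, 0, 1:] * (P - pderiv P)"
  have q: "((\<lambda>x. 1 + b * (norm (x::real^2))\<^sup>2) has_derivative (\<lambda>h. 2 * b * (x \<bullet> h))) (at x)" for x
    unfolding power2_norm_eq_inner by (auto intro!: derivative_eq_intros simp: inner_commute)
  have d: "((\<lambda>x. bump P (1 + b * (norm (x::real^2))\<^sup>2)) has_derivative
      (\<lambda>h. bump ?Q (1 + b * (norm x)\<^sup>2) * (2 * b * (x \<bullet> h)))) (at x)" for x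
    by (rule has_derivative_compose[OF q bump_deriv[unfolded has_field_derivative_def]])
  have "partial_deriv i (\<lambda>x. bump P (1 + b * (norm (x::real^2))\<^sup>2)) =
      (\<lambda>x. bump ?Q (1 + b * (norm x)\<^sup>2) * (2 * b * x $ i))" for i
    using partial_derivI[OF d] by (auto simp: inner_axis)
  then show ?case
    using Suc d by (auto simp: differentiable_def intro!: C_diff_mult C_diff_const C_diff_coord)
qed

lemma C_diff_imp_C1:
  assumes "C_diff (Suc 0) f"
  shows "C1 f (grad f)"
proof -
  have d: "f differentiable (at x)" for x using assms by simp
  have "frechet_derivative f (at x) = (\<lambda>h. grad f x \<bullet> h)" for x
  proof
    fix h :: "real^2"
    have lin: "linear (frechet_derivative f (at x))" by (rule linear_frechet_derivative[OF d])
    have "h = h $ 1 *\<^sub>R axis 1 1 + h $ 2 *\<^sub>R axis 2 1"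
      by (simp add: vec_eq_iff forall_2 axis_def)
    from arg_cong[OF this, of "frechet_derivative f (at x)"]
    have "frechet_derivative f (at x) h =
        h $ 1 * frechet_derivative f (at x) (axis 1 1) + h $ 2 * frechet_derivative f (at x) (axis 2 1)"
      by (simp only: linear_add[OF lin] linear_scale[OF lin] real_scaleR_def)
    then show "frechet_derivative f (at x) h = grad f x \<bullet> h"
      by (simp add: grad_def partial_deriv_def inner_vec_def sum_2 mult.commute)
  qed
  then have "(f has_derivative (\<lambda>h. grad f x \<bullet> h)) (at x)" for x
    using frechet_derivative_works[THEN iffD1, OF d[of x]] by simp
  moreover have "continuous_on UNIV (grad f)"
    unfolding grad_def using assms by (intro continuous_on_vec_lambda) auto
  ultimately show ?thesis by (simp add: C1_def)
qed

lemma C1_imp_partial_deriv: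
  assumes "C1 f G"
  shows "partial_deriv i f x = G x $ i" "grad f x = G x" "f differentiable (at x)"
proof -
  show p: "partial_deriv i f x = G x $ i" for i
    using partial_derivI[OF C1D(1)[OF assms]] by (simp add: inner_axis)
  then show "grad f x = G x" by (simp add: grad_def vec_eq_iff)
  show "f differentiable (at x)" using C1D(1)[OF assms] by (auto simp: differentiable_def)
qed

lemma test_function_C1c:
  assumes "\<phi> \<in> test_functions U"
  shows "C1c U \<phi> (grad \<phi>)"
proof (rule C1cI)
  show "C1 \<phi> (grad \<phi>)" using assms by (intro C_diff_imp_C1) (simp add: test_functions_def)
  show "compact (closure {x. \<phi> x \<noteq> 0})" "closure {x. \<phi> x \<noteq> 0} \<subseteq> U"
    using assms by (auto simp: test_functions_def)
  show "\<phi> x = 0" if "x \<notin> closure {x. \<phi> x \<noteq> 0}" for x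
    using that closure_subset[of "{x. \<phi> x \<noteq> 0}"] by auto
qed

lemma test_functionI:
  assumes "\<And>k. C_diff k \<phi>" "compact K" "K \<subseteq> U" "\<And>x. x \<notin> K \<Longrightarrow> \<phi> x = 0"
  shows "\<phi> \<in> test_functions U"
proof -
  have "closure {x. \<phi> x \<noteq> 0} \<subseteq> K"
    using assms(2,4) by (intro closure_minimal compact_imp_closed) auto
  then show ?thesis
    using assms(1,3) compact_closure[of "{x. \<phi> x \<noteq> 0}"]
      bounded_subset[OF compact_imp_bounded[OF assms(2)], of "{x. \<phi> x \<noteq> 0}"] closure_subset[of "{x. \<phi> x \<noteq> 0}"]
    by (auto simp: test_functions_def)
qed

lemma compact_support_uniformly_continuous:
  fixes f :: "'a::euclidean_space \<Rightarrow> 'b::euclidean_space"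
  assumes "continuous_on UNIV f" "compact K" "\<And>x. x \<notin> K \<Longrightarrow> f x = 0" "e > 0"
  obtains d where "d > 0" "\<And>x y. norm (x - y) < d \<Longrightarrow> norm (f x - f y) < e"
proof -
  obtain r where r: "K \<subseteq> ball 0 r"
    using bounded_subset_ballD[OF compact_imp_bounded[OF assms(2)], of 0] by blast
  have "uniformly_continuous_on (cball 0 (r + 1)) f"
    by (rule compact_uniformly_continuous[OF continuous_on_subset[OF assms(1)]]) auto
  then obtain d where d: "d > 0"
    "\<And>x y. x \<in> cball 0 (r + 1) \<Longrightarrow> y \<in> cball 0 (r + 1) \<Longrightarrow> dist y x < d \<Longrightarrow> dist (f y) (f x) < e"
    unfolding uniformly_continuous_on_def using assms(4) by meson
  show thesis
  proof (rule that[of "min d 1"])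
    show "min d 1 > 0" using d(1) by simp
    fix x y :: 'a assume xy: "norm (x - y) < min d 1"
    show "norm (f x - f y) < e"
    proof (cases "norm x < r \<or> norm y < r")
      case True
      have "norm x \<le> norm y + norm (x - y)" "norm y \<le> norm x + norm (x - y)"
        using norm_triangle_ineq2[of x y] norm_triangle_ineq2[of y x] by (auto simp: norm_minus_commute)
      then have "x \<in> cball 0 (r + 1)" "y \<in> cball 0 (r + 1)" using True xy by auto
      then show ?thesis using d(2)[of y x] xy by (simp add: dist_norm)
    next
      case False
      then have "x \<notin> K" "y \<notin> K" using r by (auto simp: subset_iff)
      then show ?thesis using assms(3,4) by simp
    qed
  qed
qed

lemma integrable_mult_bounded:
  fixes f :: "'a \<Rightarrow> real" and g :: "'a \<Rightarrow> 'b::euclidean_space"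
  assumes "integrable M f" "g \<in> borel_measurable M" "\<And>x. norm (g x) \<le> B"
  shows "integrable M (\<lambda>x. f x *\<^sub>R g x)"
proof (rule Bochner_Integration.integrable_bound)
  have [measurable]: "f \<in> borel_measurable M" "g \<in> borel_measurable M" using assms by auto
  show "integrable M (\<lambda>x. f x * B)" using assms(1) by simp
  show "(\<lambda>x. f x *\<^sub>R g x) \<in> borel_measurable M" by measurable
  show "AE x in M. norm (f x *\<^sub>R g x) \<le> norm (f x * B)"
  proof (rule AE_I2)
    fix x
    have "\<bar>f x\<bar> * norm (g x) \<le> \<bar>f x\<bar> * \<bar>B\<bar>"
      by (intro mult_left_mono order_trans[OF assms(3)]) auto
    then show "norm (f x *\<^sub>R g x) \<le> norm (f x * B)" by (simp add: abs_mult)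
  qed
qed

lemma integrable_mult_bounded_real:
  fixes f g :: "'a \<Rightarrow> real"
  assumes "integrable M f" "g \<in> borel_measurable M" "\<And>x. \<bar>g x\<bar> \<le> B"
  shows "integrable M (\<lambda>x. f x * g x)"
  using integrable_mult_bounded[of M f g B] assms by simp

lemma integral_norm_le:
  fixes f :: "'a \<Rightarrow> 'b::euclidean_space" and g :: "'a \<Rightarrow> real"
  assumes "integrable M f" "integrable M g" "\<And>x. norm (f x) \<le> g x"
  shows "norm (LINT x|M. f x) \<le> (LINT x|M. g x)"
  using integral_norm_bound[of M f] integral_mono[OF integrable_norm[OF assms(1)] assms(2,3)] by linarith

lemma continuous_AE_eq_0:
  fixes f :: "'a::euclidean_space \<Rightarrow> real"
  assumes "open U" "continuous_on U f" "AE x in lebesgue. x \<in> U \<longrightarrow> f x = 0" "x \<in> U"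
  shows "f x = 0"
proof (rule ccontr)
  assume "f x \<noteq> 0"
  define V where "V = U \<inter> f -` (- {0})"
  have V: "open V" unfolding V_def by (rule continuous_open_preimage[OF assms(2,1)]) auto
  have "{x \<in> space lebesgue. \<not> (x \<in> U \<longrightarrow> f x = 0)} = V" by (auto simp: V_def)
  then have "V \<in> null_sets lebesgue"
    using AE_iff_null[of lebesgue "\<lambda>x. x \<in> U \<longrightarrow> f x = 0"] assms(3) V by simp
  then have "negligible V" by (simp add: negligible_iff_null_sets)
  then show False using open_not_negligible[OF V] \<open>f x \<noteq> 0\<close> assms(4) by (auto simp: V_def)
qed

section \<open>Convolution and approximation by test functions\<close>

definition conv :: "(real^2 \<Rightarrow> real) \<Rightarrow> (real^2 \<Rightarrow> real) \<Rightarrow> real^2 \<Rightarrow> real" where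
  "conv f g x = (LINT y|lebesgue. f y * g (x - y))"

text \<open>As \<open>E\<close> is uniformly continuous, the first order remainder of
  \<open>g\<close> is small uniformly in the base point (\<open>rem\<close>). Integrated against
  \<open>\<bar>f\<bar>\<close> it stays small, so a merely integrable \<open>f\<close> has a C1
  convolution.\<close>

lemma conv_C1:
  assumes f: "integrable lebesgue f" and g: "C1c UNIV g E"
  shows "C1 (conv f g) (\<lambda>x. LINT y|lebesgue. f y *\<^sub>R E (x - y))"
proof -
  note gC = C1c_imp_C1[OF g]
  obtain K where K: "compact K" "\<And>x. x \<notin> K \<Longrightarrow> g x = 0" "\<And>x. x \<notin> K \<Longrightarrow> E x = 0"
    using C1cE[OF g] by metis
  obtain B where B: "B > 0" "\<And>x. \<bar>g x\<bar> \<le> B" "\<And>x. norm (E x) \<le> B"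
    by (rule C1c_bounded[OF g]) (rule that)
  have mg: "(\<lambda>y. g (x - y)) \<in> borel_measurable lebesgue" for x
    by (intro continuous_imp_lebesgue_measurable continuous_on_compose2[OF C1_continuous[OF gC]] continuous_intros) auto
  have mE: "(\<lambda>y. E (x - y)) \<in> borel_measurable lebesgue" for x
    by (intro continuous_imp_lebesgue_measurable continuous_on_compose2[OF C1D(2)[OF gC]] continuous_intros) auto
  have ig: "integrable lebesgue (\<lambda>y. f y * g (x - y))" for x
    by (rule integrable_mult_bounded_real[OF f mg B(2)])
  have iE: "integrable lebesgue (\<lambda>y. f y *\<^sub>R E (x - y))" for x
    by (rule integrable_mult_bounded[OF f mE B(3)])
  define I where "I = (LINT y|lebesgue. \<bar>f y\<bar>)"
  have I0: "I \<ge> 0" by (simp add: I_def)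
  have fa: "integrable lebesgue (\<lambda>y. \<bar>f y\<bar>)" using f by simp
  have unif: "\<exists>d>0. \<forall>x y. norm (x - y) < d \<longrightarrow> norm (E x - E y) < e" if "e > 0" for e
    by (rule compact_support_uniformly_continuous[OF C1D(2)[OF gC] K(1,3) that], assumption) (rule exI, rule conjI, assumption, simp)
  have rem: "\<exists>d>0. \<forall>z h. norm h < d \<longrightarrow> \<bar>g (z + h) - g z - E z \<bullet> h\<bar> \<le> e * norm h" if "e > 0" for e
  proof -
    obtain d where d: "d > 0" "\<And>x y. norm (x - y) < d \<Longrightarrow> norm (E x - E y) < e" using unif[OF \<open>e > 0\<close>] by blast
    have "\<bar>g (z + h) - g z - E z \<bullet> h\<bar> \<le> e * norm h" if h: "norm h < d" for z h
    proof -
      have "norm ((g (z + h) - E z \<bullet> h) - (g (z + 0) - E z \<bullet> 0)) \<le> e * norm (h - 0)"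
      proof (rule differentiable_bound[of "ball 0 d" "\<lambda>h. g (z + h) - E z \<bullet> h" "\<lambda>(k::real^2) (h::real^2). E (z + k) \<bullet> h - E z \<bullet> h"])
        fix k :: "real^2" assume k: "k \<in> ball 0 d"
        have 1: "((\<lambda>k. z + k) has_derivative (\<lambda>k. k)) (at k)" by (auto intro!: derivative_eq_intros)
        have "((\<lambda>h. g (z + h)) has_derivative (\<lambda>h. E (z + k) \<bullet> h)) (at k)"
          by (rule has_derivative_compose[OF 1 C1D(1)[OF gC]])
        then have "((\<lambda>h. g (z + h) - E z \<bullet> h) has_derivative (\<lambda>h. E (z + k) \<bullet> h - E z \<bullet> h)) (at k)"
          by (auto intro!: derivative_eq_intros)
        then show "((\<lambda>h. g (z + h) - E z \<bullet> h) has_derivative (\<lambda>h. E (z + k) \<bullet> h - E z \<bullet> h)) (at k within ball 0 d)"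
          by (rule has_derivative_at_withinI)
        show "onorm (\<lambda>h. E (z + k) \<bullet> h - E z \<bullet> h) \<le> e"
        proof (rule onorm_le)
          fix h :: "real^2"
          have "norm (E (z + k) - E z) < e" using d(2)[of "z + k" z] k by simp
          then have "norm (E (z + k) - E z) * norm h \<le> e * norm h" by (intro mult_right_mono) auto
          then show "norm (E (z + k) \<bullet> h - E z \<bullet> h) \<le> e * norm h"
            using Cauchy_Schwarz_ineq2[of "E (z + k) - E z" h] by (simp add: inner_diff_left)
        qed
      qed (use h d(1) in auto)
      then show ?thesis by (simp add: algebra_simps)
    qed
    then show ?thesis using d(1) by blast
  qed
  have der: "(conv f g has_derivative (\<lambda>h. (LINT y|lebesgue. f y *\<^sub>R E (x - y)) \<bullet> h)) (at x)" for x
    unfolding has_derivative_at_alt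
  proof (intro conjI allI impI)
    show "bounded_linear ((\<bullet>) (LINT y|lebesgue. f y *\<^sub>R E (x - y)))" by (rule bounded_linear_inner_right)
    fix e :: real assume "e > 0"
    \<comment> \<open>\<open>I\<close> may be 0, hence the division by \<open>I + 1\<close>;
      afterwards \<open>I / (I + 1) \<le> 1\<close> absorbs the integral.\<close>
    then have "e / (I + 1) > 0" using I0 by simp
    from rem[OF this] obtain d where d: "d > 0"
      "\<And>z h. norm h < d \<Longrightarrow> \<bar>g (z + h) - g z - E z \<bullet> h\<bar> \<le> e / (I + 1) * norm h"
      by blast
    have "norm (conv f g w - conv f g x - (LINT y|lebesgue. f y *\<^sub>R E (x - y)) \<bullet> (w - x)) \<le> e * norm (w - x)"
      if w: "norm (w - x) < d" for w
    proof -
      have "conv f g w - conv f g x - (LINT y|lebesgue. f y *\<^sub>R E (x - y)) \<bullet> (w - x) =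
          (LINT y|lebesgue. f y * g (w - y) - f y * g (x - y) - (f y *\<^sub>R E (x - y)) \<bullet> (w - x))"
        unfolding conv_def
        by (simp only: integral_inner_left[OF iE] Bochner_Integration.integral_diff[OF ig ig]
            Bochner_Integration.integral_diff[OF Bochner_Integration.integrable_diff[OF ig ig] integrable_inner_left[OF iE]])
      also have "norm \<dots> \<le> (LINT y|lebesgue. \<bar>f y\<bar> * (e / (I + 1) * norm (w - x)))"
      proof (rule integral_norm_le)
        show "integrable lebesgue (\<lambda>y. f y * g (w - y) - f y * g (x - y) - (f y *\<^sub>R E (x - y)) \<bullet> (w - x))"
          by (intro Bochner_Integration.integrable_diff ig integrable_inner_left iE)
        show "integrable lebesgue (\<lambda>y. \<bar>f y\<bar> * (e / (I + 1) * norm (w - x)))" using fa by simp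
        fix y
        have "f y * g (w - y) - f y * g (x - y) - (f y *\<^sub>R E (x - y)) \<bullet> (w - x) =
            f y * (g ((x - y) + (w - x)) - g (x - y) - E (x - y) \<bullet> (w - x))"
          by (simp add: algebra_simps)
        then show "norm (f y * g (w - y) - f y * g (x - y) - (f y *\<^sub>R E (x - y)) \<bullet> (w - x))
            \<le> \<bar>f y\<bar> * (e / (I + 1) * norm (w - x))"
          using mult_left_mono[OF d(2)[OF w, of "x - y"], of "\<bar>f y\<bar>"] by (simp add: abs_mult)
      qed
      also have "\<dots> = (I / (I + 1)) * (e * norm (w - x))" by (simp add: I_def)
      also have "\<dots> \<le> 1 * (e * norm (w - x))"
        using I0 \<open>e > 0\<close> by (intro mult_right_mono) auto
      finally show ?thesis by simp
    qed
    then show "\<exists>d>0. \<forall>w. norm (w - x) < d \<longrightarrow>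
        norm (conv f g w - conv f g x - (LINT y|lebesgue. f y *\<^sub>R E (x - y)) \<bullet> (w - x)) \<le> e * norm (w - x)"
      using d(1) by blast
  qed
  have "continuous_on UNIV (\<lambda>x. LINT y|lebesgue. f y *\<^sub>R E (x - y))"
    unfolding continuous_on_iff
  proof (intro ballI allI impI)
    fix x and e :: real assume "e > 0"
    then have "e / (I + 1) > 0" using I0 by simp
    from unif[OF this] obtain d where d: "d > 0"
      "\<And>x y. norm (x - y) < d \<Longrightarrow> norm (E x - E y) < e / (I + 1)" by blast
    have "dist (LINT y|lebesgue. f y *\<^sub>R E (w - y)) (LINT y|lebesgue. f y *\<^sub>R E (x - y)) < e" if w: "dist w x < d" for w
    proof -
      have "norm ((LINT y|lebesgue. f y *\<^sub>R E (w - y)) - (LINT y|lebesgue. f y *\<^sub>R E (x - y))) =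
          norm (LINT y|lebesgue. f y *\<^sub>R E (w - y) - f y *\<^sub>R E (x - y))"
        using iE by simp
      also have "\<dots> \<le> (LINT y|lebesgue. \<bar>f y\<bar> * (e / (I + 1)))"
      proof (rule integral_norm_le)
        fix y
        have "norm ((w - y) - (x - y)) < d" using w by (simp add: dist_norm)
        then have "norm (E (w - y) - E (x - y)) \<le> e / (I + 1)" by (rule less_imp_le[OF d(2)])
        then show "norm (f y *\<^sub>R E (w - y) - f y *\<^sub>R E (x - y)) \<le> \<bar>f y\<bar> * (e / (I + 1))"
          using mult_left_mono[of "norm (E (w - y) - E (x - y))" "e / (I + 1)" "\<bar>f y\<bar>"]
          by (simp flip: scaleR_diff_right)
      qed (use iE fa in auto)
      also have "\<dots> = (I / (I + 1)) * e" by (simp add: I_def)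
      also have "\<dots> < e" using I0 \<open>e > 0\<close> by (simp add: field_simps)
      finally show ?thesis by (simp add: dist_norm)
    qed
    then show "\<exists>d>0. \<forall>w\<in>UNIV. dist w x < d \<longrightarrow>
        dist (LINT y|lebesgue. f y *\<^sub>R E (w - y)) (LINT y|lebesgue. f y *\<^sub>R E (x - y)) < e"
      using d(1) by blast
  qed
  with der show ?thesis by (simp add: C1_def)
qed

text \<open>All derivatives fall on the kernel. The induction varies the kernel and its support,
  because the kernel of the next stage is a partial derivative of \<open>g\<close>.\<close>

lemma conv_C_diff:
  assumes f: "integrable lebesgue f" and "\<And>k. C_diff k g" "compact K" "\<And>x. x \<notin> K \<Longrightarrow> g x = 0"
  shows "C_diff k (conv f g)"
  using assms(2-4)
proof (induction k arbitrary: g K)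
  case (0 g)
  have "C1c UNIV g (grad g)" using 0 by (intro C1cI[where K = K] C_diff_imp_C1) auto
  from C1_continuous[OF conv_C1[OF f this]] show ?case by simp
next
  case (Suc k g)
  have g: "C1c UNIV g (grad g)" using Suc.prems by (intro C1cI[where K = K] C_diff_imp_C1) auto
  obtain L where L: "compact L" "\<And>x. x \<notin> L \<Longrightarrow> grad g x = 0" by (rule C1cE[OF g]) (rule that)
  obtain B where B: "\<And>x. norm (grad g x) \<le> B" by (rule C1c_bounded[OF g]) (rule that)
  note C = conv_C1[OF f g]
  have mE: "(\<lambda>y. grad g (x - y)) \<in> borel_measurable lebesgue" for x
    by (intro continuous_imp_lebesgue_measurable continuous_on_compose2[OF C1D(2)[OF C1c_imp_C1[OF g]]] continuous_intros) auto
  have "partial_deriv i (conv f g) = conv f (partial_deriv i g)" for i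
  proof
    fix x
    have "partial_deriv i (conv f g) x = (LINT y|lebesgue. f y *\<^sub>R grad g (x - y)) \<bullet> axis i 1"
      unfolding C1_imp_partial_deriv(1)[OF C] by (simp add: inner_axis)
    also have "\<dots> = (LINT y|lebesgue. (f y *\<^sub>R grad g (x - y)) \<bullet> axis i 1)"
      by (rule integral_inner_left[symmetric]) (rule integrable_mult_bounded[OF f mE B])
    also have "\<dots> = conv f (partial_deriv i g) x"
      by (simp add: conv_def grad_def inner_axis)
    finally show "partial_deriv i (conv f g) x = conv f (partial_deriv i g) x" .
  qed
  moreover have "C_diff k (conv f (partial_deriv i g))" for i
  proof (rule Suc.IH[OF _ L(1)])
    show "C_diff k (partial_deriv i g)" for k using Suc.prems(1)[of "Suc k"] by simp
    show "partial_deriv i g x = 0" if "x \<notin> L" for x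
      using L(2)[OF that] by (simp add: grad_def vec_eq_iff)
  qed
  moreover have "\<And>x. conv f g differentiable (at x)" by (rule C1_imp_partial_deriv(3)[OF C])
  ultimately show ?case by simp
qed

lemma mollifier_exists:
  assumes "d > 0"
  obtains g :: "real^2 \<Rightarrow> real" where "\<And>k. C_diff k g" "\<And>x. g x \<ge> 0" "\<And>x. norm x > d \<Longrightarrow> g x = 0"
    "(LINT x|lebesgue. g x) = 1"
proof -
  \<comment> \<open>The argument of the bump is \<open>1 - (norm x / d)\<^sup>2\<close>, positive
    exactly inside the disc of radius \<open>d\<close>.\<close>
  define b where "b x = bump 1 (1 + (- 1 / d\<^sup>2) * (norm (x::real^2))\<^sup>2)" for x
  have bC: "C_diff k b" for k unfolding b_def by (rule C_diff_bump_radial)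
  have b0: "b x = 0" if "norm x > d" for x
  proof -
    have "(norm x)\<^sup>2 > d\<^sup>2" using that assms by (intro power_strict_mono) auto
    then show ?thesis using assms by (simp add: b_def bump_def field_simps)
  qed
  have bn: "b x \<ge> 0" for x by (simp add: b_def bump_def)
  have cont: "continuous_on UNIV b" using bC[of 0] by simp
  have int: "integrable lebesgue b"
    by (rule compact_support_integrable[OF cont compact_cball[of 0 d]]) (use b0 in auto)
  have "(LINT x|lebesgue. b x) \<noteq> 0"
  proof
    assume "(LINT x|lebesgue. b x) = 0"
    then have "AE x in lebesgue. b x = 0"
      using integral_nonneg_eq_0_iff_AE[OF int] bn by simp
    then have "b 0 = 0" by (intro continuous_AE_eq_0[OF open_UNIV cont]) auto
    then show False by (simp add: b_def bump_def)
  qed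
  then have pos: "(LINT x|lebesgue. b x) > 0" using Bochner_Integration.integral_nonneg[of lebesgue b] bn by (simp add: less_le)
  show thesis
  proof (rule that[of "\<lambda>x. b x / (LINT x|lebesgue. b x)"])
    show "C_diff k (\<lambda>x. b x / (LINT x|lebesgue. b x))" for k
      unfolding divide_inverse by (intro C_diff_mult bC C_diff_const)
  qed (use bn b0 pos in auto)
qed

lemma conv_translate:
  assumes "continuous_on UNIV f" "continuous_on UNIV g"
  shows "conv f g x = (LINT y|lebesgue. f (x - y) * g y)"
proof -
  have "(\<lambda>z. f z * g (x - z)) \<in> borel_measurable borel"
    by (intro borel_measurable_continuous_onI continuous_intros continuous_on_compose2[OF assms(2)] assms(1)) auto
  from lebesgue_integral_translate[OF this, of x]
  have 1: "conv f g x = (LINT y|lebesgue. f (x + y) * g (- y))" by (simp add: conv_def)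
  have 2: "(\<lambda>y. f (x + y) * g (- y)) \<in> borel_measurable borel"
    by (intro borel_measurable_continuous_onI continuous_intros continuous_on_compose2[OF assms(2)]
        continuous_on_compose2[OF assms(1)]) auto
  have d: "distr lborel borel uminus = (lborel :: (real^2) measure)"
    using lborel_affine[of "-1::real" "0::real^2"] by (simp add: density_1 power2_eq_square)
  have "(LINT y|lebesgue. f (x + y) * g (- y)) = (LINT y|lborel. f (x + y) * g (- y))"
    using 2 by (intro integral_completion) simp
  also have "\<dots> = (LINT y|distr lborel borel uminus. f (x + y) * g (- y))" by (simp add: d)
  also have "\<dots> = (LINT y|lborel. f (x + (- y)) * g (- (- y)))"
    using 2 by (intro integral_distr) auto
  also have "\<dots> = (LINT y|lborel. f (x - y) * g y)" by simp
  also have "\<dots> = (LINT y|lebesgue. f (x - y) * g y)"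
  proof (rule integral_completion[symmetric])
    have "(\<lambda>y. f (x - y) * g y) \<in> borel_measurable borel"
      by (intro borel_measurable_continuous_onI continuous_intros assms(2) continuous_on_compose2[OF assms(1)]) auto
    then show "(\<lambda>y. f (x - y) * g y) \<in> borel_measurable lborel" by simp
  qed
  finally show ?thesis using 1 by simp
qed

lemma conv_close:
  assumes "continuous_on UNIV f" "continuous_on UNIV g" "\<And>x. g x \<ge> 0" "\<And>x. norm x > d \<Longrightarrow> g x = 0"
    "(LINT x|lebesgue. g x) = 1" "\<And>x y. norm (x - y) \<le> d \<Longrightarrow> \<bar>f x - f y\<bar> \<le> e"
  shows "\<bar>conv f g x - f x\<bar> \<le> e"
proof -
  have gi: "integrable lebesgue g"
    by (rule compact_support_integrable[OF assms(2) compact_cball[of 0 d]]) (use assms(4) in auto)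
  have fc: "continuous_on UNIV (\<lambda>y. f (x - y))"
    by (intro continuous_on_compose2[OF assms(1)] continuous_intros) auto
  have fgi: "integrable lebesgue (\<lambda>y. f (x - y) * g y)"
    by (rule compact_support_integrable[OF _ compact_cball[of 0 d]])
       (use assms(4) in \<open>auto intro!: continuous_intros fc assms(2)\<close>)
  have "conv f g x - f x = (LINT y|lebesgue. f (x - y) * g y) - (LINT y|lebesgue. f x * g y)"
    using conv_translate[OF assms(1,2)] assms(5) by simp
  also have "\<dots> = (LINT y|lebesgue. f (x - y) * g y - f x * g y)"
    by (rule Bochner_Integration.integral_diff[symmetric, OF fgi]) (use gi in simp)
  also have "norm \<dots> \<le> (LINT y|lebesgue. e * g y)"
  proof (rule integral_norm_le)
    show "integrable lebesgue (\<lambda>y. f (x - y) * g y - f x * g y)" using fgi gi by simp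
    show "integrable lebesgue (\<lambda>y. e * g y)" using gi by simp
    fix y
    show "norm (f (x - y) * g y - f x * g y) \<le> e * g y"
    proof (cases "norm y > d")
      case False
      then have "\<bar>f (x - y) - f x\<bar> * g y \<le> e * g y"
        using assms(3) by (intro mult_right_mono assms(6)) auto
      then show ?thesis using assms(3)[of y] by (simp flip: left_diff_distrib add: abs_mult)
    qed (simp add: assms(4))
  qed
  also have "\<dots> = e" using assms(5) by simp
  finally show ?thesis by simp
qed

text \<open>Integration by parts moves the derivative from the kernel back to \<open>f\<close>, so
  that \<open>conv_close\<close> applies to gradients as well.\<close>

lemma conv_gradient:
  assumes "C1c UNIV f G" "C1c UNIV g E"
  shows "(LINT y|lebesgue. f y *\<^sub>R E (x - y)) $ i = conv (\<lambda>y. G y $ i) g x"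
proof -
  note fC = C1c_imp_C1[OF assms(1)] and gC = C1c_imp_C1[OF assms(2)]
  obtain K where K: "compact K" "\<And>x. x \<notin> K \<Longrightarrow> f x = 0" by (rule C1cE[OF assms(1)]) (rule that)
  have ax: "v \<bullet> axis i 1 = v $ i" for v :: "real^2" by (simp add: inner_axis)
  have c: "C1 (\<lambda>y. g (x - y)) (\<lambda>y. - E (x - y))"
    unfolding C1_def
  proof (intro conjI allI)
    show "continuous_on UNIV (\<lambda>y. - E (x - y))"
      by (intro continuous_intros continuous_on_compose2[OF C1D(2)[OF gC]]) auto
    fix y
    have 1: "((\<lambda>y. x - y) has_derivative (\<lambda>h. - h)) (at y)" by (auto intro!: derivative_eq_intros)
    show "((\<lambda>y. g (x - y)) has_derivative (\<lambda>h. - E (x - y) \<bullet> h)) (at y)"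
      using has_derivative_compose[OF 1 C1D(1)[OF gC]] by simp
  qed
  have Ec: "continuous_on UNIV (\<lambda>y. E (x - y))"
    by (intro continuous_intros continuous_on_compose2[OF C1D(2)[OF gC]]) auto
  have int: "integrable lebesgue (\<lambda>y. f y *\<^sub>R E (x - y))"
    by (rule compact_support_integrable[OF _ K(1)])
       (use K(2) in \<open>auto intro!: continuous_intros Ec C1_continuous[OF fC]\<close>)
  have "(LINT y|lebesgue. f y *\<^sub>R E (x - y)) $ i = (LINT y|lebesgue. (f y *\<^sub>R E (x - y)) \<bullet> axis i 1)"
    by (subst ax[symmetric], rule integral_inner_left[symmetric], rule int)
  also have "\<dots> = - (LINT y|lebesgue. f y * (- E (x - y) \<bullet> axis i 1))" by simp
  also have "\<dots> = (LINT y|lebesgue. g (x - y) * (G y \<bullet> axis i 1))"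
    by (rule C1c_integration_by_parts[OF assms(1) c, symmetric])
  finally show ?thesis by (simp add: conv_def ax mult.commute)
qed

text \<open>The compact set \<open>K'\<close> is fixed before \<open>e\<close>, so uniform closeness
  also gives closeness in L2. The clause on gradients is conditional because the lemma has two uses:
  density of test functions among C1 functions, and approximation of functions that are only
  continuous in \<open>test_orthogonal_imp_AE_0\<close>.\<close>

lemma test_function_approx:
  assumes "open U" "continuous_on UNIV f" "compact K" "K \<subseteq> U" "\<And>x. x \<notin> K \<Longrightarrow> f x = 0"
  obtains K' where "compact K'" "K' \<subseteq> U" "K \<subseteq> K'"
    "\<And>e. e > 0 \<Longrightarrow> \<exists>\<psi>\<in>test_functions U. (\<forall>x. \<bar>\<psi> x - f x\<bar> \<le> e) \<and> (\<forall>x. x \<notin> K' \<longrightarrow> \<psi> x = 0) \<and>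
      (\<forall>G. C1 f G \<longrightarrow> (\<forall>x i. \<bar>grad \<psi> x $ i - G x $ i\<bar> \<le> e))"
proof (cases "K = {}")
  case True
  then have f0: "f = (\<lambda>x. 0)" using assms(5) by auto
  show thesis
  proof (rule that[of "{}"])
    fix e :: real assume e: "e > 0"
    have "(\<lambda>x. 0) \<in> test_functions U" by (rule test_functionI[of _ "{}"]) (auto simp: C_diff_const)
    moreover have "\<bar>grad (\<lambda>x. 0) x $ i - G x $ i\<bar> \<le> e" if "C1 f G" for G x i
      using C1_imp_partial_deriv(2)[OF that, of x] e by (simp add: f0)
    ultimately show "\<exists>\<psi>\<in>test_functions U. (\<forall>x. \<bar>\<psi> x - f x\<bar> \<le> e) \<and> (\<forall>x. x \<notin> {} \<longrightarrow> \<psi> x = 0) \<and>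
        (\<forall>G. C1 f G \<longrightarrow> (\<forall>x i. \<bar>grad \<psi> x $ i - G x $ i\<bar> \<le> e))"
      using e f0 by (intro bexI[of _ "\<lambda>x. 0"]) auto
  qed (use True in auto)
next
  case False
  obtain r where r: "r > 0" "{x. infdist x K \<le> r} \<subseteq> U"
    using compact_in_open_separated[OF False assms(3,1,4)] by blast
  define K' where "K' = {x. infdist x K \<le> r}"
  have K': "compact K'" unfolding K'_def by (rule compact_infdist_le[OF False assms(3) r(1)])
  show thesis
  proof (rule that[OF K'])
    show "K' \<subseteq> U" using r by (simp add: K'_def)
    show "K \<subseteq> K'" using r(1) by (auto simp: K'_def)
    fix e :: real assume e: "e > 0"
    have fi: "integrable lebesgue f" by (rule compact_support_integrable[OF assms(2,3,5)])
    show "\<exists>\<psi>\<in>test_functions U. (\<forall>x. \<bar>\<psi> x - f x\<bar> \<le> e) \<and> (\<forall>x. x \<notin> K' \<longrightarrow> \<psi> x = 0) \<and>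
        (\<forall>G. C1 f G \<longrightarrow> (\<forall>x i. \<bar>grad \<psi> x $ i - G x $ i\<bar> \<le> e))"
    proof -
      obtain d1 where d1: "d1 > 0" "\<And>x y. norm (x - y) < d1 \<Longrightarrow> norm (f x - f y) < e"
        by (rule compact_support_uniformly_continuous[OF assms(2,3,5) e], assumption) (rule that)
      \<comment> \<open>If \<open>f\<close> is not C1 the clause on gradients is vacuous. Otherwise
        the gradient is unique, so one modulus of continuity serves for every
        \<open>G\<close>.\<close>
      have "\<exists>d2>0. \<forall>G. C1 f G \<longrightarrow> (\<forall>x y. norm (x - y) < d2 \<longrightarrow> norm (G x - G y) < e)"
      proof (cases "\<exists>G. C1 f G")
        case True
        then obtain G where G: "C1 f G" by blast
        have Gc: "C1c U f G" by (rule C1cI[OF G assms(3,4,5)])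
        have Gu: "G' = G" if "C1 f G'" for G'
          using C1_imp_partial_deriv(2)[OF that] C1_imp_partial_deriv(2)[OF G] by auto
        obtain L where L: "compact L" "\<And>x. x \<notin> L \<Longrightarrow> G x = 0" by (rule C1cE[OF Gc]) (rule that)
        obtain d2 where "d2 > 0" "\<And>x y. norm (x - y) < d2 \<Longrightarrow> norm (G x - G y) < e"
          by (rule compact_support_uniformly_continuous[OF C1D(2)[OF G] L e], assumption) (rule that)
        then show ?thesis using Gu by blast
      qed (auto intro: exI[of _ 1])
      then obtain d2 where d2: "d2 > 0" "\<And>G x y. C1 f G \<Longrightarrow> norm (x - y) < d2 \<Longrightarrow> norm (G x - G y) < e" by blast
      define d where "d = min r (min d1 d2) / 2"
      have d: "d > 0" "d < r" "d < d1" "d < d2" using r(1) d1(1) d2(1) by (auto simp: d_def)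
      obtain g where g: "\<And>k. C_diff k g" "\<And>x. g x \<ge> 0" "\<And>x. norm x > d \<Longrightarrow> g x = 0"
        "(LINT x|lebesgue. g x) = 1"
        by (rule mollifier_exists[OF d(1)]) (rule that)
      have gc: "continuous_on UNIV g" using g(1)[of 0] by simp
      have gs: "g x = 0" if "x \<notin> cball 0 d" for x using that g(3) by simp
      have gC: "C1c UNIV g (grad g)"
        by (rule C1cI[OF C_diff_imp_C1[OF g(1)] compact_cball subset_UNIV gs])
      have z: "conv f g x = 0" if "x \<notin> K'" for x
      proof -
        have fz: "f y * g (x - y) = 0" for y
        proof (cases "y \<in> K")
          case True
          then have "infdist x K \<le> dist x y" by (rule infdist_le)
          then have "norm (x - y) > d" using that d by (simp add: K'_def dist_norm)
          then show ?thesis by (simp add: g(3))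
        qed (simp add: assms(5))
        show ?thesis unfolding conv_def fz by simp
      qed
      have "conv f g \<in> test_functions U"
        by (rule test_functionI[OF conv_C_diff[OF fi g(1) compact_cball gs] K' \<open>K' \<subseteq> U\<close> z])
      moreover have "\<bar>conv f g x - f x\<bar> \<le> e" for x
      proof (rule conv_close[OF assms(2) gc g(2,3,4)])
        fix x y :: "real^2" assume "norm (x - y) \<le> d"
        then have "norm (f x - f y) < e" using d(3) by (intro d1(2)) auto
        then show "\<bar>f x - f y\<bar> \<le> e" by simp
      qed
      moreover have "\<bar>grad (conv f g) x $ i - G x $ i\<bar> \<le> e" if G: "C1 f G" for G x i
      proof -
        have Gc: "C1c UNIV f G" by (rule C1cI[OF G assms(3) subset_UNIV assms(5)])
        have "grad (conv f g) x $ i = conv (\<lambda>y. G y $ i) g x"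
          unfolding C1_imp_partial_deriv(2)[OF conv_C1[OF fi gC]] by (rule conv_gradient[OF Gc gC])
        moreover have "\<bar>conv (\<lambda>y. G y $ i) g x - G x $ i\<bar> \<le> e"
        proof (rule conv_close[OF _ gc g(2,3,4)])
          show "continuous_on UNIV (\<lambda>y. G y $ i)" by (intro continuous_intros C1D(2)[OF G])
          fix x y :: "real^2" assume "norm (x - y) \<le> d"
          then have "norm (G x - G y) < e" using d(4) by (intro d2(2)[OF G]) auto
          then show "\<bar>G x $ i - G y $ i\<bar> \<le> e"
            using component_le_norm_cart[of "G x - G y" i] by simp
        qed
        ultimately show ?thesis by simp
      qed
      ultimately show ?thesis using z by (intro bexI[of _ "conv f g"]) auto
    qed
  qed
qed

lemma sq_norm_compact_le:
  fixes f :: "'a::euclidean_space \<Rightarrow> 'b::euclidean_space"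
  assumes "compact K" "\<And>x. x \<notin> K \<Longrightarrow> f x = 0" "\<And>x. norm (f x) \<le> e"
  shows "sq_norm lebesgue f \<le> e\<^sup>2 * measure lebesgue K"
proof (cases "integrable lebesgue (\<lambda>x. (norm (f x))\<^sup>2)")
  case True
  have K: "K \<in> lmeasurable" by (rule lmeasurable_compact[OF assms(1)])
  have "sq_norm lebesgue f \<le> (LINT x|lebesgue. e\<^sup>2 * indicator K x)"
    unfolding sq_norm_def
  proof (rule integral_mono[OF True])
    show "integrable lebesgue (\<lambda>x. e\<^sup>2 * indicator K x)"
      using K by (intro integrable_mult_right integrable_real_indicator) (auto simp: fmeasurable_def)
    show "(norm (f x))\<^sup>2 \<le> e\<^sup>2 * indicator K x" for x
      using assms(2)[of x] power_mono[OF assms(3)[of x], of 2] by (cases "x \<in> K") auto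
  qed
  also have "\<dots> = e\<^sup>2 * measure lebesgue K" by simp
  finally show ?thesis .
next
  case False
  \<comment> \<open>An integral that does not exist has the value 0.\<close>
  then show ?thesis by (simp add: sq_norm_def not_integrable_integral_eq)
qed

lemma sq_int_indicator:
  assumes "A \<in> lmeasurable"
  shows "sq_int lebesgue (indicator A :: 'a::euclidean_space \<Rightarrow> real)"
proof -
  have "(\<lambda>x. (norm (indicator A x :: real))\<^sup>2) = indicator A" by (auto simp: indicator_def)
  moreover have "A \<in> sets lebesgue" "emeasure lebesgue A < \<infinity>" using assms by (auto simp: fmeasurable_def)
  ultimately show ?thesis unfolding sq_int_def
    by (simp only: integrable_real_indicator borel_measurable_indicator simp_thms)
qed

text \<open>Allows the closure that defines \<open>H10\<close> to be taken over C1 functions of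
  compact support. Multiplication by C1 functions and composition with C1 functions that vanish at 0
  preserve that class, but would lead out of the smooth test functions.\<close>

lemma C1c_test_sequence:
  assumes "open U" "C1c U f G"
  obtains \<psi> where "\<And>n. \<psi> n \<in> test_functions U" "sq_lim lebesgue \<psi> f" "sq_lim lebesgue (\<lambda>n. grad (\<psi> n)) G"
proof -
  note C = C1c_imp_C1[OF assms(2)]
  obtain K where K: "compact K" "K \<subseteq> U" "\<And>x. x \<notin> K \<Longrightarrow> f x = 0" "\<And>x. x \<notin> K \<Longrightarrow> G x = 0"
    by (rule C1cE[OF assms(2)]) (rule that)
  obtain K' where K': "compact K'" "K' \<subseteq> U" "K \<subseteq> K'"
    "\<And>e. e > 0 \<Longrightarrow> \<exists>\<psi>\<in>test_functions U. (\<forall>x. \<bar>\<psi> x - f x\<bar> \<le> e) \<and> (\<forall>x. x \<notin> K' \<longrightarrow> \<psi> x = 0) \<and>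
      (\<forall>G. C1 f G \<longrightarrow> (\<forall>x i. \<bar>grad \<psi> x $ i - G x $ i\<bar> \<le> e))"
    by (rule test_function_approx[OF assms(1) C1_continuous[OF C] K(1,2,3)], assumption) (rule that)
  define e where "e n = inverse (real (Suc n))" for n
  have e: "e n > 0" for n by (simp add: e_def)
  have e0: "e \<longlonglongrightarrow> 0" unfolding e_def by (rule LIMSEQ_inverse_real_of_nat)
  have "\<exists>\<psi>. \<forall>n. \<psi> n \<in> test_functions U \<and> (\<forall>x. \<bar>\<psi> n x - f x\<bar> \<le> e n) \<and> (\<forall>x. x \<notin> K' \<longrightarrow> \<psi> n x = 0) \<and>
      (\<forall>x i. \<bar>grad (\<psi> n) x $ i - G x $ i\<bar> \<le> e n)"
    by (rule choice) (use K'(4)[OF e] C in blast)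
  then obtain \<psi> where \<psi>: "\<And>n. \<psi> n \<in> test_functions U" "\<And>n x. \<bar>\<psi> n x - f x\<bar> \<le> e n"
    "\<And>n x. x \<notin> K' \<Longrightarrow> \<psi> n x = 0" "\<And>n x i. \<bar>grad (\<psi> n) x $ i - G x $ i\<bar> \<le> e n" by blast
  have \<psi>c: "C1c K' (\<psi> n) (grad (\<psi> n))" for n
    by (rule C1cI[OF C1c_imp_C1[OF test_function_C1c[OF \<psi>(1)]] K'(1) subset_refl \<psi>(3)])
  have gz: "grad (\<psi> n) x = 0" if "x \<notin> K'" for n x
    using \<psi>c[of n] that unfolding C1c_def by blast
  have m: "(\<lambda>n. (2 * e n)\<^sup>2 * measure lebesgue K') \<longlonglongrightarrow> 0"
    using tendsto_mult_left[OF tendsto_mult[OF e0 e0], of "4 * measure lebesgue K'"]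
    by (simp add: power2_eq_square mult_ac)
  have n1: "norm (\<psi> n x - f x) \<le> 2 * e n" for n x
    using \<psi>(2)[of n x] e[of n] by simp
  have n2: "norm (grad (\<psi> n) x - G x) \<le> 2 * e n" for n x
    using norm_le_l1_cart[of "grad (\<psi> n) x - G x"] \<psi>(4)[of n x 1] \<psi>(4)[of n x 2] by (simp add: sum_2)
  have s1: "sq_lim lebesgue \<psi> f"
    unfolding sq_lim_def
  proof (intro conjI allI)
    show "(\<lambda>n. sq_norm lebesgue (\<lambda>x. \<psi> n x - f x)) \<longlonglongrightarrow> 0"
      using K(3) K'(3) \<psi>(3) n1
      by (intro tendsto_sandwich[OF always_eventually always_eventually tendsto_const m] allI sq_norm_nonneg
          sq_norm_compact_le[OF K'(1)]) auto
  qed (use C1c_sq_int[OF \<psi>c] C1c_sq_int[OF assms(2)] in auto)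
  have s2: "sq_lim lebesgue (\<lambda>n. grad (\<psi> n)) G"
    unfolding sq_lim_def
  proof (intro conjI allI)
    show "(\<lambda>n. sq_norm lebesgue (\<lambda>x. grad (\<psi> n) x - G x)) \<longlonglongrightarrow> 0"
      using K(4) K'(3) gz n2
      by (intro tendsto_sandwich[OF always_eventually always_eventually tendsto_const m] allI sq_norm_nonneg
          sq_norm_compact_le[OF K'(1)]) auto
  qed (use C1c_sq_int[OF \<psi>c] C1c_sq_int[OF assms(2)] in auto)
  show thesis by (rule that[OF \<psi>(1) s1 s2])
qed

text \<open>The fundamental lemma of the calculus of variations: orthogonality extends to continuous
  functions of compact support, then to indicators of compact sets, and inner regularity shows that
  the sets where \<open>k\<close> is positive or negative are null.\<close>

lemma test_orthogonal_imp_AE_0: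
  assumes "open U" "sq_int lebesgue k" "\<And>\<phi>. \<phi> \<in> test_functions U \<Longrightarrow> (LINT x|lebesgue. k x * \<phi> x) = 0"
  shows "AE x in lebesgue. x \<in> U \<longrightarrow> k x = 0"
proof -
  have [measurable]: "k \<in> borel_measurable lebesgue" by (rule sq_int_measurable[OF assms(2)])
  have ortho: "(LINT x|lebesgue. k x * f x) = 0"
    if f: "continuous_on UNIV f" "compact K" "K \<subseteq> U" "\<And>x. x \<notin> K \<Longrightarrow> f x = 0" for f K
  proof -
    obtain K' where K': "compact K'" "K' \<subseteq> U" "K \<subseteq> K'"
      "\<And>e. e > 0 \<Longrightarrow> \<exists>\<psi>\<in>test_functions U. (\<forall>x. \<bar>\<psi> x - f x\<bar> \<le> e) \<and> (\<forall>x. x \<notin> K' \<longrightarrow> \<psi> x = 0) \<and>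
        (\<forall>G. C1 f G \<longrightarrow> (\<forall>x i. \<bar>grad \<psi> x $ i - G x $ i\<bar> \<le> e))"
      by (rule test_function_approx[OF assms(1) f], assumption) (rule that)
    have fL: "sq_int lebesgue f" by (rule compact_support_sq_int[OF f(1,2,4)])
    define c where "c = sqrt (sq_norm lebesgue k) * sqrt (measure lebesgue K')"
    have c0: "c \<ge> 0" by (simp add: c_def sq_norm_nonneg)
    have "\<bar>LINT x|lebesgue. k x * f x\<bar> \<le> 0 + e" if "e > 0" for e
    proof -
      have "e / (c + 1) > 0" using that c0 by simp
      from K'(4)[OF this] obtain \<psi> where \<psi>: "\<psi> \<in> test_functions U" "\<And>x. \<bar>\<psi> x - f x\<bar> \<le> e / (c + 1)"
        "\<And>x. x \<notin> K' \<Longrightarrow> \<psi> x = 0" by blast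
      have \<psi>L: "sq_int lebesgue \<psi>" by (rule C1c_sq_int[OF test_function_C1c[OF \<psi>(1)]])
      have "(LINT x|lebesgue. k x * f x) = (LINT x|lebesgue. k x * f x) - (LINT x|lebesgue. k x * \<psi> x)"
        using assms(3)[OF \<psi>(1)] by simp
      also have "\<dots> = - (LINT x|lebesgue. k x \<bullet> (\<psi> x - f x))"
        using integrable_mult_sq_int[OF assms(2) fL] integrable_mult_sq_int[OF assms(2) \<psi>L]
        by (simp add: algebra_simps)
      finally have "\<bar>LINT x|lebesgue. k x * f x\<bar> \<le> sqrt (sq_norm lebesgue k) * sqrt (sq_norm lebesgue (\<lambda>x. \<psi> x - f x))"
        using sq_int_Cauchy_Schwarz_abs[OF assms(2) sq_int_diff[OF \<psi>L fL]] by simp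
      also have "\<dots> \<le> sqrt (sq_norm lebesgue k) * sqrt ((e / (c + 1))\<^sup>2 * measure lebesgue K')"
        using \<psi> f(4) K'(3)
        by (intro mult_left_mono real_sqrt_le_mono sq_norm_compact_le[OF K'(1)]) (auto simp: sq_norm_nonneg)
      also have "\<dots> = c * (e / (c + 1))"
        using that c0 by (simp add: c_def real_sqrt_mult)
      also have "\<dots> \<le> e" using that c0 by (simp add: field_simps)
      finally show ?thesis by simp
    qed
    then have "\<bar>LINT x|lebesgue. k x * f x\<bar> \<le> 0" by (rule field_le_epsilon)
    then show ?thesis by simp
  qed
  have compact0: "(LINT x|lebesgue. k x * indicator C x) = 0" if C: "compact C" "C \<subseteq> U" for C
  proof (cases "C = {}")
    case False
    obtain r where r: "r > 0" "{x. infdist x C \<le> r} \<subseteq> U"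
      using compact_in_open_separated[OF False C(1) assms(1) C(2)] by blast
    define K where "K = {x. infdist x C \<le> r}"
    have K: "compact K" unfolding K_def by (rule compact_infdist_le[OF False C(1) r(1)])
    \<comment> \<open>Continuous functions that decrease to the indicator of \<open>C\<close>; the
      factor \<open>Suc n\<close>, at least 1, keeps all supports within distance \<open>r\<close>
      of \<open>C\<close>.\<close>
    define f where "f n x = max 0 (1 - real (Suc n) / r * infdist x C)" for n x
    have fc: "continuous_on UNIV (f n)" for n unfolding f_def by (intro continuous_intros)
    have fz: "f n x = 0" if "x \<notin> K" for n x
    proof -
      have "infdist x C / r > 1" using that r(1) by (simp add: K_def)
      then have "real (Suc n) * (infdist x C / r) \<ge> 1 * 1" by (intro mult_mono) auto
      then show ?thesis by (simp add: f_def)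
    qed
    have fb: "0 \<le> f n x" "f n x \<le> 1" for n x
      using r(1) infdist_nonneg[of x C] by (auto simp: f_def)
    have "(\<lambda>n. LINT x|lebesgue. k x * f n x) \<longlonglongrightarrow> (LINT x|lebesgue. k x * indicator C x)"
    proof (rule integral_dominated_convergence[where w = "\<lambda>x. \<bar>k x\<bar> * indicator K x"])
      show "(\<lambda>x. k x * indicator C x) \<in> borel_measurable lebesgue"
        using lmeasurable_compact[OF C(1)] by (auto simp: fmeasurable_def)
      show "(\<lambda>x. k x * f n x) \<in> borel_measurable lebesgue" for n
        using continuous_imp_lebesgue_measurable[OF fc] by measurable
      have "sq_int lebesgue (indicator K :: real^2 \<Rightarrow> real)"
        by (rule sq_int_indicator) (rule lmeasurable_compact[OF K])
      from integrable_mult_sq_int[OF sq_int_abs[OF assms(2)] this]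
      show "integrable lebesgue (\<lambda>x. \<bar>k x\<bar> * indicator K x)" .
      show "AE x in lebesgue. norm (k x * f n x) \<le> \<bar>k x\<bar> * indicator K x" for n
      proof (rule AE_I2)
        fix x
        show "norm (k x * f n x) \<le> \<bar>k x\<bar> * indicator K x"
          using fb[of n x] fz[of x n] by (cases "x \<in> K") (auto simp: abs_mult mult_left_le)
      qed
      show "AE x in lebesgue. (\<lambda>n. k x * f n x) \<longlonglongrightarrow> k x * indicator C x"
      proof (rule AE_I2)
        fix x
        have "(\<lambda>n. f n x) \<longlonglongrightarrow> indicator C x"
        proof (cases "x \<in> C")
          case False
          then have p: "infdist x C > 0"
            using in_closed_iff_infdist_zero[OF compact_imp_closed[OF C(1)] \<open>C \<noteq> {}\<close>, of x] infdist_nonneg[of x C]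
            by (simp add: less_le)
          obtain N where N: "real N > r / infdist x C" using reals_Archimedean2 by blast
          have "f n x = 0" if "n \<ge> N" for n
          proof -
            have "r / infdist x C \<le> real (Suc n)" using N that by simp
            then have "1 \<le> real (Suc n) / r * infdist x C" using r(1) p by (simp add: field_simps)
            then show ?thesis by (simp add: f_def)
          qed
          then show ?thesis using False
            by (intro Lim_transform_eventually[OF tendsto_const]) (auto simp: eventually_sequentially)
        qed (simp add: f_def)
        then show "(\<lambda>n. k x * f n x) \<longlonglongrightarrow> k x * indicator C x" by (rule tendsto_mult_left)
      qed
    qed
    moreover have "(LINT x|lebesgue. k x * f n x) = 0" for n
      by (rule ortho[OF fc K _ fz]) (use r in \<open>auto simp: K_def\<close>)
    ultimately show ?thesis by (simp add: LIMSEQ_const_iff)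
  qed simp
  have null: "negligible {x\<in>U. s * k x > 0}" if "s = 1 \<or> s = -1" for s :: real
  proof -
    define S where "S = {x\<in>U. s * k x > 0}"
    have "U \<in> sets lebesgue" using assms(1) by simp
    then have "S \<in> sets lebesgue" unfolding S_def by measurable
    \<comment> \<open>Up to a null set, \<open>S\<close> is a countable union of compact sets, on
      each of which \<open>s * k\<close> is positive and has integral 0.\<close>
    then obtain C T where CT: "fsigma C" "T \<in> null_sets lebesgue" "C \<union> T = S"
      by (rule lebesgue_set_almost_fsigma) (rule that)
    obtain F :: "nat \<Rightarrow> (real^2) set" where F: "range F \<subseteq> Collect compact" "C = \<Union>(range F)"
      using fsigma_Union_compact[of C] CT(1) by blast
    have "negligible (F n)" for n
    proof -
      have Fc: "compact (F n)" "F n \<subseteq> S" using F CT by auto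
      have Fm: "F n \<in> lmeasurable" by (rule lmeasurable_compact[OF Fc(1)])
      have 0: "(LINT x|lebesgue. s * (k x * indicator (F n) x)) = 0"
        using compact0[OF Fc(1)] Fc(2) by (auto simp: S_def)
      have "sq_int lebesgue (indicator (F n) :: real^2 \<Rightarrow> real)"
        by (rule sq_int_indicator) (rule Fm)
      from integrable_mult_sq_int[OF assms(2) this]
      have i: "integrable lebesgue (\<lambda>x. s * (k x * indicator (F n) x))" by simp
      have "0 \<le> s * (k x * indicator (F n) x)" for x
        using Fc(2) by (cases "x \<in> F n") (auto simp: S_def subset_iff intro: less_imp_le)
      then have "AE x in lebesgue. s * (k x * indicator (F n) x) = 0"
        using integral_nonneg_eq_0_iff_AE[OF i] 0 by blast
      then have "AE x in lebesgue. x \<notin> F n"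
      proof eventually_elim
        case (elim x)
        then show ?case using Fc(2) by (auto simp: S_def)
      qed
      then show ?thesis
        using Fm by (simp add: negligible_iff_null_sets AE_iff_null_sets[of "F n" lebesgue] fmeasurable_def)
    qed
    then have "negligible C" unfolding F(2) by (intro negligible_countable_Union) auto
    then show ?thesis
      using CT(2,3) negligible_Un[of C T] by (auto simp: S_def[symmetric] negligible_iff_null_sets)
  qed
  have "negligible ({x\<in>U. 1 * k x > 0} \<union> {x\<in>U. (-1) * k x > 0})"
    by (intro negligible_Un null) auto
  then have "{x\<in>U. 1 * k x > 0} \<union> {x\<in>U. (-1) * k x > 0} \<in> null_sets lebesgue"
    by (simp add: negligible_iff_null_sets)
  then have "AE x in lebesgue. x \<notin> {x\<in>U. 1 * k x > 0} \<union> {x\<in>U. (-1) * k x > 0}"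
    by (rule AE_not_in)
  then show ?thesis by eventually_elim auto
qed

subsection \<open>Sobolev functions and weak solutions\<close>

text \<open>\<open>u\<close> is in \<open>H10 U\<close> and \<open>g\<close> is its gradient, both extended by zero to the plane.\<close>

definition h10 :: "(real^2) set \<Rightarrow> (real^2 \<Rightarrow> real) \<Rightarrow> (real^2 \<Rightarrow> real^2) \<Rightarrow> bool" where
  "h10 U u g \<longleftrightarrow> (\<exists>\<phi> G. (\<forall>n::nat. C1c U (\<phi> n) (G n)) \<and> sq_lim lebesgue \<phi> u \<and> sq_lim lebesgue G g)"

lemma h10E:
  assumes "h10 U u g"
  obtains \<phi> G where "\<And>n::nat. C1c U (\<phi> n) (G n)" "sq_lim lebesgue \<phi> u" "sq_lim lebesgue G g"
  using assms unfolding h10_def by blast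

lemma h10I: "(\<And>n::nat. C1c U (\<phi> n) (G n)) \<Longrightarrow> sq_lim lebesgue \<phi> u \<Longrightarrow> sq_lim lebesgue G g \<Longrightarrow> h10 U u g"
  unfolding h10_def by blast

lemma h10_sq_int:
  assumes "h10 U u g"
  shows "sq_int lebesgue u" "sq_int lebesgue g"
  using h10E[OF assms] sq_limD(2) by metis+

lemma h10_C1c:
  assumes "C1c U \<phi> G"
  shows "h10 U \<phi> G"
  by (rule h10I[of U "\<lambda>_. \<phi>" "\<lambda>_. G"]) (intro assms sq_lim_const C1c_sq_int[OF assms])+

lemma h10_mono:
  assumes "h10 U u g" "U \<subseteq> V"
  shows "h10 V u g"
proof -
  obtain \<phi> G where 1: "\<And>n::nat. C1c U (\<phi> n) (G n)" "sq_lim lebesgue \<phi> u" "sq_lim lebesgue G g"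
    by (rule h10E[OF assms(1)]) (rule that)
  show ?thesis by (rule h10I[OF C1c_mono[OF 1(1) assms(2)] 1(2,3)])
qed

lemma h10_add:
  assumes "h10 U u g" "h10 U v h"
  shows "h10 U (\<lambda>x. u x + v x) (\<lambda>x. g x + h x)"
proof -
  obtain \<phi> G where 1: "\<And>n::nat. C1c U (\<phi> n) (G n)" "sq_lim lebesgue \<phi> u" "sq_lim lebesgue G g"
    by (rule h10E[OF assms(1)]) (rule that)
  obtain \<psi> H where 2: "\<And>n::nat. C1c U (\<psi> n) (H n)" "sq_lim lebesgue \<psi> v" "sq_lim lebesgue H h"
    by (rule h10E[OF assms(2)]) (rule that)
  show ?thesis
    by (rule h10I[OF C1c_add[OF 1(1) 2(1)] sq_lim_add[OF 1(2) 2(2)] sq_lim_add[OF 1(3) 2(3)]])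
qed

lemma h10_scale:
  assumes "h10 U u g"
  shows "h10 U (\<lambda>x. c * u x) (\<lambda>x. c *\<^sub>R g x)"
proof -
  obtain \<phi> G where 1: "\<And>n::nat. C1c U (\<phi> n) (G n)" "sq_lim lebesgue \<phi> u" "sq_lim lebesgue G g"
    by (rule h10E[OF assms(1)]) (rule that)
  show ?thesis
    using sq_lim_scaleR[OF 1(2), of c] by (intro h10I[OF C1c_scale[OF 1(1)] _ sq_lim_scaleR[OF 1(3)]]) simp
qed

lemma h10_diff:
  assumes "h10 U u g" "h10 U v h"
  shows "h10 U (\<lambda>x. u x - v x) (\<lambda>x. g x - h x)"
  using h10_add[OF assms(1) h10_scale[OF assms(2), of "-1"]] by simp

lemma sq_lim_cong_AE:
  assumes "sq_lim M F f" "f' \<in> borel_measurable M" "AE x in M. f x = f' x"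
  shows "sq_lim M F f'"
  unfolding sq_lim_def
proof (intro conjI allI)
  note F = sq_limD[OF assms(1)]
  show "sq_int M (F n)" for n by (rule F)
  show f': "sq_int M f'" by (rule sq_int_cong_AE[OF F(2) assms(2,3)])
  have "sq_norm M (\<lambda>x. F n x - f' x) = sq_norm M (\<lambda>x. F n x - f x)" for n
    unfolding sq_norm_def
    using F f' assms(3)
    by (intro integral_cong_AE borel_measurable_integrable sq_int_integrable sq_int_diff) (auto elim: eventually_mono)
  then show "(\<lambda>n. sq_norm M (\<lambda>x. F n x - f' x)) \<longlonglongrightarrow> 0" using F(3) by simp
qed

lemma h10_cong_AE:
  assumes "h10 U u g" "u' \<in> borel_measurable lebesgue" "AE x in lebesgue. u x = u' x"
    "g' \<in> borel_measurable lebesgue" "AE x in lebesgue. g x = g' x"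
  shows "h10 U u' g'"
proof -
  obtain \<phi> G where 1: "\<And>n::nat. C1c U (\<phi> n) (G n)" "sq_lim lebesgue \<phi> u" "sq_lim lebesgue G g"
    by (rule h10E[OF assms(1)]) (rule that)
  show ?thesis
    by (rule h10I[OF 1(1) sq_lim_cong_AE[OF 1(2) assms(2,3)] sq_lim_cong_AE[OF 1(3) assms(4,5)]])
qed

lemma h10_AE_zero_outside:
  assumes "h10 U u g"
  shows "AE x in lebesgue. x \<notin> U \<longrightarrow> u x = 0 \<and> g x = 0"
proof -
  obtain \<phi> G where 1: "\<And>n::nat. C1c U (\<phi> n) (G n)" "sq_lim lebesgue \<phi> u" "sq_lim lebesgue G g"
    by (rule h10E[OF assms(1)]) (rule that)
  have z: "\<phi> n x = 0 \<and> G n x = 0" if "x \<notin> U" for n x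
    using 1(1)[of n] that unfolding C1c_def by blast
  obtain r where r: "strict_mono r" "AE x in lebesgue. (\<lambda>n. \<phi> (r n) x) \<longlonglongrightarrow> u x"
    using sq_lim_AE_subseq[OF 1(2)] by blast
  obtain s where s: "strict_mono s" "AE x in lebesgue. (\<lambda>n. G (s n) x) \<longlonglongrightarrow> g x"
    using sq_lim_AE_subseq[OF 1(3)] by blast
  show ?thesis
    using r(2) s(2)
  proof eventually_elim
    case (elim x)
    show ?case using elim z by (auto simp: LIMSEQ_const_iff)
  qed
qed

text \<open>The test function may be supported in any \<open>V\<close>: the extension by zero of
  \<open>u\<close> has \<open>g\<close> as its weak gradient in the whole plane, not only in
  \<open>U\<close>.\<close>

lemma h10_integration_by_parts:
  assumes "h10 U u g" "C1c V y Y"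
  shows "(LINT x|lebesgue. u x * (Y x \<bullet> h)) = - (LINT x|lebesgue. (g x \<bullet> h) * y x)"
proof -
  obtain \<phi> G where 1: "\<And>n::nat. C1c U (\<phi> n) (G n)" "sq_lim lebesgue \<phi> u" "sq_lim lebesgue G g"
    by (rule h10E[OF assms(1)]) (rule that)
  have yL: "sq_int lebesgue y" "sq_int lebesgue (\<lambda>x. Y x \<bullet> h)"
  proof -
    show "sq_int lebesgue y" by (rule C1c_sq_int[OF assms(2)])
    have [measurable]: "Y \<in> borel_measurable lebesgue" by (rule sq_int_measurable[OF C1c_sq_int(2)[OF assms(2)]])
    show "sq_int lebesgue (\<lambda>x. Y x \<bullet> h)"
    proof (rule sq_int_bound[OF C1c_sq_int(2)[OF assms(2)], where C = "norm h"])
      show "AE x in lebesgue. norm (Y x \<bullet> h) \<le> norm h * norm (Y x)"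
        by (intro AE_I2) (simp add: Cauchy_Schwarz_ineq2 mult.commute[of "norm h"])
    qed measurable
  qed
  have "(\<lambda>n. LINT x|lebesgue. \<phi> n x * (Y x \<bullet> h)) \<longlonglongrightarrow> (LINT x|lebesgue. u x * (Y x \<bullet> h))"
    by (rule sq_lim_mult_int[OF 1(2) sq_lim_const[OF yL(2)]])
  moreover have "(LINT x|lebesgue. \<phi> n x * (Y x \<bullet> h)) = - (LINT x|lebesgue. G n x \<bullet> (y x *\<^sub>R h))" for n
    using C1c_integration_by_parts[OF C1c_mono[OF 1(1) subset_UNIV] C1c_imp_C1[OF assms(2)], of n h] by simp
  moreover have "(\<lambda>n. LINT x|lebesgue. G n x \<bullet> (y x *\<^sub>R h)) \<longlonglongrightarrow> (LINT x|lebesgue. g x \<bullet> (y x *\<^sub>R h))"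
    by (rule sq_lim_inner[OF 1(3) sq_lim_const[OF sq_int_mult_vec[OF yL(1), where C = "norm h"]]]) auto
  ultimately have "(LINT x|lebesgue. u x * (Y x \<bullet> h)) = - (LINT x|lebesgue. g x \<bullet> (y x *\<^sub>R h))"
    by (intro LIMSEQ_unique[OF _ tendsto_minus]) simp_all
  then show ?thesis by (simp add: mult.commute)
qed

text \<open>A diagonal choice: each C1 approximant is replaced by a test function within
  \<open>e n\<close> of it, for the function and for the gradient.\<close>

lemma h10_test_sequence:
  assumes "open U" "h10 U u g"
  obtains \<psi> where "\<And>n::nat. \<psi> n \<in> test_functions U" "sq_lim lebesgue \<psi> u" "sq_lim lebesgue (\<lambda>n. grad (\<psi> n)) g"
proof -
  obtain \<phi> G where 1: "\<And>n::nat. C1c U (\<phi> n) (G n)" "sq_lim lebesgue \<phi> u" "sq_lim lebesgue G g"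
    by (rule h10E[OF assms(2)]) (rule that)
  define e where "e n = inverse (real (Suc n))" for n
  have e: "e n > 0" for n by (simp add: e_def)
  have e0: "e \<longlonglongrightarrow> 0" unfolding e_def by (rule LIMSEQ_inverse_real_of_nat)
  have "\<exists>\<psi>\<in>test_functions U. sq_norm lebesgue (\<lambda>x. \<psi> x - \<phi> n x) < e n \<and> sq_norm lebesgue (\<lambda>x. grad \<psi> x - G n x) < e n" for n
  proof -
    obtain \<psi> where \<psi>: "\<And>k. \<psi> k \<in> test_functions U" "sq_lim lebesgue \<psi> (\<phi> n)" "sq_lim lebesgue (\<lambda>k. grad (\<psi> k)) (G n)"
      by (rule C1c_test_sequence[OF assms(1) 1(1)]) (rule that)
    have "\<forall>\<^sub>F k in sequentially. sq_norm lebesgue (\<lambda>x. \<psi> k x - \<phi> n x) < e n \<and>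
        sq_norm lebesgue (\<lambda>x. grad (\<psi> k) x - G n x) < e n"
      using order_tendstoD(2)[OF sq_limD(3)[OF \<psi>(2)] e[of n]] order_tendstoD(2)[OF sq_limD(3)[OF \<psi>(3)] e[of n]]
      by (rule eventually_conj)
    then show ?thesis using \<psi>(1) eventually_happens'[OF sequentially_bot] by blast
  qed
  then have "\<forall>n. \<exists>\<psi>. \<psi> \<in> test_functions U \<and> sq_norm lebesgue (\<lambda>x. \<psi> x - \<phi> n x) < e n \<and> sq_norm lebesgue (\<lambda>x. grad \<psi> x - G n x) < e n"
    by blast
  from choice[OF this] obtain \<psi> where \<psi>: "\<And>n. \<psi> n \<in> test_functions U"
    "\<And>n. sq_norm lebesgue (\<lambda>x. \<psi> n x - \<phi> n x) < e n" "\<And>n. sq_norm lebesgue (\<lambda>x. grad (\<psi> n) x - G n x) < e n" by blast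
  have "sq_lim lebesgue (\<lambda>n x. \<psi> n x - \<phi> n x) (\<lambda>x. 0)"
    unfolding sq_lim_def
    using \<psi>(2) less_imp_le C1c_sq_int(1)[OF test_function_C1c[OF \<psi>(1)]] C1c_sq_int(1)[OF 1(1)]
    by (intro conjI allI sq_int_diff tendsto_sandwich[OF always_eventually always_eventually tendsto_const e0])
       (auto simp: sq_norm_nonneg)
  from sq_lim_add[OF this 1(2)] have A: "sq_lim lebesgue \<psi> u" by simp
  have "sq_lim lebesgue (\<lambda>n x. grad (\<psi> n) x - G n x) (\<lambda>x. 0)"
    unfolding sq_lim_def
    using \<psi>(3) less_imp_le C1c_sq_int(2)[OF test_function_C1c[OF \<psi>(1)]] C1c_sq_int(2)[OF 1(1)]
    by (intro conjI allI sq_int_diff tendsto_sandwich[OF always_eventually always_eventually tendsto_const e0])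
       (auto simp: sq_norm_nonneg)
  from sq_lim_add[OF this 1(3)] have B: "sq_lim lebesgue (\<lambda>n. grad (\<psi> n)) g" by simp
  show thesis by (rule that[OF \<psi>(1) A B])
qed

section \<open>Extension by zero: from integrals over \<Omega> to integrals over the plane\<close>

definition zext :: "'a set \<Rightarrow> ('a \<Rightarrow> 'b::real_vector) \<Rightarrow> 'a \<Rightarrow> 'b" where
  "zext U f x = (if x \<in> U then f x else 0)"

lemma zext_in [simp]: "x \<in> U \<Longrightarrow> zext U f x = f x"
  and zext_out [simp]: "x \<notin> U \<Longrightarrow> zext U f x = 0"
  by (auto simp: zext_def)

lemma zext_eq_indicator: "zext U f = (\<lambda>x. indicator U x *\<^sub>R f x)"
  by (auto simp: zext_def indicator_def)

lemma lebesgue_on_integral: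
  fixes f :: "real^2 \<Rightarrow> 'b::euclidean_space"
  assumes "open U"
  shows "(LINT x|lebesgue_on U. f x) = (LINT x|lebesgue. zext U f x)"
  using assms by (simp add: integral_restrict_space zext_eq_indicator)

lemma lebesgue_on_integrable:
  fixes f :: "real^2 \<Rightarrow> 'b::euclidean_space"
  assumes "open U"
  shows "integrable (lebesgue_on U) f \<longleftrightarrow> integrable lebesgue (zext U f)"
  using assms by (simp add: integrable_restrict_space zext_eq_indicator)

lemma lebesgue_on_measurable:
  fixes f :: "real^2 \<Rightarrow> 'b::euclidean_space"
  assumes "open U"
  shows "f \<in> borel_measurable (lebesgue_on U) \<longleftrightarrow> zext U f \<in> borel_measurable lebesgue"
  using assms by (simp add: borel_measurable_restrict_space_iff zext_eq_indicator)

lemma square_integrable_on_eq: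
  fixes f :: "real^2 \<Rightarrow> 'b::euclidean_space"
  assumes "open U"
  shows "f square_integrable_on U \<longleftrightarrow> sq_int lebesgue (zext U f)"
proof -
  have "zext U (\<lambda>x. (norm (f x))\<^sup>2) = (\<lambda>x. (norm (zext U f x))\<^sup>2)" by (auto simp: zext_def)
  then show ?thesis
    by (simp add: square_integrable_on_def sq_int_def lebesgue_on_measurable[OF assms] lebesgue_on_integrable[OF assms])
qed

lemma lebesgue_on_sq_norm:
  fixes f :: "real^2 \<Rightarrow> 'b::euclidean_space"
  assumes "open U"
  shows "(LINT x|lebesgue_on U. (norm (f x))\<^sup>2) = sq_norm lebesgue (zext U f)"
proof -
  have "zext U (\<lambda>x. (norm (f x))\<^sup>2) = (\<lambda>x. (norm (zext U f x))\<^sup>2)" by (auto simp: zext_def)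
  then show ?thesis by (simp add: sq_norm_def lebesgue_on_integral[OF assms])
qed

lemma lebesgue_on_AE:
  assumes "open U"
  shows "(AE x in lebesgue_on U. P x) \<longleftrightarrow> (AE x in lebesgue. x \<in> U \<longrightarrow> P x)"
  using assms by (simp add: AE_restrict_space_iff)

lemma has_weak_gradient_eq:
  assumes "open U"
  shows "has_weak_gradient U u g \<longleftrightarrow> (\<forall>\<phi>\<in>test_functions U. \<forall>i.
     (LINT x|lebesgue. zext U u x * (grad \<phi> x \<bullet> axis i 1)) = - (LINT x|lebesgue. (zext U g x \<bullet> axis i 1) * \<phi> x))"
proof -
  have ax: "v \<bullet> axis i 1 = v $ i" for v :: "real^2" and i by (simp add: inner_axis)
  have 1: "zext U (\<lambda>x. u x * partial_deriv i \<phi> x) = (\<lambda>x. zext U u x * (grad \<phi> x \<bullet> axis i 1))" for \<phi> i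
    by (auto simp: zext_def ax grad_def)
  have 2: "zext U (\<lambda>x. g x $ i * \<phi> x) = (\<lambda>x. (zext U g x \<bullet> axis i 1) * \<phi> x)" for \<phi> i
    by (auto simp: zext_def ax)
  show ?thesis unfolding has_weak_gradient_def lebesgue_on_integral[OF assms] 1 2 ..
qed

text \<open>\<open>weak_grad\<close> is an arbitrary choice among the weak gradients; only
  uniqueness almost everywhere ties it to a gradient at hand.\<close>

lemma weak_gradient_unique:
  assumes "open U" "has_weak_gradient U u g" "has_weak_gradient U u h"
    "sq_int lebesgue (zext U g)" "sq_int lebesgue (zext U h)"
  shows "AE x in lebesgue. x \<in> U \<longrightarrow> g x = h x"
proof -
  have c: "AE x in lebesgue. x \<in> U \<longrightarrow> (zext U g x - zext U h x) \<bullet> axis i 1 = 0" for i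
  proof (rule test_orthogonal_imp_AE_0[OF assms(1)])
    have d: "sq_int lebesgue (\<lambda>x. zext U g x - zext U h x)" by (rule sq_int_diff[OF assms(4,5)])
    then have [measurable]: "(\<lambda>x. zext U g x - zext U h x) \<in> borel_measurable lebesgue" by (rule sq_int_measurable)
    show "sq_int lebesgue (\<lambda>x. (zext U g x - zext U h x) \<bullet> axis i 1)"
    proof (rule sq_int_bound[OF d, where C = 1])
      show "AE x in lebesgue. norm ((zext U g x - zext U h x) \<bullet> axis i 1) \<le> 1 * norm (zext U g x - zext U h x)"
        using component_le_norm_cart[of "zext U g _ - zext U h _" i] by (simp add: inner_axis)
    qed measurable
    fix \<phi> assume \<phi>: "\<phi> \<in> test_functions U"
    have \<phi>L: "sq_int lebesgue \<phi>" by (rule C1c_sq_int[OF test_function_C1c[OF \<phi>]])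
    have v: "sq_int lebesgue (\<lambda>x. \<phi> x *\<^sub>R axis i (1::real))"
      by (rule sq_int_mult_vec[OF \<phi>L, where C = 1]) auto
    have "(LINT x|lebesgue. zext U g x \<bullet> (\<phi> x *\<^sub>R axis i 1)) = (LINT x|lebesgue. zext U h x \<bullet> (\<phi> x *\<^sub>R axis i 1))"
      using assms(2,3) \<phi> unfolding has_weak_gradient_eq[OF assms(1)] by (simp add: mult.commute)
    then have "(LINT x|lebesgue. zext U g x \<bullet> (\<phi> x *\<^sub>R axis i 1) - zext U h x \<bullet> (\<phi> x *\<^sub>R axis i 1)) = 0"
      using integrable_inner_sq_int[OF assms(4) v] integrable_inner_sq_int[OF assms(5) v] by simp
    then show "(LINT x|lebesgue. (zext U g x - zext U h x) \<bullet> axis i 1 * \<phi> x) = 0"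
      by (simp add: inner_diff_left algebra_simps)
  qed
  show ?thesis
    using c[of 1] c[of 2]
  proof eventually_elim
    case (elim x)
    then show ?case by (auto simp: inner_axis vec_eq_iff forall_2)
  qed
qed

lemma H1_weak_grad:
  assumes "u \<in> H1 U"
  shows "weak_grad U u square_integrable_on U" "has_weak_gradient U u (weak_grad U u)"
  using assms someI_ex[of "\<lambda>g. g square_integrable_on U \<and> has_weak_gradient U u g"]
  unfolding H1_def weak_grad_def by auto

lemma zext_test:
  assumes "C1c U \<phi> G"
  shows "zext U \<phi> = \<phi>" "zext U G = G"
proof -
  obtain K where K: "K \<subseteq> U" "\<And>x. x \<notin> K \<Longrightarrow> \<phi> x = 0" "\<And>x. x \<notin> K \<Longrightarrow> G x = 0"
    by (rule C1cE[OF assms]) (rule that)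
  then show "zext U \<phi> = \<phi>" "zext U G = G" by (auto simp: zext_def fun_eq_iff)
qed

lemma zext_diff: "zext U (\<lambda>x. f x - g x) = (\<lambda>x. zext U f x - zext U g x)"
  by (auto simp: zext_def)

lemma H10_imp_h10:
  assumes "open U" "u \<in> H10 U"
  shows "h10 U (zext U u) (zext U (weak_grad U u))"
proof -
  have u: "u \<in> H1 U" using assms(2) by (simp add: H10_def)
  obtain \<phi> where \<phi>: "\<And>n. \<phi> n \<in> test_functions U"
    "(\<lambda>n::nat. (LINT x|lebesgue_on U. (u x - \<phi> n x)\<^sup>2) +
        (LINT x|lebesgue_on U. (norm (weak_grad U u x - grad (\<phi> n) x))\<^sup>2)) \<longlonglongrightarrow> 0"
    using assms(2) unfolding H10_def by blast
  note C = test_function_C1c[OF \<phi>(1)]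
  define a where "a n = sq_norm lebesgue (\<lambda>x. \<phi> n x - zext U u x)" for n
  define b where "b n = sq_norm lebesgue (\<lambda>x. grad (\<phi> n) x - zext U (weak_grad U u) x)" for n
  have "(LINT x|lebesgue_on U. (u x - \<phi> n x)\<^sup>2) = a n" for n
    using lebesgue_on_sq_norm[OF assms(1), of "\<lambda>x. u x - \<phi> n x"] zext_test[OF C, of n]
    by (simp add: zext_diff a_def sq_norm_def power2_commute)
  moreover have "(LINT x|lebesgue_on U. (norm (weak_grad U u x - grad (\<phi> n) x))\<^sup>2) = b n" for n
    using lebesgue_on_sq_norm[OF assms(1), of "\<lambda>x. weak_grad U u x - grad (\<phi> n) x"] zext_test[OF C, of n]
    by (simp add: zext_diff b_def sq_norm_def norm_minus_commute)
  ultimately have ab: "(\<lambda>n. a n + b n) \<longlonglongrightarrow> 0" using \<phi>(2) by simp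
  have nn: "a n \<ge> 0" "b n \<ge> 0" for n by (auto simp: a_def b_def sq_norm_nonneg)
  have a0: "a \<longlonglongrightarrow> 0"
    by (rule tendsto_sandwich[OF always_eventually always_eventually tendsto_const ab]) (use nn in auto)
  have b0: "b \<longlonglongrightarrow> 0"
    by (rule tendsto_sandwich[OF always_eventually always_eventually tendsto_const ab]) (use nn in auto)
  have "sq_int lebesgue (zext U u)"
    using u square_integrable_on_eq[OF assms(1), of u] by (simp add: H1_def)
  moreover have "sq_int lebesgue (zext U (weak_grad U u))"
    using H1_weak_grad(1)[OF u] square_integrable_on_eq[OF assms(1)] by blast
  ultimately have "sq_lim lebesgue \<phi> (zext U u)" "sq_lim lebesgue (\<lambda>n. grad (\<phi> n)) (zext U (weak_grad U u))"
    using a0[unfolded a_def[abs_def]] b0[unfolded b_def[abs_def]] C1c_sq_int[OF C] unfolding sq_lim_def by blast+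
  then show ?thesis by (rule h10I[OF C])
qed

text \<open>The values of \<open>u'\<close> outside \<open>U\<close> are free, because
  \<open>H10\<close> does not see them. Together with \<open>H10_imp_h10\<close> this translates
  between the given definitions and functions extended by zero.\<close>

lemma h10_imp_H10:
  assumes "open U" "h10 U u g" "\<And>x. x \<in> U \<Longrightarrow> u' x = u x"
  shows "u' \<in> H10 U" "AE x in lebesgue. x \<in> U \<longrightarrow> weak_grad U u' x = g x"
proof -
  have zu: "zext U u' = zext U u" using assms(3) by (auto simp: zext_def)
  have [measurable]: "u \<in> borel_measurable lebesgue" "g \<in> borel_measurable lebesgue"
    using h10_sq_int[OF assms(2)] by (auto dest: sq_int_measurable)
  have "U \<in> sets lebesgue" using assms(1) by simp
  then have mu: "zext U u \<in> borel_measurable lebesgue" "zext U g \<in> borel_measurable lebesgue"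
    unfolding zext_eq_indicator by measurable
  have AEz: "AE x in lebesgue. u x = zext U u x" "AE x in lebesgue. g x = zext U g x"
    using h10_AE_zero_outside[OF assms(2)] by (auto elim!: eventually_mono simp: zext_def)
  have z: "h10 U (zext U u) (zext U g)"
    by (rule h10_cong_AE[OF assms(2) mu(1) AEz(1) mu(2) AEz(2)])
  note zL = h10_sq_int[OF z]
  have gU: "g square_integrable_on U" using zL(2) square_integrable_on_eq[OF assms(1)] by blast
  have wg: "has_weak_gradient U u' g"
    unfolding has_weak_gradient_eq[OF assms(1)] zu
    using h10_integration_by_parts[OF z test_function_C1c] by blast
  have H1: "u' \<in> H1 U"
    unfolding H1_def using zL(1) gU wg by (auto simp: square_integrable_on_eq[OF assms(1)] zu)
  note W = H1_weak_grad[OF H1]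
  show ae: "AE x in lebesgue. x \<in> U \<longrightarrow> weak_grad U u' x = g x"
    using weak_gradient_unique[OF assms(1) W(2) wg] W(1) zL(2) square_integrable_on_eq[OF assms(1)] by blast
  obtain \<psi> where \<psi>: "\<And>n. \<psi> n \<in> test_functions U" "sq_lim lebesgue \<psi> (zext U u)"
    "sq_lim lebesgue (\<lambda>n. grad (\<psi> n)) (zext U g)"
    by (rule h10_test_sequence[OF assms(1) z]) (rule that)
  note C = test_function_C1c[OF \<psi>(1)]
  have wm: "zext U (weak_grad U u') \<in> borel_measurable lebesgue"
    using W(1) square_integrable_on_eq[OF assms(1)] sq_int_measurable by blast
  have "AE x in lebesgue. zext U g x = zext U (weak_grad U u') x"
    using ae by (auto elim!: eventually_mono simp: zext_def)
  then have \<psi>3: "sq_lim lebesgue (\<lambda>n. grad (\<psi> n)) (zext U (weak_grad U u'))"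
    by (rule sq_lim_cong_AE[OF \<psi>(3) wm])
  have "(LINT x|lebesgue_on U. (u' x - \<psi> n x)\<^sup>2) = sq_norm lebesgue (\<lambda>x. \<psi> n x - zext U u x)" for n
    using lebesgue_on_sq_norm[OF assms(1), of "\<lambda>x. u' x - \<psi> n x"] zext_test[OF C, of n]
    by (simp add: zext_diff zu sq_norm_def power2_commute)
  moreover have "(LINT x|lebesgue_on U. (norm (weak_grad U u' x - grad (\<psi> n) x))\<^sup>2) =
      sq_norm lebesgue (\<lambda>x. grad (\<psi> n) x - zext U (weak_grad U u') x)" for n
    using lebesgue_on_sq_norm[OF assms(1), of "\<lambda>x. weak_grad U u' x - grad (\<psi> n) x"] zext_test[OF C, of n]
    by (simp add: zext_diff sq_norm_def norm_minus_commute)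
  ultimately show "u' \<in> H10 U"
    unfolding H10_def using H1 \<psi>(1) tendsto_add[OF sq_limD(3)[OF \<psi>(2)] sq_limD(3)[OF \<psi>3]]
    by (auto intro!: exI[of _ \<psi>])
qed

lemma h10_energy:
  assumes "open U" "h10 U u g"
  shows "(LINT x|lebesgue_on U. (u x)\<^sup>2) = sq_norm lebesgue u"
    "(LINT x|lebesgue_on U. (norm (weak_grad U u x))\<^sup>2) = sq_norm lebesgue g"
proof -
  note L = h10_sq_int[OF assms(2)]
  note W = h10_imp_H10[OF assms refl]
  have wz: "sq_int lebesgue (zext U (weak_grad U u))"
    using H1_weak_grad(1)[of u U] W(1) square_integrable_on_eq[OF assms(1)] by (auto simp: H10_def)
  have mz: "zext U u \<in> borel_measurable lebesgue"
  proof -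
    have "u \<in> borel_measurable lebesgue" by (rule sq_int_measurable[OF L(1)])
    moreover have "U \<in> sets lebesgue" using assms(1) by simp
    ultimately show ?thesis unfolding zext_eq_indicator by measurable
  qed
  have 1: "AE x in lebesgue. zext U u x = u x"
    using h10_AE_zero_outside[OF assms(2)] by (auto elim!: eventually_mono simp: zext_def)
  have 2: "AE x in lebesgue. zext U (weak_grad U u) x = g x"
    using h10_AE_zero_outside[OF assms(2)] W(2) by eventually_elim (auto simp: zext_def)
  have "sq_norm lebesgue (zext U u) = sq_norm lebesgue u"
    unfolding sq_norm_def
    by (rule integral_cong_AE) (use mz L(1) 1 in \<open>auto dest!: sq_int_measurable elim!: eventually_mono\<close>)
  then show "(LINT x|lebesgue_on U. (u x)\<^sup>2) = sq_norm lebesgue u"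
    using lebesgue_on_sq_norm[OF assms(1), of u] by simp
  have "sq_norm lebesgue (zext U (weak_grad U u)) = sq_norm lebesgue g"
    unfolding sq_norm_def
    by (rule integral_cong_AE) (use wz L(2) 2 in \<open>auto dest!: sq_int_measurable elim!: eventually_mono\<close>)
  then show "(LINT x|lebesgue_on U. (norm (weak_grad U u x))\<^sup>2) = sq_norm lebesgue g"
    using lebesgue_on_sq_norm[OF assms(1), of "weak_grad U u"] by simp
qed

section \<open>The bottom of the spectrum as Poincare constant\<close>

lemma dirichlet_bottom_bdd_below:
  "bdd_below ((\<lambda>u. (LINT x|lebesgue_on \<Omega>. (norm (weak_grad \<Omega> u x))\<^sup>2) / (LINT x|lebesgue_on \<Omega>. (u x)\<^sup>2)) ` S)"
  by (rule bdd_belowI[of _ 0]) (auto intro!: divide_nonneg_nonneg)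

text \<open>Poincare's inequality. The product form also covers functions that vanish almost
  everywhere, which are excluded from the infimum of the quotients.\<close>

lemma dirichlet_bottom_le:
  assumes "open U" "h10 U u g"
  shows "dirichlet_bottom U * sq_norm lebesgue u \<le> sq_norm lebesgue g"
proof (cases "AE x in lebesgue_on U. u x = 0")
  case True
  then have "AE x in lebesgue. u x = 0"
    using h10_AE_zero_outside[OF assms(2)] unfolding lebesgue_on_AE[OF assms(1)]
    by eventually_elim auto
  then have "sq_norm lebesgue u = 0"
    unfolding sq_norm_def by (intro integral_eq_zero_AE) auto
  then show ?thesis by (simp add: sq_norm_nonneg)
next
  case False
  have pos: "sq_norm lebesgue u > 0"
  proof (rule ccontr)
    assume "\<not> sq_norm lebesgue u > 0"
    then have "sq_norm lebesgue u = 0" using sq_norm_nonneg[of lebesgue u] by simp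
    then have "AE x in lebesgue. u x = 0" by (rule sq_norm_eq_0[OF h10_sq_int(1)[OF assms(2)]])
    then have "AE x in lebesgue. x \<in> U \<longrightarrow> u x = 0" by eventually_elim simp
    then show False using False unfolding lebesgue_on_AE[OF assms(1)] by blast
  qed
  have "dirichlet_bottom U \<le> (LINT x|lebesgue_on U. (norm (weak_grad U u x))\<^sup>2) / (LINT x|lebesgue_on U. (u x)\<^sup>2)"
    unfolding dirichlet_bottom_def
    using h10_imp_H10(1)[OF assms refl] False by (intro cINF_lower dirichlet_bottom_bdd_below) auto
  then show ?thesis unfolding h10_energy[OF assms] using pos by (simp add: field_simps)
qed

lemma nonzero_C1c_exists:
  assumes "open U" "U \<noteq> {}"
  obtains \<phi> G where "C1c U \<phi> G" "sq_norm lebesgue \<phi> > 0"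
proof -
  obtain x r where x: "r > 0" "cball x r \<subseteq> U" using assms open_contains_cball by blast
  obtain g where g: "\<And>k. C_diff k g" "\<And>y. g y \<ge> 0" "\<And>y. norm y > r \<Longrightarrow> g y = 0" "(LINT x|lebesgue. g x) = 1"
    by (rule mollifier_exists[OF x(1)]) (rule that)
  note gC = C_diff_imp_C1[OF g(1)]
  have C: "C1 (\<lambda>y. g (y - x)) (\<lambda>y. grad g (y - x))"
    unfolding C1_def
  proof (intro conjI allI)
    show "continuous_on UNIV (\<lambda>y. grad g (y - x))"
      by (intro continuous_on_compose2[OF C1D(2)[OF gC]] continuous_intros) auto
    have 1: "((\<lambda>y. y - x) has_derivative (\<lambda>h. h)) (at y)" for y by (auto intro!: derivative_eq_intros)
    show "((\<lambda>y. g (y - x)) has_derivative (\<bullet>) (grad g (y - x))) (at y)" for y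
      using has_derivative_compose[OF 1 C1D(1)[OF gC]] .
  qed
  have Cc: "C1c U (\<lambda>y. g (y - x)) (\<lambda>y. grad g (y - x))"
    by (rule C1cI[OF C compact_cball x(2)]) (auto intro!: g(3) simp: dist_norm norm_minus_commute)
  have "sq_norm lebesgue (\<lambda>y. g (y - x)) \<noteq> 0"
  proof
    assume "sq_norm lebesgue (\<lambda>y. g (y - x)) = 0"
    then have "AE y in lebesgue. g (y - x) = 0" by (rule sq_norm_eq_0[OF C1c_sq_int(1)[OF Cc]])
    then have "g (y - x) = 0" for y
      by (intro continuous_AE_eq_0[OF open_UNIV C1_continuous[OF C]]) auto
    from this[of "_ + x"] have "g = (\<lambda>_. 0)" by auto
    then show False using g(4) by simp
  qed
  then show thesis using that[OF Cc] sq_norm_nonneg[of lebesgue "\<lambda>y. g (y - x)"] by simp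
qed

text \<open>The infimum of an empty set of reals carries no information, so the admissible set is
  first shown to be inhabited. The inequality is then assumed for C1 functions only, from which it
  passes to \<open>H10\<close> by L2 limits.\<close>

lemma dirichlet_bottom_ge:
  assumes "open U" "U \<noteq> {}" "\<And>\<phi> G. C1c U \<phi> G \<Longrightarrow> \<kappa> * sq_norm lebesgue \<phi> \<le> sq_norm lebesgue G"
  shows "\<kappa> \<le> dirichlet_bottom U"
  unfolding dirichlet_bottom_def
proof (rule cINF_greatest)
  obtain \<phi> G where \<phi>: "C1c U \<phi> G" "sq_norm lebesgue \<phi> > 0" by (rule nonzero_C1c_exists[OF assms(1,2)]) (rule that)
  have "\<not> (AE x in lebesgue_on U. \<phi> x = 0)"
  proof
    assume "AE x in lebesgue_on U. \<phi> x = 0"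
    then have "AE x in lebesgue. \<phi> x = 0"
      using h10_AE_zero_outside[OF h10_C1c[OF \<phi>(1)]] unfolding lebesgue_on_AE[OF assms(1)] by eventually_elim auto
    then have "sq_norm lebesgue \<phi> = 0" unfolding sq_norm_def by (intro integral_eq_zero_AE) auto
    then show False using \<phi>(2) by simp
  qed
  then show "{u \<in> H10 U. \<not> (AE x in lebesgue_on U. u x = 0)} \<noteq> {}"
    using h10_imp_H10(1)[OF assms(1) h10_C1c[OF \<phi>(1)] refl] by blast
  fix u assume u: "u \<in> {u \<in> H10 U. \<not> (AE x in lebesgue_on U. u x = 0)}"
  have h: "h10 U (zext U u) (zext U (weak_grad U u))" using u by (intro H10_imp_h10 assms(1)) auto
  obtain \<psi> G where \<psi>: "\<And>n::nat. C1c U (\<psi> n) (G n)" "sq_lim lebesgue \<psi> (zext U u)"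
    "sq_lim lebesgue G (zext U (weak_grad U u))"
    by (rule h10E[OF h]) (rule that)
  have "\<kappa> * sq_norm lebesgue (zext U u) \<le> sq_norm lebesgue (zext U (weak_grad U u))"
    using assms(3)[OF \<psi>(1)]
    by (intro LIMSEQ_le[OF tendsto_mult_left[OF sq_lim_norm[OF \<psi>(2)]] sq_lim_norm[OF \<psi>(3)]]) auto
  moreover have "sq_norm lebesgue (zext U u) > 0"
  proof (rule ccontr)
    assume "\<not> sq_norm lebesgue (zext U u) > 0"
    then have "sq_norm lebesgue (zext U u) = 0" using sq_norm_nonneg[of lebesgue "zext U u"] by simp
    then have "AE x in lebesgue. zext U u x = 0" by (rule sq_norm_eq_0[OF h10_sq_int(1)[OF h]])
    then have "AE x in lebesgue_on U. u x = 0"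
      unfolding lebesgue_on_AE[OF assms(1)] by eventually_elim (auto simp: zext_def split: if_splits)
    then show False using u by blast
  qed
  ultimately show "\<kappa> \<le> (LINT x|lebesgue_on U. (norm (weak_grad U u x))\<^sup>2) / (LINT x|lebesgue_on U. (u x)\<^sup>2)"
    using lebesgue_on_sq_norm[OF assms(1), of u] lebesgue_on_sq_norm[OF assms(1), of "weak_grad U u"]
    by (simp add: field_simps)
qed

lemma dirichlet_bottom_nonneg: "open U \<Longrightarrow> U \<noteq> {} \<Longrightarrow> 0 \<le> dirichlet_bottom U"
  by (rule dirichlet_bottom_ge) (auto simp: sq_norm_nonneg)

section \<open>Weak solutions of Poisson's equation\<close>

definition wsol :: "(real^2) set \<Rightarrow> (real^2 \<Rightarrow> real) \<Rightarrow> (real^2 \<Rightarrow> real) \<Rightarrow> (real^2 \<Rightarrow> real^2) \<Rightarrow> bool" where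
  "wsol U f w g \<longleftrightarrow> h10 U w g \<and> sq_int lebesgue f \<and>
     (\<forall>\<phi> G. C1c U \<phi> G \<longrightarrow> (LINT x|lebesgue. g x \<bullet> G x) = (LINT x|lebesgue. f x * \<phi> x))"

lemma wsolD:
  assumes "wsol U f w g"
  shows "h10 U w g" "sq_int lebesgue f" "sq_int lebesgue w" "sq_int lebesgue g"
  using assms h10_sq_int[of U w g] by (auto simp: wsol_def)

text \<open>Both sides are continuous in L2, which is why \<open>wsol\<close> includes
  \<open>sq_int lebesgue f\<close>. Products and compositions formed from the solution itself
  thereby become admissible test functions.\<close>

lemma wsol_test:
  assumes "wsol U f w g" "h10 U v h"
  shows "(LINT x|lebesgue. g x \<bullet> h x) = (LINT x|lebesgue. f x * v x)"
proof -
  obtain \<phi> G where 1: "\<And>n::nat. C1c U (\<phi> n) (G n)" "sq_lim lebesgue \<phi> v" "sq_lim lebesgue G h"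
    by (rule h10E[OF assms(2)]) (rule that)
  have "(\<lambda>n. LINT x|lebesgue. g x \<bullet> G n x) \<longlonglongrightarrow> (LINT x|lebesgue. g x \<bullet> h x)"
    by (rule sq_lim_inner[OF sq_lim_const[OF wsolD(4)[OF assms(1)]] 1(3)])
  moreover have "(\<lambda>n. LINT x|lebesgue. f x * \<phi> n x) \<longlonglongrightarrow> (LINT x|lebesgue. f x * v x)"
    by (rule sq_lim_mult_int[OF sq_lim_const[OF wsolD(2)[OF assms(1)]] 1(2)])
  moreover have "(LINT x|lebesgue. g x \<bullet> G n x) = (LINT x|lebesgue. f x * \<phi> n x)" for n
    using assms(1) 1(1)[of n] by (auto simp: wsol_def)
  ultimately show ?thesis by (simp add: LIMSEQ_unique)
qed

lemma wsolI_test_functions: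
  assumes "open U" "h10 U w g" "sq_int lebesgue f"
    "\<And>\<phi>. \<phi> \<in> test_functions U \<Longrightarrow> (LINT x|lebesgue. g x \<bullet> grad \<phi> x) = (LINT x|lebesgue. f x * \<phi> x)"
  shows "wsol U f w g"
  unfolding wsol_def
proof (intro conjI allI impI assms(2,3))
  fix \<phi> G assume C: "C1c U \<phi> G"
  obtain \<psi> where \<psi>: "\<And>n. \<psi> n \<in> test_functions U" "sq_lim lebesgue \<psi> \<phi>" "sq_lim lebesgue (\<lambda>n. grad (\<psi> n)) G"
    by (rule C1c_test_sequence[OF assms(1) C]) (rule that)
  have "(\<lambda>n. LINT x|lebesgue. g x \<bullet> grad (\<psi> n) x) \<longlonglongrightarrow> (LINT x|lebesgue. g x \<bullet> G x)"
    by (rule sq_lim_inner[OF sq_lim_const[OF h10_sq_int(2)[OF assms(2)]] \<psi>(3)])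
  moreover have "(\<lambda>n. LINT x|lebesgue. f x * \<psi> n x) \<longlonglongrightarrow> (LINT x|lebesgue. f x * \<phi> x)"
    by (rule sq_lim_mult_int[OF sq_lim_const[OF assms(3)] \<psi>(2)])
  ultimately show "(LINT x|lebesgue. g x \<bullet> G x) = (LINT x|lebesgue. f x * \<phi> x)"
    using assms(4)[OF \<psi>(1)] by (simp add: LIMSEQ_unique)
qed

lemma weak_dirichlet_solution_imp_wsol:
  assumes "open U" "weak_dirichlet_solution U f u" "sq_int lebesgue (zext U f)"
  shows "wsol U (zext U f) (zext U u) (zext U (weak_grad U u))"
proof (rule wsolI_test_functions[OF assms(1) H10_imp_h10[OF assms(1)] assms(3)])
  show "u \<in> H10 U" using assms(2) by (simp add: weak_dirichlet_solution_def)
  fix \<phi> assume \<phi>: "\<phi> \<in> test_functions U"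
  have z1: "zext U (\<lambda>x. weak_grad U u x \<bullet> grad \<phi> x) = (\<lambda>x. zext U (weak_grad U u) x \<bullet> grad \<phi> x)"
    and z2: "zext U (\<lambda>x. f x * \<phi> x) = (\<lambda>x. zext U f x * \<phi> x)"
    by (auto simp: zext_def)
  have "(LINT x|lebesgue_on U. weak_grad U u x \<bullet> grad \<phi> x) = (LINT x|lebesgue_on U. f x * \<phi> x)"
    using assms(2) \<phi> by (simp add: weak_dirichlet_solution_def)
  then show "(LINT x|lebesgue. zext U (weak_grad U u) x \<bullet> grad \<phi> x) = (LINT x|lebesgue. zext U f x * \<phi> x)"
    unfolding lebesgue_on_integral[OF assms(1)] z1 z2 .
qed

lemma wsol_imp_weak_dirichlet_solution:
  assumes "open U" "wsol U f w g" "\<And>x. x \<in> U \<Longrightarrow> f' x = f x" "\<And>x. x \<in> U \<Longrightarrow> w' x = w x"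
  shows "weak_dirichlet_solution U f' w'"
  unfolding weak_dirichlet_solution_def
proof (intro conjI ballI)
  have H: "w' \<in> H10 U" "AE x in lebesgue. x \<in> U \<longrightarrow> weak_grad U w' x = g x"
    by (rule h10_imp_H10[OF assms(1) wsolD(1)[OF assms(2)]], rule assms(4), assumption)+
  show w': "w' \<in> H10 U" by (rule H(1))
  fix \<phi> assume \<phi>: "\<phi> \<in> test_functions U"
  note C = test_function_C1c[OF \<phi>]
  have 0: "\<phi> x = 0" "grad \<phi> x = 0" if "x \<notin> U" for x
    using C that unfolding C1c_def by blast+
  have wm: "(\<lambda>x. zext U (weak_grad U w') x \<bullet> grad \<phi> x) \<in> borel_measurable lebesgue"
    using sq_int_measurable[OF C1c_sq_int(2)[OF C]] sq_int_measurable[OF h10_sq_int(2)[OF H10_imp_h10[OF assms(1) w']]]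
    by measurable
  have gm: "(\<lambda>x. g x \<bullet> grad \<phi> x) \<in> borel_measurable lebesgue"
    using sq_int_measurable[OF C1c_sq_int(2)[OF C]] sq_int_measurable[OF wsolD(4)[OF assms(2)]] by measurable
  have "zext U (\<lambda>x. weak_grad U w' x \<bullet> grad \<phi> x) = (\<lambda>x. zext U (weak_grad U w') x \<bullet> grad \<phi> x)"
    by (auto simp: zext_def)
  then have "(LINT x|lebesgue_on U. weak_grad U w' x \<bullet> grad \<phi> x) = (LINT x|lebesgue. zext U (weak_grad U w') x \<bullet> grad \<phi> x)"
    by (simp add: lebesgue_on_integral[OF assms(1)])
  also have "\<dots> = (LINT x|lebesgue. g x \<bullet> grad \<phi> x)"
  proof (rule integral_cong_AE[OF wm gm])
    show "AE x in lebesgue. zext U (weak_grad U w') x \<bullet> grad \<phi> x = g x \<bullet> grad \<phi> x"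
      using H(2) by eventually_elim (auto simp: zext_def 0)
  qed
  also have "\<dots> = (LINT x|lebesgue. f x * \<phi> x)" using assms(2) C by (auto simp: wsol_def)
  also have "(\<lambda>x. f x * \<phi> x) = zext U (\<lambda>x. f' x * \<phi> x)" by (auto simp: zext_def 0 assms(3))
  finally show "(LINT x|lebesgue_on U. weak_grad U w' x \<bullet> grad \<phi> x) = (LINT x|lebesgue_on U. f' x * \<phi> x)"
    by (simp add: lebesgue_on_integral[OF assms(1)])
qed

section \<open>Product rule and chain rule for Sobolev functions\<close>

lemma h10_mult:
  assumes "h10 U u g" "C1 p P" "\<And>x. \<bar>p x\<bar> \<le> B" "\<And>x. norm (P x) \<le> B"
  shows "h10 U (\<lambda>x. p x * u x) (\<lambda>x. p x *\<^sub>R g x + u x *\<^sub>R P x)"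
proof -
  obtain \<phi> G where 1: "\<And>n::nat. C1c U (\<phi> n) (G n)" "sq_lim lebesgue \<phi> u" "sq_lim lebesgue G g"
    by (rule h10E[OF assms(1)]) (rule that)
  have pm: "p \<in> borel_measurable lebesgue" "P \<in> borel_measurable lebesgue"
    by (auto intro!: continuous_imp_lebesgue_measurable C1_continuous[OF assms(2)] C1D(2)[OF assms(2)])
  have "sq_lim lebesgue (\<lambda>n x. p x * \<phi> n x) (\<lambda>x. p x * u x)"
    using sq_lim_mult[OF 1(2) pm(1) assms(3)] by simp
  then show ?thesis
    by (rule h10I[OF C1c_mult_left[OF 1(1) assms(2)] _ sq_lim_add[OF sq_lim_mult[OF 1(3) pm(1) assms(3)] sq_lim_mult_vec[OF 1(2) pm(2) assms(4)]]])
qed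

text \<open>The gradient of the composed approximant splits into
  \<open>\<gamma>' (\<phi> n x) *\<^sub>R (G n x - g x)\<close>, dominated by the L2 error, and
  \<open>\<gamma>' (\<phi> n x) *\<^sub>R g x\<close>, which converges by dominated convergence
  along an almost everywhere convergent subsequence. \<open>\<gamma> 0 = 0\<close> keeps the
  supports compact in \<open>U\<close>.\<close>

lemma h10_compose:
  assumes "h10 U u g" "\<And>t. (\<gamma> has_real_derivative \<gamma>' t) (at t)" "continuous_on UNIV \<gamma>'" "\<gamma> 0 = 0"
    "\<And>t. \<bar>\<gamma>' t\<bar> \<le> B"
  shows "h10 U (\<lambda>x. \<gamma> (u x)) (\<lambda>x. \<gamma>' (u x) *\<^sub>R g x)"
proof -
  obtain \<phi>0 G0 where 0: "\<And>n::nat. C1c U (\<phi>0 n) (G0 n)" "sq_lim lebesgue \<phi>0 u" "sq_lim lebesgue G0 g"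
    by (rule h10E[OF assms(1)]) (rule that)
  obtain r where r: "strict_mono r" "AE x in lebesgue. (\<lambda>n. \<phi>0 (r n) x) \<longlonglongrightarrow> u x"
    using sq_lim_AE_subseq[OF 0(2)] by blast
  define \<phi> G where "\<phi> n = \<phi>0 (r n)" and "G n = G0 (r n)" for n
  have 1: "\<And>n. C1c U (\<phi> n) (G n)" "sq_lim lebesgue \<phi> u" "sq_lim lebesgue G g"
    using 0(1) sq_lim_subseq[OF 0(2) r(1)] sq_lim_subseq[OF 0(3) r(1)] by (auto simp: \<phi>_def[abs_def] G_def[abs_def])
  have ae: "AE x in lebesgue. (\<lambda>n. \<phi> n x) \<longlonglongrightarrow> u x" using r(2) by (simp add: \<phi>_def)
  note L = sq_limD(2)[OF 1(2)] sq_limD(2)[OF 1(3)] sq_limD(1)[OF 1(2)] sq_limD(1)[OF 1(3)]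
  have \<gamma>c: "continuous_on UNIV \<gamma>" by (intro continuous_at_imp_continuous_on ballI DERIV_isCont[OF assms(2)])
  have [measurable]: "\<gamma> \<in> borel_measurable borel" "\<gamma>' \<in> borel_measurable borel"
    using \<gamma>c assms(3) by (auto intro: borel_measurable_continuous_onI)
  have [measurable]: "u \<in> borel_measurable lebesgue" "g \<in> borel_measurable lebesgue"
    "\<phi> n \<in> borel_measurable lebesgue" "G n \<in> borel_measurable lebesgue" for n
    using L by (auto dest: sq_int_measurable)
  have lip: "\<bar>\<gamma> s - \<gamma> t\<bar> \<le> B * \<bar>s - t\<bar>" for s t
  proof -
    have "norm (\<gamma> s - \<gamma> t) \<le> B * norm (s - t)"
      by (rule field_differentiable_bound[of UNIV \<gamma> \<gamma>']) (use assms(2,5) in auto)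
    then show ?thesis by simp
  qed
  have s1: "sq_lim lebesgue (\<lambda>n x. \<gamma> (\<phi> n x)) (\<lambda>x. \<gamma> (u x))"
  proof (rule sq_lim_bounded_map[OF 1(2), where C = B])
    show "sq_int lebesgue (\<lambda>x. \<gamma> (\<phi> n x))" for n
      using lip[of _ 0] assms(4) by (intro sq_int_bound[OF L(3), where C = B]) auto
    show "sq_int lebesgue (\<lambda>x. \<gamma> (u x))"
      using lip[of _ 0] assms(4) by (intro sq_int_bound[OF L(1), where C = B]) auto
    show "norm (\<gamma> (\<phi> n x) - \<gamma> (u x)) \<le> B * norm (\<phi> n x - u x)" for n x using lip by simp
  qed
  have a1: "sq_lim lebesgue (\<lambda>n x. \<gamma>' (\<phi> n x) *\<^sub>R (G n x - g x)) (\<lambda>x. 0)"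
  proof (rule sq_lim_bounded_map[OF 1(3), where C = B])
    show "sq_int lebesgue (\<lambda>x. \<gamma>' (\<phi> n x) *\<^sub>R (G n x - g x))" for n
      by (rule sq_int_mult[OF sq_int_diff[OF L(4,2)] _ assms(5)]) measurable
    show "norm (\<gamma>' (\<phi> n x) *\<^sub>R (G n x - g x) - 0) \<le> B * norm (G n x - g x)" for n x
      using assms(5) by (simp add: mult_right_mono)
  qed simp
  have a2: "sq_lim lebesgue (\<lambda>n x. \<gamma>' (\<phi> n x) *\<^sub>R g x) (\<lambda>x. \<gamma>' (u x) *\<^sub>R g x)"
    unfolding sq_lim_def
  proof (intro conjI allI)
    show sn: "sq_int lebesgue (\<lambda>x. \<gamma>' (\<phi> n x) *\<^sub>R g x)" for n
      by (rule sq_int_mult[OF L(2) _ assms(5)]) measurable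
    show su: "sq_int lebesgue (\<lambda>x. \<gamma>' (u x) *\<^sub>R g x)"
      by (rule sq_int_mult[OF L(2) _ assms(5)]) measurable
    have "(\<lambda>n. LINT x|lebesgue. (norm (\<gamma>' (\<phi> n x) *\<^sub>R g x - \<gamma>' (u x) *\<^sub>R g x))\<^sup>2) \<longlonglongrightarrow> (LINT x|(lebesgue :: (real^2) measure). (0::real))"
    proof (rule integral_dominated_convergence[where w = "\<lambda>x. (2 * B)\<^sup>2 * (norm (g x))\<^sup>2"])
      show "integrable lebesgue (\<lambda>x. (2 * B)\<^sup>2 * (norm (g x))\<^sup>2)" using sq_int_integrable[OF L(2)] by simp
      show "AE x in lebesgue. (\<lambda>n. (norm (\<gamma>' (\<phi> n x) *\<^sub>R g x - \<gamma>' (u x) *\<^sub>R g x))\<^sup>2) \<longlonglongrightarrow> 0"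
        using ae
      proof eventually_elim
        case (elim x)
        have "(\<lambda>n. \<gamma>' (\<phi> n x)) \<longlonglongrightarrow> \<gamma>' (u x)"
          by (rule continuous_on_tendsto_compose[OF assms(3) elim]) auto
        then have "(\<lambda>n. (norm (\<gamma>' (\<phi> n x) *\<^sub>R g x - \<gamma>' (u x) *\<^sub>R g x))\<^sup>2) \<longlonglongrightarrow> (norm (\<gamma>' (u x) *\<^sub>R g x - \<gamma>' (u x) *\<^sub>R g x))\<^sup>2"
          by (intro tendsto_intros)
        then show ?case by simp
      qed
      show "AE x in lebesgue. norm ((norm (\<gamma>' (\<phi> n x) *\<^sub>R g x - \<gamma>' (u x) *\<^sub>R g x))\<^sup>2) \<le> (2 * B)\<^sup>2 * (norm (g x))\<^sup>2" for n
      proof (rule AE_I2)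
        fix x
        have "\<bar>\<gamma>' (\<phi> n x) - \<gamma>' (u x)\<bar> \<le> 2 * B" using assms(5)[of "\<phi> n x"] assms(5)[of "u x"] by linarith
        then have "(\<bar>\<gamma>' (\<phi> n x) - \<gamma>' (u x)\<bar> * norm (g x))\<^sup>2 \<le> (2 * B * norm (g x))\<^sup>2"
          by (intro power_mono mult_right_mono) auto
        then show "norm ((norm (\<gamma>' (\<phi> n x) *\<^sub>R g x - \<gamma>' (u x) *\<^sub>R g x))\<^sup>2) \<le> (2 * B)\<^sup>2 * (norm (g x))\<^sup>2"
          by (simp flip: scaleR_diff_left add: power_mult_distrib)
      qed
    qed measurable
    then show "(\<lambda>n. sq_norm lebesgue (\<lambda>x. \<gamma>' (\<phi> n x) *\<^sub>R g x - \<gamma>' (u x) *\<^sub>R g x)) \<longlonglongrightarrow> 0"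
      by (simp add: sq_norm_def)
  qed
  have s2: "sq_lim lebesgue (\<lambda>n x. \<gamma>' (\<phi> n x) *\<^sub>R G n x) (\<lambda>x. \<gamma>' (u x) *\<^sub>R g x)"
    using sq_lim_add[OF a1 a2] by (simp flip: scaleR_add_right)
  show ?thesis by (rule h10I[OF C1c_compose[OF 1(1) assms(2,3,4)] s1 s2])
qed

subsection \<open>Radial kernels\<close>

text \<open>Integrals of radial functions depend only on the distribution of the distance to
  \<open>z\<close>, and the areas of discs determine that distribution, with density
  \<open>2 * pi * r\<close>.\<close>

lemma distr_norm_lborel:
  fixes z :: "real^2"
  shows "distr lborel borel (\<lambda>x. norm (x - z)) = density lborel (\<lambda>r. ennreal (2 * pi * r * indicator {0..} r))"
proof (rule measure_eqI_generator_eq[where E = "range (\<lambda>a::real. {..a})" and \<Omega> = UNIV and A = "\<lambda>n::nat. {..real n}"])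
  show "Int_stable (range (\<lambda>a::real. {..a}))"
  proof (rule Int_stableI)
    fix A B :: "real set" assume "A \<in> range (\<lambda>a. {..a})" "B \<in> range (\<lambda>a. {..a})"
    then obtain a b where "A = {..a}" "B = {..b}" by auto
    then have "A \<inter> B = {..min a b}" by auto
    then show "A \<inter> B \<in> range (\<lambda>a. {..a})" by simp
  qed
  have eq: "emeasure (distr lborel borel (\<lambda>x. norm (x - z))) {..a} =
      emeasure (density lborel (\<lambda>r. ennreal (2 * pi * r * indicator {0..} r))) {..a}"
    "emeasure (distr lborel borel (\<lambda>x. norm (x - z))) {..a} \<noteq> \<infinity>" for a :: real
  proof -
    have l: "emeasure (distr lborel borel (\<lambda>x. norm (x - z))) {..a} = emeasure lborel (cball z a)"
    proof -
      have "(\<lambda>x. norm (x - z)) -` {..a} \<inter> space lborel = cball z a"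
        by (auto simp: dist_norm norm_minus_commute)
      then show ?thesis by (subst emeasure_distr) auto
    qed
    have r: "emeasure (density lborel (\<lambda>r. ennreal (2 * pi * r * indicator {0..} r))) {..a} =
        (\<integral>\<^sup>+r. ennreal (2 * pi * r) * indicator {0..a} r \<partial>lborel)"
      by (subst emeasure_density) (auto intro!: nn_integral_cong simp: indicator_def)
    show "emeasure (distr lborel borel (\<lambda>x. norm (x - z))) {..a} \<noteq> \<infinity>"
      unfolding l using emeasure_lborel_cball_finite[of z a] by simp
    show "emeasure (distr lborel borel (\<lambda>x. norm (x - z))) {..a} =
        emeasure (density lborel (\<lambda>r. ennreal (2 * pi * r * indicator {0..} r))) {..a}"
    proof (cases "a \<ge> 0")
      case True
      have "(\<integral>\<^sup>+r. ennreal (2 * pi * r) * indicator {0..a} r \<partial>lborel) = ennreal (pi * a\<^sup>2 - pi * 0\<^sup>2)"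
        using True by (intro nn_integral_FTC_Icc) (auto intro!: derivative_eq_intros)
      then show ?thesis unfolding l r using True by (simp add: emeasure_cball unit_ball_vol_2)
    next
      case False
      then show ?thesis unfolding l r by (simp add: not_le)
    qed
  qed
  show "\<And>X. X \<in> range (\<lambda>a::real. {..a}) \<Longrightarrow> emeasure (distr lborel borel (\<lambda>x. norm (x - z))) X =
      emeasure (density lborel (\<lambda>r. ennreal (2 * pi * r * indicator {0..} r))) X"
    using eq(1) by auto
  show "\<And>n. emeasure (distr lborel borel (\<lambda>x. norm (x - z))) {..real n} \<noteq> \<infinity>" by (rule eq(2))
  show "sets (distr lborel borel (\<lambda>x. norm (x - z))) = sigma_sets UNIV (range (\<lambda>a::real. {..a}))"
    "sets (density lborel (\<lambda>r. ennreal (2 * pi * r * indicator {0..} r))) = sigma_sets UNIV (range (\<lambda>a::real. {..a}))"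
    by (simp_all add: borel_eq_atMost sets_measure_of)
  show "(\<Union>n. {..real n}) = UNIV" using real_arch_simple by auto
qed auto

text \<open>The product \<open>2 * pi * r * g r\<close> has to agree with the continuous
  \<open>f\<close> for \<open>r > 0\<close> only, so \<open>g\<close> may be singular at 0; the
  weights of size \<open>1 / r\<close> in \<open>radial_cost_integrals\<close> use this.\<close>

lemma radial_integral:
  fixes z :: "real^2"
  assumes "g \<in> borel_measurable borel" "0 \<le> b" "\<And>r. r > b \<Longrightarrow> g r = 0"
    "\<And>r. 0 < r \<Longrightarrow> r \<le> b \<Longrightarrow> 2 * pi * r * g r = f r"
    "\<And>r. 0 \<le> r \<Longrightarrow> r \<le> b \<Longrightarrow> (F has_real_derivative f r) (at r)" "continuous_on {0..b} f"
  shows "integrable lebesgue (\<lambda>x. g (norm (x - z)))" "(LINT x|lebesgue. g (norm (x - z))) = F b - F 0"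
proof -
  have [measurable]: "g \<in> borel_measurable borel" by fact
  have 1: "has_bochner_integral lborel (\<lambda>x. indicator {0..b} x *\<^sub>R f x) (F b - F 0)"
    using assms(5) by (intro has_bochner_integral_FTC_Icc assms)
      (auto simp: has_real_derivative_iff_has_vector_derivative[symmetric] intro: DERIV_subset)
  have "has_bochner_integral lborel (\<lambda>r. (2 * pi * r * indicator {0..} r) *\<^sub>R g r) (F b - F 0)"
  proof (rule has_bochner_integral_cong_AE[THEN iffD1, OF _ _ _ 1])
    show "(\<lambda>x. indicator {0..b} x *\<^sub>R f x) \<in> borel_measurable lborel"
      using 1 by (auto dest: has_bochner_integral_iff[THEN iffD1])
    show "AE x in lborel. indicator {0..b} x *\<^sub>R f x = (2 * pi * x * indicator {0..} x) *\<^sub>R g x"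
      using AE_lborel_singleton[of "0::real"]
    proof eventually_elim
      case (elim r)
      then show ?case using assms(3)[of r] assms(4)[of r] by (auto simp: indicator_def)
    qed
  qed auto
  then have "has_bochner_integral (density lborel (\<lambda>r. ennreal (2 * pi * r * indicator {0..} r))) g (F b - F 0)"
    by (intro has_bochner_integral_density) (auto simp: indicator_def)
  then have 2: "has_bochner_integral (distr lborel borel (\<lambda>x. norm (x - z))) g (F b - F 0)"
    by (simp add: distr_norm_lborel)
  then have "integrable lborel (\<lambda>x. g (norm (x - z)))" "(LINT x|lborel. g (norm (x - z))) = F b - F 0"
    using integrable_distr_eq[of "\<lambda>x. norm (x - z)" lborel borel g] integral_distr[of "\<lambda>x. norm (x - z)" lborel borel g]
    by (auto simp: has_bochner_integral_iff)
  then show "integrable lebesgue (\<lambda>x. g (norm (x - z)))" "(LINT x|lebesgue. g (norm (x - z))) = F b - F 0"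
    by (auto simp: integrable_completion integral_completion)
qed

text \<open>A profile in the squared distance. Its powers are polynomials on their support, so their
  integrals are explicit, and the exponent sets the smoothness at \<open>t = b\<close>: squares are
  C1 there, cubes C2.\<close>

definition hat :: "real \<Rightarrow> real \<Rightarrow> real" where
  "hat b t = max 0 (1 - t / b)"

lemma hat_nonneg: "0 \<le> hat b t"
  by (simp add: hat_def)

lemma hat_le_1: "b > 0 \<Longrightarrow> t \<ge> 0 \<Longrightarrow> hat b t \<le> 1"
  by (simp add: hat_def)

lemma hat_eq: "b > 0 \<Longrightarrow> t \<le> b \<Longrightarrow> hat b t = 1 - t / b"
  by (simp add: hat_def)

lemma hat_eq_0: "b > 0 \<Longrightarrow> t \<ge> b \<Longrightarrow> hat b t = 0"
  by (simp add: hat_def)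

lemma max_0_power_deriv:
  "((\<lambda>t::real. max 0 t ^ Suc (Suc n)) has_real_derivative real (Suc (Suc n)) * max 0 t ^ Suc n) (at t)"
proof (cases t "0::real" rule: linorder_cases)
  case less
  have "((\<lambda>t::real. 0) has_real_derivative 0) (at t)" by simp
  then have "((\<lambda>t::real. max 0 t ^ Suc (Suc n)) has_real_derivative 0) (at t)"
    by (rule has_field_derivative_transform_within_open[where S = "{..<0}"]) (use less in auto)
  then show ?thesis using less by simp
next
  case equal
  have "((\<lambda>h::real. max 0 h ^ Suc n) \<longlongrightarrow> max 0 0 ^ Suc n) (at 0)"
    by (intro tendsto_intros)
  then have "((\<lambda>h::real. max 0 h ^ Suc n) \<longlongrightarrow> 0) (at 0)" by simp
  then have "((\<lambda>h::real. (max 0 (0 + h) ^ Suc (Suc n) - max 0 0 ^ Suc (Suc n)) / h) \<longlongrightarrow> 0) (at 0)"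
    by (rule Lim_transform_eventually) (auto simp: eventually_at_filter max_def intro!: always_eventually)
  then show ?thesis using equal by (simp add: DERIV_def)
next
  case greater
  have "((\<lambda>t::real. t ^ Suc (Suc n)) has_real_derivative real (Suc (Suc n)) * max 0 t ^ Suc n) (at t)"
    using greater DERIV_pow[of "Suc (Suc n)" t] by (simp add: max_def)
  then show ?thesis
    by (rule has_field_derivative_transform_within_open[where S = "{0<..}"]) (use greater in \<open>auto simp: max_def\<close>)
qed

lemma hat_power_deriv:
  assumes "b > 0"
  shows "((\<lambda>t. hat b t ^ Suc (Suc n)) has_real_derivative - (real (Suc (Suc n)) / b) * hat b t ^ Suc n) (at t)"
proof -
  have "((\<lambda>t. 1 - t / b) has_real_derivative - (1 / b)) (at t)"
    using assms by (auto intro!: derivative_eq_intros)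
  from DERIV_chain2[OF max_0_power_deriv this, of n]
  show ?thesis unfolding hat_def by (simp add: field_simps)
qed

lemma hat_power_deriv_scale:
  assumes "b > 0"
  shows "((\<lambda>b. hat b t ^ Suc (Suc n)) has_real_derivative real (Suc (Suc n)) * hat b t ^ Suc n * (t / b\<^sup>2)) (at b)"
proof -
  have "((\<lambda>b. 1 - t / b) has_real_derivative t / b\<^sup>2) (at b)"
    using assms by (auto intro!: derivative_eq_intros simp: power2_eq_square)
  from DERIV_chain2[OF max_0_power_deriv this, of n]
  show ?thesis unfolding hat_def by simp
qed

lemma continuous_on_hat [continuous_intros]:
  "continuous_on S f \<Longrightarrow> continuous_on S (\<lambda>x. hat b (f x))"
proof -
  assume f: "continuous_on S f"
  have "continuous_on S (\<lambda>x. 1 - f x / b)" unfolding divide_inverse by (intro continuous_intros f)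
  then show ?thesis unfolding hat_def by (rule continuous_on_max[OF continuous_on_const])
qed

lemma hat_measurable [measurable]: "hat b \<in> borel_measurable borel"
  by (intro borel_measurable_continuous_onI continuous_on_hat continuous_on_id)

lemma sq_gt_hat_0: "b > 0 \<Longrightarrow> norm (x - z) > sqrt b \<Longrightarrow> hat b ((norm (x - z))\<^sup>2) = 0"
proof -
  assume b: "b > 0" "norm (x - z) > sqrt b"
  then have "(sqrt b)\<^sup>2 \<le> (norm (x - z))\<^sup>2" by (intro power_mono) auto
  then show ?thesis using b by (intro hat_eq_0) auto
qed

lemma hat_power_integral:
  fixes z :: "real^2"
  assumes "b > 0"
  shows "integrable lebesgue (\<lambda>x. hat b ((norm (x - z))\<^sup>2) ^ Suc n)"
    "(LINT x|lebesgue. hat b ((norm (x - z))\<^sup>2) ^ Suc n) = pi * b / (real n + 2)"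
proof -
  define g where "g r = hat b (r\<^sup>2) ^ Suc n" for r
  define F where "F r = - (pi * b / (real n + 2)) * hat b (r\<^sup>2) ^ Suc (Suc n)" for r
  have m: "g \<in> borel_measurable borel" unfolding g_def[abs_def] by measurable
  have z: "g r = 0" if "r > sqrt b" for r
  proof -
    have "r\<^sup>2 \<ge> (sqrt b)\<^sup>2" using that assms by (intro power_mono) auto
    then show ?thesis using assms by (simp add: g_def hat_eq_0)
  qed
  have d: "(F has_real_derivative 2 * pi * r * g r) (at r)" for r
  proof -
    have "((\<lambda>r::real. r\<^sup>2) has_real_derivative 2 * r) (at r)" by (auto intro!: derivative_eq_intros)
    from DERIV_chain2[OF hat_power_deriv[OF assms, of n] this]
    have "(F has_real_derivative (- (pi * b / (real n + 2))) * (- (real (Suc (Suc n)) / b) * hat b (r\<^sup>2) ^ Suc n * (2 * r))) (at r)"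
      unfolding F_def by (rule DERIV_cmult)
    moreover have "(- (pi * b / (real n + 2))) * (- (real (Suc (Suc n)) / b) * hat b (r\<^sup>2) ^ Suc n * (2 * r)) = 2 * pi * r * g r"
      using assms by (simp add: g_def divide_simps)
    ultimately show ?thesis by simp
  qed
  have c: "continuous_on {0..sqrt b} (\<lambda>r. 2 * pi * r * g r)" unfolding g_def by (intro continuous_intros)
  have v: "F (sqrt b) - F 0 = pi * b / (real n + 2)" using assms by (simp add: F_def hat_def)
  show "integrable lebesgue (\<lambda>x. hat b ((norm (x - z))\<^sup>2) ^ Suc n)"
    using radial_integral(1)[OF m _ z refl d c, of z] assms by (simp add: g_def)
  show "(LINT x|lebesgue. hat b ((norm (x - z))\<^sup>2) ^ Suc n) = pi * b / (real n + 2)"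
    using radial_integral(2)[OF m _ z refl d c, of z] assms v by (simp add: g_def)
qed

lemma sq_norm_cmult: "sq_norm M (\<lambda>x. c * f x :: real) = c\<^sup>2 * sq_norm M f"
  unfolding sq_norm_def real_norm_def power2_abs power_mult_distrib by simp

lemma hat_sq_int:
  fixes z :: "real^2"
  assumes "b > 0"
  shows "sq_int lebesgue (\<lambda>x. hat b ((norm (x - z))\<^sup>2) ^ Suc n)"
    "sq_norm lebesgue (\<lambda>x. hat b ((norm (x - z))\<^sup>2) ^ Suc n) = pi * b / (2 * real n + 3)"
proof -
  have e: "(norm (hat b t ^ Suc n))\<^sup>2 = hat b t ^ Suc (2 * n + 1)" for t
    unfolding real_norm_def power2_abs power_mult[symmetric] by (rule arg_cong[where f = "\<lambda>k. hat b t ^ k"]) simp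
  have "(\<lambda>x::real^2. hat b ((norm (x - z))\<^sup>2) ^ Suc n) \<in> borel_measurable lebesgue"
    by (intro continuous_imp_lebesgue_measurable continuous_intros)
  then show "sq_int lebesgue (\<lambda>x. hat b ((norm (x - z))\<^sup>2) ^ Suc n)"
    unfolding sq_int_def e using hat_power_integral(1)[OF assms] by blast
  show "sq_norm lebesgue (\<lambda>x. hat b ((norm (x - z))\<^sup>2) ^ Suc n) = pi * b / (2 * real n + 3)"
    unfolding sq_norm_def e hat_power_integral(2)[OF assms] by (simp add: algebra_simps)
qed

text \<open>The mean value theorem bounds the difference quotients by the majorant \<open>w\<close>
  of the derivative, so dominated convergence applies.\<close>

lemma integral_has_real_derivative:
  fixes f f' :: "real \<Rightarrow> 'a \<Rightarrow> real"
  assumes "e > 0" "\<And>s. \<bar>s - b\<bar> < e \<Longrightarrow> integrable M (f s)"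
    "\<And>s y. \<bar>s - b\<bar> < e \<Longrightarrow> ((\<lambda>s. f s y) has_real_derivative f' s y) (at s)"
    "\<And>s y. \<bar>s - b\<bar> < e \<Longrightarrow> \<bar>f' s y\<bar> \<le> w y" "integrable M w" "f' b \<in> borel_measurable M"
  shows "((\<lambda>s. LINT y|M. f s y) has_real_derivative (LINT y|M. f' b y)) (at b)"
  unfolding has_field_derivative_iff tendsto_at_iff_sequentially
proof (intro allI impI)
  fix X :: "nat \<Rightarrow> real" assume X: "\<forall>i. X i \<in> UNIV - {b}" "X \<longlonglongrightarrow> b"
  obtain N where N: "\<And>n. n \<ge> N \<Longrightarrow> \<bar>X n - b\<bar> < e"
    using X(2) assms(1) unfolding LIMSEQ_def dist_real_def by blast
  define Y where "Y n = X (n + N)" for n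
  have Y: "\<bar>Y n - b\<bar> < e" "Y n \<noteq> b" "Y \<longlonglongrightarrow> b" for n
    using N X by (auto simp: Y_def[abs_def] intro: LIMSEQ_ignore_initial_segment)
  have b0: "\<bar>b - b\<bar> < e" using assms(1) by simp
  have "(\<lambda>n. LINT y|M. (f (Y n) y - f b y) / (Y n - b)) \<longlonglongrightarrow> (LINT y|M. f' b y)"
  proof (rule integral_dominated_convergence[where w = w])
    show "(\<lambda>y. (f (Y n) y - f b y) / (Y n - b)) \<in> borel_measurable M" for n
      using borel_measurable_integrable[OF assms(2)[OF Y(1)[of n]]] borel_measurable_integrable[OF assms(2)[OF b0]]
      by measurable
    show "AE y in M. (\<lambda>n. (f (Y n) y - f b y) / (Y n - b)) \<longlonglongrightarrow> f' b y"
    proof (rule AE_I2)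
      fix y
      have "((\<lambda>s. (f s y - f b y) / (s - b)) \<longlongrightarrow> f' b y) (at b)"
        using assms(3)[OF b0] by (simp add: has_field_derivative_iff)
      then show "(\<lambda>n. (f (Y n) y - f b y) / (Y n - b)) \<longlonglongrightarrow> f' b y"
        using Y unfolding tendsto_at_iff_sequentially comp_def by blast
    qed
    show "AE y in M. norm ((f (Y n) y - f b y) / (Y n - b)) \<le> w y" for n
    proof (rule AE_I2)
      fix y
      have "norm (f (Y n) y - f b y) \<le> w y * norm (Y n - b)"
      proof (rule field_differentiable_bound[of "{b - e<..<b + e}" "\<lambda>s. f s y" "\<lambda>s. f' s y"])
        fix s assume "s \<in> {b - e<..<b + e}"
        then have s: "\<bar>s - b\<bar> < e" by auto
        show "((\<lambda>s. f s y) has_field_derivative f' s y) (at s within {b - e<..<b + e})"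
          by (rule has_field_derivative_at_within[OF assms(3)[OF s]])
        show "norm (f' s y) \<le> w y" using assms(4)[OF s] by simp
      qed (use Y(1)[of n] assms(1) in auto)
      then show "norm ((f (Y n) y - f b y) / (Y n - b)) \<le> w y"
        using Y(2)[of n] by (simp add: norm_divide divide_le_eq)
    qed
  qed (use assms in auto)
  then have "(\<lambda>n. ((LINT y|M. f (Y n) y) - (LINT y|M. f b y)) / (Y n - b)) \<longlonglongrightarrow> (LINT y|M. f' b y)"
    using assms(2)[OF Y(1)] assms(2)[OF b0] by simp
  then show "((\<lambda>s. ((LINT y|M. f s y) - (LINT y|M. f b y)) / (s - b)) \<circ> X) \<longlonglongrightarrow> (LINT y|M. f' b y)"
    unfolding comp_def Y_def
    by (rule LIMSEQ_offset[of "\<lambda>n. ((LINT y|M. f (X n) y) - (LINT y|M. f b y)) / (X n - b)" N])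
qed

text \<open>The weights satisfy \<open>d/db kap = klap = \<Delta> kpot\<close> in the variable \<open>t = \<bar>y - x\<bar>\<^sup>2\<close>; since \<open>kpot \<ge> 0\<close>, means of
  subharmonic functions with respect to \<open>kap\<close> increase with \<open>b\<close>.\<close>

definition kap :: "real \<Rightarrow> real \<Rightarrow> real" where
  "kap b t = 5 / (pi * b) * hat b t ^ 4"

definition kpot :: "real \<Rightarrow> real \<Rightarrow> real" where
  "kpot b t = 1 / (4 * pi * b) * hat b t ^ 5"

definition klap :: "real \<Rightarrow> real \<Rightarrow> real" where
  "klap b t = 5 / (pi * b\<^sup>2) * (hat b t ^ 3 * (4 * (t / b) - hat b t))"

lemma kap_deriv:
  assumes "b > 0"
  shows "((\<lambda>b. kap b t) has_real_derivative klap b t) (at b)"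
proof -
  have 1: "((\<lambda>b. 5 / (pi * b)) has_real_derivative - (5 / (pi * b\<^sup>2))) (at b)"
    using assms by (auto intro!: derivative_eq_intros simp: power2_eq_square)
  have 2: "((\<lambda>b. hat b t ^ 4) has_real_derivative 4 * hat b t ^ 3 * (t / b\<^sup>2)) (at b)"
    using hat_power_deriv_scale[OF assms, of t 2] by (simp add: eval_nat_numeral)
  have "((\<lambda>b. kap b t) has_real_derivative - (5 / (pi * b\<^sup>2)) * hat b t ^ 4 + 4 * hat b t ^ 3 * (t / b\<^sup>2) * (5 / (pi * b))) (at b)"
    unfolding kap_def by (rule DERIV_mult'[THEN DERIV_cong, OF 1 2]) simp
  moreover have "- (5 / (pi * b\<^sup>2)) * hat b t ^ 4 + 4 * hat b t ^ 3 * (t / b\<^sup>2) * (5 / (pi * b)) = klap b t"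
    using assms by (simp add: klap_def field_simps power2_eq_square eval_nat_numeral)
  ultimately show ?thesis by simp
qed

lemma kpot_C2:
  assumes "b > 0"
  shows "\<exists>H. C2 (\<lambda>x. kpot b ((norm (x - z))\<^sup>2)) H (\<lambda>x. klap b ((norm (x - z))\<^sup>2))"
proof -
  have d1: "(kpot b has_real_derivative - (5 / (4 * pi * b\<^sup>2)) * hat b t ^ 4) (at t)" for t
    using DERIV_cmult[OF hat_power_deriv[OF assms, of 3], of "1 / (4 * pi * b)"] assms
    unfolding kpot_def[abs_def] by (simp add: eval_nat_numeral field_simps power2_eq_square)
  have d2: "((\<lambda>t. - (5 / (4 * pi * b\<^sup>2)) * hat b t ^ 4) has_real_derivative 5 / (pi * b ^ 3) * hat b t ^ 3) (at t)" for t
    using DERIV_cmult[OF hat_power_deriv[OF assms, of 2], of "- (5 / (4 * pi * b\<^sup>2))" t] assms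
    by (simp add: eval_nat_numeral field_simps power2_eq_square)
  have c: "continuous_on {0..} (\<lambda>t. 5 / (pi * b ^ 3) * hat b t ^ 3)" by (intro continuous_intros)
  have "4 * (t * (5 / (pi * b ^ 3) * hat b t ^ 3) + - (5 / (4 * pi * b\<^sup>2)) * hat b t ^ 4) = klap b t" for t
    using assms by (simp add: klap_def field_simps eval_nat_numeral)
  then show ?thesis using C2_radial[OF d1 d2 c, of z] by auto
qed

lemma klap_bound:
  assumes "b > 0" "t \<ge> 0"
  shows "\<bar>klap b t\<bar> \<le> 20 / (pi * b\<^sup>2)"
proof (cases "t \<le> b")
  case True
  define q where "q = hat b t"
  have q: "0 \<le> q" "q \<le> 1" using hat_nonneg hat_le_1[OF assms] by (auto simp: q_def)
  have t: "0 \<le> t / b" "t / b \<le> 1" using assms True by auto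
  have "\<bar>q ^ 3 * (4 * (t / b) - q)\<bar> \<le> 1 * 4"
    unfolding abs_mult using q t by (intro mult_mono) (auto simp: power_le_one abs_le_iff)
  then have "5 / (pi * b\<^sup>2) * \<bar>q ^ 3 * (4 * (t / b) - q)\<bar> \<le> 5 / (pi * b\<^sup>2) * 4"
    by (intro mult_left_mono) auto
  then show ?thesis by (simp add: klap_def q_def abs_mult)
qed (use assms in \<open>simp add: klap_def hat_eq_0\<close>)

lemma kap_continuous: "continuous_on UNIV (\<lambda>y. kap b ((norm (y - x))\<^sup>2))"
  unfolding kap_def by (intro continuous_intros)

lemma klap_continuous: "continuous_on UNIV (\<lambda>y. klap b ((norm (y - x))\<^sup>2))"
  unfolding klap_def divide_inverse by (intro continuous_intros)

lemma kap_nonneg: "b > 0 \<Longrightarrow> 0 \<le> kap b t"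
  by (simp add: kap_def hat_nonneg)

lemma kpot_nonneg: "b > 0 \<Longrightarrow> 0 \<le> kpot b t"
  by (simp add: kpot_def hat_nonneg)

lemma kernel_support:
  assumes "b > 0" "y \<notin> cball x (sqrt b)"
  shows "kap b ((norm (y - x))\<^sup>2) = 0" "klap b ((norm (y - x))\<^sup>2) = 0" "kpot b ((norm (y - x))\<^sup>2) = 0"
  using sq_gt_hat_0[of b y x] assms by (auto simp: kap_def klap_def kpot_def dist_norm norm_minus_commute)

lemma kap_integral:
  fixes x :: "real^2"
  assumes "b > 0"
  shows "integrable lebesgue (\<lambda>y. kap b ((norm (y - x))\<^sup>2))" "(LINT y|lebesgue. kap b ((norm (y - x))\<^sup>2)) = 1"
  using hat_power_integral[OF assms, of x 3] assms by (auto simp: kap_def eval_nat_numeral)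

text \<open>The mass does not depend on \<open>b\<close>. Hence a right-hand side bounded by
  \<open>M\<close> lets the means of a solution drift at the constant rate \<open>M / 24\<close> in
  \<open>b\<close>; this is the origin of every 24 below.\<close>

lemma kpot_integral:
  fixes x :: "real^2"
  assumes "b > 0"
  shows "integrable lebesgue (\<lambda>y. kpot b ((norm (y - x))\<^sup>2))" "(LINT y|lebesgue. kpot b ((norm (y - x))\<^sup>2)) = 1 / 24"
  using hat_power_integral[OF assms, of x 4] assms by (auto simp: kpot_def eval_nat_numeral)

text \<open>Through Cauchy-Schwarz this bounds a mean by the global L2 norm, uniformly in the
  centre.\<close>

lemma kap_sq_norm:
  fixes x :: "real^2"
  assumes "b > 0"
  shows "sq_int lebesgue (\<lambda>y. kap b ((norm (y - x))\<^sup>2))"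
    "sq_norm lebesgue (\<lambda>y. kap b ((norm (y - x))\<^sup>2)) = 25 / (9 * pi * b)"
proof -
  note c = hat_sq_int[OF assms, of x 3]
  show "sq_int lebesgue (\<lambda>y. kap b ((norm (y - x))\<^sup>2))"
    using sq_int_cmult[OF c(1), of "5 / (pi * b)"] by (simp add: kap_def eval_nat_numeral)
  have "sq_norm lebesgue (\<lambda>y. kap b ((norm (y - x))\<^sup>2)) = (5 / (pi * b))\<^sup>2 * sq_norm lebesgue (\<lambda>y. hat b ((norm (y - x))\<^sup>2) ^ Suc 3)"
    using sq_norm_cmult[of lebesgue "5 / (pi * b)" "\<lambda>y. hat b ((norm (y - x))\<^sup>2) ^ Suc 3"] by (simp add: kap_def)
  then show "sq_norm lebesgue (\<lambda>y. kap b ((norm (y - x))\<^sup>2)) = 25 / (9 * pi * b)"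
    unfolding c(2) using assms by (simp add: field_simps power2_eq_square)
qed

lemma kpot_sq_norm:
  fixes x :: "real^2"
  assumes "b > 0"
  shows "sq_int lebesgue (\<lambda>y. kpot b ((norm (y - x))\<^sup>2))"
    "sq_norm lebesgue (\<lambda>y. kpot b ((norm (y - x))\<^sup>2)) = 1 / (176 * pi * b)"
proof -
  note c = hat_sq_int[OF assms, of x 4]
  show "sq_int lebesgue (\<lambda>y. kpot b ((norm (y - x))\<^sup>2))"
    using sq_int_cmult[OF c(1), of "1 / (4 * pi * b)"] by (simp add: kpot_def eval_nat_numeral)
  have "sq_norm lebesgue (\<lambda>y. kpot b ((norm (y - x))\<^sup>2)) = (1 / (4 * pi * b))\<^sup>2 * sq_norm lebesgue (\<lambda>y. hat b ((norm (y - x))\<^sup>2) ^ Suc 4)"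
    using sq_norm_cmult[of lebesgue "1 / (4 * pi * b)" "\<lambda>y. hat b ((norm (y - x))\<^sup>2) ^ Suc 4"] by (simp add: kpot_def)
  then show "sq_norm lebesgue (\<lambda>y. kpot b ((norm (y - x))\<^sup>2)) = 1 / (176 * pi * b)"
    unfolding c(2) using assms by (simp add: field_simps power2_eq_square)
qed

subsection \<open>Subsolutions and mean values\<close>

lemma C2_compact_support:
  assumes "C2 k H L" "compact S" "\<And>x. x \<notin> S \<Longrightarrow> k x = 0"
  shows "C1c S k H" "\<And>x. x \<notin> S \<Longrightarrow> L x = 0"
proof -
  show C: "C1c S k H" using assms by (intro C1cI[of k H S]) (auto simp: C2_def)
  obtain D where D: "\<And>i. C1 (\<lambda>x. H x $ i) (D i)" "L = (\<lambda>x. \<Sum>i\<in>UNIV. D i x $ i)"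
    using assms(1) unfolding C2_def by blast
  fix x assume x: "x \<notin> S"
  have "D i x = 0" for i
  proof -
    have "C1c S (\<lambda>x. H x $ i) (D i)"
      by (rule C1cI[OF D(1) assms(2) subset_refl]) (use C in \<open>auto simp: C1c_def\<close>)
    then show ?thesis using x by (auto simp: C1c_def)
  qed
  then show "L x = 0" by (simp add: D(2))
qed

lemma h10_laplace:
  assumes "h10 U u g" "C2 k H L" "compact S" "\<And>x. x \<notin> S \<Longrightarrow> k x = 0"
  shows "(LINT x|lebesgue. g x \<bullet> H x) = - (LINT x|lebesgue. u x * L x)"
proof -
  obtain \<phi> G where 1: "\<And>n::nat. C1c U (\<phi> n) (G n)" "sq_lim lebesgue \<phi> u" "sq_lim lebesgue G g"
    by (rule h10E[OF assms(1)]) (rule that)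
  note S = C2_compact_support[OF assms(2,3,4)]
  have L: "sq_int lebesgue L" by (rule compact_support_sq_int[OF C2_continuous[OF assms(2)] assms(3) S(2)])
  have "(\<lambda>n. LINT x|lebesgue. G n x \<bullet> H x) \<longlonglongrightarrow> (LINT x|lebesgue. g x \<bullet> H x)"
    by (rule sq_lim_inner[OF 1(3) sq_lim_const[OF C1c_sq_int(2)[OF S(1)]]])
  moreover have "(\<lambda>n. - (LINT x|lebesgue. \<phi> n x * L x)) \<longlonglongrightarrow> - (LINT x|lebesgue. u x * L x)"
    by (rule tendsto_minus[OF sq_lim_mult_int[OF 1(2) sq_lim_const[OF L]]])
  moreover have "(LINT x|lebesgue. G n x \<bullet> H x) = - (LINT x|lebesgue. \<phi> n x * L x)" for n
    by (rule C1c_integration_by_parts_laplace[OF C1c_mono[OF 1(1) subset_UNIV] assms(2)])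
  ultimately show ?thesis using LIMSEQ_unique by simp
qed

text \<open>For a kernel that reaches across the boundary only the inequality for
  \<open>\<bar>w\<bar>\<close> proved below survives; the equation itself asks for
  \<open>S \<subseteq> U\<close>.\<close>

lemma wsol_laplace:
  assumes "wsol U f w g" "C2 k H L" "compact S" "S \<subseteq> U" "\<And>x. x \<notin> S \<Longrightarrow> k x = 0"
  shows "- (LINT x|lebesgue. w x * L x) = (LINT x|lebesgue. f x * k x)"
proof -
  have "C1c U k H" by (rule C1c_mono[OF C2_compact_support(1)[OF assms(2,3,5)] assms(4)])
  then show ?thesis
    using h10_laplace[OF wsolD(1)[OF assms(1)] assms(2,3,5)] assms(1) by (auto simp: wsol_def)
qed

text \<open>The shift by \<open>e\<close> makes the value at 0 vanish, as composition within
  \<open>h10\<close> requires. \<open>ssgn\<close> is the derivative, and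
  \<open>ssgn' \<ge> 0\<close> is the convexity on which Kato's inequality rests.\<close>

definition sabs :: "real \<Rightarrow> real \<Rightarrow> real" where
  "sabs e t = sqrt (t\<^sup>2 + e\<^sup>2) - e"

definition ssgn :: "real \<Rightarrow> real \<Rightarrow> real" where
  "ssgn e t = t / sqrt (t\<^sup>2 + e\<^sup>2)"

definition ssgn' :: "real \<Rightarrow> real \<Rightarrow> real" where
  "ssgn' e t = e\<^sup>2 / (t\<^sup>2 + e\<^sup>2) / sqrt (t\<^sup>2 + e\<^sup>2)"

lemma sabs_props:
  assumes "e > 0"
  shows "sabs e 0 = 0" "ssgn e 0 = 0" "(sabs e has_real_derivative ssgn e t) (at t)"
    "(ssgn e has_real_derivative ssgn' e t) (at t)" "continuous_on UNIV (ssgn e)" "continuous_on UNIV (ssgn' e)"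
    "\<bar>ssgn e t\<bar> \<le> 1" "0 \<le> ssgn' e t" "\<bar>ssgn' e t\<bar> \<le> 1 / e" "\<bar>sabs e t - \<bar>t\<bar>\<bar> \<le> e"
proof -
  have p: "t\<^sup>2 + e\<^sup>2 > 0" for t using assms by (simp add: add_nonneg_pos)
  have sp: "sqrt (t\<^sup>2 + e\<^sup>2) > 0" for t using p by simp
  have ge: "sqrt (t\<^sup>2 + e\<^sup>2) \<ge> \<bar>t\<bar>" for t by (simp add: real_le_rsqrt)
  have ge2: "sqrt (t\<^sup>2 + e\<^sup>2) \<ge> e" for t using assms by (simp add: real_le_rsqrt)
  show "sabs e 0 = 0" "ssgn e 0 = 0" using assms by (auto simp: sabs_def ssgn_def)
  have ds: "((\<lambda>t. sqrt (t\<^sup>2 + e\<^sup>2)) has_real_derivative ssgn e t) (at t)" for t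
    using p[of t] sp[of t] by (auto intro!: derivative_eq_intros simp: ssgn_def field_simps)
  show "(sabs e has_real_derivative ssgn e t) (at t)"
    unfolding sabs_def[abs_def] using DERIV_diff[OF ds DERIV_const] by simp
  have sq: "sqrt (t\<^sup>2 + e\<^sup>2) * sqrt (t\<^sup>2 + e\<^sup>2) = t\<^sup>2 + e\<^sup>2" for t using p[of t] by simp
  show "(ssgn e has_real_derivative ssgn' e t) (at t)"
  proof -
    have "((\<lambda>t. t / sqrt (t\<^sup>2 + e\<^sup>2)) has_real_derivative
        (1 * sqrt (t\<^sup>2 + e\<^sup>2) - t * ssgn e t) / (sqrt (t\<^sup>2 + e\<^sup>2) * sqrt (t\<^sup>2 + e\<^sup>2))) (at t)"
      by (rule DERIV_divide[OF DERIV_ident ds less_imp_neq[OF sp, symmetric]])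
    moreover have "(1 * sqrt (t\<^sup>2 + e\<^sup>2) - t * ssgn e t) / (sqrt (t\<^sup>2 + e\<^sup>2) * sqrt (t\<^sup>2 + e\<^sup>2)) = ssgn' e t"
    proof -
      have R: "1 * R - t * (t / R) = (R * R - t\<^sup>2) / R" if "R > 0" for R
        using that by (simp add: field_simps power2_eq_square)
      have "1 * sqrt (t\<^sup>2 + e\<^sup>2) - t * ssgn e t = (sqrt (t\<^sup>2 + e\<^sup>2) * sqrt (t\<^sup>2 + e\<^sup>2) - t\<^sup>2) / sqrt (t\<^sup>2 + e\<^sup>2)"
        unfolding ssgn_def by (rule R[OF sp])
      then show ?thesis unfolding sq ssgn'_def by simp
    qed
    ultimately show ?thesis unfolding ssgn_def[abs_def] by simp
  qed
  show "continuous_on UNIV (ssgn e)"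
    unfolding ssgn_def[abs_def] using sp by (intro continuous_intros) (auto simp: less_imp_neq[symmetric])
  show "continuous_on UNIV (ssgn' e)"
    unfolding ssgn'_def[abs_def] using p sp by (intro continuous_intros) (auto simp: less_imp_neq[symmetric])
  show "\<bar>ssgn e t\<bar> \<le> 1" using ge[of t] sp[of t] by (simp add: ssgn_def)
  show n: "0 \<le> ssgn' e t" using p[of t] sp[of t] by (simp add: ssgn'_def)
  have "e\<^sup>2 / (t\<^sup>2 + e\<^sup>2) \<le> 1" using p[of t] by simp
  then have "ssgn' e t \<le> 1 / sqrt (t\<^sup>2 + e\<^sup>2)"
    unfolding ssgn'_def using sp[of t] by (intro divide_right_mono) auto
  also have "\<dots> \<le> 1 / e" using ge2[of t] assms sp[of t] by (intro divide_left_mono mult_pos_pos) auto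
  finally show "\<bar>ssgn' e t\<bar> \<le> 1 / e" using n by simp
  have "sqrt (t\<^sup>2 + e\<^sup>2) \<le> \<bar>t\<bar> + e" using sqrt_add_le_add_sqrt[of "t\<^sup>2" "e\<^sup>2"] assms by simp
  then show "\<bar>sabs e t - \<bar>t\<bar>\<bar> \<le> e" using ge[of t] assms by (simp add: sabs_def)
qed

text \<open>Kato's inequality: test with \<open>k * ssgn e w\<close> and let \<open>e\<close> tend to zero.\<close>

lemma wsol_abs_subsolution:
  assumes "wsol U f w g" "C2 k H L" "compact S" "\<And>x. x \<notin> S \<Longrightarrow> k x = 0" "\<And>x. k x \<ge> 0"
  shows "- (LINT x|lebesgue. \<bar>w x\<bar> * L x) \<le> (LINT x|lebesgue. \<bar>f x\<bar> * k x)"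
proof -
  note W = wsolD[OF assms(1)]
  have C: "C1c S k H" "\<And>x. x \<notin> S \<Longrightarrow> L x = 0"
    by (rule C2_compact_support[OF assms(2,3)], rule assms(4), assumption)+
  have Lc: "sq_int lebesgue L" by (rule compact_support_sq_int[OF C2_continuous[OF assms(2)] assms(3) C(2)])
  have Li: "integrable lebesgue L" by (rule compact_support_integrable[OF C2_continuous[OF assms(2)] assms(3) C(2)])
  obtain B where B: "B > 0" "\<And>x. \<bar>k x\<bar> \<le> B" "\<And>x. norm (H x) \<le> B" by (rule C1c_bounded[OF C(1)]) (rule that)
  have kL: "sq_int lebesgue k" "sq_int lebesgue H" by (rule C1c_sq_int[OF C(1)])+
  note kC = C1c_imp_C1[OF C(1)]
  have [measurable]: "k \<in> borel_measurable lebesgue" "w \<in> borel_measurable lebesgue"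
    "f \<in> borel_measurable lebesgue" "g \<in> borel_measurable lebesgue" "H \<in> borel_measurable lebesgue"
    using kL W by (auto dest: sq_int_measurable)
  have fk: "integrable lebesgue (\<lambda>x. \<bar>f x\<bar> * k x)"
    by (rule integrable_mult_sq_int[OF sq_int_abs[OF W(2)] kL(1)])
  have wL: "integrable lebesgue (\<lambda>x. \<bar>w x\<bar> * L x)"
    by (rule integrable_mult_sq_int[OF sq_int_abs[OF W(3)] Lc])
  have main: "- (LINT x|lebesgue. \<bar>w x\<bar> * L x) \<le> (LINT x|lebesgue. \<bar>f x\<bar> * k x) + e * (LINT x|lebesgue. \<bar>L x\<bar>)"
    if e: "e > 0" for e
  proof -
    note s = sabs_props[OF e]
    have [measurable]: "ssgn e \<in> borel_measurable borel" "ssgn' e \<in> borel_measurable borel"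
      using s(5,6) by (auto intro: borel_measurable_continuous_onI)
    have h1: "h10 U (\<lambda>x. ssgn e (w x)) (\<lambda>x. ssgn' e (w x) *\<^sub>R g x)"
      by (rule h10_compose[OF W(1) s(4,6,2,9)])
    \<comment> \<open>As \<open>ssgn e 0 = 0\<close>, this product is in \<open>h10 U\<close> even
      if the support of \<open>k\<close> reaches across the boundary, so it may be used as a test
      function.\<close>
    have h2: "h10 U (\<lambda>x. k x * ssgn e (w x)) (\<lambda>x. k x *\<^sub>R ssgn' e (w x) *\<^sub>R g x + ssgn e (w x) *\<^sub>R H x)"
      by (rule h10_mult[OF h1 kC B(2,3)])
    have h3: "h10 U (\<lambda>x. sabs e (w x)) (\<lambda>x. ssgn e (w x) *\<^sub>R g x)"
      by (rule h10_compose[OF W(1) s(3,5,1,7)])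
    have i1: "integrable lebesgue (\<lambda>x. g x \<bullet> (k x *\<^sub>R ssgn' e (w x) *\<^sub>R g x))"
      by (intro integrable_inner_sq_int W(4) sq_int_mult[OF sq_int_mult[OF W(4) _ s(9)] _ B(2)]) measurable
    have i2: "integrable lebesgue (\<lambda>x. g x \<bullet> (ssgn e (w x) *\<^sub>R H x))"
      by (intro integrable_inner_sq_int W(4) sq_int_mult[OF kL(2) _ s(7)]) measurable
    have "- (LINT x|lebesgue. sabs e (w x) * L x) = (LINT x|lebesgue. (ssgn e (w x) *\<^sub>R g x) \<bullet> H x)"
      using h10_laplace[OF h3 assms(2,3,4)] by simp
    also have "\<dots> = (LINT x|lebesgue. g x \<bullet> (ssgn e (w x) *\<^sub>R H x))" by simp
    also have "\<dots> = (LINT x|lebesgue. g x \<bullet> (k x *\<^sub>R ssgn' e (w x) *\<^sub>R g x + ssgn e (w x) *\<^sub>R H x))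
        - (LINT x|lebesgue. g x \<bullet> (k x *\<^sub>R ssgn' e (w x) *\<^sub>R g x))"
      using i1 i2 by (simp add: inner_add_right)
    also have "(LINT x|lebesgue. g x \<bullet> (k x *\<^sub>R ssgn' e (w x) *\<^sub>R g x + ssgn e (w x) *\<^sub>R H x)) =
        (LINT x|lebesgue. f x * (k x * ssgn e (w x)))"
      by (rule wsol_test[OF assms(1) h2])
    finally have 0: "- (LINT x|lebesgue. sabs e (w x) * L x) = (LINT x|lebesgue. f x * (k x * ssgn e (w x)))
        - (LINT x|lebesgue. g x \<bullet> (k x *\<^sub>R ssgn' e (w x) *\<^sub>R g x))" .
    \<comment> \<open>Convexity enters here: the term with \<open>ssgn'\<close> has the right sign
      and is dropped.\<close>
    have "(LINT x|lebesgue. g x \<bullet> (k x *\<^sub>R ssgn' e (w x) *\<^sub>R g x)) \<ge> 0"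
      using s(8) assms(5) by (intro Bochner_Integration.integral_nonneg) simp
    with 0 have 1: "- (LINT x|lebesgue. sabs e (w x) * L x) \<le> (LINT x|lebesgue. f x * (k x * ssgn e (w x)))"
      by linarith
    have 2: "(LINT x|lebesgue. f x * (k x * ssgn e (w x))) \<le> (LINT x|lebesgue. \<bar>f x\<bar> * k x)"
    proof (rule integral_mono[OF _ fk])
      show "integrable lebesgue (\<lambda>x. f x * (k x * ssgn e (w x)))"
        by (rule integrable_mult_sq_int[OF W(2) h10_sq_int(1)[OF h2]])
      fix x
      have "f x * (k x * ssgn e (w x)) \<le> \<bar>f x * (k x * ssgn e (w x))\<bar>" by (rule abs_ge_self)
      also have "\<dots> = (\<bar>f x\<bar> * k x) * \<bar>ssgn e (w x)\<bar>" using assms(5) by (simp add: abs_mult)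
      also have "\<dots> \<le> \<bar>f x\<bar> * k x" using s(7)[of "w x"] assms(5)[of x] by (intro mult_left_le) auto
      finally show "f x * (k x * ssgn e (w x)) \<le> \<bar>f x\<bar> * k x" .
    qed
    have i3: "integrable lebesgue (\<lambda>x. sabs e (w x) * L x)"
      by (rule integrable_mult_sq_int[OF h10_sq_int(1)[OF h3] Lc])
    have "(LINT x|lebesgue. sabs e (w x) * L x) - (LINT x|lebesgue. \<bar>w x\<bar> * L x)
        = (LINT x|lebesgue. (sabs e (w x) - \<bar>w x\<bar>) * L x)"
      using i3 wL by (simp add: left_diff_distrib)
    also have "\<dots> \<le> (LINT x|lebesgue. e * \<bar>L x\<bar>)"
    proof (rule integral_mono)
      show "integrable lebesgue (\<lambda>x. (sabs e (w x) - \<bar>w x\<bar>) * L x)"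
        using i3 wL by (simp add: left_diff_distrib)
      show "integrable lebesgue (\<lambda>x. e * \<bar>L x\<bar>)" using Li by simp
      fix x
      have "(sabs e (w x) - \<bar>w x\<bar>) * L x \<le> \<bar>(sabs e (w x) - \<bar>w x\<bar>) * L x\<bar>" by (rule abs_ge_self)
      also have "\<dots> \<le> e * \<bar>L x\<bar>" unfolding abs_mult using s(10) by (intro mult_right_mono) auto
      finally show "(sabs e (w x) - \<bar>w x\<bar>) * L x \<le> e * \<bar>L x\<bar>" .
    qed
    also have "\<dots> = e * (LINT x|lebesgue. \<bar>L x\<bar>)" by simp
    finally show ?thesis using 1 2 by linarith
  qed
  define I where "I = (LINT x|lebesgue. \<bar>L x\<bar>)"
  have I0: "I \<ge> 0" by (simp add: I_def)
  show ?thesis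
  proof (rule field_le_epsilon)
    fix e :: real assume e: "e > 0"
    have "e / (I + 1) > 0" using e I0 by simp
    from main[OF this] have "- (LINT x|lebesgue. \<bar>w x\<bar> * L x) \<le> (LINT x|lebesgue. \<bar>f x\<bar> * k x) + e / (I + 1) * I"
      by (simp add: I_def)
    also have "e / (I + 1) * I \<le> e" using e I0 by (simp add: field_simps)
    finally show "- (LINT x|lebesgue. \<bar>w x\<bar> * L x) \<le> (LINT x|lebesgue. \<bar>f x\<bar> * k x) + e" by simp
  qed
qed

section \<open>Weighted means over discs, with \<open>b\<close> the squared radius\<close>

definition kmean :: "(real^2 \<Rightarrow> real) \<Rightarrow> real \<Rightarrow> real^2 \<Rightarrow> real" where
  "kmean v b x = (LINT y|lebesgue. v y * kap b ((norm (y - x))\<^sup>2))"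

lemma kmean_deriv:
  assumes "sq_int lebesgue v" "b > 0"
  shows "((\<lambda>b. kmean v b x) has_real_derivative (LINT y|lebesgue. v y * klap b ((norm (y - x))\<^sup>2))) (at b)"
  unfolding kmean_def
\<comment> \<open>For \<open>s\<close> within \<open>b / 2\<close> of \<open>b\<close> the bound
  \<open>20 / (pi * s\<^sup>2)\<close> is at most \<open>80 / (pi * b\<^sup>2)\<close>, and all
  kernels are supported in the disc of squared radius \<open>2 * b\<close>.\<close>
proof (rule integral_has_real_derivative[where e = "b / 2" and w = "\<lambda>y. \<bar>v y\<bar> * (80 / (pi * b\<^sup>2) * indicator (cball x (sqrt (2 * b))) y)"])
  have [measurable]: "v \<in> borel_measurable lebesgue" by (rule sq_int_measurable[OF assms(1)])
  show "b / 2 > 0" using assms(2) by simp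
  show "integrable lebesgue (\<lambda>y. v y * kap s ((norm (y - x))\<^sup>2))" if "\<bar>s - b\<bar> < b / 2" for s
    by (intro integrable_mult_sq_int assms(1) kap_sq_norm) (use that assms(2) in arith)
  show "((\<lambda>s. v y * kap s ((norm (y - x))\<^sup>2)) has_real_derivative v y * klap s ((norm (y - x))\<^sup>2)) (at s)"
    if "\<bar>s - b\<bar> < b / 2" for s y
    by (intro DERIV_cmult kap_deriv) (use that assms(2) in arith)
  show "integrable lebesgue (\<lambda>y. \<bar>v y\<bar> * (80 / (pi * b\<^sup>2) * indicator (cball x (sqrt (2 * b))) y))"
    by (intro integrable_mult_sq_int sq_int_abs assms(1) sq_int_cmult sq_int_indicator lmeasurable_cball)
  show "(\<lambda>y. v y * klap b ((norm (y - x))\<^sup>2)) \<in> borel_measurable lebesgue"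
    using continuous_imp_lebesgue_measurable[OF klap_continuous] by measurable
  fix s y assume s: "\<bar>s - b\<bar> < b / 2"
  then have sp: "s > b / 2" "s < 2 * b" "s > 0" using assms(2) by arith+
  have "\<bar>klap s ((norm (y - x))\<^sup>2)\<bar> \<le> 80 / (pi * b\<^sup>2) * indicator (cball x (sqrt (2 * b))) y"
  proof (cases "y \<in> cball x (sqrt (2 * b))")
    case True
    have "(b / 2)\<^sup>2 \<le> s\<^sup>2" using sp assms(2) by (intro power_mono) auto
    then have "20 / (pi * s\<^sup>2) \<le> 20 / (pi * (b / 2)\<^sup>2)"
      using assms(2) sp by (intro divide_left_mono mult_left_mono) auto
    also have "\<dots> = 80 / (pi * b\<^sup>2)" by (simp add: power2_eq_square)
    finally show ?thesis using klap_bound[OF sp(3), of "(norm (y - x))\<^sup>2"] True by simp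
  next
    case False
    then have "y \<notin> cball x (sqrt s)" using sp by (auto intro: order_trans real_sqrt_le_mono)
    then show ?thesis using kernel_support(2)[OF sp(3), of y x] False by simp
  qed
  then show "\<bar>v y * klap s ((norm (y - x))\<^sup>2)\<bar> \<le> \<bar>v y\<bar> * (80 / (pi * b\<^sup>2) * indicator (cball x (sqrt (2 * b))) y)"
    unfolding abs_mult by (intro mult_left_mono) auto
qed

lemma kmean_tendsto:
  assumes "sq_int lebesgue v" "isCont v x"
  shows "((\<lambda>b. kmean v b x) \<longlongrightarrow> v x) (at_right 0)"
proof (rule tendstoI)
  fix e :: real assume e: "e > 0"
  then have "e / 2 > 0" by simp
  with assms(2)[unfolded continuous_at_eps_delta] obtain d where d: "d > 0"
    "\<And>y. dist y x < d \<Longrightarrow> dist (v y) (v x) < e / 2"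
    by blast
  have "dist (kmean v b x) (v x) < e" if b: "b > 0" "b < d\<^sup>2" for b
  proof -
    have kv: "integrable lebesgue (\<lambda>y. v y * kap b ((norm (y - x))\<^sup>2))"
      by (intro integrable_mult_sq_int assms(1) kap_sq_norm b)
    have kx: "integrable lebesgue (\<lambda>y. v x * kap b ((norm (y - x))\<^sup>2))" using kap_integral(1)[OF b(1)] by simp
    have "kmean v b x - v x = (LINT y|lebesgue. v y * kap b ((norm (y - x))\<^sup>2) - v x * kap b ((norm (y - x))\<^sup>2))"
      unfolding Bochner_Integration.integral_diff[OF kv kx] kmean_def using kap_integral(2)[OF b(1), of x] by simp
    also have "norm \<dots> \<le> (LINT y|lebesgue. e / 2 * kap b ((norm (y - x))\<^sup>2))"
    proof (rule integral_norm_le)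
      show "integrable lebesgue (\<lambda>y. v y * kap b ((norm (y - x))\<^sup>2) - v x * kap b ((norm (y - x))\<^sup>2))" using kv kx by simp
      show "integrable lebesgue (\<lambda>y. e / 2 * kap b ((norm (y - x))\<^sup>2))" using kap_integral(1)[OF b(1)] by simp
      fix y
      show "norm (v y * kap b ((norm (y - x))\<^sup>2) - v x * kap b ((norm (y - x))\<^sup>2)) \<le> e / 2 * kap b ((norm (y - x))\<^sup>2)"
      proof (cases "y \<in> cball x (sqrt b)")
        case True
        have "sqrt b < d" using b d(1) by (simp add: real_less_lsqrt)
        then have "dist y x < d" using True by (simp add: dist_commute)
        then have "\<bar>v y - v x\<bar> * kap b ((norm (y - x))\<^sup>2) \<le> e / 2 * kap b ((norm (y - x))\<^sup>2)"
          using d(2)[of y] by (intro mult_right_mono kap_nonneg b) (auto simp: dist_real_def)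
        then show ?thesis using kap_nonneg[OF b(1)] by (simp flip: left_diff_distrib add: abs_mult)
      next
        case False
        then show ?thesis using kernel_support(1)[OF b(1), of y x] by simp
      qed
    qed
    also have "\<dots> = e / 2" using kap_integral(2)[OF b(1), of x] by simp
    finally show ?thesis using e by (simp add: dist_real_def)
  qed
  then show "\<forall>\<^sub>F b in at_right 0. dist (kmean v b x) (v x) < e"
    using d(1) unfolding eventually_at_right[OF zero_less_one] by (intro exI[of _ "d\<^sup>2"]) auto
qed

text \<open>\<open>\<Gamma>\<close> compensates the drift of the means. It is left abstract because
  it is linear in \<open>b\<close> for a bounded right-hand side but a multiple of
  \<open>sqrt b\<close> for one that is only in L2.\<close>

lemma kmean_mono:
  assumes "sq_int lebesgue v" "0 < b" "b \<le> B"
    and sub: "\<And>b. 0 < b \<Longrightarrow> b \<le> B \<Longrightarrow> - (LINT y|lebesgue. v y * klap b ((norm (y - x))\<^sup>2)) \<le> \<Gamma>' b"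
    and \<Gamma>: "\<And>b. 0 < b \<Longrightarrow> b \<le> B \<Longrightarrow> (\<Gamma> has_real_derivative \<Gamma>' b) (at b)"
  shows "kmean v b x + \<Gamma> b \<le> kmean v B x + \<Gamma> B"
proof (rule DERIV_nonneg_imp_nondecreasing[of b B "\<lambda>b. kmean v b x + \<Gamma> b"])
  fix c assume c: "b \<le> c" "c \<le> B"
  have "((\<lambda>b. kmean v b x + \<Gamma> b) has_real_derivative (LINT y|lebesgue. v y * klap c ((norm (y - x))\<^sup>2)) + \<Gamma>' c) (at c)"
    using assms(2) c by (intro DERIV_add kmean_deriv assms(1) \<Gamma>) auto
  moreover have "(LINT y|lebesgue. v y * klap c ((norm (y - x))\<^sup>2)) + \<Gamma>' c \<ge> 0" using sub[of c] assms(2) c by simp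
  ultimately show "\<exists>y. ((\<lambda>b. kmean v b x + \<Gamma> b) has_real_derivative y) (at c) \<and> 0 \<le> y" by blast
qed (use assms in auto)

lemma kmean_upper:
  assumes "sq_int lebesgue v" "isCont v x" "B > 0"
    and sub: "\<And>b. 0 < b \<Longrightarrow> b \<le> B \<Longrightarrow> - (LINT y|lebesgue. v y * klap b ((norm (y - x))\<^sup>2)) \<le> \<Gamma>' b"
    and \<Gamma>: "\<And>b. 0 < b \<Longrightarrow> b \<le> B \<Longrightarrow> (\<Gamma> has_real_derivative \<Gamma>' b) (at b)" "(\<Gamma> \<longlongrightarrow> 0) (at_right 0)"
  shows "v x \<le> kmean v B x + \<Gamma> B"
proof -
  have mono: "kmean v b x + \<Gamma> b \<le> kmean v B x + \<Gamma> B" if b: "0 < b" "b < B" for b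
    by (rule kmean_mono[OF assms(1) b(1) less_imp_le[OF b(2)] sub \<Gamma>(1)])
  have lim: "((\<lambda>b. kmean v b x + \<Gamma> b) \<longlongrightarrow> v x + 0) (at_right 0)"
    by (intro tendsto_add kmean_tendsto assms(1,2) \<Gamma>(2))
  have ev: "\<forall>\<^sub>F b in at_right 0. kmean v b x + \<Gamma> b \<le> kmean v B x + \<Gamma> B"
    using mono assms(3) unfolding eventually_at_right[OF zero_less_one] by (intro exI[of _ B]) auto
  have "v x + 0 \<le> kmean v B x + \<Gamma> B"
    by (rule tendsto_upperbound[OF lim ev]) simp
  then show ?thesis by simp
qed

lemma kpot_compact_C2:
  assumes "b > 0"
  obtains H where "C2 (\<lambda>y. kpot b ((norm (y - x))\<^sup>2)) H (\<lambda>y. klap b ((norm (y - x))\<^sup>2))"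
  using kpot_C2[OF assms, of x] by blast

lemma wsol_abs_klap:
  assumes "wsol U f w g" "AE x in lebesgue. \<bar>f x\<bar> \<le> M" "c > 0"
  shows "- (LINT y|lebesgue. \<bar>w y\<bar> * klap c ((norm (y - x))\<^sup>2)) \<le> M / 24"
proof -
  note W = wsolD[OF assms(1)]
  note c = assms(3)
  obtain H where H: "C2 (\<lambda>y. kpot c ((norm (y - x))\<^sup>2)) H (\<lambda>y. klap c ((norm (y - x))\<^sup>2))"
    by (rule kpot_compact_C2[OF c]) (rule that)
  have "- (LINT y|lebesgue. \<bar>w y\<bar> * klap c ((norm (y - x))\<^sup>2)) \<le> (LINT y|lebesgue. \<bar>f y\<bar> * kpot c ((norm (y - x))\<^sup>2))"
    by (rule wsol_abs_subsolution[OF assms(1) H compact_cball kernel_support(3)[OF c] kpot_nonneg[OF c]])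
  also have "\<dots> \<le> (LINT y|lebesgue. M * kpot c ((norm (y - x))\<^sup>2))"
  proof (rule integral_mono_AE)
    show "integrable lebesgue (\<lambda>y. \<bar>f y\<bar> * kpot c ((norm (y - x))\<^sup>2))"
      by (intro integrable_mult_sq_int sq_int_abs W kpot_sq_norm c)
    show "integrable lebesgue (\<lambda>y. M * kpot c ((norm (y - x))\<^sup>2))" using kpot_integral(1)[OF c] by simp
    show "AE y in lebesgue. \<bar>f y\<bar> * kpot c ((norm (y - x))\<^sup>2) \<le> M * kpot c ((norm (y - x))\<^sup>2)"
      using assms(2) by eventually_elim (intro mult_right_mono kpot_nonneg c)
  qed
  also have "\<dots> = M / 24" using kpot_integral(2)[OF c, of x] by simp
  finally show ?thesis .
qed

text \<open>The disc may reach across the boundary, since Kato's inequality holds for the extension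
  by zero; so the scale \<open>b\<close> can be chosen independently of the position of
  \<open>x\<close> in \<open>U\<close>.\<close>

lemma wsol_submean:
  assumes "wsol U f w g" "AE x in lebesgue. \<bar>f x\<bar> \<le> M" "isCont (\<lambda>y. \<bar>w y\<bar>) x" "b > 0"
  shows "\<bar>w x\<bar> \<le> kmean (\<lambda>y. \<bar>w y\<bar>) b x + M * b / 24"
proof -
  have "((\<lambda>b. M * b / 24) has_real_derivative M / 24) (at c)" for c
    by (auto intro!: derivative_eq_intros)
  moreover have "((\<lambda>b. M * b / 24) \<longlongrightarrow> 0) (at_right 0)" by (auto intro!: tendsto_eq_intros)
  ultimately show ?thesis
    using wsol_abs_klap[OF assms(1,2)]
    by (intro kmean_upper[OF sq_int_abs[OF wsolD(3)[OF assms(1)]] assms(3,4), where \<Gamma>' = "\<lambda>_. M / 24"]) auto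
qed

lemma wsol_kmean_mono:
  assumes "wsol U f w g" "AE x in lebesgue. \<bar>f x\<bar> \<le> M" "0 < b" "b \<le> B"
  shows "kmean (\<lambda>y. \<bar>w y\<bar>) b x + M * b / 24 \<le> kmean (\<lambda>y. \<bar>w y\<bar>) B x + M * B / 24"
proof -
  have "((\<lambda>b. M * b / 24) has_real_derivative M / 24) (at c)" for c
    by (auto intro!: derivative_eq_intros)
  then show ?thesis
    using wsol_abs_klap[OF assms(1,2)]
    by (intro kmean_mono[OF sq_int_abs[OF wsolD(3)[OF assms(1)]] assms(3,4), where \<Gamma>' = "\<lambda>_. M / 24"]) auto
qed

lemma kmean_abs: "\<bar>kmean v b x\<bar> \<le> kmean (\<lambda>y. \<bar>v y\<bar>) b x" if "b > 0"
proof -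
  have "\<bar>kmean v b x\<bar> \<le> (LINT y|lebesgue. \<bar>v y * kap b ((norm (y - x))\<^sup>2)\<bar>)"
    unfolding kmean_def by (rule integral_abs_bound)
  also have "\<dots> = kmean (\<lambda>y. \<bar>v y\<bar>) b x"
    unfolding kmean_def using kap_nonneg[OF that] by (simp add: abs_mult)
  finally show ?thesis .
qed

lemma kmean_abs_le:
  assumes "sq_int lebesgue v" "b > 0"
  shows "\<bar>kmean v b x\<bar> \<le> sqrt (25 / (9 * pi * b)) * sqrt (sq_norm lebesgue v)"
  using sq_int_Cauchy_Schwarz_abs[OF assms(1) kap_sq_norm(1)[OF assms(2)], of x]
  by (simp add: kmean_def kap_sq_norm(2)[OF assms(2)] mult.commute)

subsection \<open>Interior regularity\<close>

lemma bounded_support_imp_integrable: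
  fixes w :: "real^2 \<Rightarrow> real"
  assumes "sq_int lebesgue w" "bounded U" "AE x in lebesgue. x \<notin> U \<longrightarrow> w x = 0"
  shows "integrable lebesgue w"
proof -
  obtain r where r: "U \<subseteq> cball 0 r"
    using bounded_subset_ballD[OF assms(2), of 0] subset_trans[OF _ ball_subset_cball] by blast
  have i: "integrable lebesgue (\<lambda>x. w x * indicator (cball 0 r) x)"
    by (intro integrable_mult_sq_int assms(1) sq_int_indicator lmeasurable_cball)
  show ?thesis
  proof (rule integrable_cong_AE[THEN iffD1, OF _ _ _ i])
    show "AE x in lebesgue. w x * indicator (cball 0 r) x = w x"
      using assms(3) by eventually_elim (use r in \<open>auto simp: indicator_def\<close>)
  qed (use i assms(1) in \<open>auto dest: sq_int_measurable\<close>)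
qed

lemma kap_C1c:
  assumes "b > 0"
  obtains E where "C1c UNIV (\<lambda>z. kap b ((norm z)\<^sup>2)) E"
proof -
  have d: "(kap b has_real_derivative - (20 / (pi * b\<^sup>2)) * hat b t ^ 3) (at t)" for t
    using DERIV_cmult[OF hat_power_deriv[OF assms, of 2], of "5 / (pi * b)" t] assms
    unfolding kap_def[abs_def] by (simp add: eval_nat_numeral field_simps power2_eq_square)
  have c: "continuous_on {0..} (\<lambda>t. - (20 / (pi * b\<^sup>2)) * hat b t ^ 3)" by (intro continuous_intros)
  have "C1c UNIV (\<lambda>z. kap b ((norm (z - 0))\<^sup>2)) (\<lambda>z. (2 * (- (20 / (pi * b\<^sup>2)) * hat b ((norm (z - 0))\<^sup>2) ^ 3)) *\<^sub>R (z - 0))"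
    by (rule C1cI[OF C1_radial[OF d c] compact_cball[of 0 "sqrt b"] subset_UNIV kernel_support(1)[OF assms]])
  then show thesis using that by simp
qed

lemma kmean_eq_conv: "kmean v b = conv v (\<lambda>z. kap b ((norm z)\<^sup>2))"
  by (rule ext) (simp add: kmean_def conv_def norm_minus_commute)

lemma kmean_continuous:
  assumes "integrable lebesgue v" "b > 0"
  shows "continuous_on UNIV (kmean v b)"
proof -
  obtain E where "C1c UNIV (\<lambda>z. kap b ((norm z)\<^sup>2)) E" by (rule kap_C1c[OF assms(2)]) (rule that)
  from C1_continuous[OF conv_C1[OF assms(1) this]] show ?thesis by (simp add: kmean_eq_conv)
qed

text \<open>The kernel depends on the distance only, so averaging is self-adjoint.\<close>

lemma kmean_symmetric:
  assumes "integrable lebesgue w" "sq_int lebesgue w" "continuous_on UNIV \<phi>" "compact K" "\<And>x. x \<notin> K \<Longrightarrow> \<phi> x = 0" "b > 0"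
  shows "(LINT x|lebesgue. kmean w b x * \<phi> x) = (LINT y|lebesgue. w y * kmean \<phi> b y)"
proof -
  \<comment> \<open>Fubini's theorem is applied on the Borel product space, so \<open>w\<close> is
    first replaced by a Borel function that agrees with it almost everywhere.\<close>
  obtain v where v: "v \<in> borel_measurable lborel" "AE x in lborel. w x = v x"
    using completion_ex_borel_measurable_real[OF sq_int_measurable[OF assms(2)]] by blast
  have vl: "AE x in lebesgue. w x = v x" using v(2) by (rule AE_completion)
  have [measurable]: "v \<in> borel_measurable borel" using v(1) by simp
  have vm: "v \<in> borel_measurable lebesgue" using v(1) by (rule measurable_completion)
  have \<phi>m [measurable]: "\<phi> \<in> borel_measurable borel" by (rule borel_measurable_continuous_onI[OF assms(3)])
  have [measurable]: "kap b \<in> borel_measurable borel" unfolding kap_def[abs_def] by measurable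
  have vi: "integrable lebesgue v"
    by (rule integrable_cong_AE[THEN iffD1, OF _ vm vl assms(1)]) (rule sq_int_measurable[OF assms(2)])
  have vs: "sq_int lebesgue v" by (rule sq_int_cong_AE[OF assms(2) vm vl])
  have \<phi>i: "integrable lebesgue \<phi>" by (rule compact_support_integrable[OF assms(3,4,5)])
  have kwv: "kmean w b x = kmean v b x" for x
    unfolding kmean_def
  proof (rule integral_cong_AE)
    have kl: "(\<lambda>y. kap b ((norm (y - x))\<^sup>2)) \<in> borel_measurable lebesgue"
      by (rule continuous_imp_lebesgue_measurable[OF kap_continuous])
    show "(\<lambda>y. w y * kap b ((norm (y - x))\<^sup>2)) \<in> borel_measurable lebesgue"
      "(\<lambda>y. v y * kap b ((norm (y - x))\<^sup>2)) \<in> borel_measurable lebesgue"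
      using kl sq_int_measurable[OF assms(2)] vm by measurable
    show "AE y in lebesgue. w y * kap b ((norm (y - x))\<^sup>2) = v y * kap b ((norm (y - x))\<^sup>2)"
      using vl by eventually_elim simp
  qed
  define F where "F = (\<lambda>(x::real^2, y::real^2). v y * kap b ((norm (y - x))\<^sup>2) * \<phi> x)"
  have Fm: "F \<in> borel_measurable (lborel \<Otimes>\<^sub>M lborel)" unfolding F_def by measurable
  have inner: "integrable lborel (\<lambda>y. v y * kap b ((norm (y - x))\<^sup>2))" for x
  proof -
    have "integrable lebesgue (\<lambda>y. v y * kap b ((norm (y - x))\<^sup>2))"
      by (intro integrable_mult_sq_int vs kap_sq_norm assms(6))
    then show ?thesis by (subst (asm) integrable_completion) auto
  qed
  have kmv: "kmean v b x = (LINT y|lborel. v y * kap b ((norm (y - x))\<^sup>2))" for x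
    unfolding kmean_def by (rule integral_completion) measurable
  have kma: "kmean (\<lambda>y. \<bar>v y\<bar>) b x = (LINT y|lborel. \<bar>v y\<bar> * kap b ((norm (y - x))\<^sup>2))" for x
    unfolding kmean_def by (rule integral_completion) measurable
  have Fi: "integrable (lborel \<Otimes>\<^sub>M lborel) F"
  proof (rule lborel_pair.Fubini_integrable[OF Fm])
    show "AE x in lborel. integrable lborel (\<lambda>y. F (x, y))"
      using inner by (auto simp: F_def)
    have e: "(LINT y|lborel. norm (F (x, y))) = kmean (\<lambda>y. \<bar>v y\<bar>) b x * \<bar>\<phi> x\<bar>" for x
      unfolding kma F_def by (simp add: abs_mult kap_nonneg[OF assms(6)])
    have c: "continuous_on UNIV (\<lambda>x. kmean (\<lambda>y. \<bar>v y\<bar>) b x * \<bar>\<phi> x\<bar>)"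
      using vi by (intro continuous_intros kmean_continuous assms) auto
    have "integrable lebesgue (\<lambda>x. kmean (\<lambda>y. \<bar>v y\<bar>) b x * \<bar>\<phi> x\<bar>)"
      by (rule compact_support_integrable[OF c assms(4)]) (simp add: assms(5))
    then show "integrable lborel (\<lambda>x. LINT y|lborel. norm (F (x, y)))"
      unfolding e using borel_measurable_continuous_onI[OF c] by (subst (asm) integrable_completion) auto
  qed
  have "(LINT x|lborel. LINT y|lborel. F (x, y)) = (LINT y|lborel. LINT x|lborel. F (x, y))"
    using lborel_pair.Fubini_integral[of "\<lambda>x y. F (x, y)"] Fi by simp
  moreover have "(LINT x|lborel. LINT y|lborel. F (x, y)) = (LINT x|lebesgue. kmean v b x * \<phi> x)"
  proof -
    have "(LINT y|lborel. F (x, y)) = kmean v b x * \<phi> x" for x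
      unfolding kmv F_def using inner by simp
    moreover have "(LINT x|lebesgue. kmean v b x * \<phi> x) = (LINT x|lborel. kmean v b x * \<phi> x)"
      using borel_measurable_continuous_onI[OF kmean_continuous[OF vi assms(6)]] by (intro integral_completion) auto
    ultimately show ?thesis by simp
  qed
  moreover have "(LINT y|lborel. LINT x|lborel. F (x, y)) = (LINT y|lebesgue. v y * kmean \<phi> b y)"
  proof -
    have "(LINT x|lborel. F (x, y)) = v y * kmean \<phi> b y" for y
    proof -
      have "(LINT x|lborel. F (x, y)) = (LINT x|lborel. v y * (\<phi> x * kap b ((norm (x - y))\<^sup>2)))"
        unfolding F_def by (simp add: norm_minus_commute mult_ac)
      also have "\<dots> = v y * (LINT x|lborel. \<phi> x * kap b ((norm (x - y))\<^sup>2))" by simp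
      also have "(LINT x|lborel. \<phi> x * kap b ((norm (x - y))\<^sup>2)) = kmean \<phi> b y"
        unfolding kmean_def by (rule integral_completion[symmetric]) measurable
      finally show ?thesis .
    qed
    moreover have "(LINT y|lebesgue. v y * kmean \<phi> b y) = (LINT y|lborel. v y * kmean \<phi> b y)"
      using borel_measurable_continuous_onI[OF kmean_continuous[OF \<phi>i assms(6)]] by (intro integral_completion) auto
    ultimately show ?thesis by simp
  qed
  moreover have "(LINT y|lebesgue. v y * kmean \<phi> b y) = (LINT y|lebesgue. w y * kmean \<phi> b y)"
  proof (rule integral_cong_AE)
    have "kmean \<phi> b \<in> borel_measurable lebesgue"
      by (rule continuous_imp_lebesgue_measurable[OF kmean_continuous[OF \<phi>i assms(6)]])
    then show "(\<lambda>y. v y * kmean \<phi> b y) \<in> borel_measurable lebesgue" "(\<lambda>y. w y * kmean \<phi> b y) \<in> borel_measurable lebesgue"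
      using vm sq_int_measurable[OF assms(2)] by measurable
    show "AE y in lebesgue. v y * kmean \<phi> b y = w y * kmean \<phi> b y" using vl by eventually_elim simp
  qed
  ultimately show ?thesis by (simp add: kwv)
qed

text \<open>When the disc lies in \<open>U\<close> the kernel \<open>kpot\<close> is itself a test
  function, and the mean has derivative exactly \<open>- c / 24\<close> in \<open>b\<close>.\<close>

lemma wsol_kmean_const:
  assumes "wsol U f w g" "\<And>x. x \<in> U \<Longrightarrow> f x = c" "0 < b" "b \<le> B" "cball x (sqrt B) \<subseteq> U"
  shows "kmean w b x + c * b / 24 = kmean w B x + c * B / 24"
proof (cases "b = B")
  case False
  have "((\<lambda>b. kmean w b x + c * b / 24) has_real_derivative 0) (at s)" if s: "b \<le> s" "s \<le> B" for s
  proof -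
    have sp: "s > 0" using assms(3) s by simp
    have sub: "cball x (sqrt s) \<subseteq> U" using s assms(5) by (meson order_trans real_sqrt_le_mono subset_cball)
    obtain H where H: "C2 (\<lambda>y. kpot s ((norm (y - x))\<^sup>2)) H (\<lambda>y. klap s ((norm (y - x))\<^sup>2))"
      by (rule kpot_compact_C2[OF sp]) (rule that)
    have "- (LINT y|lebesgue. w y * klap s ((norm (y - x))\<^sup>2)) = (LINT y|lebesgue. f y * kpot s ((norm (y - x))\<^sup>2))"
      by (rule wsol_laplace[OF assms(1) H compact_cball sub kernel_support(3)[OF sp]])
    also have "(\<lambda>y. f y * kpot s ((norm (y - x))\<^sup>2)) = (\<lambda>y. c * kpot s ((norm (y - x))\<^sup>2))"
    proof
      fix y
      show "f y * kpot s ((norm (y - x))\<^sup>2) = c * kpot s ((norm (y - x))\<^sup>2)"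
        using assms(2)[of y] sub kernel_support(3)[OF sp, of y x] by (cases "y \<in> cball x (sqrt s)") auto
    qed
    also have "(LINT y|lebesgue. c * kpot s ((norm (y - x))\<^sup>2)) = c / 24" using kpot_integral(2)[OF sp, of x] by simp
    finally have "(LINT y|lebesgue. w y * klap s ((norm (y - x))\<^sup>2)) + c / 24 = 0" by simp
    moreover have "((\<lambda>b. kmean w b x + c * b / 24) has_real_derivative
        (LINT y|lebesgue. w y * klap s ((norm (y - x))\<^sup>2)) + c / 24) (at s)"
      by (intro DERIV_add kmean_deriv wsolD(3)[OF assms(1)] sp) (auto intro!: derivative_eq_intros)
    ultimately show ?thesis by simp
  qed
  note d = this
  have "continuous_on {b..B} (\<lambda>b. kmean w b x + c * b / 24)"
    by (intro continuous_at_imp_continuous_on ballI DERIV_isCont[OF d]) auto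
  then show ?thesis
    using DERIV_isconst_end[of b B "\<lambda>b. kmean w b x + c * b / 24"] d False assms(4) by auto
qed simp

text \<open>Weyl's lemma: by \<open>wsol_kmean_const\<close> the corrected means do not depend on the scale, so they define the
  continuous representative.\<close>

lemma wsol_continuous_representative:
  assumes "open U" "bounded U" "wsol U f w g" "\<And>x. x \<in> U \<Longrightarrow> f x = c" "\<And>x. x \<notin> U \<Longrightarrow> f x = 0"
  obtains W where "continuous_on U W" "\<And>x. x \<notin> U \<Longrightarrow> W x = 0" "AE x in lebesgue. w x = W x" "W \<in> borel_measurable lebesgue"
proof -
  note S = wsolD[OF assms(3)]
  have z: "AE x in lebesgue. x \<notin> U \<longrightarrow> w x = 0"
    using h10_AE_zero_outside[OF S(1)] by eventually_elim simp
  have wi: "integrable lebesgue w" by (rule bounded_support_imp_integrable[OF S(3) assms(2) z])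
  have ex: "\<exists>b>0. cball x (sqrt b) \<subseteq> U" if "x \<in> U" for x
  proof -
    from bspec[OF assms(1)[unfolded open_contains_cball] that]
    obtain e where "e > 0" "cball x e \<subseteq> U" by blast
    then show ?thesis by (intro exI[of _ "e\<^sup>2"]) simp
  qed
  define \<beta> where "\<beta> x = (SOME b. b > 0 \<and> cball x (sqrt b) \<subseteq> U)" for x
  have \<beta>: "\<beta> x > 0" "cball x (sqrt (\<beta> x)) \<subseteq> U" if "x \<in> U" for x
    using someI_ex[OF ex[OF that]] by (auto simp: \<beta>_def)
  define W where "W x = (if x \<in> U then kmean w (\<beta> x) x + c * \<beta> x / 24 else 0)" for x
  have W: "W x = kmean w b x + c * b / 24" if "x \<in> U" "b > 0" "cball x (sqrt b) \<subseteq> U" for x b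
  proof (cases "b \<le> \<beta> x")
    case True
    have "kmean w b x + c * b / 24 = kmean w (\<beta> x) x + c * \<beta> x / 24"
      by (rule wsol_kmean_const[OF assms(3,4) that(2) True \<beta>(2)[OF that(1)]])
    then show ?thesis using that(1) by (simp add: W_def)
  next
    case False
    have "kmean w (\<beta> x) x + c * \<beta> x / 24 = kmean w b x + c * b / 24"
      using False by (intro wsol_kmean_const[OF assms(3,4) \<beta>(1)[OF that(1)] _ that(3)]) auto
    then show ?thesis using that(1) by (simp add: W_def)
  qed
  have cont: "continuous_on U W"
  proof (rule continuous_at_imp_continuous_on, rule ballI)
    fix x assume x: "x \<in> U"
    obtain e where e: "e > 0" "cball x e \<subseteq> U" using assms(1)[unfolded open_contains_cball] x by blast
    define b where "b = (e / 2)\<^sup>2"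
    have b: "b > 0" "sqrt b = e / 2" using e by (auto simp: b_def)
    have Wb: "W y = kmean w b y + c * b / 24" if "y \<in> ball x (e / 2)" for y
    proof (rule W)
      show "cball y (sqrt b) \<subseteq> U"
      proof
        fix v assume "v \<in> cball y (sqrt b)"
        then have "dist x v \<le> e" using that b(2) dist_triangle[of x v y] by simp
        then show "v \<in> U" using e(2) by auto
      qed
      then show "y \<in> U" using b by auto
    qed (rule b)
    have "isCont (\<lambda>y. kmean w b y + c * b / 24) x"
      using kmean_continuous[OF wi b(1)] by (intro continuous_intros) (simp add: continuous_on_eq_continuous_at)
    moreover have "\<forall>\<^sub>F y in nhds x. W y = kmean w b y + c * b / 24"
      using eventually_nhds_in_open[of "ball x (e / 2)" x] e(1) by (auto elim!: eventually_mono simp: Wb)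
    ultimately show "isCont W x" by (subst isCont_cong)
  qed
  have Wm: "W \<in> borel_measurable lebesgue"
  proof -
    have "(\<lambda>x. indicator U x *\<^sub>R W x) \<in> borel_measurable borel"
      by (rule borel_measurable_continuous_on_indicator[OF _ cont]) (use assms(1) in auto)
    moreover have "(\<lambda>x. indicator U x *\<^sub>R W x) = W" by (auto simp: W_def indicator_def)
    ultimately have "W \<in> borel_measurable borel" by simp
    then have "W \<in> borel_measurable lborel" by simp
    then show ?thesis by (rule measurable_completion)
  qed
  obtain R where R: "U \<subseteq> cball 0 R" "R > 0"

  proof -
    obtain R where "0 < R" "U \<subseteq> ball 0 R" using bounded_subset_ballD[OF assms(2), of 0] by blast
    with ball_subset_cball[of 0 R] show ?thesis by (intro that[of R]) auto
  qed
  define B where "B = R\<^sup>2"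
  have B: "B > 0" using R by (simp add: B_def)
  \<comment> \<open>A bound that puts \<open>W\<close> in L2. Means of \<open>\<bar>w\<bar>\<close>
    increase up to the drift, so the small scales forced near the boundary are dominated by the
    fixed scale \<open>B\<close>, where Cauchy-Schwarz gives a bound independent of
    \<open>x\<close>.\<close>
  define C where "C = sqrt (25 / (9 * pi * B)) * sqrt (sq_norm lebesgue (\<lambda>y. \<bar>w y\<bar>)) + \<bar>c\<bar> * B / 24"
  have fb: "AE x in lebesgue. \<bar>f x\<bar> \<le> \<bar>c\<bar>" using assms(4,5) by (intro AE_I2) (metis abs_ge_zero abs_zero order_refl)
  have Wb: "\<bar>W x\<bar> \<le> C" for x
  proof (cases "x \<in> U")
    case True
    define b where "b = min (\<beta> x) B"
    have b: "b > 0" "b \<le> B" "b \<le> \<beta> x" using \<beta>(1)[OF True] B by (auto simp: b_def)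
    then have b: "b > 0" "b \<le> B" "cball x (sqrt b) \<subseteq> U"
      using subset_trans[OF subset_cball \<beta>(2)[OF True], of "sqrt b"] by auto
    have "\<bar>kmean w b x\<bar> \<le> kmean (\<lambda>y. \<bar>w y\<bar>) b x"
      by (rule kmean_abs[OF b(1)])
    moreover have "\<bar>c * b / 24\<bar> = \<bar>c\<bar> * b / 24" using b by (simp add: abs_mult)
    ultimately have "\<bar>W x\<bar> \<le> kmean (\<lambda>y. \<bar>w y\<bar>) b x + \<bar>c\<bar> * b / 24"
      unfolding W[OF True b(1,3)] by linarith
    also have "\<dots> \<le> kmean (\<lambda>y. \<bar>w y\<bar>) B x + \<bar>c\<bar> * B / 24"
      by (rule wsol_kmean_mono[OF assms(3) fb b(1,2)])
    also have "\<dots> \<le> C" using kmean_abs_le[OF sq_int_abs[OF S(3)] B, of x] unfolding C_def by linarith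
    finally show ?thesis .
  next
    case False
    then show ?thesis using B by (simp add: W_def C_def sq_norm_nonneg)
  qed
  have WL: "sq_int lebesgue W"
  proof (rule sq_int_bound[OF sq_int_indicator[OF lmeasurable_cball[of 0 R]] Wm, where C = C])
    show "AE x in lebesgue. norm (W x) \<le> C * norm (indicator (cball 0 R) x :: real)"
    proof (rule AE_I2)
      fix x
      show "norm (W x) \<le> C * norm (indicator (cball 0 R) x :: real)"
        using Wb[of x] R(1) by (cases "x \<in> cball 0 R") (auto simp: W_def)
    qed
  qed
  have "AE x in lebesgue. x \<in> U \<longrightarrow> w x - W x = 0"
  proof (rule test_orthogonal_imp_AE_0[OF assms(1) sq_int_diff[OF S(3) WL]])
    fix \<phi> assume \<phi>: "\<phi> \<in> test_functions U"
    note Cc = test_function_C1c[OF \<phi>]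
    obtain K where K: "compact K" "K \<subseteq> U" "\<And>x. x \<notin> K \<Longrightarrow> \<phi> x = 0" by (rule C1cE[OF Cc]) (rule that)
    obtain P where P: "P > 0" "\<And>x. \<bar>\<phi> x\<bar> \<le> P" "\<And>x. norm (grad \<phi> x) \<le> P" by (rule C1c_bounded[OF Cc]) (rule that)
    have \<phi>c: "continuous_on UNIV \<phi>" by (rule C1_continuous[OF C1c_imp_C1[OF Cc]])
    have \<phi>L: "sq_int lebesgue \<phi>" by (rule C1c_sq_int[OF Cc])
    have \<phi>i: "integrable lebesgue \<phi>" by (rule compact_support_integrable[OF \<phi>c K(1,3)])
    have "\<exists>r>0. \<forall>x\<in>K. cball x r \<subseteq> U"
    proof (cases "K = {}")
      case False
      obtain r where r: "r > 0" "{x. infdist x K \<le> r} \<subseteq> U"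
        using compact_in_open_separated[OF False K(1) assms(1) K(2)] by blast
      have "cball x r \<subseteq> U" if "x \<in> K" for x
      proof
        fix y assume "y \<in> cball x r"
        then have "infdist y K \<le> r" using infdist_le[OF that, of y] by (simp add: dist_commute)
        then show "y \<in> U" using r(2) by blast
      qed
      then show ?thesis using r(1) by blast
    qed (auto intro: exI[of _ 1])
    then obtain r where r: "r > 0" "\<And>x. x \<in> K \<Longrightarrow> cball x r \<subseteq> U" by blast
    define d where "d = (LINT x|lebesgue. (w x - W x) * \<phi> x)"
    have wp: "integrable lebesgue (\<lambda>x. w x * \<phi> x)" by (rule integrable_mult_sq_int[OF S(3) \<phi>L])
    have Wp: "integrable lebesgue (\<lambda>x. W x * \<phi> x)" by (rule integrable_mult_sq_int[OF WL \<phi>L])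
    define I where "I = (LINT x|lebesgue. \<bar>w x\<bar>)"
    define J where "J = (LINT x|lebesgue. \<bar>\<phi> x\<bar>)"
    \<comment> \<open>On the support of \<open>\<phi>\<close> the function \<open>W\<close> is a
      corrected mean at every small scale \<open>b\<close>. By symmetry the mean moves over to
      \<open>\<phi>\<close>, which it changes by at most \<open>P * sqrt b\<close>; as
      \<open>b\<close> tends to 0, \<open>w\<close> and \<open>W\<close> agree against
      \<open>\<phi>\<close>.\<close>
    have key: "\<bar>d\<bar> \<le> I * (P * sqrt b) + \<bar>c\<bar> * b / 24 * J" if b: "b > 0" "b \<le> r\<^sup>2" for b
    proof -
      have sb: "sqrt b \<le> r" using b r(1) by (simp add: real_le_lsqrt)
      have kc: "continuous_on UNIV (kmean w b)" by (rule kmean_continuous[OF wi b(1)])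
      have kwi: "integrable lebesgue (\<lambda>x. kmean w b x * \<phi> x)"
        by (rule compact_support_integrable[OF continuous_on_mult[OF kc \<phi>c] K(1)]) (simp add: K(3))
      have "(LINT x|lebesgue. W x * \<phi> x) = (LINT x|lebesgue. kmean w b x * \<phi> x + c * b / 24 * \<phi> x)"
      proof (rule Bochner_Integration.integral_cong[OF refl])
        fix x
        show "W x * \<phi> x = kmean w b x * \<phi> x + c * b / 24 * \<phi> x"
        proof (cases "x \<in> K")
          case True
          have "cball x (sqrt b) \<subseteq> U" using r(2)[OF True] sb by (meson order_trans subset_cball)
          then have "W x = kmean w b x + c * b / 24" using True K(2) b(1) by (intro W) auto
          then show ?thesis by (simp add: distrib_right)
        qed (simp add: K(3))
      qed
      also have "\<dots> = (LINT x|lebesgue. kmean w b x * \<phi> x) + c * b / 24 * (LINT x|lebesgue. \<phi> x)"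
        using kwi \<phi>i by simp
      also have "(LINT x|lebesgue. kmean w b x * \<phi> x) = (LINT y|lebesgue. w y * kmean \<phi> b y)"
        by (rule kmean_symmetric[OF wi S(3) \<phi>c K(1,3) b(1)])
      finally have 1: "(LINT x|lebesgue. W x * \<phi> x) = (LINT y|lebesgue. w y * kmean \<phi> b y) + c * b / 24 * (LINT x|lebesgue. \<phi> x)" .
      have k\<phi>: "\<bar>kmean \<phi> b y - \<phi> y\<bar> \<le> P * sqrt b" for y
        unfolding kmean_eq_conv
      proof (rule conv_close[OF \<phi>c])
        show "continuous_on UNIV (\<lambda>z::real^2. kap b ((norm z)\<^sup>2))" using kap_continuous[of b 0] by simp
        show "kap b ((norm z)\<^sup>2) = 0" if "sqrt b < norm z" for z :: "real^2"
          using kernel_support(1)[OF b(1), of z 0] that by simp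
        show "(LINT z|lebesgue. kap b ((norm (z::real^2))\<^sup>2)) = 1" using kap_integral(2)[OF b(1), of 0] by simp
        show "\<bar>\<phi> x - \<phi> y\<bar> \<le> P * sqrt b" if "norm (x - y) \<le> sqrt b" for x y
          using C1_Lipschitz[OF C1c_imp_C1[OF Cc] P(3), of x y] mult_left_mono[OF that, of P] P(1) by linarith
      qed (rule kap_nonneg[OF b(1)])
      have kL: "integrable lebesgue (\<lambda>y. w y * kmean \<phi> b y)"
      proof (rule integrable_mult_bounded_real[OF wi, where B = "P + P * sqrt b"])
        show "kmean \<phi> b \<in> borel_measurable lebesgue"
          by (rule continuous_imp_lebesgue_measurable[OF kmean_continuous[OF \<phi>i b(1)]])
        show "\<bar>kmean \<phi> b y\<bar> \<le> P + P * sqrt b" for y using k\<phi>[of y] P(2)[of y] by linarith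
      qed
      have "d = (LINT x|lebesgue. w x * \<phi> x) - (LINT x|lebesgue. W x * \<phi> x)"
        unfolding d_def left_diff_distrib by (rule Bochner_Integration.integral_diff[OF wp Wp])
      also have "\<dots> = (LINT x|lebesgue. w x * \<phi> x - w x * kmean \<phi> b x) - c * b / 24 * (LINT x|lebesgue. \<phi> x)"
        unfolding 1 Bochner_Integration.integral_diff[OF wp kL] by simp
      finally have "\<bar>d\<bar> \<le> \<bar>LINT x|lebesgue. w x * \<phi> x - w x * kmean \<phi> b x\<bar> + \<bar>c * b / 24 * (LINT x|lebesgue. \<phi> x)\<bar>"
        by linarith
      also have "\<bar>LINT x|lebesgue. w x * \<phi> x - w x * kmean \<phi> b x\<bar> \<le> (LINT x|lebesgue. \<bar>w x\<bar> * (P * sqrt b))"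
      proof (rule integral_norm_le[where 'b = real, unfolded real_norm_def])
        show "integrable lebesgue (\<lambda>x. w x * \<phi> x - w x * kmean \<phi> b x)" using wp kL by simp
        show "integrable lebesgue (\<lambda>x. \<bar>w x\<bar> * (P * sqrt b))" using wi by simp
        fix x
        have "\<bar>w x\<bar> * \<bar>\<phi> x - kmean \<phi> b x\<bar> \<le> \<bar>w x\<bar> * (P * sqrt b)"
          using k\<phi>[of x] by (intro mult_left_mono) (auto simp: abs_minus_commute)
        then show "\<bar>w x * \<phi> x - w x * kmean \<phi> b x\<bar> \<le> \<bar>w x\<bar> * (P * sqrt b)"
          by (simp flip: right_diff_distrib add: abs_mult)
      qed
      also have "\<dots> = I * (P * sqrt b)" by (simp add: I_def)
      also have "\<bar>c * b / 24 * (LINT x|lebesgue. \<phi> x)\<bar> \<le> \<bar>c\<bar> * b / 24 * J"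
        unfolding abs_mult J_def using b by (intro mult_mono integral_abs_bound) (auto simp: abs_mult)
      finally show ?thesis by simp
    qed
    have lim: "((\<lambda>b. I * (P * sqrt b) + \<bar>c\<bar> * b / 24 * J) \<longlongrightarrow> I * (P * sqrt 0) + \<bar>c\<bar> * 0 / 24 * J) (at_right 0)"
      by (intro tendsto_intros) simp
    have ev: "\<forall>\<^sub>F b in at_right 0. \<bar>d\<bar> \<le> I * (P * sqrt b) + \<bar>c\<bar> * b / 24 * J"
      using key r(1) unfolding eventually_at_right[OF zero_less_one] by (intro exI[of _ "r\<^sup>2"]) auto
    have "\<bar>d\<bar> \<le> I * (P * sqrt 0) + \<bar>c\<bar> * 0 / 24 * J"
      by (rule tendsto_lowerbound[OF lim ev]) simp
    then show "(LINT x|lebesgue. (w x - W x) * \<phi> x) = 0" by (simp add: d_def)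
  qed
  then have "AE x in lebesgue. w x = W x"
    using z by eventually_elim (auto simp: W_def)
  then show thesis using that[OF cont _ _ Wm] by (auto simp: W_def)
qed

subsection \<open>The angular Hardy inequality\<close>

text \<open>A circle about \<open>z\<close> inside \<open>\<Omega>\<close> would be contractible
  there. Radial projection from \<open>z\<close>, continuous on \<open>\<Omega>\<close> because
  \<open>z \<notin> \<Omega>\<close>, would then make the identity of the unit circle homotopic to a
  constant.\<close>

lemma circle_meets_complement:
  fixes \<Omega> :: "(real^2) set"
  assumes "simply_connected \<Omega>" "z \<notin> \<Omega>" "r > 0"
  shows "\<exists>y. norm (y - z) = r \<and> y \<notin> \<Omega>"
proof (rule ccontr)
  assume "\<not> ?thesis"
  then have sub: "y \<in> \<Omega>" if "norm (y - z) = r" for y using that by blast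
  \<comment> \<open>\<open>f\<close> maps the unit circle of the complex plane onto the circle about
    \<open>z\<close>, and \<open>p\<close> projects back, so that \<open>p\<close> after
    \<open>f\<close> is the identity.\<close>
  define f where "f w = z + r *\<^sub>R (Re w *\<^sub>R axis 1 1 + Im w *\<^sub>R axis 2 1)" for w
  define p where "p y = complex_of_real (1 / norm (y - z)) * Complex ((y - z) $ 1) ((y - z) $ 2)" for y :: "real^2"
  have nrm: "norm v = sqrt ((v $ 1)\<^sup>2 + (v $ 2)\<^sup>2)" for v :: "real^2"
    by (simp add: norm_vec_def L2_set_def sum_2)
  have fc: "continuous_on (sphere 0 1) f" unfolding f_def by (intro continuous_intros)
  have fn: "norm (f w - z) = r" if "w \<in> sphere 0 1" for w
  proof -
    have "norm (Re w *\<^sub>R axis 1 1 + Im w *\<^sub>R axis 2 1 :: real^2) = norm w"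
      by (simp add: nrm axis_def cmod_def)
    then show ?thesis using that assms(3) by (simp add: f_def)
  qed
  have fS: "f ` sphere 0 1 \<subseteq> \<Omega>" using sub fn by auto
  obtain a where a: "homotopic_with_canon (\<lambda>h. True) (sphere 0 1) \<Omega> f (\<lambda>x. a)"
    using assms(1) fc fS unfolding simply_connected_eq_contractible_circlemap by blast
  have ne: "norm (y - z) \<noteq> 0" if "y \<in> \<Omega>" for y using that assms(2) by auto
  have pc: "continuous_on \<Omega> p"
    unfolding p_def complex_eq using ne by (intro continuous_intros) auto
  have pS: "p \<in> \<Omega> \<rightarrow> sphere 0 1"
  proof
    fix y assume y: "y \<in> \<Omega>"
    have "norm (Complex ((y - z) $ 1) ((y - z) $ 2)) = norm (y - z)" by (simp add: nrm cmod_def)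
    then show "p y \<in> sphere 0 1" using ne[OF y] by (simp add: p_def norm_mult norm_divide)
  qed
  have "homotopic_with_canon (\<lambda>h. True) (sphere 0 1) (sphere 0 1) (p \<circ> f) (p \<circ> (\<lambda>x. a))"
    by (rule homotopic_with_compose_continuous_left[OF a pc pS])
  then have "homotopic_with_canon (\<lambda>h. True) (sphere 0 1) (sphere 0 1) id (\<lambda>x. p a)"
  proof (rule homotopic_with_eq)
    fix w :: complex assume "w \<in> topspace (top_of_set (sphere 0 1))"
    then have w: "w \<in> sphere 0 1" by simp
    have "p (f w) = complex_of_real (1 / r) * Complex (r * Re w) (r * Im w)"
      unfolding p_def fn[OF w] by (simp add: f_def axis_def)
    then show "id w = (p \<circ> f) w" using assms(3) by (simp add: complex_eq_iff)
  qed auto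
  then have "contractible (sphere (0::complex) 1)" unfolding contractible_def by blast
  then show False by (simp add: contractible_sphere)
qed

text \<open>The difference of the two sides is the integral of \<open>4 (v' - 1/2 v cot)\<^sup>2\<close>, up to the derivative of the
  periodic function \<open>1/2 v\<^sup>2 cot\<close>, where the cotangent has argument \<open>(t - t0) / 2\<close>.\<close>

lemma Wirtinger_with_zero:
  fixes v v' :: "real \<Rightarrow> real"
  assumes d: "\<And>t. (v has_real_derivative v' t) (at t)" and c: "continuous_on UNIV v'"
    and per: "\<And>t. v (t + 2 * pi) = v t" and z: "\<delta> > 0" "\<And>t. \<bar>t - t0\<bar> < \<delta> \<Longrightarrow> v t = 0"
  shows "integral {0..2 * pi} (\<lambda>t. (v t)\<^sup>2) \<le> 4 * integral {0..2 * pi} (\<lambda>t. (v' t)\<^sup>2)"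
proof -
  define S where "S t = sin ((t - t0) / 2)" for t
  define K where "K t = cos ((t - t0) / 2) / S t" for t
  define H where "H t = 1 / 2 * (v t)\<^sup>2 * K t" for t
  define h where "h t = v t * v' t * K t - 1 / 4 * (v t)\<^sup>2 / (S t)\<^sup>2" for t
  have vc: "continuous_on UNIV v" by (intro continuous_at_imp_continuous_on ballI DERIV_isCont[OF d])
  have pern: "v (t + 2 * pi * real n) = v t" for t n
    by (induction n) (use per[of "t + 2 * pi * real _"] in \<open>auto simp: algebra_simps\<close>)
  have peri: "v (t + 2 * pi * of_int k) = v t" for t k
  proof (cases "k \<ge> 0")
    case True
    then show ?thesis using pern[of t "nat k"] by simp
  next
    case False
    then show ?thesis using pern[of "t + 2 * pi * of_int k" "nat (- k)"] by simp
  qed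
  have zero: "v s = 0" if "S t = 0" "\<bar>s - t\<bar> < \<delta>" for s t
  proof -
    have "\<exists>k::int. (t - t0) / 2 = of_int k * pi" using that(1) unfolding S_def sin_zero_iff_int2 .
    then obtain k :: int where "(t - t0) / 2 = of_int k * pi" ..
    then have t: "t = t0 + 2 * pi * of_int k" by (simp add: field_simps)
    have "v s = v (s + 2 * pi * of_int (- k))" by (rule peri[symmetric])
    also have "\<dots> = 0" by (rule z(2)) (use that(2) t in simp)
    finally show ?thesis .
  qed
  \<comment> \<open>Division by zero gives 0, so \<open>K\<close> and \<open>h\<close> are defined
    everywhere. Near a zero of \<open>S\<close>, which is a translate of \<open>t0\<close> by
    periods, \<open>v\<close> vanishes identically, and so does \<open>H\<close>.\<close>
  have Hd: "(H has_real_derivative h t) (at t)" for t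
  proof (cases "S t = 0")
    case True
    have "((\<lambda>t. 0) has_real_derivative 0) (at t)" by simp
    then have "(H has_real_derivative 0) (at t)"
      by (rule has_field_derivative_transform_within_open[where S = "{t - \<delta><..<t + \<delta>}"])
         (use z(1) zero[OF True] in \<open>auto simp: H_def abs_less_iff\<close>)
    then show ?thesis using True by (simp add: h_def K_def)
  next
    case False
    have Sd: "(S has_real_derivative cos ((t - t0) / 2) / 2) (at t)"
      unfolding S_def by (auto intro!: derivative_eq_intros)
    have Cd: "((\<lambda>t. cos ((t - t0) / 2)) has_real_derivative - (S t / 2)) (at t)"
      unfolding S_def by (auto intro!: derivative_eq_intros)
    have Kd: "(K has_real_derivative ((- (S t / 2)) * S t - cos ((t - t0) / 2) * (cos ((t - t0) / 2) / 2)) / (S t * S t)) (at t)"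
      unfolding K_def by (rule DERIV_divide[OF Cd Sd False])
    have "(cos ((t - t0) / 2))\<^sup>2 = 1 - (S t)\<^sup>2" unfolding S_def by (rule cos_squared_eq)
    then have "(- (S t / 2)) * S t - cos ((t - t0) / 2) * (cos ((t - t0) / 2) / 2) = - (1 / 2)"
      by (simp add: power2_eq_square field_simps)
    then have e: "((- (S t / 2)) * S t - cos ((t - t0) / 2) * (cos ((t - t0) / 2) / 2)) / (S t * S t) = - (1 / (2 * (S t)\<^sup>2))"
      by (simp add: power2_eq_square)
    have vd: "((\<lambda>t. 1 / 2 * (v t)\<^sup>2) has_real_derivative v t * v' t) (at t)"
      by (rule derivative_eq_intros d refl | simp)+
    show ?thesis
      unfolding H_def using DERIV_mult[OF vd Kd[unfolded e]] by (rule DERIV_cong) (simp add: h_def)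
  qed
  have "(h has_integral (H (2 * pi) - H 0)) {0..2 * pi}"
    by (rule fundamental_theorem_of_calculus)
       (use Hd in \<open>auto simp: has_real_derivative_iff_has_vector_derivative[symmetric] intro: DERIV_subset\<close>)
  moreover have "H (2 * pi) = H 0"
  proof -
    have "v (2 * pi) = v 0" using per[of 0] by simp
    moreover have "K (2 * pi) = K 0"
    proof -
      have "(2 * pi - t0) / 2 = pi - t0 / 2" by simp
      then show ?thesis unfolding K_def S_def by (simp only:) simp
    qed
    ultimately show ?thesis by (simp add: H_def)
  qed
  ultimately have hI: "(h has_integral 0) {0..2 * pi}" by simp
  have i1: "(\<lambda>t. (v t)\<^sup>2) integrable_on {0..2 * pi}"
    by (intro integrable_continuous_real continuous_intros continuous_on_subset[OF vc]) auto
  have i2: "(\<lambda>t. (v' t)\<^sup>2) integrable_on {0..2 * pi}"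
    by (intro integrable_continuous_real continuous_intros continuous_on_subset[OF c]) auto
  have sI: "((\<lambda>t. (v' t)\<^sup>2 - 1 / 4 * (v t)\<^sup>2) has_integral
      integral {0..2 * pi} (\<lambda>t. (v' t)\<^sup>2) - 1 / 4 * integral {0..2 * pi} (\<lambda>t. (v t)\<^sup>2)) {0..2 * pi}"
    by (intro has_integral_diff has_integral_mult_right integrable_integral i1 i2)
  have "h t \<le> (v' t)\<^sup>2 - 1 / 4 * (v t)\<^sup>2" for t
  proof (cases "S t = 0")
    case True
    then show ?thesis using zero[OF True, of t] z(1) by (simp add: h_def)
  next
    case False
    have "(cos ((t - t0) / 2))\<^sup>2 = 1 - (S t)\<^sup>2" unfolding S_def by (rule cos_squared_eq)
    then have K2: "(K t)\<^sup>2 = 1 / (S t)\<^sup>2 - 1" using False by (simp add: K_def power_divide field_simps)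
    have "0 \<le> (v' t - 1 / 2 * v t * K t)\<^sup>2" by simp
    also have "\<dots> = (v' t)\<^sup>2 - v t * v' t * K t + 1 / 4 * (v t)\<^sup>2 * (K t)\<^sup>2"
      by (simp add: power2_eq_square algebra_simps)
    also have "\<dots> = (v' t)\<^sup>2 - 1 / 4 * (v t)\<^sup>2 - h t"
      unfolding K2 h_def using False by (simp add: field_simps)
    finally show ?thesis by simp
  qed
  then have "0 \<le> integral {0..2 * pi} (\<lambda>t. (v' t)\<^sup>2) - 1 / 4 * integral {0..2 * pi} (\<lambda>t. (v t)\<^sup>2)"
    by (intro has_integral_le[OF hI sI]) auto
  then show ?thesis by simp
qed

section \<open>Rotations of the plane\<close>

definition perp :: "real^2 \<Rightarrow> real^2" where
  "perp y = (- y $ 2) *\<^sub>R axis 1 1 + y $ 1 *\<^sub>R axis 2 1"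

definition rot :: "real \<Rightarrow> real^2 \<Rightarrow> real^2" where
  "rot t y = cos t *\<^sub>R y + sin t *\<^sub>R perp y"

lemma perp_nth [simp]: "perp y $ 1 = - y $ 2" "perp y $ 2 = y $ 1"
  by (simp_all add: perp_def axis_def)

lemma rot_nth: "rot t y $ 1 = cos t * y $ 1 - sin t * y $ 2" "rot t y $ 2 = cos t * y $ 2 + sin t * y $ 1"
  by (simp_all add: rot_def)

lemma norm_real2_sq: "(norm (v::real^2))\<^sup>2 = (v $ 1)\<^sup>2 + (v $ 2)\<^sup>2"
  unfolding power2_norm_eq_inner inner_vec_def by (simp add: sum_2 power2_eq_square)

lemma norm_rot [simp]: "norm (rot t y) = norm y"
proof -
  have "(c * a - s * b)\<^sup>2 + (c * b + s * a)\<^sup>2 = (c\<^sup>2 + s\<^sup>2) * (a\<^sup>2 + b\<^sup>2)" for a b c s :: real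
    by (simp add: power2_eq_square algebra_simps)
  then have "(norm (rot t y))\<^sup>2 = ((cos t)\<^sup>2 + (sin t)\<^sup>2) * (norm y)\<^sup>2"
    unfolding norm_real2_sq rot_nth .
  then show ?thesis by (simp add: power2_eq_iff_nonneg)
qed

lemma norm_perp [simp]: "norm (perp y) = norm y"
proof -
  have "(norm (perp y))\<^sup>2 = (norm y)\<^sup>2" unfolding norm_real2_sq by simp
  then show ?thesis by (simp add: power2_eq_iff_nonneg)
qed

lemma rot_deriv: "((\<lambda>t. rot t y) has_vector_derivative perp (rot t y)) (at t)"
proof -
  have "((\<lambda>t. rot t y) has_vector_derivative (- sin t *\<^sub>R y + cos t *\<^sub>R perp y)) (at t)"
    unfolding rot_def by (auto intro!: derivative_eq_intros)
  moreover have "- sin t *\<^sub>R y + cos t *\<^sub>R perp y = perp (rot t y)"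
    by (simp add: vec_eq_iff forall_2 rot_nth)
  ultimately show ?thesis by simp
qed

lemma rot_periodic: "rot (t + 2 * pi) y = rot t y"
  by (simp add: rot_def)

lemma rot_transitive:
  assumes "norm p = norm y"
  shows "\<exists>t. rot t y = p"
proof (cases "y = 0")
  case True
  then have "p = 0" using assms by simp
  then show ?thesis using True by (intro exI[of _ 0]) (simp add: rot_def)
next
  case False
  define r where "r = norm y"
  have r: "r > 0" using False by (simp add: r_def)
  have "(y $ 1 / r)\<^sup>2 + (y $ 2 / r)\<^sup>2 = 1" "(p $ 1 / r)\<^sup>2 + (p $ 2 / r)\<^sup>2 = 1"
    using norm_real2_sq[of y] norm_real2_sq[of p] assms r
    by (auto simp: r_def[symmetric] power_divide add_divide_distrib[symmetric])
  then obtain u s where "y $ 1 / r = cos u" "y $ 2 / r = sin u" "p $ 1 / r = cos s" "p $ 2 / r = sin s"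
    using sincos_total_2pi_le by meson
  then have e: "y $ 1 = r * cos u" "y $ 2 = r * sin u" "p $ 1 = r * cos s" "p $ 2 = r * sin s"
    using r by (auto simp: field_simps)
  have s: "s = (s - u) + u" by simp
  have "rot (s - u) y = p"
    unfolding vec_eq_iff forall_2 rot_nth e
    by (subst (3 6) s, simp only: cos_add sin_add) (simp add: algebra_simps)
  then show ?thesis by blast
qed

lemma orthogonal_rot: "orthogonal_transformation (rot t)"
proof -
  have "linear (rot t)"
  proof (rule linearI)
    show "rot t (x + y) = rot t x + rot t y" for x y by (simp add: vec_eq_iff forall_2 rot_nth algebra_simps)
    show "rot t (c *\<^sub>R x) = c *\<^sub>R rot t x" for c x by (simp add: vec_eq_iff forall_2 rot_nth algebra_simps)
  qed
  then show ?thesis by (simp add: orthogonal_transformation)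
qed

lemma rot_inverse: "rot (- t) (rot t y) = y" "rot t (rot (- t) y) = y"
proof -
  have 1: "rot (- t) (rot t y) = y" for t
  proof -
    have "c * (c * a - s * b) + s * (c * b + s * a) = (s\<^sup>2 + c\<^sup>2) * a" for a b c s :: real
      by (simp add: power2_eq_square algebra_simps)
    from this[of "cos t" _ "sin t"]
    have "cos t * (cos t * a - sin t * b) + sin t * (cos t * b + sin t * a) = a" for a b by simp
    moreover have "c * (c * b + s * a) - s * (c * a - s * b) = (s\<^sup>2 + c\<^sup>2) * b" for a b c s :: real
      by (simp add: power2_eq_square algebra_simps)
    from this[of "cos t" _ "sin t"]
    have "cos t * (cos t * b + sin t * a) - sin t * (cos t * a - sin t * b) = b" for a b by simp
    ultimately show ?thesis by (simp add: vec_eq_iff forall_2 rot_nth)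
  qed
  show "rot (- t) (rot t y) = y" by (rule 1)
  show "rot t (rot (- t) y) = y" using 1[of "- t"] by simp
qed

lemma rot_measurable [measurable]: "rot t \<in> borel_measurable borel"
  unfolding rot_def perp_def by (intro borel_measurable_continuous_onI continuous_intros)

text \<open>Boxes determine Lebesgue measure, and their preimages are images under the inverse
  rotation, an orthogonal map, which preserves measure.\<close>

lemma distr_rot: "distr lborel borel (rot t) = lborel"
proof (rule lborel_eqI[symmetric])
  fix l u :: "real^2" assume lu: "\<And>b. b \<in> Basis \<Longrightarrow> l \<bullet> b \<le> u \<bullet> b"
  have im: "rot t -` box l u \<inter> space lborel = rot (- t) ` box l u"
    using rot_inverse by (auto simp: image_iff) metis+
  have bl: "box l u \<in> lmeasurable" by simp
  have l2: "rot (- t) ` box l u \<in> lmeasurable" by (rule measurable_orthogonal_image[OF orthogonal_rot bl])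
  have m: "rot (- t) ` box l u \<in> sets borel"
    unfolding im[symmetric] using measurable_sets[OF rot_measurable, of "box l u" t] by simp
  have "emeasure (distr lborel borel (rot t)) (box l u) = emeasure lborel (rot (- t) ` box l u)"
    by (subst emeasure_distr) (simp_all add: im[symmetric])
  also have "\<dots> = emeasure lebesgue (rot (- t) ` box l u)" using m by simp
  also have "\<dots> = measure lebesgue (rot (- t) ` box l u)" by (rule emeasure_eq_measure2[OF l2])
  also have "\<dots> = measure lebesgue (box l u)" by (simp add: measure_orthogonal_image[OF orthogonal_rot bl])
  also have "\<dots> = (\<Prod>b\<in>Basis. (u - l) \<bullet> b)" using lu by simp
  finally show "emeasure (distr lborel borel (rot t)) (box l u) = ennreal (\<Prod>b\<in>Basis. (u - l) \<bullet> b)" .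
qed simp

lemma nn_integral_rot:
  assumes [measurable]: "F \<in> borel_measurable borel"
  shows "(\<integral>\<^sup>+y. F (rot t y) \<partial>lborel) = (\<integral>\<^sup>+y. F y \<partial>lborel)"
proof -
  have "(\<integral>\<^sup>+y. F y \<partial>lborel) = (\<integral>\<^sup>+y. F y \<partial>distr lborel borel (rot t))" by (simp add: distr_rot)
  also have "\<dots> = (\<integral>\<^sup>+y. F (rot t y) \<partial>lborel)" by (rule nn_integral_distr) measurable
  finally show ?thesis by simp
qed

text \<open>Since \<open>\<Omega>\<close> is simply connected, \<open>\<phi>\<close> has a zero on every circle about \<open>z\<close>.\<close>

lemma angular_orbit:
  fixes \<Omega> :: "(real^2) set"
  assumes "simply_connected \<Omega>" "z \<notin> \<Omega>" "C1c \<Omega> \<phi> G"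
  shows "(\<integral>\<^sup>+t. ennreal ((\<phi> (z + rot t y))\<^sup>2) * indicator {0..2 * pi} t \<partial>lborel) \<le>
    (\<integral>\<^sup>+t. ennreal (4 * (norm y)\<^sup>2 * (norm (G (z + rot t y)))\<^sup>2) * indicator {0..2 * pi} t \<partial>lborel)"
proof -
  note C = C1c_imp_C1[OF assms(3)]
  obtain K where K: "compact K" "K \<subseteq> \<Omega>" "\<And>x. x \<notin> K \<Longrightarrow> \<phi> x = 0" by (rule C1cE[OF assms(3)]) (rule that)
  define v where "v t = \<phi> (z + rot t y)" for t
  define v' where "v' t = G (z + rot t y) \<bullet> perp (rot t y)" for t
  have rc: "continuous_on UNIV (\<lambda>t. rot t y)" unfolding rot_def by (intro continuous_intros)
  have Gc: "continuous_on UNIV (\<lambda>t. G (z + rot t y))"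
    by (intro continuous_on_compose2[OF C1D(2)[OF C]] continuous_intros rc) auto
  have d: "(v has_real_derivative v' t) (at t)" for t
  proof -
    have "((\<lambda>t. z + rot t y) has_vector_derivative perp (rot t y)) (at t)"
      using has_vector_derivative_add[OF has_vector_derivative_const rot_deriv] by simp
    then have "((\<lambda>t. z + rot t y) has_derivative (\<lambda>s. s *\<^sub>R perp (rot t y))) (at t)"
      by (simp add: has_vector_derivative_def)
    from has_derivative_compose[OF this C1D(1)[OF C]]
    have "((\<lambda>t. \<phi> (z + rot t y)) has_vector_derivative v' t) (at t)"
      by (simp add: has_vector_derivative_def v'_def)
    then show ?thesis by (simp add: has_real_derivative_iff_has_vector_derivative v_def[abs_def])
  qed
  have c: "continuous_on UNIV v'"
    unfolding v'_def perp_def by (intro continuous_intros Gc rc)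
  have "\<exists>t0. z + rot t0 y \<notin> K"
  proof (cases "y = 0")
    \<comment> \<open>The orbit of 0 is the single point \<open>z\<close>, which lies outside
      \<open>\<Omega>\<close>.\<close>
    case True
    then have "z + rot 0 y = z" by (simp add: rot_def perp_def)
    then show ?thesis using assms(2) K(2) by (intro exI[of _ 0]) auto
  next
    case False
    then obtain p where p: "norm (p - z) = norm y" "p \<notin> \<Omega>"
      using circle_meets_complement[OF assms(1,2), of "norm y"] by auto
    obtain t0 where "rot t0 y = p - z" using rot_transitive[OF p(1)] by blast
    then have "z + rot t0 y = p" by simp
    then show ?thesis using p(2) K(2) by (intro exI[of _ t0]) auto
  qed
  then obtain t0 where t0: "z + rot t0 y \<notin> K" by blast
  \<comment> \<open>\<open>Wirtinger_with_zero\<close> asks for an interval of zeros; the compact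
    support of \<open>\<phi>\<close> provides one about \<open>t0\<close>.\<close>
  have "open ((\<lambda>t. z + rot t y) -` (- K))"
    using continuous_on_open_vimage[OF open_UNIV, of "\<lambda>t. z + rot t y"] K(1) compact_imp_closed
    by (auto intro!: continuous_intros rc)
  moreover have "t0 \<in> (\<lambda>t. z + rot t y) -` (- K)" using t0 by simp
  ultimately obtain \<delta> where \<delta>: "\<delta> > 0" "ball t0 \<delta> \<subseteq> (\<lambda>t. z + rot t y) -` (- K)"
    by (rule openE) (rule that)
  have z0: "v t = 0" if "\<bar>t - t0\<bar> < \<delta>" for t
  proof -
    have "t \<in> ball t0 \<delta>" using that by (simp add: dist_real_def abs_minus_commute)
    then have "z + rot t y \<notin> K" using \<delta>(2) by auto
    then show ?thesis by (simp add: v_def K(3))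
  qed
  have W: "integral {0..2 * pi} (\<lambda>t. (v t)\<^sup>2) \<le> 4 * integral {0..2 * pi} (\<lambda>t. (v' t)\<^sup>2)"
    by (rule Wirtinger_with_zero[OF d c _ \<delta>(1) z0]) (simp_all add: v_def rot_periodic)
  have vc: "continuous_on UNIV v" by (intro continuous_at_imp_continuous_on ballI DERIV_isCont[OF d])
  have i1: "(\<lambda>t. (v t)\<^sup>2) integrable_on {0..2 * pi}"
    by (intro integrable_continuous_real continuous_intros continuous_on_subset[OF vc]) auto
  have i3: "(\<lambda>t. 4 * (norm y)\<^sup>2 * (norm (G (z + rot t y)))\<^sup>2) integrable_on {0..2 * pi}"
    by (intro integrable_continuous_real continuous_intros continuous_on_subset[OF Gc]) auto
  have i4: "(\<lambda>t. 4 * (v' t)\<^sup>2) integrable_on {0..2 * pi}"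
    by (intro integrable_continuous_real continuous_intros continuous_on_subset[OF c]) auto
  have "4 * integral {0..2 * pi} (\<lambda>t. (v' t)\<^sup>2) = integral {0..2 * pi} (\<lambda>t. 4 * (v' t)\<^sup>2)" by simp
  also have "\<dots> \<le> integral {0..2 * pi} (\<lambda>t. 4 * (norm y)\<^sup>2 * (norm (G (z + rot t y)))\<^sup>2)"
  proof (rule integral_le[OF i4 i3])
    fix t
    have "\<bar>v' t\<bar> \<le> norm (G (z + rot t y)) * norm y"
      unfolding v'_def using Cauchy_Schwarz_ineq2[of "G (z + rot t y)" "perp (rot t y)"] by simp
    then have "(v' t)\<^sup>2 \<le> (norm (G (z + rot t y)) * norm y)\<^sup>2"
      using power_mono[of "\<bar>v' t\<bar>" _ 2] by simp
    then show "4 * (v' t)\<^sup>2 \<le> 4 * (norm y)\<^sup>2 * (norm (G (z + rot t y)))\<^sup>2"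
      by (simp add: power_mult_distrib mult.commute)
  qed
  finally have "integral {0..2 * pi} (\<lambda>t. (v t)\<^sup>2) \<le> integral {0..2 * pi} (\<lambda>t. 4 * (norm y)\<^sup>2 * (norm (G (z + rot t y)))\<^sup>2)"
    using W by linarith
  then show ?thesis
    using nn_integral_has_integral_lebesgue'[OF _ integrable_integral[OF i1]]
      nn_integral_has_integral_lebesgue'[OF _ integrable_integral[OF i3]]
    by (simp add: v_def ennreal_leI)
qed

text \<open>Averaging over rotations about \<open>z\<close> replaces polar coordinates.\<close>

lemma angular_Hardy_nn:
  fixes \<Omega> :: "(real^2) set"
  assumes "simply_connected \<Omega>" "z \<notin> \<Omega>" "C1c \<Omega> \<phi> G" "e > 0"
  shows "(\<integral>\<^sup>+y. ennreal ((\<phi> (z + y))\<^sup>2 / ((norm y)\<^sup>2 + e)) \<partial>lborel) \<le> (\<integral>\<^sup>+y. ennreal (4 * (norm (G (z + y)))\<^sup>2) \<partial>lborel)"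
proof -
  note C = C1c_imp_C1[OF assms(3)]
  have [measurable]: "\<phi> \<in> borel_measurable borel" "G \<in> borel_measurable borel"
    by (auto intro!: borel_measurable_continuous_onI C1_continuous[OF C] C1D(2)[OF C])
  define F where "F y = ennreal ((\<phi> (z + y))\<^sup>2 / ((norm y)\<^sup>2 + e))" for y
  define Q where "Q y = ennreal (4 * (norm (G (z + y)))\<^sup>2)" for y
  have [measurable]: "F \<in> borel_measurable borel" "Q \<in> borel_measurable borel"
    unfolding F_def Q_def by measurable
  have [measurable]: "(\<lambda>p. rot (fst p) (snd p)) \<in> borel_measurable (lborel \<Otimes>\<^sub>M lborel)"
  proof -
    have "(\<lambda>p. rot (fst p) (snd p)) \<in> borel_measurable borel"
      unfolding rot_def perp_def by (intro borel_measurable_continuous_onI continuous_intros)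
    then show ?thesis by (simp add: lborel_prod)
  qed
  define I where "I = (indicator {0..2 * pi} :: real \<Rightarrow> ennreal)"
  have [measurable]: "I \<in> borel_measurable borel" unfolding I_def by simp
  have II: "(\<integral>\<^sup>+t. I t \<partial>lborel) = ennreal (2 * pi)" unfolding I_def by simp
  have swap: "(\<integral>\<^sup>+y. \<integral>\<^sup>+t. R (rot t y) * I t \<partial>lborel \<partial>lborel) = ennreal (2 * pi) * (\<integral>\<^sup>+y. R y \<partial>lborel)"
    if [measurable]: "R \<in> borel_measurable borel" for R
  proof -
    have "(\<lambda>p. R (rot (fst p) (snd p)) * I (fst p)) \<in> borel_measurable (lborel \<Otimes>\<^sub>M lborel)"
      by measurable
    from lborel_pair.Fubini[OF this]
    have "(\<integral>\<^sup>+y. \<integral>\<^sup>+t. R (rot t y) * I t \<partial>lborel \<partial>lborel) = (\<integral>\<^sup>+t. \<integral>\<^sup>+y. R (rot t y) * I t \<partial>lborel \<partial>lborel)"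
      by simp
    also have "\<dots> = (\<integral>\<^sup>+t. (\<integral>\<^sup>+y. R y \<partial>lborel) * I t \<partial>lborel)"
    proof (rule nn_integral_cong)
      fix t
      have "(\<integral>\<^sup>+y. R (rot t y) * I t \<partial>lborel) = (\<integral>\<^sup>+y. R (rot t y) \<partial>lborel) * I t"
        by (rule nn_integral_multc) measurable
      then show "(\<integral>\<^sup>+y. R (rot t y) * I t \<partial>lborel) = (\<integral>\<^sup>+y. R y \<partial>lborel) * I t"
        by (simp add: nn_integral_rot)
    qed
    also have "\<dots> = (\<integral>\<^sup>+y. R y \<partial>lborel) * (\<integral>\<^sup>+t. I t \<partial>lborel)" by (rule nn_integral_cmult) measurable
    finally show ?thesis by (simp add: II mult.commute)
  qed
  have orbit: "(\<integral>\<^sup>+t. F (rot t y) * I t \<partial>lborel) \<le> (\<integral>\<^sup>+t. Q (rot t y) * I t \<partial>lborel)" for y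
  proof -
    define c where "c = 1 / ((norm y)\<^sup>2 + e)"
    have c: "c \<ge> 0" "c * (norm y)\<^sup>2 \<le> 1"
      using assms(4) by (auto simp: c_def divide_le_eq add_nonneg_pos)
    have "(\<integral>\<^sup>+t. F (rot t y) * I t \<partial>lborel) = (\<integral>\<^sup>+t. ennreal c * (ennreal ((\<phi> (z + rot t y))\<^sup>2) * I t) \<partial>lborel)"
      using c(1) by (simp add: F_def c_def divide_inverse ennreal_mult'[symmetric] mult.assoc[symmetric])
         (simp add: mult.commute)
    also have "\<dots> = ennreal c * (\<integral>\<^sup>+t. ennreal ((\<phi> (z + rot t y))\<^sup>2) * I t \<partial>lborel)"
    proof (rule nn_integral_cmult)
      have "(\<lambda>t. rot t y) \<in> borel_measurable borel" unfolding rot_def by measurable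
      then show "(\<lambda>t. ennreal ((\<phi> (z + rot t y))\<^sup>2) * I t) \<in> borel_measurable lborel" by measurable
    qed
    also have "\<dots> \<le> ennreal c * (\<integral>\<^sup>+t. ennreal (4 * (norm y)\<^sup>2 * (norm (G (z + rot t y)))\<^sup>2) * I t \<partial>lborel)"
      unfolding I_def by (intro mult_left_mono angular_orbit[OF assms(1,2,3)]) simp
    also have "\<dots> = (\<integral>\<^sup>+t. ennreal c * (ennreal (4 * (norm y)\<^sup>2 * (norm (G (z + rot t y)))\<^sup>2) * I t) \<partial>lborel)"
    proof (rule nn_integral_cmult[symmetric])
      have "(\<lambda>t. rot t y) \<in> borel_measurable borel" unfolding rot_def by measurable
      then show "(\<lambda>t. ennreal (4 * (norm y)\<^sup>2 * (norm (G (z + rot t y)))\<^sup>2) * I t) \<in> borel_measurable lborel" by measurable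
    qed
    also have "\<dots> \<le> (\<integral>\<^sup>+t. Q (rot t y) * I t \<partial>lborel)"
    proof (rule nn_integral_mono)
      fix t
      have "c * (4 * (norm y)\<^sup>2 * (norm (G (z + rot t y)))\<^sup>2) = (c * (norm y)\<^sup>2) * (4 * (norm (G (z + rot t y)))\<^sup>2)" by simp
      also have "\<dots> \<le> 1 * (4 * (norm (G (z + rot t y)))\<^sup>2)" using c by (intro mult_right_mono) auto
      finally have "ennreal (c * (4 * (norm y)\<^sup>2 * (norm (G (z + rot t y)))\<^sup>2)) \<le> Q (rot t y)"
        unfolding Q_def by (intro ennreal_leI) simp
      then show "ennreal c * (ennreal (4 * (norm y)\<^sup>2 * (norm (G (z + rot t y)))\<^sup>2) * I t) \<le> Q (rot t y) * I t"
        using c(1) by (simp add: ennreal_mult' mult.assoc[symmetric] mult_right_mono)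
    qed
    finally show ?thesis .
  qed
  have "ennreal (2 * pi) * (\<integral>\<^sup>+y. F y \<partial>lborel) \<le> ennreal (2 * pi) * (\<integral>\<^sup>+y. Q y \<partial>lborel)"
    unfolding swap[symmetric, OF \<open>F \<in> borel_measurable borel\<close>] swap[symmetric, OF \<open>Q \<in> borel_measurable borel\<close>]
    by (intro nn_integral_mono orbit)
  then have "(\<integral>\<^sup>+y. F y \<partial>lborel) \<le> (\<integral>\<^sup>+y. Q y \<partial>lborel)"
    by (subst (asm) ennreal_mult_le_mult_iff) auto
  then show ?thesis by (simp add: F_def Q_def)
qed

lemma angular_Hardy_C1c:
  fixes \<Omega> :: "(real^2) set"
  assumes "simply_connected \<Omega>" "z \<notin> \<Omega>" "C1c \<Omega> \<phi> G" "e > 0"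
  shows "(LINT x|lebesgue. (\<phi> x)\<^sup>2 / ((norm (x - z))\<^sup>2 + e)) \<le> 4 * sq_norm lebesgue G"
proof -
  note C = C1c_imp_C1[OF assms(3)]
  obtain K where K: "compact K" "\<And>x. x \<notin> K \<Longrightarrow> \<phi> x = 0" "\<And>x. x \<notin> K \<Longrightarrow> G x = 0" by (rule C1cE[OF assms(3)]) (rule that)
  have pos: "(norm v)\<^sup>2 + e \<noteq> 0" for v :: "real^2" using assms(4) by (smt (verit) zero_le_power2)
  have Fc: "continuous_on UNIV (\<lambda>x. (\<phi> x)\<^sup>2 / ((norm (x - z))\<^sup>2 + e))"
    using pos by (intro continuous_intros C1_continuous[OF C]) auto
  have Fc': "continuous_on UNIV (\<lambda>y. (\<phi> (z + y))\<^sup>2 / ((norm y)\<^sup>2 + e))"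
    using pos by (intro continuous_intros continuous_on_compose2[OF C1_continuous[OF C]]) auto
  have Gc: "continuous_on UNIV (\<lambda>x. 4 * (norm (G x))\<^sup>2)" by (intro continuous_intros C1D(2)[OF C])
  have Gc': "continuous_on UNIV (\<lambda>y. 4 * (norm (G (z + y)))\<^sup>2)"
    by (intro continuous_intros continuous_on_compose2[OF C1D(2)[OF C]]) auto
  have Kz: "compact ((\<lambda>x. - z + x) ` K)" by (rule compact_translation[OF K(1)])
  have Kz2: "z + y \<notin> K" if "y \<notin> (\<lambda>x. - z + x) ` K" for y using that by force
  have i1: "integrable lborel (\<lambda>y. (\<phi> (z + y))\<^sup>2 / ((norm y)\<^sup>2 + e))"
    using compact_support_integrable[OF Fc' Kz] K(2)[OF Kz2] borel_measurable_continuous_onI[OF Fc']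
    by (simp add: integrable_completion)
  have i2: "integrable lborel (\<lambda>y. 4 * (norm (G (z + y)))\<^sup>2)"
    using compact_support_integrable[OF Gc' Kz] K(3)[OF Kz2] borel_measurable_continuous_onI[OF Gc']
      integrable_completion[of "\<lambda>y. 4 * (norm (G (z + y)))\<^sup>2" lborel] by simp
  have "ennreal (LINT y|lborel. (\<phi> (z + y))\<^sup>2 / ((norm y)\<^sup>2 + e)) \<le> ennreal (LINT y|lborel. 4 * (norm (G (z + y)))\<^sup>2)"
    using angular_Hardy_nn[OF assms] assms(4)
    by (subst (asm) nn_integral_eq_integral[OF i1], simp, subst (asm) nn_integral_eq_integral[OF i2]) auto
  then have "(LINT y|lborel. (\<phi> (z + y))\<^sup>2 / ((norm y)\<^sup>2 + e)) \<le> (LINT y|lborel. 4 * (norm (G (z + y)))\<^sup>2)"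
    by (simp add: ennreal_le_iff)
  moreover have "(LINT y|lborel. (\<phi> (z + y))\<^sup>2 / ((norm y)\<^sup>2 + e)) = (LINT x|lebesgue. (\<phi> x)\<^sup>2 / ((norm (x - z))\<^sup>2 + e))"
    using lebesgue_integral_translate[OF borel_measurable_continuous_onI[OF Fc], of z]
      integral_completion[of "\<lambda>y. (\<phi> (z + y))\<^sup>2 / ((norm y)\<^sup>2 + e)" lborel] borel_measurable_continuous_onI[OF Fc'] by simp
  moreover have "(LINT y|lborel. 4 * (norm (G (z + y)))\<^sup>2) = (LINT x|lebesgue. 4 * (norm (G x))\<^sup>2)"
    using lebesgue_integral_translate[OF borel_measurable_continuous_onI[OF Gc], of z]
      integral_completion[of "\<lambda>y. 4 * (norm (G (z + y)))\<^sup>2" lborel] borel_measurable_continuous_onI[OF Gc'] by simp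
  ultimately show ?thesis by (simp add: sq_norm_def)
qed

text \<open>For \<open>e > 0\<close> the weight is bounded, so both sides pass to L2 limits. The
  parameter is never sent to 0: the weighted estimate takes it proportional to its own
  regularisation parameter.\<close>

lemma angular_Hardy:
  fixes \<Omega> :: "(real^2) set"
  assumes "simply_connected \<Omega>" "z \<notin> \<Omega>" "h10 \<Omega> v h" "e > 0"
  shows "integrable lebesgue (\<lambda>x. (v x)\<^sup>2 / ((norm (x - z))\<^sup>2 + e))"
    "(LINT x|lebesgue. (v x)\<^sup>2 / ((norm (x - z))\<^sup>2 + e)) \<le> 4 * sq_norm lebesgue h"
proof -
  obtain \<phi> G where 1: "\<And>n::nat. C1c \<Omega> (\<phi> n) (G n)" "sq_lim lebesgue \<phi> v" "sq_lim lebesgue G h"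
    by (rule h10E[OF assms(3)]) (rule that)
  define a where "a x = 1 / ((norm (x - z))\<^sup>2 + e)" for x
  have pos: "(norm (x - z))\<^sup>2 + e > 0" for x using assms(4) by (simp add: add_nonneg_pos)
  have "continuous_on UNIV a" unfolding a_def using pos by (intro continuous_intros) (auto simp: less_imp_neq[symmetric])
  then have am: "a \<in> borel_measurable lebesgue" by (rule continuous_imp_lebesgue_measurable)
  have ab: "\<bar>a x\<bar> \<le> 1 / e" for x
  proof -
    have "1 / ((norm (x - z))\<^sup>2 + e) \<le> 1 / e" using assms(4) by (intro divide_left_mono) (auto intro: mult_pos_pos[OF pos])
    then show ?thesis using pos[of x] by (simp add: a_def abs_of_pos)
  qed
  have s: "sq_lim lebesgue (\<lambda>n x. a x * \<phi> n x) (\<lambda>x. a x * v x)"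
    using sq_lim_mult[OF 1(2) am ab] by simp
  have e: "a x * w * w = w\<^sup>2 / ((norm (x - z))\<^sup>2 + e)" for x w by (simp add: a_def power2_eq_square)
  have "(LINT x|lebesgue. a x * v x * v x) \<le> 4 * sq_norm lebesgue h"
    using angular_Hardy_C1c[OF assms(1,2) 1(1) assms(4)]
    by (intro LIMSEQ_le[OF sq_lim_mult_int[OF s 1(2)] tendsto_mult_left[OF sq_lim_norm[OF 1(3)]]]) (auto simp: e)
  then show "(LINT x|lebesgue. (v x)\<^sup>2 / ((norm (x - z))\<^sup>2 + e)) \<le> 4 * sq_norm lebesgue h" by (simp add: e)
  have "integrable lebesgue (\<lambda>x. a x * v x * v x)"
    by (rule integrable_mult_sq_int[OF sq_limD(2)[OF s] sq_limD(2)[OF 1(2)]])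
  then show "integrable lebesgue (\<lambda>x. (v x)\<^sup>2 / ((norm (x - z))\<^sup>2 + e))" by (simp add: e)
qed

subsection \<open>Bounds for solutions\<close>

text \<open>Completing the square in the gradient of \<open>p * w\<close>; the last integral is the
  weak form of an equation tested with \<open>p\<^sup>2 * w\<close>. The identity is kept separate
  from any equation, because the decay estimate applies it to differences of solutions, which
  satisfy an equation only locally.\<close>

lemma h10_mult_energy:
  assumes "h10 U w g" "C1 p P" "\<And>x. \<bar>p x\<bar> \<le> B" "\<And>x. norm (P x) \<le> B"
  defines "h \<equiv> \<lambda>x. p x *\<^sub>R (p x *\<^sub>R g x + w x *\<^sub>R P x) + (p x * w x) *\<^sub>R P x"
  shows "h10 U (\<lambda>x. p x * (p x * w x)) h"
    "sq_norm lebesgue (\<lambda>x. p x *\<^sub>R g x + w x *\<^sub>R P x) =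
      (LINT x|lebesgue. (w x)\<^sup>2 * (norm (P x))\<^sup>2) + (LINT x|lebesgue. g x \<bullet> h x)"
proof -
  note W = h10_sq_int[OF assms(1)]
  have pm: "P \<in> borel_measurable lebesgue"
    by (auto intro!: continuous_imp_lebesgue_measurable C1D(2)[OF assms(2)])
  show h2: "h10 U (\<lambda>x. p x * (p x * w x)) h"
    unfolding h_def by (rule h10_mult[OF h10_mult[OF assms(1-4)] assms(2-4)])
  have wP: "sq_int lebesgue (\<lambda>x. w x *\<^sub>R P x)" by (rule sq_int_mult_vec[OF W(1) pm assms(4)])
  have i1: "integrable lebesgue (\<lambda>x. (w x *\<^sub>R P x) \<bullet> (w x *\<^sub>R P x))" by (rule integrable_inner_sq_int[OF wP wP])
  have i2: "integrable lebesgue (\<lambda>x. g x \<bullet> h x)" by (rule integrable_inner_sq_int[OF W(2) h10_sq_int(2)[OF h2]])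
  have "sq_norm lebesgue (\<lambda>x. p x *\<^sub>R g x + w x *\<^sub>R P x) = (LINT x|lebesgue. (w x *\<^sub>R P x) \<bullet> (w x *\<^sub>R P x) + g x \<bullet> h x)"
    unfolding sq_norm_def power2_norm_eq_inner h_def
    by (intro Bochner_Integration.integral_cong refl)
       (simp only: inner_add_left inner_add_right inner_scaleR_left inner_scaleR_right,
        simp add: inner_commute[of "P _" "g _"] algebra_simps)
  also have "\<dots> = (LINT x|lebesgue. (w x *\<^sub>R P x) \<bullet> (w x *\<^sub>R P x)) + (LINT x|lebesgue. g x \<bullet> h x)"
    by (rule Bochner_Integration.integral_add[OF i1 i2])
  also have "(\<lambda>x. (w x *\<^sub>R P x) \<bullet> (w x *\<^sub>R P x)) = (\<lambda>x. (w x)\<^sup>2 * (norm (P x))\<^sup>2)"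
    unfolding power2_norm_eq_inner by (simp add: power2_eq_square mult.assoc)
  finally show "sq_norm lebesgue (\<lambda>x. p x *\<^sub>R g x + w x *\<^sub>R P x) =
      (LINT x|lebesgue. (w x)\<^sup>2 * (norm (P x))\<^sup>2) + (LINT x|lebesgue. g x \<bullet> h x)" .
qed

lemma wsol_energy:
  assumes "wsol U f w g" "C1 p P" "\<And>x. \<bar>p x\<bar> \<le> B" "\<And>x. norm (P x) \<le> B"
  shows "sq_norm lebesgue (\<lambda>x. p x *\<^sub>R g x + w x *\<^sub>R P x) =
    (LINT x|lebesgue. (w x)\<^sup>2 * (norm (P x))\<^sup>2) + (LINT x|lebesgue. f x * ((p x)\<^sup>2 * w x))"
  unfolding h10_mult_energy(2)[OF wsolD(1)[OF assms(1)] assms(2-4)]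
    wsol_test[OF assms(1) h10_mult_energy(1)[OF wsolD(1)[OF assms(1)] assms(2-4)]]
  by (simp add: power2_eq_square mult.assoc)

lemma bounded_weight_integrable:
  fixes w a :: "real^2 \<Rightarrow> real"
  assumes "sq_int lebesgue w" "a \<in> borel_measurable lebesgue" "\<And>x. \<bar>a x\<bar> \<le> B"
  shows "integrable lebesgue (\<lambda>x. (w x)\<^sup>2 * a x)"
  using integrable_mult_sq_int[OF sq_int_mult_real[OF assms] assms(1)] by (simp add: power2_eq_square mult_ac)

lemma cball_weight_integrable:
  fixes w :: "real^2 \<Rightarrow> real"
  assumes "sq_int lebesgue w"
  shows "integrable lebesgue (\<lambda>x. (w x)\<^sup>2 * indicator (cball z r) x)"
proof (rule bounded_weight_integrable[OF assms, where B = 1])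
  show "(indicator (cball z r) :: real^2 \<Rightarrow> real) \<in> borel_measurable lebesgue"
    using sq_int_measurable[OF sq_int_indicator[OF lmeasurable_cball]] .
qed (simp add: indicator_def)

text \<open>Poincare's inequality for \<open>hat\<^sup>2 w\<close>, centred at \<open>x\<close>, bounds the mean of \<open>\<bar>w\<bar>\<close>.\<close>

lemma wsol_sup_step:
  assumes "wsol U f w g" "AE x in lebesgue. \<bar>f x\<bar> \<le> 1" "\<And>x. \<bar>w x\<bar> \<le> M" "M > 0" "lam > 0"
    and poincare: "\<And>v h. h10 U v h \<Longrightarrow> lam * sq_norm lebesgue v \<le> sq_norm lebesgue h"
    and cont: "isCont (\<lambda>y. \<bar>w y\<bar>) x"
  shows "\<bar>w x\<bar> \<le> M / 4 + sqrt (19 * M / (9 * lam))"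
proof -
  note W = wsolD[OF assms(1)]
  \<comment> \<open>With this radius the drift \<open>b / 24\<close> is \<open>M / 4\<close>, and
    the bound \<open>(20 * M\<^sup>2 / (3 * b) + M) / lam\<close> for the square of the mean becomes
    \<open>19 * M / (9 * lam)\<close>.\<close>
  define b where "b = 6 * M"
  have b: "b > 0" using assms(4) by (simp add: b_def)
  define t where "t y = (norm (y - x))\<^sup>2" for y
  define p where "p y = hat b (t y) ^ 2" for y
  define P where "P y = (2 * (- (2 / b) * hat b (t y))) *\<^sub>R (y - x)" for y
  have d: "((\<lambda>s. hat b s ^ 2) has_real_derivative - (2 / b) * hat b s) (at s)" for s
    using hat_power_deriv[OF b, of 0 s] by (simp add: numeral_2_eq_2)
  have c: "continuous_on {0..} (\<lambda>s. - (2 / b) * hat b s)" by (intro continuous_intros)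
  have C: "C1 p P" unfolding p_def P_def t_def by (rule C1_radial[OF d c])
  have Cc: "C1c UNIV p P"
    by (rule C1cI[OF C compact_cball[of x "sqrt b"] subset_UNIV])
       (simp add: p_def t_def sq_gt_hat_0[OF b] dist_norm norm_minus_commute)
  obtain B where B: "B > 0" "\<And>y. \<bar>p y\<bar> \<le> B" "\<And>y. norm (P y) \<le> B" by (rule C1c_bounded[OF Cc]) (rule that)
  have pL: "sq_int lebesgue p" by (rule C1c_sq_int[OF Cc])
  have PN: "(norm (P y))\<^sup>2 = 16 / b * (hat b (t y) ^ Suc 1 - hat b (t y) ^ Suc 2)" for y
  proof -
    \<comment> \<open>Trades the factor \<open>t\<close> for powers of \<open>hat\<close>, so that
      the integral of the squared gradient reduces to \<open>hat_power_integral\<close>.\<close>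
    have tb: "t y * hat b (t y) = b * (hat b (t y) - hat b (t y) ^ 2)"
      using b by (auto simp: hat_def max_def field_simps power2_eq_square)
    have "norm (P y) = 4 / b * hat b (t y) * norm (y - x)"
      using b hat_nonneg[of b "t y"] by (simp add: P_def abs_mult)
    then have "(norm (P y))\<^sup>2 = 16 / b\<^sup>2 * (hat b (t y) * (t y * hat b (t y)))"
      by (simp add: t_def power_mult_distrib power_divide power2_eq_square)
    also have "\<dots> = 16 / b * (hat b (t y) ^ Suc 1 - hat b (t y) ^ Suc 2)"
      unfolding tb using b by (simp add: power2_eq_square field_simps eval_nat_numeral)
    finally show ?thesis .
  qed
  have Pint: "integrable lebesgue (\<lambda>y. (norm (P y))\<^sup>2)" by (rule sq_int_integrable[OF C1c_sq_int(2)[OF Cc]])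
  have PI: "(LINT y|lebesgue. (norm (P y))\<^sup>2) = 4 * pi / 3"
  proof -
    have "(LINT y|lebesgue. (norm (P y))\<^sup>2) = 16 / b * (LINT y|lebesgue. hat b (t y) ^ Suc 1 - hat b (t y) ^ Suc 2)"
      unfolding PN by (rule integral_mult_right_zero)
    also have "(LINT y|lebesgue. hat b (t y) ^ Suc 1 - hat b (t y) ^ Suc 2) = pi * b / (real 1 + 2) - pi * b / (real 2 + 2)"
      unfolding t_def Bochner_Integration.integral_diff[OF hat_power_integral(1)[OF b] hat_power_integral(1)[OF b]]
        hat_power_integral(2)[OF b] ..
    also have "16 / b * (pi * b / (real 1 + 2) - pi * b / (real 2 + 2)) = 4 * pi / 3" using b by (simp add: field_simps)
    finally show ?thesis .
  qed
  have p4: "(p y)\<^sup>2 = hat b (t y) ^ Suc 3" for y by (simp add: p_def power_mult[symmetric])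
  have p2i: "integrable lebesgue (\<lambda>y. (p y)\<^sup>2)" using hat_power_integral(1)[OF b, of x 3] by (simp add: p4 t_def)
  have p2I: "(LINT y|lebesgue. (p y)\<^sup>2) = pi * b / 5" using hat_power_integral(2)[OF b, of x 3] by (simp add: p4 t_def)
  have pwL: "sq_int lebesgue (\<lambda>y. p y * \<bar>w y\<bar>)"
    by (rule sq_int_mult_real[OF sq_int_abs[OF W(3)] sq_int_measurable[OF pL] B(2)])
  define J where "J = sq_norm lebesgue (\<lambda>y. p y * \<bar>w y\<bar>)"
  have J': "J = sq_norm lebesgue (\<lambda>y. p y * w y)" unfolding J_def sq_norm_def by (simp add: abs_mult)
  have 1: "lam * J \<le> M\<^sup>2 * (4 * pi / 3) + M * (pi * b / 5)"
  proof -
    have "lam * J \<le> sq_norm lebesgue (\<lambda>y. p y *\<^sub>R g y + w y *\<^sub>R P y)"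
      unfolding J' by (rule poincare[OF h10_mult[OF W(1) C B(2,3)]])
    also have "\<dots> = (LINT y|lebesgue. (w y)\<^sup>2 * (norm (P y))\<^sup>2) + (LINT y|lebesgue. f y * ((p y)\<^sup>2 * w y))"
      by (rule wsol_energy[OF assms(1) C B(2,3)])
    also have "(LINT y|lebesgue. (w y)\<^sup>2 * (norm (P y))\<^sup>2) \<le> (LINT y|lebesgue. M\<^sup>2 * (norm (P y))\<^sup>2)"
    proof (rule integral_mono)
      show "integrable lebesgue (\<lambda>y. (w y)\<^sup>2 * (norm (P y))\<^sup>2)"
      proof (rule bounded_weight_integrable[OF W(3), where B = "B\<^sup>2"])
        show "(\<lambda>y. (norm (P y))\<^sup>2) \<in> borel_measurable lebesgue" using Pint by auto
        show "\<bar>(norm (P y))\<^sup>2\<bar> \<le> B\<^sup>2" for y using B(3)[of y] by (simp add: power_mono)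
      qed
      show "(w y)\<^sup>2 * (norm (P y))\<^sup>2 \<le> M\<^sup>2 * (norm (P y))\<^sup>2" for y
        using power_mono[OF assms(3)[of y], of 2] by (intro mult_right_mono) auto
    qed (use Pint in simp)
    also have "\<dots> = M\<^sup>2 * (4 * pi / 3)" by (simp add: PI)
    also have "(LINT y|lebesgue. f y * ((p y)\<^sup>2 * w y)) \<le> (LINT y|lebesgue. M * (p y)\<^sup>2)"
    proof (rule integral_mono_AE)
      have "sq_int lebesgue (\<lambda>y. p y * (p y * w y))"
        by (rule sq_int_mult_real[OF sq_int_mult_real[OF W(3) sq_int_measurable[OF pL] B(2)] sq_int_measurable[OF pL] B(2)])
      from integrable_mult_sq_int[OF W(2) this]
      show "integrable lebesgue (\<lambda>y. f y * ((p y)\<^sup>2 * w y))" by (simp add: power2_eq_square mult_ac)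
      show "AE y in lebesgue. f y * ((p y)\<^sup>2 * w y) \<le> M * (p y)\<^sup>2"
        using assms(2)
      proof eventually_elim
        case (elim y)
        have "f y * w y \<le> \<bar>f y\<bar> * \<bar>w y\<bar>" by (metis abs_ge_self abs_mult)
        also have "\<dots> \<le> 1 * M" using elim assms(3)[of y] by (intro mult_mono) auto
        finally have "f y * w y * (p y)\<^sup>2 \<le> M * (p y)\<^sup>2" by (intro mult_right_mono) auto
        then show ?case by (simp add: mult_ac)
      qed
    qed (use p2i in simp)
    also have "\<dots> = M * (pi * b / 5)" by (simp add: p2I)
    finally show ?thesis by simp
  qed
  define m where "m = kmean (\<lambda>y. \<bar>w y\<bar>) b x"
  have m: "m = 5 / (pi * b) * (LINT y|lebesgue. p y * (p y * \<bar>w y\<bar>))"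
  proof -
    have "m = (LINT y|lebesgue. 5 / (pi * b) * (p y * (p y * \<bar>w y\<bar>)))"
      unfolding m_def kmean_def
      by (intro Bochner_Integration.integral_cong refl) (simp add: kap_def p_def t_def power2_eq_square power4_eq_xxxx)
    then show ?thesis by (simp only: integral_mult_right_zero)
  qed
  have "(LINT y|lebesgue. p y * (p y * \<bar>w y\<bar>))\<^sup>2 \<le> sq_norm lebesgue p * J"
    using sq_int_Cauchy_Schwarz[OF pL pwL] by (simp add: J_def)
  also have "sq_norm lebesgue p = pi * b / 5" using p2I by (simp add: sq_norm_def)
  finally have "m\<^sup>2 \<le> (5 / (pi * b))\<^sup>2 * (pi * b / 5 * J)"
    unfolding m power_mult_distrib by (intro mult_left_mono) auto
  also have "\<dots> = 5 / (pi * b) * J" using b by (simp add: field_simps power2_eq_square)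
  finally have "lam * m\<^sup>2 \<le> lam * (5 / (pi * b) * J)" using assms(5) by (intro mult_left_mono) auto
  also have "\<dots> = 5 / (pi * b) * (lam * J)" by simp
  also have "\<dots> \<le> 5 / (pi * b) * (M\<^sup>2 * (4 * pi / 3) + M * (pi * b / 5))" using 1 b by (intro mult_left_mono) auto
  also have "\<dots> = 19 * M / 9" using assms(4) by (simp add: b_def field_simps power2_eq_square)
  finally have "m\<^sup>2 \<le> 19 * M / (9 * lam)" using assms(5) by (simp add: field_simps)
  then have "m \<le> sqrt (19 * M / (9 * lam))" by (rule real_le_rsqrt)
  moreover have "\<bar>w x\<bar> \<le> m + 1 * b / 24" unfolding m_def by (rule wsol_submean[OF assms(1,2) cont b])
  ultimately show ?thesis by (simp add: b_def)
qed

text \<open>The step inequality holds for the supremum \<open>M\<close> itself: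
  \<open>3 / 4 * M \<le> sqrt (19 * M / (9 * lam))\<close>, and 304/81 is 16/9 times 19/9.\<close>

lemma wsol_sup_bound:
  assumes "wsol U f w g" "AE x in lebesgue. \<bar>f x\<bar> \<le> 1" "lam > 0"
    and poincare: "\<And>v h. h10 U v h \<Longrightarrow> lam * sq_norm lebesgue v \<le> sq_norm lebesgue h"
    and cont: "\<And>x. x \<in> U \<Longrightarrow> isCont w x" and zero: "\<And>x. x \<notin> U \<Longrightarrow> w x = 0"
  shows "\<bar>w x\<bar> \<le> 304 / 81 / lam"
proof -
  note W = wsolD[OF assms(1)]
  have ca: "isCont (\<lambda>y. \<bar>w y\<bar>) x" if "x \<in> U" for x using cont[OF that] by (intro continuous_intros)
  \<comment> \<open>A crude bound at scale 1. It makes the supremum finite, so that the step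
    inequality can be solved for it.\<close>
  define C where "C = sqrt (25 / (9 * pi * 1)) * sqrt (sq_norm lebesgue (\<lambda>y. \<bar>w y\<bar>)) + 1 / 24"
  have C: "\<bar>w x\<bar> \<le> C" for x
  proof (cases "x \<in> U")
    case True
    show ?thesis
      using wsol_submean[OF assms(1,2) ca[OF True] zero_less_one] kmean_abs_le[OF sq_int_abs[OF W(3)] zero_less_one, of x]
      unfolding C_def by linarith
  next
    case False
    then show ?thesis by (simp add: zero C_def sq_norm_nonneg)
  qed
  have bdd: "bdd_above (range (\<lambda>x. \<bar>w x\<bar>))" using C by (intro bdd_aboveI2[of _ _ C]) auto
  define M where "M = (SUP x. \<bar>w x\<bar>)"
  have M: "\<bar>w x\<bar> \<le> M" for x unfolding M_def by (rule cSUP_upper[OF UNIV_I bdd])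
  have M0: "M \<ge> 0" using M[of undefined] by linarith
  have "M \<le> 304 / 81 / lam"
  proof (cases "M = 0")
    case False
    then have Mp: "M > 0" using M0 by simp
    have "\<bar>w x\<bar> \<le> M / 4 + sqrt (19 * M / (9 * lam))" for x
    proof (cases "x \<in> U")
      case True
      then show ?thesis by (intro wsol_sup_step[OF assms(1,2) M Mp assms(3) poincare ca])
    next
      case False
      then show ?thesis using Mp assms(3) by (simp add: zero)
    qed
    then have "M \<le> M / 4 + sqrt (19 * M / (9 * lam))" unfolding M_def by (intro cSUP_least) auto
    then have "3 / 4 * M \<le> sqrt (19 * M / (9 * lam))" by simp
    then have "(3 / 4 * M)\<^sup>2 \<le> (sqrt (19 * M / (9 * lam)))\<^sup>2" using Mp by (intro power_mono) auto
    also have "\<dots> = 19 * M / (9 * lam)" using Mp assms(3) by simp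
    finally show ?thesis using Mp assms(3) by (simp add: field_simps power2_eq_square)
  qed (use assms(3) in simp)
  then show ?thesis using M[of x] by linarith
qed

section \<open>The weighted estimate near a boundary point\<close>

lemma radial_cost_integrals:
  fixes z :: "real^2"
  assumes "b > 0"
  defines "g1 \<equiv> \<lambda>r. 1 / r * (4 * hat b (r\<^sup>2) ^ 3 / b + 16 * r\<^sup>2 * hat b (r\<^sup>2) ^ 2 / b\<^sup>2)"
    and "g2 \<equiv> \<lambda>r. 1 / r * hat b (r\<^sup>2) ^ 4"
  shows "integrable lebesgue (\<lambda>x. g1 (norm (x - z)))" "(LINT x|lebesgue. g1 (norm (x - z))) = 128 / 21 * pi / sqrt b"
    "integrable lebesgue (\<lambda>x. g2 (norm (x - z)))" "(LINT x|lebesgue. g2 (norm (x - z))) = 256 / 315 * pi * sqrt b"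
proof -
  define R where "R = sqrt b"
  have R: "R > 0" "b = R\<^sup>2" using assms(1) by (auto simp: R_def)
  have hz: "hat b (r\<^sup>2) = 0" if "r > R" for r
  proof -
    have "r\<^sup>2 \<ge> R\<^sup>2" using that R(1) by (intro power_mono) auto
    then show ?thesis using R(2) assms(1) by (intro hat_eq_0) auto
  qed
  have he: "hat b (r\<^sup>2) = 1 - r\<^sup>2 / b" if "0 \<le> r" "r \<le> R" for r
  proof -
    have "r\<^sup>2 \<le> R\<^sup>2" using that by (intro power_mono) auto
    then show ?thesis using R(2) assms(1) by (intro hat_eq) auto
  qed
  define f1 where "f1 r = 2 * pi * (4 * (1 - r\<^sup>2 / b) ^ 3 / b + 16 * r\<^sup>2 * (1 - r\<^sup>2 / b) ^ 2 / b\<^sup>2)" for r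
  define f2 where "f2 r = 2 * pi * (1 - r\<^sup>2 / b) ^ 4" for r
  define F1 where "F1 r = 2 * pi * (4 / b * (r - r ^ 3 / b + 3 * r ^ 5 / (5 * b\<^sup>2) - r ^ 7 / (7 * b ^ 3))
      + 16 / b\<^sup>2 * (r ^ 3 / 3 - 2 * r ^ 5 / (5 * b) + r ^ 7 / (7 * b\<^sup>2)))" for r
  define F2 where "F2 r = 2 * pi * (r - 4 * r ^ 3 / (3 * b) + 6 * r ^ 5 / (5 * b\<^sup>2) - 4 * r ^ 7 / (7 * b ^ 3) + r ^ 9 / (9 * b ^ 4))" for r
  have F1: "(F1 has_real_derivative f1 r) (at r)" for r
    unfolding F1_def f1_def using assms(1)
    by (auto intro!: derivative_eq_intros simp: field_simps eval_nat_numeral)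
  have F2: "(F2 has_real_derivative f2 r) (at r)" for r
    unfolding F2_def f2_def using assms(1)
    by (auto intro!: derivative_eq_intros simp: field_simps eval_nat_numeral)
  have c1: "continuous_on {0..R} f1" unfolding f1_def by (intro continuous_intros) (use assms(1) in auto)
  have c2: "continuous_on {0..R} f2" unfolding f2_def by (intro continuous_intros) (use assms(1) in auto)
  have m: "g1 \<in> borel_measurable borel" "g2 \<in> borel_measurable borel" unfolding g1_def g2_def by measurable
  have z1: "g1 r = 0" if "r > R" for r using hz[OF that] by (simp add: g1_def)
  have z2: "g2 r = 0" if "r > R" for r using hz[OF that] by (simp add: g2_def)
  have e1: "2 * pi * r * g1 r = f1 r" if "0 < r" "r \<le> R" for r
    using he[of r] that by (simp add: g1_def f1_def)
  have e2: "2 * pi * r * g2 r = f2 r" if "0 < r" "r \<le> R" for r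
    using he[of r] that by (simp add: g2_def f2_def)
  have v1: "F1 R - F1 0 = 128 / 21 * pi / R"
    using R(1) unfolding F1_def R(2) by (simp add: field_simps eval_nat_numeral)
  have v2: "F2 R - F2 0 = 256 / 315 * pi * R"
    using R(1) unfolding F2_def R(2) by (simp add: field_simps eval_nat_numeral)
  show "integrable lebesgue (\<lambda>x. g1 (norm (x - z)))" "integrable lebesgue (\<lambda>x. g2 (norm (x - z)))"
    by (rule radial_integral(1)[OF m(1) less_imp_le[OF R(1)] z1 e1 F1 c1] radial_integral(1)[OF m(2) less_imp_le[OF R(1)] z2 e2 F2 c2]; assumption)+
  have "(LINT x|lebesgue. g1 (norm (x - z))) = F1 R - F1 0"
    by (rule radial_integral(2)[OF m(1) less_imp_le[OF R(1)] z1 e1 F1 c1])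
  then show "(LINT x|lebesgue. g1 (norm (x - z))) = 128 / 21 * pi / sqrt b" using v1 by (simp add: R_def)
  have "(LINT x|lebesgue. g2 (norm (x - z))) = F2 R - F2 0"
    by (rule radial_integral(2)[OF m(2) less_imp_le[OF R(1)] z2 e2 F2 c2])
  then show "(LINT x|lebesgue. g2 (norm (x - z))) = 256 / 315 * pi * sqrt b" using v2 by (simp add: R_def)
qed

text \<open>Applied to the multiplier \<open>hat b t\<^sup>2 / (t + a) powr (1/4)\<close> with \<open>t = \<bar>x - z\<bar>\<^sup>2\<close>: for \<open>t \<le> a\<close> the angular Hardy term
  beats the gradient of the multiplier, for larger \<open>t\<close> the two balance up to the contribution of the outer cutoff.\<close>

lemma weight_pointwise:
  fixes t a b e :: real
  assumes "a > 0" "b > 0" "e > 0" "e \<le> 2 * a" "t \<ge> 0"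
  defines "q \<equiv> hat b t" and "s \<equiv> 1 / sqrt (t + a)"
  shows "s * q ^ 4 / (4 * (t + e)) - 4 * t * (s * (q\<^sup>2 * (2 / b + q / (4 * (t + a)))\<^sup>2))
      = s * q ^ 4 * (1 / (4 * (t + e)) - t / (4 * (t + a)\<^sup>2)) - s * (4 * (t / (t + a)) * q ^ 3 / b + 16 * t * q\<^sup>2 / b\<^sup>2)"
    "0 \<le> 1 / (4 * (t + e)) - t / (4 * (t + a)\<^sup>2)"
proof -
  have p: "t + a > 0" "t + e > 0" using assms by auto
  define A where "A = 1 / (t + a)"
  have A: "1 / (4 * (t + a)) = A / 4" "t / (4 * (t + a)\<^sup>2) = t * A\<^sup>2 / 4" "t / (t + a) = t * A" "q / (4 * (t + a)) = q * A / 4"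
    by (auto simp: A_def power_divide)
  have B: "16 * t * q\<^sup>2 / b\<^sup>2 = 16 * t * q\<^sup>2 * (1 / b)\<^sup>2" "2 / b = 2 * (1 / b)" "4 * (t * A) * q ^ 3 / b = 4 * (t * A) * q ^ 3 * (1 / b)"
    by (auto simp: power_divide)
  show "s * q ^ 4 / (4 * (t + e)) - 4 * t * (s * (q\<^sup>2 * (2 / b + q / (4 * (t + a)))\<^sup>2))
      = s * q ^ 4 * (1 / (4 * (t + e)) - t / (4 * (t + a)\<^sup>2)) - s * (4 * (t / (t + a)) * q ^ 3 / b + 16 * t * q\<^sup>2 / b\<^sup>2)"
    unfolding A B by (simp add: algebra_simps power2_eq_square eval_nat_numeral)
  have "t * (t + e) \<le> t * (t + 2 * a)" using assms by (intro mult_left_mono) auto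
  also have "\<dots> \<le> (t + a)\<^sup>2" by (simp add: power2_eq_square algebra_simps)
  finally have 1: "t * (t + e) \<le> (t + a)\<^sup>2" .
  have "t * (4 * (t + e)) = 4 * (t * (t + e))" by simp
  also have "\<dots> \<le> 1 * (4 * (t + a)\<^sup>2)" using 1 by simp
  finally have "t / (4 * (t + a)\<^sup>2) \<le> 1 / (4 * (t + e))" using p by (subst divide_le_eq, subst times_divide_eq_left, subst pos_le_divide_eq) auto
  then show "0 \<le> 1 / (4 * (t + e)) - t / (4 * (t + a)\<^sup>2)" by simp
qed

text \<open>The Hardy term is at least \<open>25 / 101 / a\<close> and the gradient term at most
  \<open>1 / 16 / a\<close>, both attained at \<open>t = a\<close>; the difference is just above
  \<open>37 / 200 / a\<close>.\<close>

lemma weight_inner_bound: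
  fixes t a :: real
  assumes "a > 0" "0 \<le> t" "t \<le> a"
  shows "37 / 200 / a \<le> 1 / (4 * (t + a / 100)) - t / (4 * (t + a)\<^sup>2)"
proof -
  have "1 / (4 * (t + a / 100)) \<ge> 1 / (4 * (a + a / 100))" using assms by (intro divide_left_mono) auto
  moreover have "t / (4 * (t + a)\<^sup>2) \<le> 1 / (16 * a)"
  proof -
    have "0 \<le> (t - a)\<^sup>2" by simp
    then have "t * (16 * a) \<le> 1 * (4 * (t + a)\<^sup>2)" by (simp add: power2_eq_square algebra_simps)
    then show ?thesis using assms by (simp add: field_simps)
  qed
  moreover have "1 / (4 * (a + a / 100)) - 1 / (16 * a) \<ge> 37 / 200 / a" using assms by (simp add: field_simps)
  ultimately show ?thesis by linarith
qed

text \<open>Hardy's inequality for \<open>p * w\<close> and the energy identity share the quantity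
  \<open>E\<close>. Eliminating it bounds the integral of \<open>w\<^sup>2\<close> times (Hardy
  weight minus squared gradient of \<open>p\<close>) by that of \<open>f * p\<^sup>2 * w\<close>.
  The difference in brackets has a positive lower bound on the inner disc, up to a loss caused by
  the outer cutoff alone.\<close>

lemma wsol_weighted_bound:
  fixes \<Omega> :: "(real^2) set"
  assumes "simply_connected \<Omega>" "z \<notin> \<Omega>" "U \<subseteq> \<Omega>" "wsol U f w g" "AE x in lebesgue. \<bar>f x\<bar> \<le> 1"
    "\<And>x. \<bar>w x\<bar> \<le> M" "M > 0" "a > 0" "b > 0" "a < b"
  shows "37 / 200 / a / sqrt (2 * a) * (1 - a / b) ^ 4 * (LINT x|lebesgue. (w x)\<^sup>2 * indicator (cball z (sqrt a)) x)
      \<le> M\<^sup>2 * (128 / 21 * pi / sqrt b) + M * (256 / 315 * pi * sqrt b)"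
proof -
  note W = wsolD[OF assms(4)]
  define e where "e = a / 100"
  have e: "e > 0" "e \<le> 2 * a" using assms(8) by (auto simp: e_def)
  define t where "t x = (norm (x - z))\<^sup>2" for x
  have t0: "t x \<ge> 0" for x by (simp add: t_def)
  define s where "s x = 1 / sqrt (t x + a)" for x
  \<comment> \<open>With \<open>u\<close> the squared distance, the fourth root gives the weight the
    size of the distance to the power -1/2, and \<open>a\<close> removes its singularity at
    \<open>z\<close>. The squared \<open>hat\<close> is C1, so the product is an admissible
    multiplier.\<close>
  define F where "F u = hat b u ^ 2 / sqrt (sqrt (u + a))" for u
  define F' where "F' u = - (hat b u * (2 / b + hat b u / (4 * (u + a))) / sqrt (sqrt (u + a)))" for u
  have Fd: "(F has_real_derivative F' u) (at u)" if "u \<ge> 0" for u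
  proof -
    have ua: "u + a > 0" using that assms(8) by simp
    define k where "k = sqrt (sqrt (u + a))"
    have k: "k > 0" "k ^ 2 = sqrt (u + a)" "k ^ 4 = u + a"
    proof -
      show "k > 0" using ua by (simp add: k_def)
      show k2: "k ^ 2 = sqrt (u + a)" using ua by (simp add: k_def)
      have "k ^ 4 = (k ^ 2) ^ 2" by simp
      then show "k ^ 4 = u + a" unfolding k2 using ua by simp
    qed
    have kd: "((\<lambda>u. sqrt (sqrt (u + a))) has_real_derivative 1 / (4 * k ^ 3)) (at u)"
    proof -
      have 1: "((\<lambda>u. sqrt (u + a)) has_real_derivative 1 / (2 * k ^ 2)) (at u)"
        unfolding k(2) using ua by (auto intro!: derivative_eq_intros simp: field_simps)
      have 2: "((\<lambda>v. sqrt v) has_real_derivative 1 / (2 * k)) (at (sqrt (u + a)))"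
        unfolding k_def using DERIV_real_sqrt[of "sqrt (u + a)"] ua by (simp add: inverse_eq_divide mult.commute)
      have "1 / (2 * k) * (1 / (2 * k ^ 2)) = 1 / (4 * k ^ 3)" by (simp add: eval_nat_numeral)
      then show ?thesis using DERIV_chain2[OF 2 1] by simp
    qed
    have hd: "((\<lambda>u. hat b u ^ 2) has_real_derivative - (2 / b) * hat b u) (at u)"
      using hat_power_deriv[OF assms(9), of 0 u] by (simp add: numeral_2_eq_2)
    have "(F has_real_derivative (- (2 / b) * hat b u * k - hat b u ^ 2 * (1 / (4 * k ^ 3))) / (k * k)) (at u)"
      unfolding F_def k_def by (rule DERIV_divide[OF hd kd[unfolded k_def]]) (use k(1) in \<open>simp add: k_def\<close>)
    moreover have "(- (2 / b) * hat b u * k - hat b u ^ 2 * (1 / (4 * k ^ 3))) / (k * k) = F' u"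
    proof -
      have "F' u = - (hat b u * (2 / b + hat b u / (4 * k ^ 4)) / k)"
        unfolding k(3) unfolding F'_def k_def ..
      then show ?thesis using k(1) assms(9) by (simp add: field_simps eval_nat_numeral)
    qed
    ultimately show ?thesis by simp
  qed
  have Fc: "continuous_on {0..} F'"
    unfolding F'_def using assms(8) by (intro continuous_intros) auto
  define p where "p x = F (t x)" for x
  define P where "P x = (2 * F' (t x)) *\<^sub>R (x - z)" for x
  have C: "C1 p P" unfolding p_def P_def t_def by (rule C1_radial[OF Fd Fc])
  have Cc: "C1c UNIV p P"
    by (rule C1cI[OF C compact_cball[of z "sqrt b"] subset_UNIV])
       (simp add: p_def F_def t_def sq_gt_hat_0[OF assms(9)] dist_norm norm_minus_commute)
  obtain B where B: "B > 0" "\<And>x. \<bar>p x\<bar> \<le> B" "\<And>x. norm (P x) \<le> B" by (rule C1c_bounded[OF Cc]) (rule that)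
  have pm: "p \<in> borel_measurable lebesgue" "P \<in> borel_measurable lebesgue"
    using C1c_sq_int[OF Cc] by (auto dest: sq_int_measurable)
  have ss: "sqrt (sqrt (t x + a)) * sqrt (sqrt (t x + a)) = sqrt (t x + a)" for x
    using t0[of x] assms(8) by simp
  have p2: "(p x)\<^sup>2 = s x * hat b (t x) ^ 4" for x
    unfolding p_def F_def s_def power_divide using ss[of x] by (simp add: power2_eq_square eval_nat_numeral)
  have P2: "(norm (P x))\<^sup>2 = 4 * t x * (s x * ((hat b (t x))\<^sup>2 * (2 / b + hat b (t x) / (4 * (t x + a)))\<^sup>2))" for x
  proof -
    have "(norm (P x))\<^sup>2 = 4 * (F' (t x))\<^sup>2 * t x" by (simp add: P_def t_def power_mult_distrib)
    also have "(F' (t x))\<^sup>2 = s x * ((hat b (t x))\<^sup>2 * (2 / b + hat b (t x) / (4 * (t x + a)))\<^sup>2)"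
      unfolding F'_def s_def power2_minus power_divide power_mult_distrib using ss[of x] by (simp add: power2_eq_square)
    finally show ?thesis by simp
  qed
  define E where "E = sq_norm lebesgue (\<lambda>x. p x *\<^sub>R g x + w x *\<^sub>R P x)"
  have h: "h10 \<Omega> (\<lambda>x. p x * w x) (\<lambda>x. p x *\<^sub>R g x + w x *\<^sub>R P x)"
    by (rule h10_mono[OF h10_mult[OF W(1) C B(2,3)] assms(3)])
  have ang: "integrable lebesgue (\<lambda>x. (p x * w x)\<^sup>2 / (t x + e))" "(LINT x|lebesgue. (p x * w x)\<^sup>2 / (t x + e)) \<le> 4 * E"
    unfolding t_def E_def by (rule angular_Hardy[OF assms(1,2) h e(1)])+
  have en: "E = (LINT x|lebesgue. (w x)\<^sup>2 * (norm (P x))\<^sup>2) + (LINT x|lebesgue. f x * ((p x)\<^sup>2 * w x))"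
    unfolding E_def by (rule wsol_energy[OF assms(4) C B(2,3)])
  have i1: "integrable lebesgue (\<lambda>x. (w x)\<^sup>2 * ((p x)\<^sup>2 / (4 * (t x + e))))"
    using integrable_mult_right[OF ang(1), of "1 / 4"] by (simp add: power_mult_distrib mult_ac)
  have i2: "integrable lebesgue (\<lambda>x. (w x)\<^sup>2 * (norm (P x))\<^sup>2)"
  proof (rule bounded_weight_integrable[OF W(3), where B = "B\<^sup>2"])
    show "(\<lambda>x. (norm (P x))\<^sup>2) \<in> borel_measurable lebesgue" using pm by measurable
    show "\<bar>(norm (P x))\<^sup>2\<bar> \<le> B\<^sup>2" for x using B(3)[of x] by (simp add: power_mono)
  qed
  \<comment> \<open>The two costs: \<open>G1\<close> majorises the loss \<open>D\<close> from the
    outer cutoff, and \<open>G2\<close> the weight \<open>p\<^sup>2\<close> that multiplies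
    \<open>f * w\<close>. Both use \<open>s x \<le> 1 / norm (x - z)\<close>, which makes their
    integrals independent of \<open>a\<close>.\<close>
  define G1 where "G1 x = (\<lambda>r. 1 / r * (4 * hat b (r\<^sup>2) ^ 3 / b + 16 * r\<^sup>2 * hat b (r\<^sup>2) ^ 2 / b\<^sup>2)) (norm (x - z))" for x
  define G2 where "G2 x = (\<lambda>r. 1 / r * hat b (r\<^sup>2) ^ 4) (norm (x - z))" for x
  have G: "integrable lebesgue G1" "(LINT x|lebesgue. G1 x) = 128 / 21 * pi / sqrt b"
    "integrable lebesgue G2" "(LINT x|lebesgue. G2 x) = 256 / 315 * pi * sqrt b"
    unfolding G1_def[abs_def] G2_def[abs_def] by (rule radial_cost_integrals[OF assms(9)])+
  define \<kappa> where "\<kappa> = 37 / 200 / a / sqrt (2 * a) * (1 - a / b) ^ 4"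
  have sr: "s x \<le> 1 / norm (x - z)" if "x \<noteq> z" for x
  proof -
    have "norm (x - z) = sqrt (t x)" by (simp add: t_def)
    also have "\<dots> \<le> sqrt (t x + a)" using assms(8) by simp
    finally show ?thesis unfolding s_def using that t0[of x] assms(8) by (intro divide_left_mono) (auto intro!: mult_pos_pos add_nonneg_pos)
  qed
  have s0: "s x \<ge> 0" for x using t0[of x] assms(8) by (simp add: s_def)
  have ri: "integrable lebesgue (\<lambda>x. M\<^sup>2 * G1 x + ((w x)\<^sup>2 * ((p x)\<^sup>2 / (4 * (t x + e))) - (w x)\<^sup>2 * (norm (P x))\<^sup>2))"
    using G(1) i1 i2 by simp
  have ki: "integrable lebesgue (\<lambda>x. (w x)\<^sup>2 * indicator (cball z (sqrt a)) x)"
    by (rule cball_weight_integrable[OF W(3)])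
  have "\<kappa> * (LINT x|lebesgue. (w x)\<^sup>2 * indicator (cball z (sqrt a)) x)
      = (LINT x|lebesgue. \<kappa> * ((w x)\<^sup>2 * indicator (cball z (sqrt a)) x))" by simp
  \<comment> \<open>Adding \<open>M\<^sup>2 * G1\<close> pays for the negative part of the
    integrand, so that the comparison is pointwise.\<close>
  also have "\<dots> \<le> (LINT x|lebesgue. M\<^sup>2 * G1 x + ((w x)\<^sup>2 * ((p x)\<^sup>2 / (4 * (t x + e))) - (w x)\<^sup>2 * (norm (P x))\<^sup>2))"
  proof (rule integral_mono)
    show "integrable lebesgue (\<lambda>x. \<kappa> * ((w x)\<^sup>2 * indicator (cball z (sqrt a)) x))" using ki by simp
    show "integrable lebesgue (\<lambda>x. M\<^sup>2 * G1 x + ((w x)\<^sup>2 * ((p x)\<^sup>2 / (4 * (t x + e))) - (w x)\<^sup>2 * (norm (P x))\<^sup>2))" by (rule ri)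
    fix x
    define q where "q = hat b (t x)"
    define \<gamma> where "\<gamma> = 1 / (4 * (t x + e)) - t x / (4 * (t x + a)\<^sup>2)"
    define D where "D = s x * (4 * (t x / (t x + a)) * q ^ 3 / b + 16 * t x * q\<^sup>2 / b\<^sup>2)"
    have q0: "q \<ge> 0" by (simp add: q_def hat_nonneg)
    have eq: "(p x)\<^sup>2 / (4 * (t x + e)) - (norm (P x))\<^sup>2 = s x * q ^ 4 * \<gamma> - D"
      unfolding p2 P2 \<gamma>_def D_def q_def s_def
      by (rule weight_pointwise(1)[OF assms(8,9) e t0])
    have \<gamma>0: "\<gamma> \<ge> 0" unfolding \<gamma>_def by (rule weight_pointwise(2)[OF assms(8,9) e t0])
    have DG: "D \<le> G1 x"
    proof (cases "x = z")
      case True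
      then show ?thesis by (simp add: D_def G1_def t_def)
    next
      case False
      have "t x / (t x + a) \<le> 1" using t0[of x] assms(8) by simp
      then have "4 * (t x / (t x + a)) * q ^ 3 / b \<le> 4 * 1 * q ^ 3 / b"
        using q0 assms(9) by (intro divide_right_mono mult_right_mono mult_left_mono) auto
      then have "D \<le> s x * (4 * q ^ 3 / b + 16 * t x * q\<^sup>2 / b\<^sup>2)"
        unfolding D_def using s0 by (intro mult_left_mono) auto
      also have "\<dots> \<le> 1 / norm (x - z) * (4 * q ^ 3 / b + 16 * t x * q\<^sup>2 / b\<^sup>2)"
        using q0 t0[of x] assms(9) by (intro mult_right_mono sr[OF False]) auto
      finally show ?thesis by (simp add: G1_def q_def t_def)
    qed
    have D0: "D \<ge> 0" unfolding D_def using s0[of x] q0 t0[of x] assms(8,9) by (intro mult_nonneg_nonneg add_nonneg_nonneg divide_nonneg_nonneg) auto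
    have wM: "(w x)\<^sup>2 \<le> M\<^sup>2" using power_mono[OF assms(6)[of x], of 2] by simp
    have "(w x)\<^sup>2 * D \<le> M\<^sup>2 * G1 x" using wM DG D0 by (intro mult_mono) auto
    moreover have "\<kappa> * indicator (cball z (sqrt a)) x \<le> s x * q ^ 4 * \<gamma>"
    proof (cases "x \<in> cball z (sqrt a)")
      case True
      then have "norm (x - z) \<le> sqrt a" by (simp add: dist_norm norm_minus_commute)
      then have ta: "t x \<le> a" unfolding t_def using power_mono[of "norm (x - z)" "sqrt a" 2] assms(8) by simp
      have 1: "1 / sqrt (2 * a) \<le> s x"
        unfolding s_def using ta t0[of x] assms(8) by (intro divide_left_mono) (auto intro!: mult_pos_pos)
      have 2: "1 - a / b \<le> q" unfolding q_def hat_def using divide_right_mono[OF ta, of b] assms(9) by simp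
      have 3: "37 / 200 / a \<le> \<gamma>" unfolding \<gamma>_def e_def by (rule weight_inner_bound[OF assms(8) t0 ta])
      have "0 \<le> 1 - a / b" using assms(9,10) by simp
      then have "1 / sqrt (2 * a) * (1 - a / b) ^ 4 * (37 / 200 / a) \<le> s x * q ^ 4 * \<gamma>"
        using 1 2 3 s0[of x] q0 assms(8) by (intro mult_mono power_mono mult_nonneg_nonneg) auto
      then show ?thesis using True by (simp add: \<kappa>_def mult_ac)
    qed (use s0 q0 \<gamma>0 in simp)
    then have "(w x)\<^sup>2 * (\<kappa> * indicator (cball z (sqrt a)) x) \<le> (w x)\<^sup>2 * (s x * q ^ 4 * \<gamma>)"
      by (rule mult_left_mono) simp
    moreover have "(w x)\<^sup>2 * ((p x)\<^sup>2 / (4 * (t x + e))) - (w x)\<^sup>2 * (norm (P x))\<^sup>2 = (w x)\<^sup>2 * (s x * q ^ 4 * \<gamma>) - (w x)\<^sup>2 * D"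
      unfolding right_diff_distrib[symmetric] eq ..
    ultimately show "\<kappa> * ((w x)\<^sup>2 * indicator (cball z (sqrt a)) x) \<le>
        M\<^sup>2 * G1 x + ((w x)\<^sup>2 * ((p x)\<^sup>2 / (4 * (t x + e))) - (w x)\<^sup>2 * (norm (P x))\<^sup>2)"
      by (simp add: mult.left_commute)
  qed
  also have "\<dots> = M\<^sup>2 * (128 / 21 * pi / sqrt b) + ((LINT x|lebesgue. (w x)\<^sup>2 * ((p x)\<^sup>2 / (4 * (t x + e)))) - (LINT x|lebesgue. (w x)\<^sup>2 * (norm (P x))\<^sup>2))"
    using G(1,2) i1 i2 by simp
  also have "(LINT x|lebesgue. (w x)\<^sup>2 * ((p x)\<^sup>2 / (4 * (t x + e)))) - (LINT x|lebesgue. (w x)\<^sup>2 * (norm (P x))\<^sup>2)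
      \<le> (LINT x|lebesgue. f x * ((p x)\<^sup>2 * w x))"
  proof -
    have "(LINT x|lebesgue. (w x)\<^sup>2 * ((p x)\<^sup>2 / (4 * (t x + e)))) = (LINT x|lebesgue. 1 / 4 * ((p x * w x)\<^sup>2 / (t x + e)))"
      by (intro Bochner_Integration.integral_cong refl) (simp add: power_mult_distrib mult_ac)
    also have "\<dots> = 1 / 4 * (LINT x|lebesgue. (p x * w x)\<^sup>2 / (t x + e))" by (rule integral_mult_right_zero)
    finally show ?thesis using ang(2) en by linarith
  qed
  also have "(LINT x|lebesgue. f x * ((p x)\<^sup>2 * w x)) \<le> (LINT x|lebesgue. M * G2 x)"
  proof (rule integral_mono_AE)
    have "sq_int lebesgue (\<lambda>x. p x * (p x * w x))"
      by (rule sq_int_mult_real[OF sq_int_mult_real[OF W(3) pm(1) B(2)] pm(1) B(2)])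
    from integrable_mult_sq_int[OF W(2) this]
    show "integrable lebesgue (\<lambda>x. f x * ((p x)\<^sup>2 * w x))" by (simp add: power2_eq_square mult_ac)
    show "integrable lebesgue (\<lambda>x. M * G2 x)" using G(3) by simp
    \<comment> \<open>At \<open>z\<close> itself division by zero makes \<open>G2 z = 0\<close>, so
      the comparison can fail there.\<close>
    have "AE x in lebesgue. x \<noteq> z" by (rule AE_completion[OF AE_lborel_singleton])
    then show "AE x in lebesgue. f x * ((p x)\<^sup>2 * w x) \<le> M * G2 x"
      using assms(5)
    proof eventually_elim
      case (elim x)
      have "(p x)\<^sup>2 \<le> G2 x"
        unfolding p2 G2_def t_def[symmetric] using sr[OF elim(1)] hat_nonneg[of b "t x"] by (intro mult_right_mono) auto
      have "f x * w x \<le> \<bar>f x\<bar> * \<bar>w x\<bar>" by (metis abs_ge_self abs_mult)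
      also have "\<dots> \<le> 1 * M" using elim assms(6)[of x] by (intro mult_mono) auto
      finally have "f x * w x * (p x)\<^sup>2 \<le> M * (p x)\<^sup>2" by (intro mult_right_mono) auto
      also have "\<dots> \<le> M * G2 x" using \<open>(p x)\<^sup>2 \<le> G2 x\<close> assms(7) by (intro mult_left_mono) auto
      finally show ?case by (simp add: mult_ac)
    qed
  qed
  also have "(LINT x|lebesgue. M * G2 x) = M * (256 / 315 * pi * sqrt b)" by (simp add: G(4))
  finally show ?thesis unfolding \<kappa>_def by simp
qed

text \<open>Only the values in the disc enter the mean, so the global L2 norm of
  \<open>kmean_abs_le\<close> may be cut down to any disc that contains it.\<close>

lemma kmean_abs_le_local:
  assumes "sq_int lebesgue w" "b > 0" "cball x (sqrt b) \<subseteq> cball z r"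
  shows "kmean (\<lambda>y. \<bar>w y\<bar>) b x \<le> sqrt (25 / (9 * pi * b)) * sqrt (LINT y|lebesgue. (w y)\<^sup>2 * indicator (cball z r) y)"
proof -
  define v where "v y = indicator (cball z r) y * \<bar>w y\<bar>" for y
  have m: "(indicator (cball z r) :: real^2 \<Rightarrow> real) \<in> borel_measurable lebesgue"
    using sq_int_measurable[OF sq_int_indicator[OF lmeasurable_cball]] .
  have v: "sq_int lebesgue v"
    unfolding v_def[abs_def] by (rule sq_int_mult_real[OF sq_int_abs[OF assms(1)] m, of 1]) (simp add: indicator_def)
  have "kmean (\<lambda>y. \<bar>w y\<bar>) b x = kmean v b x"
    unfolding kmean_def
  proof (intro Bochner_Integration.integral_cong refl)
    fix y
    show "\<bar>w y\<bar> * kap b ((norm (y - x))\<^sup>2) = v y * kap b ((norm (y - x))\<^sup>2)"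
    proof (cases "y \<in> cball z r")
      case False
      then have "y \<notin> cball x (sqrt b)" using assms(3) by blast
      then have "kap b ((norm (y - x))\<^sup>2) = 0" by (rule kernel_support(1)[OF assms(2)])
      then show ?thesis by simp
    qed (simp add: v_def)
  qed
  also have "\<dots> \<le> sqrt (25 / (9 * pi * b)) * sqrt (sq_norm lebesgue v)"
    using kmean_abs_le[OF v assms(2), of x] by linarith
  also have "sq_norm lebesgue v = (LINT y|lebesgue. (w y)\<^sup>2 * indicator (cball z r) y)"
    unfolding sq_norm_def by (intro Bochner_Integration.integral_cong refl) (simp add: v_def indicator_def)
  finally show ?thesis .
qed

text \<open>The weighted estimate with \<open>a = 9 * d\<^sup>2\<close> and \<open>b = 9 * M\<close>
  controls \<open>w\<close> in L2 on the disc of radius \<open>3 * d\<close> about \<open>z\<close>.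
  That disc contains the one of radius \<open>2 * d\<close> about \<open>x\<close>, where the mean
  value estimate applies with drift \<open>4 * d\<^sup>2 / 24\<close>. An integral of order
  \<open>d ^ 3\<close> over an area of order \<open>d\<^sup>2\<close> leaves
  \<open>sqrt d\<close>.\<close>

lemma wsol_near_boundary:
  fixes \<Omega> :: "(real^2) set"
  assumes "simply_connected \<Omega>" "z \<notin> \<Omega>" "U \<subseteq> \<Omega>" "wsol U f w g" "AE x in lebesgue. \<bar>f x\<bar> \<le> 1"
    "\<And>x. \<bar>w x\<bar> \<le> M" "M > 0" "isCont (\<lambda>y. \<bar>w y\<bar>) x" "x \<noteq> z" and d: "d = norm (x - z)" "1000 * d\<^sup>2 \<le> M"
  shows "\<bar>w x\<bar> \<le> sqrt (644 * d * (M * sqrt M)) + d\<^sup>2 / 6"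
proof -
  note W = wsolD[OF assms(4)]
  have d0: "d > 0" using assms(9) d by simp
  define I where "I = (LINT y|lebesgue. (w y)\<^sup>2 * indicator (cball z (3 * d)) y)"
  have sa: "sqrt (9 * d\<^sup>2) = 3 * d" using d0 by (simp add: real_sqrt_mult)
  have ab: "9 * d\<^sup>2 < 9 * M" using d(2) d0 by (simp add: zero_less_power) (smt (verit) zero_less_power)
  have "37 / 200 / (9 * d\<^sup>2) / sqrt (2 * (9 * d\<^sup>2)) * (1 - 9 * d\<^sup>2 / (9 * M)) ^ 4 * I
      \<le> M\<^sup>2 * (128 / 21 * pi / sqrt (9 * M)) + M * (256 / 315 * pi * sqrt (9 * M))"
    using wsol_weighted_bound[OF assms(1-7) _ _ ab] d0 assms(7) unfolding I_def sa by simp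
  moreover have "M\<^sup>2 * (128 / 21 * pi / sqrt (9 * M)) + M * (256 / 315 * pi * sqrt (9 * M)) = 1408 / 315 * pi * (M * sqrt M)"
  proof -
    have s: "sqrt (9 * M) = 3 * sqrt M" by (simp add: real_sqrt_mult)
    have "M = sqrt M * sqrt M" using assms(7) by simp
    then have X0: "M\<^sup>2 / sqrt M = M * sqrt M" using assms(7) by (simp add: field_simps power2_eq_square)
    have X1: "M\<^sup>2 * (128 / 21 * pi / (3 * sqrt M)) = 128 / 63 * pi * (M\<^sup>2 / sqrt M)" by simp
    have X2: "M * (256 / 315 * pi * (3 * sqrt M)) = 256 / 105 * pi * (M * sqrt M)" by simp
    have X3: "1408 / 315 * pi * (M * sqrt M) = 128 / 63 * pi * (M * sqrt M) + 256 / 105 * pi * (M * sqrt M)" by algebra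
    show ?thesis unfolding s X1 X2 X0 X3 ..
  qed
  \<comment> \<open>\<open>1000 * d\<^sup>2 \<le> M\<close> makes the fourth power at least 0.996,
    and 1.41422 bounds \<open>sqrt 2\<close>; \<open>36.84 / 7638\<close> rounds the resulting
    factor down.\<close>
  moreover have "37 / 200 / (9 * d\<^sup>2) / sqrt (2 * (9 * d\<^sup>2)) * (1 - 9 * d\<^sup>2 / (9 * M)) ^ 4 \<ge> 36.84 / (7638 * d ^ 3)"
  proof -
    have "0 < 1 - 1 / (1000::real)" by simp
    moreover have "1 - 1 / 1000 \<le> 1 - 9 * d\<^sup>2 / (9 * M)" using d(2) assms(7) by (simp add: field_simps)
    ultimately have "(1 - 1 / 1000) ^ 4 \<le> (1 - 9 * d\<^sup>2 / (9 * M)) ^ 4" by (intro power_mono) auto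
    moreover have "996 / 1000 \<le> (1 - 1 / 1000 :: real) ^ 4" by (simp add: eval_nat_numeral)
    ultimately have 1: "996 / 1000 \<le> (1 - 9 * d\<^sup>2 / (9 * M)) ^ 4" by linarith
    have "sqrt (2 * (9 * d\<^sup>2)) = sqrt 2 * (3 * d)" by (subst real_sqrt_mult) (simp add: sa)
    also have "\<dots> \<le> 1.41422 * (3 * d)" using d0 by (intro mult_right_mono real_le_lsqrt) (auto simp: power2_eq_square)
    finally have 2: "sqrt (2 * (9 * d\<^sup>2)) \<le> 1.41422 * (3 * d)" .
    have "36.84 / (7638 * d ^ 3) = 36.84 / 7638 / d ^ 3" by simp
    also have "\<dots> \<le> (37 / 200 / 9 / (1.41422 * 3) * (996 / 1000)) / d ^ 3"
      using d0 by (intro divide_right_mono) auto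
    also have "\<dots> = 37 / 200 / (9 * d\<^sup>2) / (1.41422 * (3 * d)) * (996 / 1000)"
      by (simp add: power2_eq_square power3_eq_cube)
    also have "\<dots> \<le> 37 / 200 / (9 * d\<^sup>2) / sqrt (2 * (9 * d\<^sup>2)) * (1 - 9 * d\<^sup>2 / (9 * M)) ^ 4"
      using 1 2 d0 by (intro mult_mono divide_left_mono) auto
    finally show ?thesis .
  qed
  moreover have "I \<ge> 0" unfolding I_def by (intro Bochner_Integration.integral_nonneg) auto
  ultimately have "36.84 / (7638 * d ^ 3) * I \<le> 1408 / 315 * pi * (M * sqrt M)"
    using mult_right_mono[of "36.84 / (7638 * d ^ 3)" _ I] by (smt (verit))
  then have "I \<le> 7638 * d ^ 3 / 36.84 * (1408 / 315 * pi * (M * sqrt M))" using d0 by (simp add: field_simps)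
  then have "25 / (9 * pi * (4 * d\<^sup>2)) * I \<le> 25 / (9 * pi * (4 * d\<^sup>2)) * (7638 * d ^ 3 / 36.84 * (1408 / 315 * pi * (M * sqrt M)))"
    using d0 by (intro mult_left_mono) auto
  also have "\<dots> = (25 / 36 * 7638 / 36.84 * 1408 / 315) * (d * (M * sqrt M))"
    using d0 by (simp add: power2_eq_square power3_eq_cube)
  also have "\<dots> \<le> 644 * (d * (M * sqrt M))" using d0 assms(7) by (intro mult_right_mono) auto
  finally have I: "25 / (9 * pi * (4 * d\<^sup>2)) * I \<le> 644 * d * (M * sqrt M)" by simp
  have b: "4 * d\<^sup>2 > 0" using d0 by simp
  have sb: "sqrt (4 * d\<^sup>2) = 2 * d" using d0 by (simp add: real_sqrt_mult)
  have "cball x (2 * d) \<subseteq> cball z (3 * d)"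
  proof
    fix y assume "y \<in> cball x (2 * d)"
    then show "y \<in> cball z (3 * d)" using dist_triangle[of z y x] d(1) by (simp add: dist_norm norm_minus_commute)
  qed
  then have "kmean (\<lambda>y. \<bar>w y\<bar>) (4 * d\<^sup>2) x \<le> sqrt (25 / (9 * pi * (4 * d\<^sup>2))) * sqrt I"
    unfolding I_def by (intro kmean_abs_le_local[OF W(3) b]) (simp add: sb)
  also have "\<dots> = sqrt (25 / (9 * pi * (4 * d\<^sup>2)) * I)" by (simp only: real_sqrt_mult)
  also have "\<dots> \<le> sqrt (644 * d * (M * sqrt M))" by (rule real_sqrt_le_mono[OF I])
  finally show ?thesis using wsol_submean[OF assms(4,5,8) b] by simp
qed

section \<open>Comparison with the right-hand side of (i)\<close>

lemma bound_function_min: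
  fixes c :: real
  assumes "c > 0"
  shows "304 / 81 \<le> 8 / 15 * c powr (3/2) + 2 powr (9/2) * exp (- c)"
proof -
  define r where "r = sqrt c"
  define k where "k = sqrt (2::real)"
  have r: "r > 0" "c = r\<^sup>2" using assms by (auto simp: r_def)
  have k: "k > 0" "k * k = 2" by (auto simp: k_def)
  have k1: "1.41 \<le> k" unfolding k_def by (intro real_le_rsqrt) (simp add: power2_eq_square)
  have ln: "0.69 \<le> ln (2::real)" using ln_approx_bounds[of 2 2] by (simp add: eval_nat_numeral)
  have c: "c powr (3/2) = r ^ 3"
  proof -
    have "c powr (3/2) = (c powr (1/2)) powr 3" by (simp add: powr_powr)
    also have "\<dots> = r powr (real 3)" using assms by (simp add: powr_half_sqrt r_def)
    also have "\<dots> = r ^ 3" by (rule powr_realpow[OF r(1)])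
    finally show ?thesis .
  qed
  have p: "2 powr (9/2) = 16 * k"
  proof -
    have "(2::real) powr (9/2) = 2 powr (4 + 1/2)" by simp
    also have "\<dots> = 2 powr 4 * 2 powr (1/2)" by (rule powr_add)
    also have "\<dots> = 16 * k" by (simp add: powr_half_sqrt k_def)
    finally show ?thesis .
  qed
  text \<open>Tangent of \<open>exp\<close> at \<open>- 4 ln 2\<close>, then of the resulting cubic at its minimum \<open>r = 5 \<surd>2 / 4\<close>.\<close>
  have "1 + (4 * ln 2 - c) \<le> exp (4 * ln 2 - c)" by (rule exp_ge_add_one_self)
  also have "exp (4 * ln 2 - c) = exp (4 * ln (2::real)) * exp (- c)" by (simp add: exp_add[symmetric])
  also have "exp (4 * ln (2::real)) = 16" using exp_of_nat_mult[of 4 "ln (2::real)"] by simp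
  finally have "k * (1 + (4 * ln 2 - c)) \<le> k * (16 * exp (- c))" using k by (intro mult_left_mono) auto
  moreover have "8 / 15 * r ^ 3 \<ge> k * r\<^sup>2 - 25 / 24 * k"
  proof -
    have "0 \<le> (r - 5 / 4 * k)\<^sup>2 * (8 / 15 * r + k / 3)" using r k by (intro mult_nonneg_nonneg) auto
    also have "\<dots> = 8 / 15 * r ^ 3 - k * r\<^sup>2 + (k * k) * (5 / 6 - 5/6) * r + (k * k) * k * 25 / 48"
      by (simp add: power2_eq_square power3_eq_cube algebra_simps)
    finally show ?thesis unfolding k(2) by simp
  qed
  moreover have "k * (1 + 4 * ln 2 - 25 / 24) \<ge> 1.41 * (1 + 4 * 0.69 - 25 / 24)"
    using k1 ln by (intro mult_mono) auto
  ultimately show ?thesis unfolding c p r(2)[symmetric] by (simp add: algebra_simps)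
qed

text \<open>After multiplication by \<open>lam\<close> the bounds depend on \<open>\<sigma>\<close>
  and \<open>c\<close> only. At \<open>\<sigma> = 1 / 20\<close> the factor
  \<open>32/3 * \<sigma>\<close> is the 8/15 of \<open>bound_function_min\<close>, so from there on
  the uniform bound suffices. Below, since \<open>20 * \<sigma> \<le> 1\<close>, the right-hand side
  is at least \<open>20 * \<sigma>\<close> times its value at 1/20, hence more than
  \<open>75 * \<sigma>\<close>.\<close>

lemma bound_function_le:
  fixes lam d c y :: real
  assumes "lam > 0" "d > 0" "c > 0" "y \<le> 304 / 81 / lam"
    and "1000 * d\<^sup>2 \<le> 4 / lam \<Longrightarrow> y \<le> sqrt (644 * d * (4 / lam * sqrt (4 / lam))) + d\<^sup>2 / 6"
  shows "y \<le> 32/3 * d powr (1/2) * lam powr (-3/4) * c powr (3/2) + inverse lam * 2 powr (9/2) * exp (- c)"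
proof -
  define q where "q = lam powr (1/4)"
  define \<sigma> where "\<sigma> = sqrt d * q"
  have q: "q > 0" using assms(1) by (simp add: q_def)
  have q4: "q ^ 4 = lam" using assms(1) by (simp add: q_def powr_powr powr_realpow[symmetric])
  have qi: "lam powr (-3/4) = 1 / q ^ 3"
    using assms(1) by (simp add: q_def powr_powr powr_realpow[symmetric] powr_minus_divide)
  have s0: "\<sigma> > 0" using q assms(2) by (simp add: \<sigma>_def)
  define A where "A = c powr (3/2)"
  define B where "B = 2 powr (9/2) * exp (- c)"
  have AB: "A \<ge> 0" "B \<ge> 0" by (auto simp: A_def B_def)
  have min: "304 / 81 \<le> 8 / 15 * A + B" unfolding A_def B_def by (rule bound_function_min[OF assms(3)])
  have rhs: "32/3 * d powr (1/2) * lam powr (-3/4) * c powr (3/2) + inverse lam * 2 powr (9/2) * exp (- c)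
      = (32/3 * \<sigma> * A + B) / lam"
    unfolding qi A_def[symmetric] using q assms(2) q4[symmetric]
    by (simp add: B_def \<sigma>_def powr_half_sqrt field_simps eval_nat_numeral)
  have "lam * y \<le> 32/3 * \<sigma> * A + B"
  proof (cases "\<sigma> \<ge> 1 / 20")
    case True
    have "lam * y \<le> 304 / 81" using assms(1,4) by (simp add: field_simps)
    also note min
    also have "8 / 15 * A \<le> 32/3 * \<sigma> * A" using True AB by (intro mult_right_mono) auto
    finally show ?thesis by simp
  next
    case False
    have d2: "\<sigma>\<^sup>2 = d * q\<^sup>2" "\<sigma> ^ 4 = d\<^sup>2 * lam"
    proof -
      show 1: "\<sigma>\<^sup>2 = d * q\<^sup>2" using assms(2) by (simp add: \<sigma>_def power_mult_distrib)
      have "\<sigma> ^ 4 = (\<sigma>\<^sup>2)\<^sup>2" by simp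
      also have "\<dots> = d\<^sup>2 * lam" unfolding 1 power_mult_distrib q4[symmetric] by simp
      finally show "\<sigma> ^ 4 = d\<^sup>2 * lam" .
    qed
    have s3: "\<sigma> ^ 3 \<le> (1 / 20) ^ 3" using False s0 by (intro power_mono) auto
    have s4: "\<sigma> ^ 4 \<le> \<sigma> / 8000" using mult_left_mono[OF s3, of \<sigma>] s0 by (simp add: eval_nat_numeral)
    have "1000 * d\<^sup>2 \<le> 4 / lam" using s4 False assms(1) unfolding d2 by (simp add: field_simps)
    then have y: "y \<le> sqrt (644 * d * (4 / lam * sqrt (4 / lam))) + d\<^sup>2 / 6" by (rule assms(5))
    have "lam * sqrt (644 * d * (4 / lam * sqrt (4 / lam))) = sqrt (5152 * \<sigma>\<^sup>2)"
    proof -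
      have l: "sqrt lam = q\<^sup>2" using q q4 by (intro real_sqrt_unique) auto
      have "sqrt (4 / lam) = 2 / q\<^sup>2" by (simp add: real_sqrt_divide l)
      then have "lam\<^sup>2 * (644 * d * (4 / lam * sqrt (4 / lam))) = 5152 * \<sigma>\<^sup>2"
        unfolding d2 using q by (simp add: q4[symmetric] field_simps eval_nat_numeral)
      moreover have "lam * sqrt (644 * d * (4 / lam * sqrt (4 / lam))) = sqrt (lam\<^sup>2 * (644 * d * (4 / lam * sqrt (4 / lam))))"
        unfolding real_sqrt_mult[of "lam\<^sup>2"] using assms(1) by simp
      ultimately show ?thesis by simp
    qed
    \<comment> \<open>\<open>5152 = 8 * 644\<close> is just below
      \<open>72\<^sup>2 = 5184\<close>.\<close>
    also have "\<dots> \<le> 72 * \<sigma>" using s0 by (intro real_le_lsqrt) (auto simp: power_mult_distrib)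
    finally have "lam * (sqrt (644 * d * (4 / lam * sqrt (4 / lam))) + d\<^sup>2 / 6) \<le> 72 * \<sigma> + \<sigma> ^ 4 / 6"
      unfolding d2 by (simp add: algebra_simps)
    then have "lam * y \<le> 72 * \<sigma> + \<sigma> ^ 4 / 6" using mult_left_mono[OF y, of lam] assms(1) by linarith
    also have "\<dots> \<le> 20 * \<sigma> * (304 / 81)" using s4 s0 by simp
    also have "\<dots> \<le> 20 * \<sigma> * (8 / 15 * A + B)" using s0 min by (intro mult_left_mono) auto
    also have "\<dots> = 32/3 * \<sigma> * A + 20 * \<sigma> * B" by (simp add: algebra_simps)
    also have "20 * \<sigma> * B \<le> 1 * B" using False AB by (intro mult_right_mono) auto
    finally show ?thesis by simp
  qed
  then show ?thesis unfolding rhs using assms(1) by (simp add: field_simps)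
qed

text \<open>Stated for any \<open>f\<close> bounded by 1 and any
  \<open>U \<subseteq> \<Omega>\<close>, so that it serves the truncated torsion functions as well
  as the normalised eigenfunction.\<close>

lemma wsol_distance_bound:
  fixes \<Omega> :: "(real^2) set"
  assumes "open \<Omega>" "simply_connected \<Omega>" "z \<notin> \<Omega>" "U \<subseteq> \<Omega>" "wsol U f w g" "AE x in lebesgue. \<bar>f x\<bar> \<le> 1"
    "lam > 0" "\<And>y. \<bar>w y\<bar> \<le> 304 / 81 / lam" "isCont w x" "x \<noteq> z" "c > 0"
  shows "w x \<le> 32/3 * norm (x - z) powr (1/2) * lam powr (-3/4) * c powr (3/2) + inverse lam * 2 powr (9/2) * exp (- c)"
proof (rule bound_function_le)
  show "w x \<le> 304 / 81 / lam" using assms(8)[of x] by linarith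
  have c: "isCont (\<lambda>y. \<bar>w y\<bar>) x" using assms(9) by (intro continuous_intros)
  \<comment> \<open>304/81 is rounded up to 4, whose square root is rational; the room in
    \<open>bound_function_le\<close> allows it.\<close>
  have M: "\<bar>w y\<bar> \<le> 4 / lam" for y
  proof -
    have "304 / 81 / lam \<le> 4 / lam" using assms(7) by (intro divide_right_mono) auto
    then show ?thesis using assms(8)[of y] by linarith
  qed
  show "w x \<le> sqrt (644 * norm (x - z) * (4 / lam * sqrt (4 / lam))) + (norm (x - z))\<^sup>2 / 6"
    if "1000 * (norm (x - z))\<^sup>2 \<le> 4 / lam"
    using wsol_near_boundary[OF assms(2-6) M _ c assms(10) refl that] assms(7) by simp
qed (use assms in auto)

subsection \<open>The torsion function\<close>

text \<open>The bounded support turns the Cauchy property in L2 into one in L1, hence almost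
  everywhere convergence along a subsequence; Fatou's lemma brings the limit back to L2.\<close>

lemma sq_complete_bounded_support:
  fixes F :: "nat \<Rightarrow> real^2 \<Rightarrow> 'b::euclidean_space"
  assumes "\<And>n. sq_int lebesgue (F n)" "bounded U" "\<And>n x. x \<notin> U \<Longrightarrow> F n x = 0"
    and cauchy: "\<And>e. e > 0 \<Longrightarrow> \<exists>N. \<forall>i\<ge>N. \<forall>j\<ge>N. sq_norm lebesgue (\<lambda>x. F i x - F j x) < e"
  obtains f where "sq_lim lebesgue F f"
proof -
  obtain R where R: "U \<subseteq> cball 0 R" using assms(2) by (auto simp: bounded_iff subset_eq)
  define k where "k = (indicator (cball 0 R) :: real^2 \<Rightarrow> real)"
  have k: "sq_int lebesgue k" unfolding k_def by (rule sq_int_indicator[OF lmeasurable_cball])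
  have kF: "k x *\<^sub>R F n x = F n x" for x n using assms(3)[of x n] R by (cases "x \<in> U") (auto simp: k_def)
  have Fm: "F n \<in> borel_measurable lebesgue" for n by (rule sq_int_measurable[OF assms(1)])
  have i: "integrable lebesgue (F n)" for n
  proof (rule Bochner_Integration.integrable_bound)
    show "integrable lebesgue (\<lambda>x. k x * norm (F n x))" by (rule integrable_mult_sq_int[OF k sq_int_norm[OF assms(1)]])
    show "AE x in lebesgue. norm (F n x) \<le> norm (k x * norm (F n x))"
      by (subst (1) kF[symmetric]) (simp add: k_def)
  qed (rule Fm)
  have L1: "\<exists>N. \<forall>i\<ge>N. \<forall>j\<ge>N. (LINT x|lebesgue. norm (F i x - F j x)) < e" if "e > 0" for e
  proof -
    define C where "C = sqrt (sq_norm lebesgue k) + 1"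
    have C: "C > 0" by (simp add: C_def add_nonneg_pos sq_norm_nonneg)
    obtain N where N: "\<And>i j. i \<ge> N \<Longrightarrow> j \<ge> N \<Longrightarrow> sq_norm lebesgue (\<lambda>x. F i x - F j x) < (e / C)\<^sup>2"
      using cauchy[of "(e / C)\<^sup>2"] \<open>e > 0\<close> C by auto
    have "(LINT x|lebesgue. norm (F i x - F j x)) < e" if "i \<ge> N" "j \<ge> N" for i j
    proof -
      have d: "sq_int lebesgue (\<lambda>x. norm (F i x - F j x))" by (intro sq_int_norm sq_int_diff assms(1))
      have "norm (F i x - F j x) = k x \<bullet> norm (F i x - F j x)" for x
        using kF[of x i] kF[of x j] by (auto simp: k_def indicator_def split: if_splits)
      then have "(LINT x|lebesgue. norm (F i x - F j x)) = (LINT x|lebesgue. k x \<bullet> norm (F i x - F j x))"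
        by (intro Bochner_Integration.integral_cong refl)
      also have "\<dots> \<le> sqrt (sq_norm lebesgue k) * sqrt (sq_norm lebesgue (\<lambda>x. norm (F i x - F j x)))"
        using sq_int_Cauchy_Schwarz_abs[OF k d] by linarith
      also have "\<dots> \<le> sqrt (sq_norm lebesgue k) * sqrt ((e / C)\<^sup>2)"
        using N[OF that] by (intro mult_left_mono real_sqrt_le_mono) (auto simp: sq_norm_def sq_norm_nonneg)
      also have "\<dots> = sqrt (sq_norm lebesgue k) * (e / C)" using \<open>e > 0\<close> C by simp
      also have "\<dots> < C * (e / C)" using \<open>e > 0\<close> C by (intro mult_strict_right_mono) (auto simp: C_def)
      finally show ?thesis using C by simp
    qed
    then show ?thesis by blast
  qed
  obtain r where r: "strict_mono r" "AE x in lebesgue. Cauchy (\<lambda>i. F (r i) x)"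
    by (rule cauchy_L1_AE_cauchy_subseq[OF i L1], assumption) (rule that)
  define f where "f x = lim (\<lambda>i. F (r i) x)" for x
  have fm: "f \<in> borel_measurable lebesgue" unfolding f_def by (intro borel_measurable_lim_metric Fm)
  have f: "AE x in lebesgue. (\<lambda>i. F (r i) x) \<longlonglongrightarrow> f x"
    using r(2) by eventually_elim (auto simp: f_def Cauchy_convergent_iff convergent_LIMSEQ_iff)
  have nn: "(\<integral>\<^sup>+x. ennreal ((norm (F n x - f x))\<^sup>2) \<partial>lebesgue) \<le> ennreal e"
    if e: "\<And>i. i \<ge> N \<Longrightarrow> sq_norm lebesgue (\<lambda>x. F n x - F i x) \<le> e" for n N e
  proof -
    have "(\<integral>\<^sup>+x. ennreal ((norm (F n x - f x))\<^sup>2) \<partial>lebesgue)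
        = (\<integral>\<^sup>+x. liminf (\<lambda>i. ennreal ((norm (F n x - F (r i) x))\<^sup>2)) \<partial>lebesgue)"
    proof (rule nn_integral_cong_AE, use f in eventually_elim)
      case (elim x)
      then have "(\<lambda>i. ennreal ((norm (F n x - F (r i) x))\<^sup>2)) \<longlonglongrightarrow> ennreal ((norm (F n x - f x))\<^sup>2)"
        by (intro tendsto_intros)
      then show ?case by (rule lim_imp_Liminf[OF sequentially_bot, symmetric])
    qed
    also have "\<dots> \<le> liminf (\<lambda>i. \<integral>\<^sup>+x. ennreal ((norm (F n x - F (r i) x))\<^sup>2) \<partial>lebesgue)"
      by (rule nn_integral_liminf) (use Fm in measurable)
    also have "\<dots> \<le> liminf (\<lambda>i::nat. ennreal e)"
    proof (rule Liminf_mono, rule eventually_mono[OF eventually_ge_at_top[of N]])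
      fix i assume "i \<ge> N"
      then have "r i \<ge> N" using seq_suble[OF r(1), of i] by linarith
      have "(\<integral>\<^sup>+x. ennreal ((norm (F n x - F (r i) x))\<^sup>2) \<partial>lebesgue) = ennreal (sq_norm lebesgue (\<lambda>x. F n x - F (r i) x))"
        unfolding sq_norm_def by (rule nn_integral_eq_integral[OF sq_int_integrable[OF sq_int_diff[OF assms(1,1)]]]) simp
      also have "\<dots> \<le> ennreal e" by (rule ennreal_leI[OF e[OF \<open>r i \<ge> N\<close>]])
      finally show "(\<integral>\<^sup>+x. ennreal ((norm (F n x - F (r i) x))\<^sup>2) \<partial>lebesgue) \<le> ennreal e" .
    qed
    finally show ?thesis by (simp add: Liminf_const)
  qed
  have dm: "(\<lambda>x. F n x - f x) \<in> borel_measurable lebesgue" for n using Fm fm by measurable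
  obtain N1 where N1: "\<And>i j. i \<ge> N1 \<Longrightarrow> j \<ge> N1 \<Longrightarrow> sq_norm lebesgue (\<lambda>x. F i x - F j x) < 1"
    using cauchy[of 1] by auto
  have d1: "sq_int lebesgue (\<lambda>x. F N1 x - f x)"
    unfolding sq_int_def
  proof (intro conjI dm integrableI_bounded)
    have "(\<integral>\<^sup>+x. ennreal ((norm (F N1 x - f x))\<^sup>2) \<partial>lebesgue) \<le> ennreal 1"
      by (rule nn[of N1]) (use N1[of N1] in \<open>auto intro: less_imp_le\<close>)
    then show "(\<integral>\<^sup>+x. ennreal (norm ((norm (F N1 x - f x))\<^sup>2)) \<partial>lebesgue) < \<infinity>"
      by (auto simp: top_unique intro: le_less_trans)
  qed (use dm in measurable)
  have fi: "sq_int lebesgue f" using sq_int_diff[OF assms(1)[of N1] d1] by simp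
  have "sq_lim lebesgue F f"
    unfolding sq_lim_def
  proof (intro conjI allI assms(1) fi, rule LIMSEQ_I)
    fix e :: real assume "e > 0"
    then obtain N where N: "\<And>i j. i \<ge> N \<Longrightarrow> j \<ge> N \<Longrightarrow> sq_norm lebesgue (\<lambda>x. F i x - F j x) < e / 2"
      using cauchy[of "e / 2"] by auto
    have "sq_norm lebesgue (\<lambda>x. F n x - f x) < e" if "n \<ge> N" for n
    proof -
      have "ennreal (sq_norm lebesgue (\<lambda>x. F n x - f x)) = (\<integral>\<^sup>+x. ennreal ((norm (F n x - f x))\<^sup>2) \<partial>lebesgue)"
        unfolding sq_norm_def by (rule nn_integral_eq_integral[symmetric, OF sq_int_integrable[OF sq_int_diff[OF assms(1) fi]]]) simp
      also have "\<dots> \<le> ennreal (e / 2)" by (rule nn[of N]) (use N[OF that] in \<open>auto intro: less_imp_le\<close>)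
      finally show ?thesis using \<open>e > 0\<close> by (simp add: ennreal_le_iff)
    qed
    then show "\<exists>N. \<forall>n\<ge>N. norm (sq_norm lebesgue (\<lambda>x. F n x - f x) - 0) < e"
      by (intro exI[of _ N]) (simp add: sq_norm_nonneg)
  qed
  then show ?thesis by (rule that)
qed

text \<open>The direct method for the Dirichlet energy \<open>J\<close>. Midpoints have energy at
  least the infimum \<open>m\<close>, so by the parallelogram identity the gradients of a minimising
  sequence are Cauchy; Poincare's inequality transfers this to the functions.\<close>

lemma wsol_exists:
  assumes "bounded U" "sq_int lebesgue f" "lam > 0"
    and poincare: "\<And>\<phi> G. C1c U \<phi> G \<Longrightarrow> lam * sq_norm lebesgue \<phi> \<le> sq_norm lebesgue G"
  obtains w g where "wsol U f w g"
proof -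
  define J where "J \<phi> G = sq_norm lebesgue G - 2 * (LINT x|lebesgue. f x * \<phi> x)" for \<phi> and G :: "real^2 \<Rightarrow> real^2"
  define S where "S = {J \<phi> G | \<phi> G. C1c U \<phi> G}"
  \<comment> \<open>With \<open>T\<close> the L2 norm of the gradient, Poincare's inequality gives
    \<open>J \<ge> T\<^sup>2 - 2 * K * T \<ge> - K\<^sup>2\<close>.\<close>
  define K where "K = sqrt (sq_norm lebesgue f / lam)"
  have lower: "- K\<^sup>2 \<le> J \<phi> G" if "C1c U \<phi> G" for \<phi> G
  proof -
    note q = C1c_sq_int[OF that]
    define T where "T = sqrt (sq_norm lebesgue G)"
    have "\<bar>LINT x|lebesgue. f x * \<phi> x\<bar> \<le> sqrt (sq_norm lebesgue f) * sqrt (sq_norm lebesgue \<phi>)"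
      using sq_int_Cauchy_Schwarz_abs[OF assms(2) q(1)] by simp
    also have "\<dots> \<le> sqrt (sq_norm lebesgue f) * sqrt (sq_norm lebesgue G / lam)"
      using poincare[OF that] assms(3) by (intro mult_left_mono real_sqrt_le_mono) (auto simp: field_simps sq_norm_nonneg)
    also have "\<dots> = K * T" by (simp add: K_def T_def real_sqrt_divide)
    finally have "\<bar>LINT x|lebesgue. f x * \<phi> x\<bar> \<le> K * T" .
    moreover have "J \<phi> G = T\<^sup>2 - 2 * (LINT x|lebesgue. f x * \<phi> x)" by (simp add: J_def T_def sq_norm_nonneg)
    moreover have "0 \<le> (T - K)\<^sup>2" by simp
    ultimately show ?thesis by (simp add: power2_eq_square algebra_simps)
  qed
  have bdd: "bdd_below S" unfolding S_def using lower by (intro bdd_belowI[of _ "- K\<^sup>2"]) auto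
  define m where "m = Inf S"
  have m: "m \<le> J \<phi> G" if "C1c U \<phi> G" for \<phi> G
    unfolding m_def by (rule cInf_lower[OF _ bdd]) (use that in \<open>auto simp: S_def\<close>)
  have ne: "S \<noteq> {}" using C1c_zero by (auto simp: S_def)
  have "\<exists>\<phi> G. C1c U \<phi> G \<and> J \<phi> G < m + 1 / real (Suc n)" for n
  proof -
    have "\<exists>s\<in>S. s < m + 1 / real (Suc n)" unfolding m_def by (rule cInf_lessD[OF ne]) simp
    then show ?thesis by (auto simp: S_def)
  qed
  then obtain \<phi> G where \<phi>: "\<And>n. C1c U (\<phi> n) (G n)" "\<And>n::nat. J (\<phi> n) (G n) < m + 1 / real (Suc n)" by metis
  note q = C1c_sq_int[OF \<phi>(1)]
  have par: "sq_norm lebesgue (\<lambda>x. G i x - G j x) \<le> 2 / real (Suc i) + 2 / real (Suc j)" for i j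
  proof -
    have C: "C1c U (\<lambda>x. 1 / 2 * (\<phi> i x + \<phi> j x)) (\<lambda>x. (1 / 2) *\<^sub>R (G i x + G j x))"
      by (rule C1c_scale[OF C1c_add[OF \<phi>(1) \<phi>(1)]])
    have 1: "sq_norm lebesgue (\<lambda>x. G i x - G j x) = sq_norm lebesgue (G i) - 2 * (LINT x|lebesgue. G i x \<bullet> G j x) + sq_norm lebesgue (G j)"
      using sq_norm_add_scaled[OF q(2)[of i] q(2)[of j], of "-1"] by simp
    have 2: "sq_norm lebesgue (\<lambda>x. (1 / 2) *\<^sub>R (G i x + G j x)) =
        1 / 4 * (sq_norm lebesgue (G i) + 2 * (LINT x|lebesgue. G i x \<bullet> G j x) + sq_norm lebesgue (G j))"
      using sq_norm_add_scaled[OF q(2)[of i] q(2)[of j], of 1] by (simp add: sq_norm_def power_mult_distrib power_divide)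
    have 3: "(LINT x|lebesgue. f x * (1 / 2 * (\<phi> i x + \<phi> j x))) =
        1 / 2 * ((LINT x|lebesgue. f x * \<phi> i x) + (LINT x|lebesgue. f x * \<phi> j x))"
      using integrable_mult_sq_int[OF assms(2) q(1)[of i]] integrable_mult_sq_int[OF assms(2) q(1)[of j]]
      by (simp add: distrib_left)
    have "m \<le> J (\<lambda>x. 1 / 2 * (\<phi> i x + \<phi> j x)) (\<lambda>x. (1 / 2) *\<^sub>R (G i x + G j x))" by (rule m[OF C])
    also have "\<dots> = 1 / 2 * (J (\<phi> i) (G i) + J (\<phi> j) (G j)) - 1 / 4 * sq_norm lebesgue (\<lambda>x. G i x - G j x)"
      unfolding J_def 1 2 3 by algebra
    finally have "sq_norm lebesgue (\<lambda>x. G i x - G j x) \<le> 2 * (J (\<phi> i) (G i) - m) + 2 * (J (\<phi> j) (G j) - m)" by argo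
    also have "\<dots> \<le> 2 * (1 / real (Suc i)) + 2 * (1 / real (Suc j))" using \<phi>(2)[of i] \<phi>(2)[of j] by argo
    finally show ?thesis by simp
  qed
  have gc: "\<exists>N. \<forall>i\<ge>N. \<forall>j\<ge>N. sq_norm lebesgue (\<lambda>x. G i x - G j x) < e" if "e > 0" for e
  proof -
    obtain N :: nat where N: "4 / e < real N" using reals_Archimedean2 by blast
    have "2 / real (Suc i) < e / 2" if "i \<ge> N" for i
    proof -
      have "4 / e < real (Suc i)" using N that by simp
      then show ?thesis using \<open>e > 0\<close> by (simp add: field_simps)
    qed
    then show ?thesis using par by (intro exI[of _ N]) (smt (verit) field_sum_of_halves)
  qed
  have fc: "\<exists>N. \<forall>i\<ge>N. \<forall>j\<ge>N. sq_norm lebesgue (\<lambda>x. \<phi> i x - \<phi> j x) < e" if "e > 0" for e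
  proof -
    obtain N where N: "\<And>i j. i \<ge> N \<Longrightarrow> j \<ge> N \<Longrightarrow> sq_norm lebesgue (\<lambda>x. G i x - G j x) < lam * e"
      using gc[of "lam * e"] \<open>e > 0\<close> assms(3) by auto
    have "sq_norm lebesgue (\<lambda>x. \<phi> i x - \<phi> j x) < e" if "i \<ge> N" "j \<ge> N" for i j
    proof -
      have "C1c U (\<lambda>x. \<phi> i x + (-1) * \<phi> j x) (\<lambda>x. G i x + (-1) *\<^sub>R G j x)"
        by (rule C1c_add[OF \<phi>(1) C1c_scale[OF \<phi>(1)]])
      from poincare[OF this] N[OF that] have "lam * sq_norm lebesgue (\<lambda>x. \<phi> i x - \<phi> j x) < lam * e" by simp
      then show ?thesis using assms(3) by simp
    qed
    then show ?thesis by blast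
  qed
  have z: "\<phi> n x = 0" "G n x = 0" if "x \<notin> U" for n x
    using that by (metis C1cE[OF \<phi>(1)] subsetD)+
  obtain w where w: "sq_lim lebesgue \<phi> w" by (rule sq_complete_bounded_support[OF q(1) assms(1) z(1) fc], assumption+)
  obtain g where g: "sq_lim lebesgue G g" by (rule sq_complete_bounded_support[OF q(2) assms(1) z(2) gc], assumption+)
  have h: "h10 U w g" by (rule h10I[OF \<phi>(1) w g])
  have Jm: "sq_norm lebesgue g - 2 * (LINT x|lebesgue. f x * w x) \<le> m"
  proof (rule LIMSEQ_le)
    show "(\<lambda>n. J (\<phi> n) (G n)) \<longlonglongrightarrow> sq_norm lebesgue g - 2 * (LINT x|lebesgue. f x * w x)"
      unfolding J_def by (intro tendsto_intros sq_lim_norm[OF g] sq_lim_mult_int[OF sq_lim_const[OF assms(2)] w])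
    show "(\<lambda>n. m + 1 / real (Suc n)) \<longlonglongrightarrow> m"
      using tendsto_add[OF tendsto_const[of m] LIMSEQ_inverse_real_of_nat] by (simp add: inverse_eq_divide)
  qed (use \<phi>(2) in \<open>auto intro: less_imp_le\<close>)
  have "(LINT x|lebesgue. g x \<bullet> G' x) = (LINT x|lebesgue. f x * \<psi> x)" if \<psi>: "C1c U \<psi> G'" for \<psi> G'
  proof -
    note p = C1c_sq_int[OF \<psi>]
    define B where "B = (LINT x|lebesgue. g x \<bullet> G' x) - (LINT x|lebesgue. f x * \<psi> x)"
    \<comment> \<open>First variation at the minimiser: with constant term 0 the discriminant
      condition forces \<open>B = 0\<close>, which is the weak equation.\<close>
    have "0 \<le> 0 + 2 * t * B + t\<^sup>2 * sq_norm lebesgue G'" for t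
    proof -
      have 1: "sq_lim lebesgue (\<lambda>n x. G n x + t *\<^sub>R G' x) (\<lambda>x. g x + t *\<^sub>R G' x)"
        by (rule sq_lim_add[OF g sq_lim_const[OF sq_int_scaleR[OF p(2)]]])
      have 2: "sq_lim lebesgue (\<lambda>n x. \<phi> n x + t * \<psi> x) (\<lambda>x. w x + t * \<psi> x)"
        by (rule sq_lim_add[OF w sq_lim_const[OF sq_int_cmult[OF p(1)]]])
      have "(\<lambda>n. J (\<lambda>x. \<phi> n x + t * \<psi> x) (\<lambda>x. G n x + t *\<^sub>R G' x)) \<longlonglongrightarrow>
          sq_norm lebesgue (\<lambda>x. g x + t *\<^sub>R G' x) - 2 * (LINT x|lebesgue. f x * (w x + t * \<psi> x))"
        unfolding J_def by (intro tendsto_intros sq_lim_norm[OF 1] sq_lim_mult_int[OF sq_lim_const[OF assms(2)] 2])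
      then have "m \<le> sq_norm lebesgue (\<lambda>x. g x + t *\<^sub>R G' x) - 2 * (LINT x|lebesgue. f x * (w x + t * \<psi> x))"
        by (rule LIMSEQ_le_const) (use m[OF C1c_add[OF \<phi>(1) C1c_scale[OF \<psi>]]] in auto)
      moreover have "(LINT x|lebesgue. f x * (w x + t * \<psi> x)) = (LINT x|lebesgue. f x * w x) + t * (LINT x|lebesgue. f x * \<psi> x)"
        using integrable_mult_sq_int[OF assms(2) h10_sq_int(1)[OF h]] integrable_mult_sq_int[OF assms(2) p(1)]
        by (simp add: distrib_left mult.left_commute[of _ t])
      ultimately show ?thesis
        using Jm sq_norm_add_scaled[OF h10_sq_int(2)[OF h] p(2), of t] by (simp add: B_def algebra_simps)
    qed
    from quadratic_nonneg_discrim[OF this _ sq_norm_nonneg] have "B\<^sup>2 \<le> 0" by simp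
    then show ?thesis by (simp add: B_def)
  qed
  then have "wsol U f w g" using h assms(2) by (simp add: wsol_def)
  then show ?thesis by (rule that)
qed

lemma wsol_diff:
  assumes "wsol U f1 w1 g1" "wsol U f2 w2 g2"
  shows "wsol U (\<lambda>x. f1 x - f2 x) (\<lambda>x. w1 x - w2 x) (\<lambda>x. g1 x - g2 x)"
  unfolding wsol_def
proof (intro conjI allI impI)
  note A = wsolD[OF assms(1)] note B = wsolD[OF assms(2)]
  show "h10 U (\<lambda>x. w1 x - w2 x) (\<lambda>x. g1 x - g2 x)" by (rule h10_diff[OF A(1) B(1)])
  show "sq_int lebesgue (\<lambda>x. f1 x - f2 x)" by (rule sq_int_diff[OF A(2) B(2)])
  fix \<phi> G assume "C1c U \<phi> G"
  then have h: "h10 U \<phi> G" by (rule h10_C1c)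
  note q = h10_sq_int[OF h]
  show "(LINT x|lebesgue. (g1 x - g2 x) \<bullet> G x) = (LINT x|lebesgue. (f1 x - f2 x) * \<phi> x)"
    using wsol_test[OF assms(1) h] wsol_test[OF assms(2) h]
      integrable_inner_sq_int[OF A(4) q(2)] integrable_inner_sq_int[OF B(4) q(2)]
      integrable_mult_sq_int[OF A(2) q(1)] integrable_mult_sq_int[OF B(2) q(1)]
    by (simp add: inner_diff_left left_diff_distrib)
qed

lemma wsol_unique:
  assumes "wsol U f w1 g1" "wsol U f w2 g2" "lam > 0"
    and poincare: "\<And>v h. h10 U v h \<Longrightarrow> lam * sq_norm lebesgue v \<le> sq_norm lebesgue h"
  shows "AE x in lebesgue. w1 x = w2 x"
proof -
  have w: "wsol U (\<lambda>x. f x - f x) (\<lambda>x. w1 x - w2 x) (\<lambda>x. g1 x - g2 x)" by (rule wsol_diff[OF assms(1,2)])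
  note W = wsolD[OF w]
  have "sq_norm lebesgue (\<lambda>x. g1 x - g2 x) = 0"
    using wsol_test[OF w W(1)] unfolding sq_norm_def power2_norm_eq_inner by simp
  then have "lam * sq_norm lebesgue (\<lambda>x. w1 x - w2 x) \<le> 0" using poincare[OF W(1)] by simp
  then have "sq_norm lebesgue (\<lambda>x. w1 x - w2 x) = 0"
    using sq_norm_nonneg[of lebesgue "\<lambda>x. w1 x - w2 x"] assms(3) by (simp add: mult_le_0_iff)
  from sq_norm_eq_0[OF W(3) this] show ?thesis by simp
qed

text \<open>\<open>torsion_bounded\<close> is a definite description and denotes the solution only
  once existence and uniqueness are known. Uniqueness is pointwise, because the candidates are
  continuous in \<open>D\<close> and 0 outside.\<close>

lemma torsion_bounded_wsol:
  assumes "open D" "bounded D" "lam > 0"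
    and poincare: "\<And>v h. h10 D v h \<Longrightarrow> lam * sq_norm lebesgue v \<le> sq_norm lebesgue h"
  obtains g where "wsol D (indicator D) (torsion_bounded D) g" "continuous_on D (torsion_bounded D)"
    "\<And>x. x \<notin> D \<Longrightarrow> torsion_bounded D x = 0"
proof -
  define f where "f = (indicator D :: real^2 \<Rightarrow> real)"
  have f: "sq_int lebesgue f"
    unfolding f_def by (rule sq_int_indicator) (use assms(1,2) in \<open>simp add: lmeasurable_open\<close>)
  obtain w g where w: "wsol D f w g" by (rule wsol_exists[OF assms(2) f assms(3) poincare[OF h10_C1c]], assumption) (rule that)
  obtain W where W: "continuous_on D W" "\<And>x. x \<notin> D \<Longrightarrow> W x = 0" "AE x in lebesgue. w x = W x" "W \<in> borel_measurable lebesgue"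
    by (rule wsol_continuous_representative[OF assms(1,2) w, of 1]) (auto simp: f_def intro: that)
  have g: "AE x in lebesgue. g x = g x" by simp
  have "h10 D W g" by (rule h10_cong_AE[OF wsolD(1)[OF w] W(4,3) sq_int_measurable[OF wsolD(4)[OF w]] g])
  then have WW: "wsol D f W g" using w by (simp add: wsol_def)
  define P where "P v \<longleftrightarrow> weak_dirichlet_solution D (\<lambda>_. 1) v \<and> continuous_on D v \<and> (\<forall>x. x \<notin> D \<longrightarrow> v x = 0)" for v
  have "P W"
    unfolding P_def using W(1,2) wsol_imp_weak_dirichlet_solution[OF assms(1) WW, of "\<lambda>_. 1" W] by (simp add: f_def)
  moreover have "v = W" if "P v" for v
  proof
    fix x
    have "zext D (\<lambda>_. 1) = f" by (auto simp: zext_def f_def)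
    moreover have "zext D v = v" using that by (auto simp: zext_def P_def)
    ultimately have "wsol D f v (zext D (weak_grad D v))"
      using weak_dirichlet_solution_imp_wsol[OF assms(1), of "\<lambda>_. 1" v] f that by (simp add: P_def)
    from wsol_unique[OF this WW assms(3) poincare] have "AE x in lebesgue. v x = W x" .
    then have ae: "AE x in lebesgue. x \<in> D \<longrightarrow> v x - W x = 0" by eventually_elim simp
    have "continuous_on D (\<lambda>x. v x - W x)" using that W(1) unfolding P_def by (intro continuous_intros) auto
    from continuous_AE_eq_0[OF assms(1) this ae, of x] show "v x = W x"
      using that W(2)[of x] by (cases "x \<in> D") (auto simp: P_def)
  qed
  ultimately have "torsion_bounded D = W" unfolding torsion_bounded_def P_def by (rule the_equality)
  then show ?thesis using that WW W(1,2) by (simp add: f_def)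
qed

section \<open>Convergence of the truncated torsion functions\<close>

lemma h10_cutoff:
  assumes "h10 U u g" "C1c V p P"
  shows "h10 (U \<inter> V) (\<lambda>x. p x * u x) (\<lambda>x. p x *\<^sub>R g x + u x *\<^sub>R P x)"
proof -
  obtain \<phi> G where 1: "\<And>n::nat. C1c U (\<phi> n) (G n)" "sq_lim lebesgue \<phi> u" "sq_lim lebesgue G g"
    by (rule h10E[OF assms(1)]) (rule that)
  note p = C1c_imp_C1[OF assms(2)]
  have pm: "p \<in> borel_measurable lebesgue" "P \<in> borel_measurable lebesgue"
    by (auto intro!: continuous_imp_lebesgue_measurable C1_continuous[OF p] C1D(2)[OF p])
  obtain B where B: "\<And>x. \<bar>p x\<bar> \<le> B" "\<And>x. norm (P x) \<le> B" by (rule C1c_bounded[OF assms(2)]) (rule that)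
  \<comment> \<open>The product is supported in the intersection of the two supports. This is how a
    function on \<open>\<Omega>\<close> becomes an admissible test function on each
    truncation.\<close>
  have C: "C1c (U \<inter> V) (\<lambda>x. p x * \<phi> n x) (\<lambda>x. p x *\<^sub>R G n x + \<phi> n x *\<^sub>R P x)" for n
  proof -
    obtain K where K: "compact K" "K \<subseteq> U" "\<And>x. x \<notin> K \<Longrightarrow> \<phi> n x = 0" by (rule C1cE[OF 1(1)[of n]]) (rule that)
    obtain L where L: "compact L" "L \<subseteq> V" "\<And>x. x \<notin> L \<Longrightarrow> p x = 0" by (rule C1cE[OF assms(2)]) (rule that)
    show ?thesis
      by (rule C1cI[OF C1c_imp_C1[OF C1c_mult_left[OF 1(1) p]] compact_Int[OF K(1) L(1)]]) (use K L in auto)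
  qed
  have "sq_lim lebesgue (\<lambda>n x. p x * \<phi> n x) (\<lambda>x. p x * u x)"
    using sq_lim_mult[OF 1(2) pm(1) B(1)] by simp
  then show ?thesis
    by (rule h10I[OF C _ sq_lim_add[OF sq_lim_mult[OF 1(3) pm(1) B(1)] sq_lim_mult_vec[OF 1(2) pm(2) B(2)]]])
qed

text \<open>The profile is the square of \<open>hat\<close> at \<open>b = R\<^sup>2\<close>: on the
  half disc \<open>hat \<ge> 3 / 4\<close>, whence 9/16, and the gradient has norm at most
  \<open>4 / R\<close>.\<close>

lemma cutoff_exists:
  fixes z :: "real^2"
  assumes "R > 0"
  obtains p P where "C1 p P" "\<And>x. 0 \<le> p x" "\<And>x. p x \<le> 1" "\<And>x. x \<notin> cball z R \<Longrightarrow> p x = 0"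
    "\<And>x. x \<notin> cball z R \<Longrightarrow> P x = 0" "\<And>x. (norm (P x))\<^sup>2 \<le> 16 / R\<^sup>2" "\<And>x. x \<in> cball z (R / 2) \<Longrightarrow> 9 / 16 \<le> p x"
proof -
  define b where "b = R\<^sup>2"
  have b: "b > 0" "sqrt b = R" using assms by (auto simp: b_def)
  define t where "t x = (norm (x - z))\<^sup>2" for x
  define p where "p x = hat b (t x) ^ 2" for x
  define P where "P x = (2 * (- (2 / b) * hat b (t x))) *\<^sub>R (x - z)" for x
  have d: "((\<lambda>s. hat b s ^ 2) has_real_derivative - (2 / b) * hat b s) (at s)" for s
    using hat_power_deriv[OF b(1), of 0 s] by (simp add: numeral_2_eq_2)
  have c: "continuous_on {0..} (\<lambda>s. - (2 / b) * hat b s)" by (intro continuous_intros)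
  have 1: "C1 p P" unfolding p_def P_def t_def by (rule C1_radial[OF d c])
  have z: "hat b (t x) = 0" if "x \<notin> cball z R" for x
    using that sq_gt_hat_0[OF b(1), of x z] by (simp add: t_def b(2) dist_norm norm_minus_commute)
  have h: "0 \<le> hat b (t x)" "hat b (t x) \<le> 1" for x
    using hat_le_1[OF b(1), of "t x"] by (auto simp: hat_nonneg t_def)
  have 2: "0 \<le> p x" "p x \<le> 1" for x using h[of x] by (auto simp: p_def power_le_one)
  have tR: "t x \<le> s\<^sup>2" if "x \<in> cball z s" for x s
    using that unfolding t_def by (intro power_mono) (auto simp: dist_norm norm_minus_commute)
  have 3: "(norm (P x))\<^sup>2 \<le> 16 / R\<^sup>2" for x
  proof (cases "x \<in> cball z R")
    case True
    have "(norm (P x))\<^sup>2 = 16 / b\<^sup>2 * (p x * t x)"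
      by (simp add: P_def p_def t_def power_mult_distrib power_divide)
    also have "\<dots> \<le> 16 / b\<^sup>2 * (1 * b)" using 2[of x] tR[OF True] by (intro mult_left_mono mult_mono) (auto simp: b_def t_def)
    also have "\<dots> = 16 / R\<^sup>2" using assms by (simp add: power2_eq_square b_def)
    finally show ?thesis .
  qed (use z[of x] in \<open>simp add: P_def\<close>)
  have 4: "9 / 16 \<le> p x" if "x \<in> cball z (R / 2)" for x
  proof -
    have "t x / b \<le> 1 / 4" using tR[OF that] assms by (simp add: b_def power_divide field_simps)
    then have "3 / 4 \<le> hat b (t x)" unfolding hat_def by linarith
    from power_mono[OF this, of 2] show ?thesis by (simp add: p_def power_divide)
  qed
  show ?thesis by (rule that[OF 1 2 _ _ 3 4]) (use z in \<open>auto simp: p_def P_def\<close>)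
qed

text \<open>Cutting off costs a gradient of size \<open>1 / R\<close>, which Poincare's inequality turns into decay.\<close>

lemma local_energy_decay:
  assumes "h10 U v g" "R > 0" "lam > 0"
    and poincare: "\<And>v h. h10 U v h \<Longrightarrow> lam * sq_norm lebesgue v \<le> sq_norm lebesgue h"
    and eqn: "\<And>p P. C1c (ball 0 (2 * R)) p P \<Longrightarrow>
      (LINT x|lebesgue. g x \<bullet> (p x *\<^sub>R (p x *\<^sub>R g x + v x *\<^sub>R P x) + (p x * v x) *\<^sub>R P x)) = 0"
  shows "lam * (81 / 256) * (LINT x|lebesgue. (v x)\<^sup>2 * indicator (cball 0 (R / 2)) x)
    \<le> 16 / R\<^sup>2 * (LINT x|lebesgue. (v x)\<^sup>2 * indicator (cball 0 R) x)"
proof -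
  note V = h10_sq_int[OF assms(1)]
  obtain p P where P: "C1 p P" "\<And>x. x \<notin> cball 0 R \<Longrightarrow> p x = 0" "\<And>x. x \<notin> cball 0 R \<Longrightarrow> P x = 0"
    "\<And>x. (norm (P x))\<^sup>2 \<le> 16 / R\<^sup>2" and p: "\<And>x. x \<in> cball 0 (R / 2) \<Longrightarrow> 9 / 16 \<le> p x"
    by (rule cutoff_exists[OF assms(2), of 0]) (rule that)
  have C: "C1c (ball 0 (2 * R)) p P"
    by (rule C1cI[OF P(1) compact_cball[of 0 R] _ P(2)]) (use assms(2) in auto)
  obtain B where B: "\<And>x. \<bar>p x\<bar> \<le> B" "\<And>x. norm (P x) \<le> B" by (rule C1c_bounded[OF C]) (rule that)
  have ind: "integrable lebesgue (\<lambda>x. (v x)\<^sup>2 * indicator (cball 0 s) x)" for s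
    by (rule cball_weight_integrable[OF V(1)])
  have pv: "sq_int lebesgue (\<lambda>x. p x * v x)" by (rule h10_sq_int(1)[OF h10_mult[OF assms(1) P(1) B]])
  have "81 / 256 * (LINT x|lebesgue. (v x)\<^sup>2 * indicator (cball 0 (R / 2)) x)
      = (LINT x|lebesgue. 81 / 256 * ((v x)\<^sup>2 * indicator (cball 0 (R / 2)) x))" by simp
  also have "\<dots> \<le> (LINT x|lebesgue. (norm (p x * v x))\<^sup>2)"
  proof (rule integral_mono)
    show "integrable lebesgue (\<lambda>x. 81 / 256 * ((v x)\<^sup>2 * indicator (cball 0 (R / 2)) x))" using ind by simp
    show "integrable lebesgue (\<lambda>x. (norm (p x * v x))\<^sup>2)" by (rule sq_int_integrable[OF pv])
    fix x :: "real^2"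
    show "81 / 256 * ((v x)\<^sup>2 * indicator (cball 0 (R / 2)) x) \<le> (norm (p x * v x))\<^sup>2"
    proof (cases "x \<in> cball 0 (R / 2)")
      case True
      then have "(9 / 16)\<^sup>2 \<le> (p x)\<^sup>2" by (intro power_mono p) auto
      then have "81 / 256 \<le> (p x)\<^sup>2" by (simp add: power_divide)
      then show ?thesis using True mult_right_mono[of "81 / 256" "(p x)\<^sup>2" "(v x)\<^sup>2"] by (simp add: power_mult_distrib)
    qed simp
  qed
  finally have 1: "81 / 256 * (LINT x|lebesgue. (v x)\<^sup>2 * indicator (cball 0 (R / 2)) x) \<le> sq_norm lebesgue (\<lambda>x. p x * v x)"
    by (simp add: sq_norm_def)
  have "lam * sq_norm lebesgue (\<lambda>x. p x * v x) \<le> sq_norm lebesgue (\<lambda>x. p x *\<^sub>R g x + v x *\<^sub>R P x)"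
    by (rule poincare[OF h10_mult[OF assms(1) P(1) B]])
  also have "\<dots> = (LINT x|lebesgue. (v x)\<^sup>2 * (norm (P x))\<^sup>2)"
    using h10_mult_energy(2)[OF assms(1) P(1) B] eqn[OF C] by simp
  also have "\<dots> \<le> (LINT x|lebesgue. 16 / R\<^sup>2 * ((v x)\<^sup>2 * indicator (cball 0 R) x))"
  proof (rule integral_mono)
    show "integrable lebesgue (\<lambda>x. (v x)\<^sup>2 * (norm (P x))\<^sup>2)"
    proof (rule bounded_weight_integrable[OF V(1), where B = "16 / R\<^sup>2"])
      have "P \<in> borel_measurable lebesgue" by (rule continuous_imp_lebesgue_measurable[OF C1D(2)[OF P(1)]])
      then show "(\<lambda>x. (norm (P x))\<^sup>2) \<in> borel_measurable lebesgue" by measurable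
    qed (use P(4) in simp)
    show "integrable lebesgue (\<lambda>x. 16 / R\<^sup>2 * ((v x)\<^sup>2 * indicator (cball 0 R) x))" using ind by simp
    show "(v x)\<^sup>2 * (norm (P x))\<^sup>2 \<le> 16 / R\<^sup>2 * ((v x)\<^sup>2 * indicator (cball 0 R) x)" for x
    proof (cases "x \<in> cball 0 R")
      case True
      have "(v x)\<^sup>2 * (norm (P x))\<^sup>2 \<le> (v x)\<^sup>2 * (16 / R\<^sup>2)" by (intro mult_left_mono P(4)) simp
      then show ?thesis using True by (simp add: mult.commute)
    qed (simp add: P(3))
  qed
  also have "\<dots> = 16 / R\<^sup>2 * (LINT x|lebesgue. (v x)\<^sup>2 * indicator (cball 0 R) x)" by simp
  finally have 2: "lam * sq_norm lebesgue (\<lambda>x. p x * v x) \<le> \<dots>" .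
  have "lam * (81 / 256) * (LINT x|lebesgue. (v x)\<^sup>2 * indicator (cball 0 (R / 2)) x) \<le> lam * sq_norm lebesgue (\<lambda>x. p x * v x)"
    unfolding mult.assoc by (rule mult_left_mono[OF 1 less_imp_le[OF assms(3)]])
  then show ?thesis using 2 by (rule order_trans)
qed

text \<open>The difference solves the homogeneous equation in the large ball. Each energy decay
  gains a factor of order \<open>1 / R\<^sup>2\<close>: the first merely compensates the area in the
  trivial bound \<open>4 * M\<^sup>2 * (pi * R\<^sup>2)\<close>, the second makes the result tend to
  0.\<close>

lemma wsol_diff_decay:
  assumes "wsol U1 f1 w1 g1" "wsol U2 f2 w2 g2" "U1 \<subseteq> \<Omega>" "U2 \<subseteq> \<Omega>" "\<Omega> \<inter> ball 0 (2 * R) \<subseteq> U1" "\<Omega> \<inter> ball 0 (2 * R) \<subseteq> U2"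
    "\<And>x. x \<in> \<Omega> \<Longrightarrow> norm x < 2 * R \<Longrightarrow> f1 x = f2 x" "\<And>x. \<bar>w1 x\<bar> \<le> M" "\<And>x. \<bar>w2 x\<bar> \<le> M" "R > 0" "lam > 0"
    and poincare: "\<And>v h. h10 \<Omega> v h \<Longrightarrow> lam * sq_norm lebesgue v \<le> sq_norm lebesgue h"
  shows "(LINT x|lebesgue. (w1 x - w2 x)\<^sup>2 * indicator (cball 0 (R / 4)) x) \<le> 2 ^ 16 * (pi * M\<^sup>2 / R\<^sup>2) / lam\<^sup>2"
proof -
  define v where "v x = w1 x - w2 x" for x
  define g where "g x = g1 x - g2 x" for x
  note W1 = wsolD[OF assms(1)] note W2 = wsolD[OF assms(2)]
  have v: "h10 \<Omega> v g"
    unfolding v_def g_def by (rule h10_diff[OF h10_mono[OF W1(1) assms(3)] h10_mono[OF W2(1) assms(4)]])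
  note V = h10_sq_int[OF v]
  have eqn: "(LINT x|lebesgue. g x \<bullet> (p x *\<^sub>R (p x *\<^sub>R g x + v x *\<^sub>R P x) + (p x * v x) *\<^sub>R P x)) = 0"
    if C: "C1c (ball 0 s) p P" "s \<le> 2 * R" for p P s
  proof -
    define h where "h x = p x *\<^sub>R (p x *\<^sub>R g x + v x *\<^sub>R P x) + (p x * v x) *\<^sub>R P x" for x
    have CR: "C1c (ball 0 (2 * R)) p P" by (rule C1c_mono[OF C(1) subset_ball[OF C(2)]])
    have "h10 (\<Omega> \<inter> ball 0 (2 * R) \<inter> ball 0 (2 * R)) (\<lambda>x. p x * (p x * v x)) h"
      unfolding h_def[abs_def] by (rule h10_cutoff[OF h10_cutoff[OF v CR] CR])
    then have h: "h10 (\<Omega> \<inter> ball 0 (2 * R)) (\<lambda>x. p x * (p x * v x)) h" by (simp add: Int_assoc)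
    note H = h10_sq_int[OF h]
    have "(LINT x|lebesgue. g x \<bullet> h x) = (LINT x|lebesgue. g1 x \<bullet> h x) - (LINT x|lebesgue. g2 x \<bullet> h x)"
      unfolding g_def inner_diff_left
      by (rule Bochner_Integration.integral_diff[OF integrable_inner_sq_int[OF W1(4) H(2)] integrable_inner_sq_int[OF W2(4) H(2)]])
    also have "(LINT x|lebesgue. g1 x \<bullet> h x) = (LINT x|lebesgue. f1 x * (p x * (p x * v x)))"
      by (rule wsol_test[OF assms(1) h10_mono[OF h assms(5)]])
    also have "(LINT x|lebesgue. g2 x \<bullet> h x) = (LINT x|lebesgue. f2 x * (p x * (p x * v x)))"
      by (rule wsol_test[OF assms(2) h10_mono[OF h assms(6)]])
    also have "(LINT x|lebesgue. f1 x * (p x * (p x * v x))) = (LINT x|lebesgue. f2 x * (p x * (p x * v x)))"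
    proof (rule integral_cong_AE)
      show "(\<lambda>x. f1 x * (p x * (p x * v x))) \<in> borel_measurable lebesgue"
        by (rule borel_measurable_integrable[OF integrable_mult_sq_int[OF W1(2) H(1)]])
      show "(\<lambda>x. f2 x * (p x * (p x * v x))) \<in> borel_measurable lebesgue"
        by (rule borel_measurable_integrable[OF integrable_mult_sq_int[OF W2(2) H(1)]])
      show "AE x in lebesgue. f1 x * (p x * (p x * v x)) = f2 x * (p x * (p x * v x))"
        using h10_AE_zero_outside[OF h] by eventually_elim (use assms(7) in auto)
    qed
    finally show ?thesis by (simp add: h_def)
  qed
  define A where "A s = (LINT x|lebesgue. (v x)\<^sup>2 * indicator (cball 0 s) x)" for s
  have A1: "lam * (81 / 256) * A (R / 2) \<le> 16 / R\<^sup>2 * A R"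
    unfolding A_def by (rule local_energy_decay[OF v assms(10,11) poincare eqn]) auto
  have A2: "lam * (81 / 256) * A (R / 2 / 2) \<le> 16 / (R / 2)\<^sup>2 * A (R / 2)"
    unfolding A_def by (rule local_energy_decay[OF v _ assms(11) poincare eqn]) (use assms(10) in auto)
  have A0: "A R \<le> 4 * M\<^sup>2 * (pi * R\<^sup>2)"
  proof -
    have "A R \<le> (LINT x|lebesgue. 4 * M\<^sup>2 * indicator (cball (0::real^2) R) x)"
      unfolding A_def
    proof (rule integral_mono)
      show "integrable lebesgue (\<lambda>x. (v x)\<^sup>2 * indicator (cball 0 R) x)"
        by (rule cball_weight_integrable[OF V(1)])
      show "integrable lebesgue (\<lambda>x. 4 * M\<^sup>2 * indicator (cball (0::real^2) R) x)"
        using lmeasurable_cball[of "0::real^2" R] by (intro integrable_mult_right) (simp add: lmeasurable_iff_integrable)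
      fix x
      have "\<bar>v x\<bar> \<le> 2 * M" using assms(8,9)[of x] by (simp add: v_def)
      then have "(v x)\<^sup>2 \<le> 4 * M\<^sup>2" using power_mono[of "\<bar>v x\<bar>" "2 * M" 2] by (simp add: power_mult_distrib)
      then show "(v x)\<^sup>2 * indicator (cball 0 R) x \<le> 4 * M\<^sup>2 * indicator (cball 0 R) x" by (intro mult_right_mono) auto
    qed
    also have "\<dots> = 4 * M\<^sup>2 * measure lebesgue (cball (0::real^2) R)" by simp
    also have "measure lebesgue (cball (0::real^2) R) = pi * R\<^sup>2"
      using content_cball[of R "0::real^2"] assms(10) by (simp add: unit_ball_vol_2)
    finally show ?thesis .
  qed
  have "lam * (81 / 256) * A (R / 2) \<le> 16 / R\<^sup>2 * (4 * M\<^sup>2 * (pi * R\<^sup>2))"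
    by (rule order_trans[OF A1 mult_left_mono[OF A0]]) simp
  also have "\<dots> = 64 * (pi * M\<^sup>2)" using assms(10) by simp
  finally have B: "lam * A (R / 2) \<le> 256 / 81 * 64 * (pi * M\<^sup>2)" by simp
  have "lam * (81 / 256) * A (R / 4) \<le> 64 / R\<^sup>2 * A (R / 2)" using A2 by (simp add: power_divide)
  then have "lam * (lam * (81 / 256) * A (R / 4)) \<le> lam * (64 / R\<^sup>2 * A (R / 2))" using assms(11) by (intro mult_left_mono) auto
  also have "\<dots> = 64 / R\<^sup>2 * (lam * A (R / 2))" by simp
  also have "\<dots> \<le> 64 / R\<^sup>2 * (256 / 81 * 64 * (pi * M\<^sup>2))" by (intro mult_left_mono B) auto
  finally have "lam\<^sup>2 * A (R / 4) \<le> 256 / 81 * (64 / R\<^sup>2 * (256 / 81 * 64 * (pi * M\<^sup>2)))" by (simp add: power2_eq_square)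
  also have "\<dots> = (256 / 81 * 64 * (256 / 81) * 64) * (pi * M\<^sup>2 / R\<^sup>2)" by simp
  also have "\<dots> \<le> 2 ^ 16 * (pi * M\<^sup>2 / R\<^sup>2)" by (intro mult_right_mono) auto
  finally have "A (R / 4) \<le> 2 ^ 16 * (pi * M\<^sup>2 / R\<^sup>2) / lam\<^sup>2" using assms(11) by (subst pos_le_divide_eq) (simp_all add: mult.commute)
  then show ?thesis by (simp add: A_def v_def)
qed

lemma kmean_diff:
  assumes "sq_int lebesgue v" "sq_int lebesgue w" "b > 0"
  shows "kmean (\<lambda>x. v x - w x) b x = kmean v b x - kmean w b x"
  unfolding kmean_def left_diff_distrib
  by (rule Bochner_Integration.integral_diff[OF integrable_mult_sq_int[OF assms(1) kap_sq_norm(1)[OF assms(3)]]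
    integrable_mult_sq_int[OF assms(2) kap_sq_norm(1)[OF assms(3)]]])

text \<open>The corrected mean is constant in the scale and tends to \<open>w x\<close>. With this
  exact formula the difference of two torsion functions at a point reduces to a local L2
  norm.\<close>

lemma wsol_kmean_value:
  assumes "wsol U f w g" "\<And>x. x \<in> U \<Longrightarrow> f x = c" "0 < B" "cball x (sqrt B) \<subseteq> U" "isCont w x"
  shows "w x = kmean w B x + c * B / 24"
proof (rule tendsto_unique[OF trivial_limit_at_right_real])
  have "((\<lambda>b. kmean w b x + c * b / 24) \<longlongrightarrow> w x + c * 0 / 24) (at_right 0)"
    by (intro tendsto_add tendsto_divide tendsto_mult tendsto_const tendsto_ident_at kmean_tendsto[OF wsolD(3)[OF assms(1)] assms(5)]) simp
  then show "((\<lambda>b. kmean w b x + c * b / 24) \<longlongrightarrow> w x) (at_right 0)" by simp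
  have "\<forall>\<^sub>F b in at_right 0. kmean w b x + c * b / 24 = kmean w B x + c * B / 24"
    by (intro eventually_at_rightI[of 0 B]) (auto intro!: wsol_kmean_const[OF assms(1,2) _ _ assms(4)] simp: assms(3))
  then show "((\<lambda>b. kmean w b x + c * b / 24) \<longlongrightarrow> kmean w B x + c * B / 24) (at_right 0)"
    by (rule tendsto_eventually)
qed

lemma dirichlet_bottom_poincare:
  assumes "open \<Omega>" "U \<subseteq> \<Omega>" "h10 U v h"
  shows "dirichlet_bottom \<Omega> * sq_norm lebesgue v \<le> sq_norm lebesgue h"
  by (rule dirichlet_bottom_le[OF assms(1) h10_mono[OF assms(3,2)]])

lemma torsion_bounded_ball:
  assumes "open \<Omega>" "dirichlet_bottom \<Omega> > 0"
  obtains g where "wsol (\<Omega> \<inter> ball 0 r) (indicator (\<Omega> \<inter> ball 0 r)) (torsion_bounded (\<Omega> \<inter> ball 0 r)) g"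
    "\<And>x. x \<in> \<Omega> \<inter> ball 0 r \<Longrightarrow> isCont (torsion_bounded (\<Omega> \<inter> ball 0 r)) x"
    "\<And>x. x \<notin> \<Omega> \<inter> ball 0 r \<Longrightarrow> torsion_bounded (\<Omega> \<inter> ball 0 r) x = 0"
    "\<And>x. \<bar>torsion_bounded (\<Omega> \<inter> ball 0 r) x\<bar> \<le> 304 / 81 / dirichlet_bottom \<Omega>"
proof -
  define D where "D = \<Omega> \<inter> ball 0 r"
  have D: "open D" "bounded D" "D \<subseteq> \<Omega>" using assms(1) by (auto simp: D_def intro: bounded_subset)
  note P = dirichlet_bottom_poincare[OF assms(1) D(3)]
  obtain g where g: "wsol D (indicator D) (torsion_bounded D) g" "continuous_on D (torsion_bounded D)"
    "\<And>x. x \<notin> D \<Longrightarrow> torsion_bounded D x = 0"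
    by (rule torsion_bounded_wsol[OF D(1,2) assms(2) P], assumption) (rule that)
  have c: "isCont (torsion_bounded D) x" if "x \<in> D" for x
    using g(2) that continuous_on_eq_continuous_at[OF D(1)] by blast
  have "\<bar>torsion_bounded D x\<bar> \<le> 304 / 81 / dirichlet_bottom \<Omega>" for x
    by (rule wsol_sup_bound[OF g(1) _ assms(2) P c g(3)]) auto
  then show ?thesis using that g(1,3) c unfolding D_def by blast
qed

text \<open>Convergence of the truncations comes from the decay of their differences, rather than
  from monotonicity in the domain, and so yields a finite limit at once.\<close>

lemma torsion_bounded_Cauchy:
  assumes "open \<Omega>" "dirichlet_bottom \<Omega> > 0" "e > 0"
  shows "\<exists>R0. \<forall>r\<ge>R0. \<forall>r'\<ge>R0. \<bar>torsion_bounded (\<Omega> \<inter> ball 0 r) x - torsion_bounded (\<Omega> \<inter> ball 0 r') x\<bar> < e"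
proof (cases "x \<in> \<Omega>")
  case True
  define lam where "lam = dirichlet_bottom \<Omega>"
  define M where "M = 304 / 81 / lam"
  obtain s where s: "s > 0" "cball x s \<subseteq> \<Omega>" using assms(1) True by (meson open_contains_cball)
  define B where "B = s\<^sup>2"
  have B: "B > 0" "sqrt B = s" using s(1) by (auto simp: B_def)
  define K where "K = 25 / (9 * pi * B) * (2 ^ 16 * (pi * M\<^sup>2) / lam\<^sup>2)"
  have K: "K \<ge> 0" using B by (simp add: K_def)
  \<comment> \<open>The first entry places the disc about \<open>x\<close> inside
    \<open>cball 0 (R / 4)\<close>; the second makes the final error \<open>sqrt K / R\<close>
    smaller than \<open>e\<close>.\<close>
  define R where "R = max (4 * (norm x + s)) (sqrt K / e + 1)"
  have R1: "4 * norm x + 4 * s \<le> R" by (simp add: R_def distrib_left)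
  have R2: "sqrt K / e < R" by (simp add: R_def less_max_iff_disj)
  have "R > 0" using R1 s(1) norm_ge_zero[of x] by linarith
  moreover have "norm x + s \<le> R / 4" using R1 by linarith
  ultimately have R: "R > 0" "norm x + s \<le> R / 4" "sqrt K / e < R" using R2 by blast+
  have "\<bar>torsion_bounded (\<Omega> \<inter> ball 0 r) x - torsion_bounded (\<Omega> \<inter> ball 0 r') x\<bar> < e" if r: "r \<ge> 2 * R" "r' \<ge> 2 * R" for r r'
  proof -
    define U1 where "U1 = \<Omega> \<inter> ball 0 r"
    define U2 where "U2 = \<Omega> \<inter> ball 0 r'"
    define w1 where "w1 = torsion_bounded U1"
    define w2 where "w2 = torsion_bounded U2"
    obtain g1 where g1: "wsol U1 (indicator U1) w1 g1" "\<And>x. x \<in> U1 \<Longrightarrow> isCont w1 x" "\<And>x. \<bar>w1 x\<bar> \<le> M"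
      by (rule torsion_bounded_ball[OF assms(1,2), of r]) (rule that[unfolded U1_def w1_def M_def lam_def])
    obtain g2 where g2: "wsol U2 (indicator U2) w2 g2" "\<And>x. x \<in> U2 \<Longrightarrow> isCont w2 x" "\<And>x. \<bar>w2 x\<bar> \<le> M"
      by (rule torsion_bounded_ball[OF assms(1,2), of r']) (rule that[unfolded U2_def w2_def M_def lam_def])
    have U: "U1 \<subseteq> \<Omega>" "U2 \<subseteq> \<Omega>" "\<Omega> \<inter> ball 0 (2 * R) \<subseteq> U1" "\<Omega> \<inter> ball 0 (2 * R) \<subseteq> U2" using r by (auto simp: U1_def U2_def)
    have sub: "cball x s \<subseteq> cball 0 (R / 4)" using R(2) by (simp add: cball_subset_cball_iff dist_norm)
    also have "\<dots> \<subseteq> ball 0 (2 * R)" using R(1) by auto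
    finally have "cball x s \<subseteq> \<Omega> \<inter> ball 0 (2 * R)" using s(2) by blast
    then have c: "cball x (sqrt B) \<subseteq> U1" "cball x (sqrt B) \<subseteq> U2" using U(3,4) B(2) by auto
    have x: "x \<in> U1" "x \<in> U2" using c s(1) B(2) by (auto simp: subset_eq)
    note q = wsolD(3)[OF g1(1)] wsolD(3)[OF g2(1)]
    have "w1 x - w2 x = kmean w1 B x - kmean w2 B x"
      using wsol_kmean_value[OF g1(1) _ B(1) c(1) g1(2)[OF x(1)], of 1] wsol_kmean_value[OF g2(1) _ B(1) c(2) g2(2)[OF x(2)], of 1]
      by simp
    also have "\<dots> = kmean (\<lambda>y. w1 y - w2 y) B x" by (rule kmean_diff[OF q B(1), symmetric])
    finally have "\<bar>w1 x - w2 x\<bar> \<le> kmean (\<lambda>y. \<bar>w1 y - w2 y\<bar>) B x" using kmean_abs[OF B(1)] by simp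
    also have "\<dots> \<le> sqrt (25 / (9 * pi * B)) * sqrt (LINT y|lebesgue. (w1 y - w2 y)\<^sup>2 * indicator (cball 0 (R / 4)) y)"
      by (rule kmean_abs_le_local[OF sq_int_diff[OF q] B(1)]) (use sub B(2) in simp)
    also have "\<dots> \<le> sqrt (25 / (9 * pi * B)) * sqrt (2 ^ 16 * (pi * M\<^sup>2 / R\<^sup>2) / lam\<^sup>2)"
    proof (intro mult_left_mono real_sqrt_le_mono)
      show "(LINT y|lebesgue. (w1 y - w2 y)\<^sup>2 * indicator (cball 0 (R / 4)) y) \<le> 2 ^ 16 * (pi * M\<^sup>2 / R\<^sup>2) / lam\<^sup>2"
        unfolding lam_def
      proof (rule wsol_diff_decay[OF g1(1) g2(1) U _ g1(3) g2(3) R(1) assms(2)])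
        show "indicator U1 y = (indicator U2 y :: real)" if "y \<in> \<Omega>" "norm y < 2 * R" for y
          using that U(3,4) by (auto simp: indicator_def)
      qed (rule dirichlet_bottom_le[OF assms(1)])
    qed (use B in auto)
    also have "\<dots> = sqrt (K / R\<^sup>2)" by (simp add: K_def real_sqrt_mult[symmetric])
    also have "\<dots> = sqrt K / R" using R(1) by (simp add: real_sqrt_divide)
    also have "\<dots> < e" using R(1,3) assms(3) by (simp add: field_simps)
    finally show ?thesis by (simp add: w1_def w2_def U1_def U2_def)
  qed
  then show ?thesis by blast
next
  case False
  have "torsion_bounded (\<Omega> \<inter> ball 0 r) x = 0" for r
    by (rule torsion_bounded_ball[OF assms(1,2), of r]) (use False in auto)
  then show ?thesis using assms(3) by simp
qed

text \<open>\<open>Lim\<close> denotes the limit only once one is known to exist. The Cauchy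
  estimate gives it along the integers first, and then for real radii.\<close>

lemma torsion_limit:
  assumes "open \<Omega>" "dirichlet_bottom \<Omega> > 0"
  obtains T where "torsion \<Omega> = (\<lambda>x. ereal (T x))"
    "\<And>x. ((\<lambda>r. torsion_bounded (\<Omega> \<inter> ball 0 r) x) \<longlongrightarrow> T x) at_top"
proof -
  have "\<exists>L. ((\<lambda>r. torsion_bounded (\<Omega> \<inter> ball 0 r) x) \<longlongrightarrow> L) at_top" for x
  proof -
    define w where "w r = torsion_bounded (\<Omega> \<inter> ball 0 r) x" for r
    have C: "\<exists>R0. \<forall>r\<ge>R0. \<forall>r'\<ge>R0. \<bar>w r - w r'\<bar> < e" if "e > 0" for e
      unfolding w_def by (rule torsion_bounded_Cauchy[OF assms that])
    have "Cauchy (\<lambda>n. w (real n))"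
    proof (rule metric_CauchyI)
      fix e :: real assume "e > 0"
      then obtain R0 where R0: "\<And>r r'. r \<ge> R0 \<Longrightarrow> r' \<ge> R0 \<Longrightarrow> \<bar>w r - w r'\<bar> < e" using C by blast
      have "\<bar>w (real m) - w (real n)\<bar> < e" if "m \<ge> nat \<lceil>R0\<rceil>" "n \<ge> nat \<lceil>R0\<rceil>" for m n
        by (rule R0) (use that in linarith)+
      then show "\<exists>M. \<forall>m\<ge>M. \<forall>n\<ge>M. dist (w (real m)) (w (real n)) < e" unfolding dist_real_def by blast
    qed
    then obtain L where L: "(\<lambda>n. w (real n)) \<longlonglongrightarrow> L" by (auto simp: Cauchy_convergent_iff convergent_def)
    have "(w \<longlongrightarrow> L) at_top"
    proof (rule tendstoI)
      fix e :: real assume "e > 0"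
      then obtain R0 where R0: "\<And>r r'. r \<ge> R0 \<Longrightarrow> r' \<ge> R0 \<Longrightarrow> \<bar>w r - w r'\<bar> < e / 2" using C[of "e / 2"] by auto
      have "dist (w r) L < e" if "r \<ge> R0" for r
      proof -
        have "(\<lambda>n. \<bar>w r - w (real n)\<bar>) \<longlonglongrightarrow> \<bar>w r - L\<bar>" by (intro tendsto_intros L)
        moreover have "\<bar>w r - w (real n)\<bar> \<le> e / 2" if "n \<ge> nat \<lceil>R0\<rceil>" for n
          by (rule less_imp_le[OF R0[OF \<open>r \<ge> R0\<close>]]) (use that in linarith)
        ultimately have "\<bar>w r - L\<bar> \<le> e / 2" using LIMSEQ_le_const2 by blast
        then show ?thesis using \<open>e > 0\<close> by (simp add: dist_real_def)
      qed
      then show "\<forall>\<^sub>F r in at_top. dist (w r) L < e" unfolding eventually_at_top_linorder by blast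
    qed
    then show ?thesis unfolding w_def[abs_def] by blast
  qed
  then obtain T where T: "\<And>x. ((\<lambda>r. torsion_bounded (\<Omega> \<inter> ball 0 r) x) \<longlongrightarrow> T x) at_top" by metis
  have "torsion \<Omega> x = ereal (T x)" for x
    unfolding torsion_def by (rule tendsto_Lim[OF trivial_limit_at_top_linorder tendsto_ereal[OF T]])
  then show ?thesis using that T by blast
qed

text \<open>Cutoffs at radius \<open>R\<close> have energy at most \<open>16 * pi\<close> while
  their mass grows like \<open>R\<^sup>2\<close>. A positive bottom of the spectrum thus excludes
  \<open>\<Omega> = UNIV\<close>, where the distance to the boundary is infinite.\<close>

lemma dirichlet_bottom_UNIV: "dirichlet_bottom UNIV = 0"
proof -
  have "dirichlet_bottom UNIV \<le> e" if "e > 0" for e :: real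
  proof -
    \<comment> \<open>The cutoff gives the bound \<open>256 / R\<^sup>2\<close>, which is
      \<open>e / 4\<close> for this radius.\<close>
    define R where "R = sqrt (1024 / e)"
    have R: "R > 0" "R\<^sup>2 = 1024 / e" using that by (auto simp: R_def)
    obtain p P where P: "C1 p P" "\<And>x. x \<notin> cball (0::real^2) R \<Longrightarrow> p x = 0" "\<And>x. x \<notin> cball 0 R \<Longrightarrow> P x = 0"
      "\<And>x. (norm (P x))\<^sup>2 \<le> 16 / R\<^sup>2" and p: "\<And>x. x \<in> cball 0 (R / 2) \<Longrightarrow> 9 / 16 \<le> p x"
      by (rule cutoff_exists[OF R(1), of 0]) (rule that)
    have C: "C1c UNIV p P" by (rule C1cI[OF P(1) compact_cball[of 0 R] _ P(2)]) auto
    have ball: "measure lebesgue (cball (0::real^2) s) = pi * s\<^sup>2" if "s \<ge> 0" for s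
      using content_cball[OF that, of "0::real^2"] by (simp add: unit_ball_vol_2)
    have "sq_norm lebesgue P \<le> (4 / R)\<^sup>2 * measure lebesgue (cball (0::real^2) R)"
    proof (rule sq_norm_compact_le[OF compact_cball P(3)])
      show "norm (P x) \<le> 4 / R" for x
        by (rule power2_le_imp_le) (use P(4)[of x] R(1) in \<open>auto simp: power_divide\<close>)
    qed
    also have "\<dots> = 16 * pi" unfolding ball[OF less_imp_le[OF R(1)]] using R(1) by (simp add: power_divide)
    finally have 1: "sq_norm lebesgue P \<le> 16 * pi" .
    have "sq_norm lebesgue (indicator (cball (0::real^2) (R / 2)) :: real^2 \<Rightarrow> real) \<le> (2::real)\<^sup>2 * sq_norm lebesgue p"
    proof (rule sq_norm_bound[OF C1c_sq_int(1)[OF C] sq_int_indicator[OF lmeasurable_cball]])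
      show "norm (indicator (cball 0 (R / 2)) x :: real) \<le> 2 * norm (p x)" for x
        using p[of x] by (cases "x \<in> cball 0 (R / 2)") auto
    qed
    moreover have "sq_norm lebesgue (indicator (cball (0::real^2) (R / 2)) :: real^2 \<Rightarrow> real) = measure lebesgue (cball (0::real^2) (R / 2))"
    proof -
      have "(norm (indicator (cball (0::real^2) (R / 2)) x :: real))\<^sup>2 = indicator (cball 0 (R / 2)) x" for x
        by (cases "x \<in> cball 0 (R / 2)") auto
      then show ?thesis unfolding sq_norm_def by (simp only: Bochner_Integration.integral_indicator) simp
    qed
    ultimately have 2: "pi * (R / 2)\<^sup>2 \<le> 4 * sq_norm lebesgue p" using ball[of "R / 2"] R(1) by simp
    have 3: "dirichlet_bottom UNIV * sq_norm lebesgue p \<le> sq_norm lebesgue P"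
      by (rule dirichlet_bottom_le[OF open_UNIV h10_C1c[OF C]])
    have 0: "dirichlet_bottom UNIV \<ge> 0" by (rule dirichlet_bottom_nonneg) auto
    have "dirichlet_bottom UNIV * (pi * (R / 2)\<^sup>2) \<le> dirichlet_bottom UNIV * (4 * sq_norm lebesgue p)"
      by (rule mult_left_mono[OF 2 0])
    also have "\<dots> \<le> 64 * pi" using 1 3 by simp
    finally have "dirichlet_bottom UNIV * R\<^sup>2 \<le> 256" by (simp add: power_divide)
    then show ?thesis unfolding R(2) using that by (simp add: field_simps)
  qed
  then have "dirichlet_bottom UNIV \<le> 0" by (rule field_le_epsilon) simp
  then show ?thesis using dirichlet_bottom_nonneg[of UNIV] by simp
qed

lemma boundary_dist_attained:
  assumes "open \<Omega>" "\<Omega> \<noteq> UNIV"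
  obtains z where "z \<notin> \<Omega>" "boundary_dist \<Omega> x = ereal (norm (x - z))"
proof -
  have "closed (- \<Omega>)" "- \<Omega> \<noteq> {}" using assms by auto
  then obtain z where z: "z \<in> - \<Omega>" "\<forall>y\<in>- \<Omega>. dist x z \<le> dist x y" by (rule distance_attains_inf[of _ x]) blast
  have "boundary_dist \<Omega> x = ereal (dist x z)"
    unfolding boundary_dist_def
  proof (rule antisym)
    show "(INF y\<in>- \<Omega>. ereal (dist x y)) \<le> ereal (dist x z)" by (rule INF_lower[OF z(1)])
    show "ereal (dist x z) \<le> (INF y\<in>- \<Omega>. ereal (dist x y))" by (rule INF_greatest) (use z(2) in simp)
  qed
  then show ?thesis using that z(1) by (simp add: dist_norm)
qed

text \<open>The bound for the truncations involves the bottom of the spectrum of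
  \<open>\<Omega>\<close> and a point of its complement, but not the radius, so it survives the
  limit.\<close>

lemma torsion_le:
  fixes \<Omega> :: "(real^2) set"
  assumes "open \<Omega>" "simply_connected \<Omega>" "dirichlet_bottom \<Omega> > 0" "c > 0" "x \<in> \<Omega>"
  shows "torsion \<Omega> x \<le> ereal (32/3 * real_of_ereal (boundary_dist \<Omega> x) powr (1/2)
                 * dirichlet_bottom \<Omega> powr (-3/4) * c powr (3/2)
               + inverse (dirichlet_bottom \<Omega>) * 2 powr (9/2) * exp (- c))"
proof -
  have "\<Omega> \<noteq> UNIV" using assms(3) dirichlet_bottom_UNIV by auto
  then obtain z where z: "z \<notin> \<Omega>" "boundary_dist \<Omega> x = ereal (norm (x - z))"
    by (rule boundary_dist_attained[OF assms(1), of x]) (rule that)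
  obtain T where T: "torsion \<Omega> = (\<lambda>x. ereal (T x))"
    "\<And>x. ((\<lambda>r. torsion_bounded (\<Omega> \<inter> ball 0 r) x) \<longlongrightarrow> T x) at_top"
    by (rule torsion_limit[OF assms(1,3)]) (rule that)
  have "T x \<le> 32/3 * norm (x - z) powr (1/2) * dirichlet_bottom \<Omega> powr (-3/4) * c powr (3/2)
      + inverse (dirichlet_bottom \<Omega>) * 2 powr (9/2) * exp (- c)" (is "_ \<le> ?rhs")
  proof (rule tendsto_upperbound[OF T(2) _ trivial_limit_at_top_linorder])
    have "torsion_bounded (\<Omega> \<inter> ball 0 r) x \<le> ?rhs" if r: "r \<ge> norm x + 1" for r
    proof -
      obtain g where g: "wsol (\<Omega> \<inter> ball 0 r) (indicator (\<Omega> \<inter> ball 0 r)) (torsion_bounded (\<Omega> \<inter> ball 0 r)) g"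
        "\<And>x. x \<in> \<Omega> \<inter> ball 0 r \<Longrightarrow> isCont (torsion_bounded (\<Omega> \<inter> ball 0 r)) x"
        "\<And>x. \<bar>torsion_bounded (\<Omega> \<inter> ball 0 r) x\<bar> \<le> 304 / 81 / dirichlet_bottom \<Omega>"
        by (rule torsion_bounded_ball[OF assms(1,3), of r]) (rule that)
      show ?thesis
        by (rule wsol_distance_bound[OF assms(1,2) z(1) _ g(1) _ assms(3) g(3)])
           (use assms(4,5) r z(1) in \<open>auto intro!: g(2)\<close>)
    qed
    then show "\<forall>\<^sub>F r in at_top. torsion_bounded (\<Omega> \<inter> ball 0 r) x \<le> ?rhs"
      unfolding eventually_at_top_linorder by blast
  qed
  then show ?thesis by (simp add: T(1) z(2))
qed

section \<open>A lower bound for the supremum of the torsion function\<close>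

lemma wsol_indicator_nonneg:
  assumes "open D" "bounded D" "wsol D (indicator D) w g" "\<And>x. x \<in> D \<Longrightarrow> isCont w x" "\<And>x. x \<notin> D \<Longrightarrow> w x = 0"
  shows "0 \<le> w x"
proof -
  note W = wsolD[OF assms(3)]
  define f where "f = (indicator D :: real^2 \<Rightarrow> real)"
  have D: "D \<in> lmeasurable" using assms(1,2) by (simp add: lmeasurable_open)
  have fi: "integrable lebesgue f" using D by (simp add: f_def lmeasurable_iff_integrable)
  have f: "sq_int lebesgue f" unfolding f_def by (rule sq_int_indicator[OF D])
  have I: "integrable lebesgue (\<lambda>x. f x * (\<bar>w x\<bar> - w x))"
    by (rule integrable_mult_sq_int[OF f sq_int_diff[OF sq_int_abs[OF W(3)] W(3)]])
  have small: "(LINT x|lebesgue. f x * (\<bar>w x\<bar> - w x)) \<le> e * measure lebesgue D" if e: "e > 0" for e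
  proof -
    note S = sabs_props[OF e]
    \<comment> \<open>A regularised \<open>\<bar>t\<bar> - t\<close>, twice the negative part. Its
      derivative is at most 0, so testing with it gives a nonpositive integral, while
      \<open>f * (\<bar>w\<bar> - w)\<close> is nonnegative; the two differ by a multiple of
      \<open>e\<close>.\<close>
    define \<gamma> where "\<gamma> t = sabs e t - t" for t
    have h: "h10 D (\<lambda>x. \<gamma> (w x)) (\<lambda>x. (ssgn e (w x) - 1) *\<^sub>R g x)"
    proof (rule h10_compose[OF W(1), where B = 2])
      show "(\<gamma> has_real_derivative ssgn e t - 1) (at t)" for t
        unfolding \<gamma>_def[abs_def] by (rule DERIV_diff[OF S(3) DERIV_ident])
      show "continuous_on UNIV (\<lambda>t. ssgn e t - 1)" by (intro continuous_intros S(5))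
      show "\<bar>ssgn e t - 1\<bar> \<le> 2" for t using S(7)[of t] by linarith
    qed (simp add: \<gamma>_def S(1))
    have "(LINT x|lebesgue. f x * \<gamma> (w x)) = (LINT x|lebesgue. g x \<bullet> ((ssgn e (w x) - 1) *\<^sub>R g x))"
      unfolding f_def by (rule wsol_test[OF assms(3) h, symmetric])
    also have "\<dots> = - (LINT x|lebesgue. (1 - ssgn e (w x)) * (g x \<bullet> g x))"
      by (simp only: integral_minus[symmetric] inner_scaleR_right) (simp add: left_diff_distrib)
    also have "\<dots> \<le> 0"
      using S(7) by (simp add: abs_le_iff Bochner_Integration.integral_nonneg)
    finally have 1: "(LINT x|lebesgue. f x * \<gamma> (w x)) \<le> 0" .
    have "(LINT x|lebesgue. f x * (\<bar>w x\<bar> - w x)) \<le> (LINT x|lebesgue. f x * \<gamma> (w x) + e * f x)"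
    proof (rule integral_mono[OF I])
      show "integrable lebesgue (\<lambda>x. f x * \<gamma> (w x) + e * f x)"
        using integrable_mult_sq_int[OF f h10_sq_int(1)[OF h]] fi by simp
      show "f x * (\<bar>w x\<bar> - w x) \<le> f x * \<gamma> (w x) + e * f x" for x
        using S(10)[of "w x"] by (auto simp: f_def \<gamma>_def indicator_def)
    qed
    also have "\<dots> = (LINT x|lebesgue. f x * \<gamma> (w x)) + e * measure lebesgue D"
      using integrable_mult_sq_int[OF f h10_sq_int(1)[OF h]] fi by (simp add: f_def)
    finally show ?thesis using 1 by simp
  qed
  have "(LINT x|lebesgue. f x * (\<bar>w x\<bar> - w x)) \<le> 0"
  proof (rule field_le_epsilon)
    fix e :: real assume "e > 0"
    then have "e / (measure lebesgue D + 1) > 0" by (simp add: add_nonneg_pos)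
    note small[OF this]
    also have "e / (measure lebesgue D + 1) * measure lebesgue D \<le> e / (measure lebesgue D + 1) * (measure lebesgue D + 1)"
      using \<open>e > 0\<close> by (intro mult_left_mono) auto
    also have "\<dots> = e" using measure_nonneg[of lebesgue D] by (simp add: add_nonneg_eq_0_iff)
    finally show "(LINT x|lebesgue. f x * (\<bar>w x\<bar> - w x)) \<le> 0 + e" by simp
  qed
  moreover have nn: "0 \<le> f x * (\<bar>w x\<bar> - w x)" for x by (simp add: f_def indicator_def)
  ultimately have "(LINT x|lebesgue. f x * (\<bar>w x\<bar> - w x)) = 0"
    by (intro antisym Bochner_Integration.integral_nonneg)
  then have "AE x in lebesgue. f x * (\<bar>w x\<bar> - w x) = 0"
    using integral_nonneg_eq_0_iff_AE[OF I] nn by simp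
  then have ae: "AE x in lebesgue. x \<in> D \<longrightarrow> \<bar>w x\<bar> - w x = 0" by eventually_elim (auto simp: f_def)
  have "continuous_on D (\<lambda>x. \<bar>w x\<bar> - w x)"
    by (intro continuous_intros continuous_at_imp_continuous_on ballI assms(4))
  from continuous_AE_eq_0[OF assms(1) this ae, of x] show ?thesis using assms(5)[of x] by (cases "x \<in> D") auto
qed

text \<open>For \<open>t \<ge> 0\<close> one has
  \<open>1 / (e + t) = 1 / e - t / (e + t) / e\<close>. The odd extension of
  \<open>t / (e + t)\<close> is C1 on the whole line, with bounded derivative and value 0 at 0, as
  \<open>h10_compose\<close> requires.\<close>

lemma frac_abs_deriv:
  fixes e t :: real
  assumes "e > 0"
  shows "((\<lambda>t. t / (e + \<bar>t\<bar>)) has_real_derivative e / (e + \<bar>t\<bar>)\<^sup>2) (at t)"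
proof (cases "t = 0")
  case True
  have "((\<lambda>h. 1 / (e + \<bar>h\<bar>)) \<longlongrightarrow> 1 / (e + \<bar>0\<bar>)) (at 0)" using assms by (intro tendsto_intros) auto
  also have "?this \<longleftrightarrow> ((\<lambda>h. h / (e + \<bar>h\<bar>) / h) \<longlongrightarrow> 1 / e) (at 0)"
    by (subst LIM_equal[of 0 _ "\<lambda>h. h / (e + \<bar>h\<bar>) / h"]) auto
  finally show ?thesis using True assms by (simp add: DERIV_def power2_eq_square)
next
  case False
  then consider "t > 0" | "t < 0" by linarith
  then show ?thesis
  proof cases
    case 1
    have "((\<lambda>t. t / (e + t)) has_real_derivative e / (e + \<bar>t\<bar>)\<^sup>2) (at t)"
      using 1 assms by (auto intro!: derivative_eq_intros simp: power2_eq_square field_simps)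
    then show ?thesis
      by (rule has_field_derivative_transform_within_open[of _ _ _ "{0<..}"]) (use 1 in auto)
  next
    case 2
    have "((\<lambda>t. t / (e - t)) has_real_derivative e / (e + \<bar>t\<bar>)\<^sup>2) (at t)"
      using 2 assms by (auto intro!: derivative_eq_intros simp: power2_eq_square field_simps)
    then show ?thesis
      by (rule has_field_derivative_transform_within_open[of _ _ _ "{..<0}"]) (use 2 in auto)
  qed
qed

text \<open>The test function is \<open>\<phi>\<^sup>2 / (e + w)\<close>.\<close>

lemma wsol_reciprocal_weight:
  assumes "wsol D f w g" "\<And>x. 0 \<le> w x" "C1c D \<phi> G" "\<And>x. x \<in> D \<Longrightarrow> f x = 1" "e > 0"
  shows "(LINT x|lebesgue. (\<phi> x)\<^sup>2 / (e + w x)) \<le> sq_norm lebesgue G"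
proof -
  note W = wsolD[OF assms(1)]
  define \<gamma> where "\<gamma> t = - (1 / e) * (t / (e + \<bar>t\<bar>))" for t
  define \<gamma>' where "\<gamma>' t = - 1 / (e + \<bar>t\<bar>)\<^sup>2" for t
  have hg: "h10 D (\<lambda>x. \<gamma> (w x)) (\<lambda>x. \<gamma>' (w x) *\<^sub>R g x)"
  proof (rule h10_compose[OF W(1), where B = "1 / e\<^sup>2"])
    show "(\<gamma> has_real_derivative \<gamma>' t) (at t)" for t
      using DERIV_cmult[OF frac_abs_deriv[OF assms(5)], of "- (1 / e)" t] assms(5) by (simp add: \<gamma>_def[abs_def] \<gamma>'_def)
    show "continuous_on UNIV \<gamma>'" unfolding \<gamma>'_def[abs_def] using assms(5) by (intro continuous_intros) (auto simp: add_pos_nonneg)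
    show "\<bar>\<gamma>' t\<bar> \<le> 1 / e\<^sup>2" for t
      using assms(5) by (auto simp: \<gamma>'_def intro!: divide_left_mono power_mono mult_pos_pos zero_less_power add_pos_nonneg)
  qed (simp add: \<gamma>_def)
  obtain B where B: "\<And>x. \<bar>\<phi> x\<bar> \<le> B" "\<And>x. norm (G x) \<le> B" by (rule C1c_bounded[OF assms(3)]) (rule that)
  note C = C1c_imp_C1[OF assms(3)]
  have h1: "h10 D (\<lambda>x. \<phi> x * \<gamma> (w x)) (\<lambda>x. \<phi> x *\<^sub>R (\<gamma>' (w x) *\<^sub>R g x) + \<gamma> (w x) *\<^sub>R G x)" by (rule h10_mult[OF hg C B])
  \<comment> \<open>The constant \<open>1 / e\<close> that separates \<open>\<gamma> (w x)\<close>
    from \<open>1 / (e + w x)\<close> would violate the condition at 0 in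
    \<open>h10_compose\<close>; multiplied by \<open>\<phi>\<close> it is admissible and is restored
    here.\<close>
  have h2: "h10 D (\<lambda>x. \<phi> x * \<gamma> (w x) + 1 / e * \<phi> x) (\<lambda>x. (\<phi> x *\<^sub>R (\<gamma>' (w x) *\<^sub>R g x) + \<gamma> (w x) *\<^sub>R G x) + (1 / e) *\<^sub>R G x)"
    by (rule h10_add[OF h1 h10_scale[OF h10_C1c[OF assms(3)]]])
  have r: "\<gamma> (w x) + 1 / e = 1 / (e + w x)" for x
  proof -
    have "e + w x > 0" using assms(2)[of x] assms(5) by simp
    then have "1 - w x / (e + w x) = e / (e + w x)" by (simp add: diff_divide_eq_iff)
    then have "1 / e * (1 - w x / (e + w x)) = 1 / (e + w x)" using assms(5) by simp
    then show ?thesis using assms(2)[of x] by (simp add: \<gamma>_def right_diff_distrib)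
  qed
  have r': "\<gamma>' (w x) = - ((1 / (e + w x)) * (1 / (e + w x)))" for x using assms(2)[of x] by (simp add: \<gamma>'_def power2_eq_square)
  have r1: "\<phi> x * \<gamma> (w x) + 1 / e * \<phi> x = \<phi> x * (1 / (e + w x))" for x
    unfolding r[symmetric] by (simp add: distrib_left)
  have r2: "(\<phi> x *\<^sub>R (\<gamma>' (w x) *\<^sub>R g x) + \<gamma> (w x) *\<^sub>R G x) + (1 / e) *\<^sub>R G x
      = (1 / (e + w x)) *\<^sub>R (G x - (1 / (e + w x) * \<phi> x) *\<^sub>R g x)" for x
    unfolding r'
    by (subst add.assoc, subst scaleR_add_left[symmetric], subst r) (simp add: scaleR_diff_right mult.commute mult.left_commute)
  have h3: "h10 D (\<lambda>x. \<phi> x * (1 / (e + w x))) (\<lambda>x. (1 / (e + w x)) *\<^sub>R (G x - (1 / (e + w x) * \<phi> x) *\<^sub>R g x))"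
    using h2 unfolding r1 r2 .
  have h4: "h10 D (\<lambda>x. \<phi> x * (\<phi> x * (1 / (e + w x))))
      (\<lambda>x. \<phi> x *\<^sub>R ((1 / (e + w x)) *\<^sub>R (G x - (1 / (e + w x) * \<phi> x) *\<^sub>R g x)) + (\<phi> x * (1 / (e + w x))) *\<^sub>R G x)"
    by (rule h10_mult[OF h3 C B])
  define H where "H x = \<phi> x *\<^sub>R ((1 / (e + w x)) *\<^sub>R (G x - (1 / (e + w x) * \<phi> x) *\<^sub>R g x)) + (\<phi> x * (1 / (e + w x))) *\<^sub>R G x" for x
  obtain K where K: "K \<subseteq> D" "\<And>x. x \<notin> K \<Longrightarrow> \<phi> x = 0" by (rule C1cE[OF assms(3)]) (rule that)
  have "(LINT x|lebesgue. (\<phi> x)\<^sup>2 / (e + w x)) = (LINT x|lebesgue. f x * (\<phi> x * (\<phi> x * (1 / (e + w x)))))"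
  proof (intro Bochner_Integration.integral_cong refl)
    fix x
    show "(\<phi> x)\<^sup>2 / (e + w x) = f x * (\<phi> x * (\<phi> x * (1 / (e + w x))))"
    proof (cases "x \<in> K")
      case True
      then show ?thesis using assms(4)[OF subsetD[OF K(1) True]] by (simp add: power2_eq_square)
    qed (simp add: K(2))
  qed
  also have "\<dots> = (LINT x|lebesgue. g x \<bullet> H x)" unfolding H_def by (rule wsol_test[OF assms(1) h4, symmetric])
  also have "\<dots> \<le> (LINT x|lebesgue. (norm (G x))\<^sup>2)"
  proof (rule integral_mono)
    show "integrable lebesgue (\<lambda>x. g x \<bullet> H x)"
      unfolding H_def by (rule integrable_inner_sq_int[OF W(4) h10_sq_int(2)[OF h4]])
    show "integrable lebesgue (\<lambda>x. (norm (G x))\<^sup>2)" by (rule sq_int_integrable[OF C1c_sq_int(2)[OF assms(3)]])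
    fix x
    define k where "k = \<phi> x * (1 / (e + w x))"
    have "H x = k *\<^sub>R (G x - k *\<^sub>R g x) + k *\<^sub>R G x" by (simp add: H_def k_def)
    then have "g x \<bullet> H x = 2 * k * (g x \<bullet> G x) - k\<^sup>2 * (g x \<bullet> g x)"
      by (simp only: inner_add_right inner_diff_right inner_scaleR_right) (simp add: right_diff_distrib power2_eq_square)
    \<comment> \<open>Pointwise, \<open>g x \<bullet> H x\<close> is the squared norm of
      \<open>G x\<close> minus that of \<open>G x - k *\<^sub>R g x\<close>.\<close>
    moreover have "0 \<le> (G x - k *\<^sub>R g x) \<bullet> (G x - k *\<^sub>R g x)" by simp
    then have "0 \<le> G x \<bullet> G x - k * (g x \<bullet> G x) - k * (g x \<bullet> G x - k * (g x \<bullet> g x))"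
      by (simp only: inner_diff_left inner_diff_right inner_scaleR_right inner_scaleR_left inner_commute[of "G x" "g x"])
    then have "0 \<le> G x \<bullet> G x - 2 * k * (g x \<bullet> G x) + k\<^sup>2 * (g x \<bullet> g x)"
      by (simp add: power2_eq_square right_diff_distrib)
    ultimately show "g x \<bullet> H x \<le> (norm (G x))\<^sup>2" by (simp add: power2_norm_eq_inner)
  qed
  finally show ?thesis by (simp add: sq_norm_def)
qed

text \<open>A lower bound of Barta's type: where the torsion function is at most \<open>M\<close>,
  the reciprocal weight gives \<open>dirichlet_bottom \<Omega> \<ge> 1 / (M + e)\<close>. The
  weights of the truncations pass to the limit by dominated convergence, with majorant
  \<open>(\<phi> x)\<^sup>2 / e\<close>.\<close>

lemma torsion_max_lower:
  assumes "open \<Omega>" "\<Omega> \<noteq> {}" "dirichlet_bottom \<Omega> > 0" "\<And>y. y \<in> \<Omega> \<Longrightarrow> torsion \<Omega> y \<le> ereal M"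
  shows "1 \<le> dirichlet_bottom \<Omega> * M"
proof -
  define lam where "lam = dirichlet_bottom \<Omega>"
  obtain T where T: "torsion \<Omega> = (\<lambda>x. ereal (T x))"
    "\<And>x. ((\<lambda>r. torsion_bounded (\<Omega> \<inter> ball 0 r) x) \<longlongrightarrow> T x) at_top"
    by (rule torsion_limit[OF assms(1,3)]) (rule that)
  define w where "w n = torsion_bounded (\<Omega> \<inter> ball 0 (real n))" for n
  have wT: "(\<lambda>n. w n x) \<longlonglongrightarrow> T x" for x
    unfolding w_def by (rule filterlim_compose[OF T(2) filterlim_real_sequentially])
  have w0: "0 \<le> w n x" for n x
  proof -
    obtain g where g: "wsol (\<Omega> \<inter> ball 0 (real n)) (indicator (\<Omega> \<inter> ball 0 (real n))) (w n) g"
      "\<And>x. x \<in> \<Omega> \<inter> ball 0 (real n) \<Longrightarrow> isCont (w n) x" "\<And>x. x \<notin> \<Omega> \<inter> ball 0 (real n) \<Longrightarrow> w n x = 0"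
      unfolding w_def by (rule torsion_bounded_ball[OF assms(1,3), of "real n"]) (rule that[unfolded w_def])
    show ?thesis by (rule wsol_indicator_nonneg[OF _ _ g]) (use assms(1) in \<open>auto intro: bounded_subset\<close>)
  qed
  have T0: "0 \<le> T x" for x by (rule LIMSEQ_le_const[OF wT]) (use w0 in blast)
  have TM: "T x \<le> M" if "x \<in> \<Omega>" for x using assms(4)[OF that] by (simp add: T(1))
  have M0: "M \<ge> 0" using assms(2) T0 TM by (meson all_not_in_conv order_trans)
  have "1 \<le> lam * (M + e)" if e: "e > 0" for e
  proof -
    have "1 / (M + e) \<le> lam"
      unfolding lam_def
    proof (rule dirichlet_bottom_ge[OF assms(1,2)])
      fix \<phi> G assume C: "C1c \<Omega> \<phi> G"
      obtain K where K: "compact K" "K \<subseteq> \<Omega>" "\<And>x. x \<notin> K \<Longrightarrow> \<phi> x = 0" by (rule C1cE[OF C]) (rule that)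
      obtain R where R: "\<And>x. x \<in> K \<Longrightarrow> norm x \<le> R" using compact_imp_bounded[OF K(1)] by (auto simp: bounded_iff)
      note q = C1c_sq_int[OF C]
      have le: "(LINT x|lebesgue. (\<phi> x)\<^sup>2 / (e + w n x)) \<le> sq_norm lebesgue G" if n: "n \<ge> nat \<lceil>R\<rceil> + 1" for n
      proof -
        obtain g where g: "wsol (\<Omega> \<inter> ball 0 (real n)) (indicator (\<Omega> \<inter> ball 0 (real n))) (w n) g"
          unfolding w_def by (rule torsion_bounded_ball[OF assms(1,3), of "real n"]) (rule that[unfolded w_def])
        have "K \<subseteq> \<Omega> \<inter> ball 0 (real n)"
        proof
          fix x assume x: "x \<in> K"
          have "norm x \<le> R" by (rule R[OF x])
          then have "norm x < real n" using n by linarith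
          then show "x \<in> \<Omega> \<inter> ball 0 (real n)" using x K(2) by auto
        qed
        then have "C1c (\<Omega> \<inter> ball 0 (real n)) \<phi> G" by (intro C1cI[OF C1c_imp_C1[OF C] K(1) _ K(3)])
        then show ?thesis by (rule wsol_reciprocal_weight[OF g w0 _ _ e]) simp
      qed
      have wm: "w n \<in> borel_measurable lebesgue" for n
      proof -
        obtain g where "wsol (\<Omega> \<inter> ball 0 (real n)) (indicator (\<Omega> \<inter> ball 0 (real n))) (w n) g"
          unfolding w_def by (rule torsion_bounded_ball[OF assms(1,3), of "real n"]) (rule that[unfolded w_def])
        then show ?thesis by (intro sq_int_measurable wsolD(3))
      qed
      have Tm: "T \<in> borel_measurable lebesgue" by (rule borel_measurable_LIMSEQ_real[OF wT wm])
      have pi: "integrable lebesgue (\<lambda>x. (\<phi> x)\<^sup>2)" using sq_int_integrable[OF q(1)] by simp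
      have pm: "\<phi> \<in> borel_measurable lebesgue" by (rule sq_int_measurable[OF q(1)])
      have dom: "(\<lambda>n. LINT x|lebesgue. (\<phi> x)\<^sup>2 / (e + w n x)) \<longlonglongrightarrow> (LINT x|lebesgue. (\<phi> x)\<^sup>2 / (e + T x))"
        "integrable lebesgue (\<lambda>x. (\<phi> x)\<^sup>2 / (e + T x))"
      proof (rule_tac [1] integral_dominated_convergence, rule_tac [6] integrable_dominated_convergence)
        show "AE x in lebesgue. (\<lambda>n. (\<phi> x)\<^sup>2 / (e + w n x)) \<longlonglongrightarrow> (\<phi> x)\<^sup>2 / (e + T x)"
        proof (rule AE_I2)
          fix x
          have "e + T x \<noteq> 0" using T0[of x] e by linarith
          then show "(\<lambda>n. (\<phi> x)\<^sup>2 / (e + w n x)) \<longlonglongrightarrow> (\<phi> x)\<^sup>2 / (e + T x)" by (intro tendsto_intros wT)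
        qed
        then show "AE x in lebesgue. (\<lambda>n. (\<phi> x)\<^sup>2 / (e + w n x)) \<longlonglongrightarrow> (\<phi> x)\<^sup>2 / (e + T x)" .
        show "AE x in lebesgue. norm ((\<phi> x)\<^sup>2 / (e + w n x)) \<le> (\<phi> x)\<^sup>2 / e" for n
          using w0 e by (intro AE_I2) (auto intro!: divide_left_mono mult_pos_pos add_pos_nonneg simp: abs_of_nonneg)
        then show "AE x in lebesgue. norm ((\<phi> x)\<^sup>2 / (e + w n x)) \<le> (\<phi> x)\<^sup>2 / e" for n .
      qed (use pi pm wm Tm in \<open>measurable; simp\<close>)+
      have "1 / (M + e) * sq_norm lebesgue \<phi> = (LINT x|lebesgue. (\<phi> x)\<^sup>2 / (M + e))" by (simp add: sq_norm_def)
      also have "\<dots> \<le> (LINT x|lebesgue. (\<phi> x)\<^sup>2 / (e + T x))"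
      proof (rule integral_mono[OF _ dom(2)])
        fix x
        show "(\<phi> x)\<^sup>2 / (M + e) \<le> (\<phi> x)\<^sup>2 / (e + T x)"
        proof (cases "x \<in> \<Omega>")
          case True
          then show ?thesis using TM[OF True] T0[of x] e by (intro divide_left_mono) (auto intro!: mult_pos_pos)
        next
          case False
          then have "x \<notin> K" using K(2) by blast
          then show ?thesis by (simp add: K(3))
        qed
      qed (use pi in simp)
      also have "\<dots> \<le> sq_norm lebesgue G"
        by (rule LIMSEQ_le_const2[OF dom(1)]) (use le in blast)
      finally show "1 / (M + e) * sq_norm lebesgue \<phi> \<le> sq_norm lebesgue G" .
    qed
    then show ?thesis using M0 e by (simp add: field_simps)
  qed
  note 1 = this
  have lam: "lam > 0" using assms(3) by (simp add: lam_def)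
  have "1 \<le> lam * M"
  proof (rule field_le_epsilon)
    fix e :: real assume "e > 0"
    then show "1 \<le> lam * M + e" using 1[of "e / lam"] lam by (simp add: distrib_left)
  qed
  then show ?thesis by (simp add: lam_def)
qed

section \<open>From the pointwise bound to the distance\<close>

lemma distance_lower_bound:
  fixes lam d c y :: real
  assumes "lam > 0" "d \<ge> 0" "c \<ge> 9/2 * ln 2" "1 \<le> lam * y"
    "y \<le> 32/3 * d powr (1/2) * lam powr (-3/4) * c powr (3/2) + inverse lam * 2 powr (9/2) * exp (- c)"
  shows "3^2 / 2^10 * ((1 - 2 powr (9/2) * exp (- c))\<^sup>2 / c ^ 3) * lam powr (-1/2) \<le> d"
proof -
  have c: "c > 0" using assms(3) ln_gt_zero[of 2] by (smt (verit) mult_pos_pos divide_pos_pos)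
  define K where "K = 2 powr (9/2) * exp (- c)"
  have "2 powr (9/2) = exp (9/2 * ln (2::real))" unfolding powr_def by simp
  then have "K = exp (9/2 * ln 2 + - c)" unfolding K_def exp_add by simp
  then have K: "K \<le> 1" using assms(3) by simp
  \<comment> \<open>Times \<open>lam\<close> the upper bound is \<open>A + K\<close>, so
    \<open>1 - K \<le> A\<close>. The condition on \<open>c\<close> amounts to
    \<open>K \<le> 1\<close>, which permits squaring, and \<open>(32/3)\<^sup>2 = 2^10 / 3^2\<close>
    is the constant of the result.\<close>
  define A where "A = 32/3 * d powr (1/2) * lam powr (1/4) * c powr (3/2)"
  have "lam * (lam powr (-3/4)) = lam powr (1 + (-3/4))" unfolding powr_add using assms(1) by simp
  then have l: "lam * lam powr (-3/4) = lam powr (1/4)" by simp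
  have "1 \<le> lam * (32/3 * d powr (1/2) * lam powr (-3/4) * c powr (3/2) + inverse lam * 2 powr (9/2) * exp (- c))"
    using mult_left_mono[OF assms(5), of lam] assms(1,4) by linarith
  also have "\<dots> = 32/3 * d powr (1/2) * (lam * lam powr (-3/4)) * c powr (3/2) + K"
    using assms(1) by (simp add: K_def distrib_left mult_ac)
  finally have "1 - K \<le> A" unfolding l A_def by simp
  then have "(1 - K)\<^sup>2 \<le> A\<^sup>2" using K by (intro power_mono) auto
  also have "A\<^sup>2 = 1024 / 9 * d * lam powr (1/2) * c ^ 3"
  proof -
    have p: "(u powr v)\<^sup>2 = u powr (2 * v)" for u v :: real
      by (simp add: power2_eq_square powr_add[symmetric])
    have c3: "c powr 3 = c ^ 3" using powr_realpow[OF c, of 3] by simp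
    show ?thesis unfolding A_def power_mult_distrib p using assms(2) c3 by (simp add: power_divide)
  qed
  finally have "(1 - K)\<^sup>2 \<le> (1024 / 9 * d * lam powr (1/2)) * c ^ 3" .
  then have "(1 - K)\<^sup>2 / c ^ 3 \<le> 1024 / 9 * d * lam powr (1/2)" using c by (simp add: divide_le_eq)
  then have "3^2 / 2^10 * ((1 - K)\<^sup>2 / c ^ 3) * lam powr (-1/2) \<le> 3^2 / 2^10 * (1024 / 9 * d * lam powr (1/2)) * lam powr (-1/2)"
    by (intro mult_right_mono mult_left_mono) auto
  also have "\<dots> = d * (lam powr (1/2) * lam powr (-1/2))" by simp
  also have "lam powr (1/2) * lam powr (-1/2) = 1" unfolding powr_add[symmetric] using assms(1) by simp
  finally show ?thesis by (simp add: K_def)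
qed

text \<open>\<open>GREATEST\<close> denotes the maximum only if it is attained. The quotient is at
  most \<open>1 / c ^ 3\<close>, so for large \<open>c\<close> it stays below its value at
  \<open>c0 + 1\<close>, and on the remaining compact interval continuity suffices.\<close>

lemma c2_const_attained:
  obtains c where "c \<ge> 9/2 * ln 2" "c2_const = (1 - 2 powr (9/2) * exp (- c))\<^sup>2 / c ^ 3"
proof -
  define c0 where "c0 = 9/2 * ln (2::real)"
  define F where "F c = (1 - 2 powr (9/2) * exp (- c))\<^sup>2 / c ^ 3" for c :: real
  have c0: "c0 > 0" by (simp add: c0_def)
  have Ke: "2 powr (9/2) * exp (- c) = exp (c0 - c)" for c :: real
  proof -
    have "2 powr (9/2) = exp c0" unfolding powr_def c0_def by simp
    then have "2 powr (9/2) * exp (- c) = exp (c0 + - c)" unfolding exp_add by simp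
    then show ?thesis by simp
  qed
  \<comment> \<open>At \<open>c0\<close> the quotient vanishes, so a point beyond it serves as the
    positive reference value.\<close>
  have F1: "F (c0 + 1) > 0"
  proof -
    have "exp (-1) < (1::real)" by simp
    then show ?thesis using c0 unfolding F_def Ke by simp
  qed
  have Fle: "F c \<le> 1 / c ^ 3" if "c \<ge> c0" for c
  proof -
    have "exp (c0 - c) \<le> 1" using that by simp
    then have "(1 - exp (c0 - c))\<^sup>2 \<le> 1" by (intro power_le_one) auto
    then show ?thesis unfolding F_def Ke using that c0 by (intro divide_right_mono) auto
  qed
  define C where "C = max (c0 + 1) (max 1 (1 / F (c0 + 1)))"
  have C: "C \<ge> c0 + 1" "C \<ge> 1" "C \<ge> 1 / F (c0 + 1)" by (auto simp: C_def)
  have "continuous_on {c0..C} F" unfolding F_def using c0 by (intro continuous_intros) auto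
  then obtain c where c: "c \<in> {c0..C}" "\<And>d. d \<in> {c0..C} \<Longrightarrow> F d \<le> F c"
    using continuous_attains_sup[of "{c0..C}" F] C(1) by auto
  have max: "F d \<le> F c" if d: "d \<ge> c0" for d
  proof (cases "d \<le> C")
    case True
    then show ?thesis using c(2) d by simp
  next
    case False
    then have d1: "d \<ge> 1" "d \<ge> 1 / F (c0 + 1)" using C(2,3) by linarith+
    have "F d \<le> 1 / d ^ 3" by (rule Fle[OF d])
    also have "\<dots> \<le> 1 / d ^ 1" using power_increasing[of 1 3 d] d1(1) by (intro divide_left_mono) auto
    also have "\<dots> \<le> F (c0 + 1)" using d1 F1 by (simp add: field_simps)
    also have "\<dots> \<le> F c" by (rule c(2)) (use C(1) in auto)
    finally show ?thesis .
  qed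
  have "c2_const = F c"
    unfolding c2_const_def F_def[symmetric] c0_def[symmetric]
    by (rule Greatest_equality) (use c(1) max in auto)
  then show ?thesis using that[of c] c(1) by (simp add: F_def c0_def)
qed

subsection \<open>The first eigenfunction\<close>

lemma wsol_scale:
  assumes "wsol U f w g"
  shows "wsol U (\<lambda>x. c * f x) (\<lambda>x. c * w x) (\<lambda>x. c *\<^sub>R g x)"
  using assms unfolding wsol_def by (auto intro: h10_scale sq_int_cmult simp: mult.assoc)

text \<open>An eigenfunction is bounded: \<open>\<bar>f\<bar> \<in> L\<^sup>2\<close> makes the drift of the means integrable in \<open>b\<close> at 0.\<close>

lemma wsol_L2_bound:
  assumes "wsol U f w g" "isCont w x" "B > 0"
  shows "\<bar>w x\<bar> \<le> sqrt (25 / (9 * pi * B)) * sqrt (sq_norm lebesgue w) + 2 * sqrt (sq_norm lebesgue f / (176 * pi)) * sqrt B"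
proof -
  note W = wsolD[OF assms(1)]
  define K where "K = sqrt (sq_norm lebesgue f / (176 * pi))"
  have "\<bar>w x\<bar> \<le> kmean (\<lambda>y. \<bar>w y\<bar>) B x + 2 * K * sqrt B"
  proof (rule kmean_upper[where \<Gamma>' = "\<lambda>b. K / sqrt b"])
    show "sq_int lebesgue (\<lambda>y. \<bar>w y\<bar>)" by (rule sq_int_abs[OF W(3)])
    show "isCont (\<lambda>y. \<bar>w y\<bar>) x" using assms(2) by (intro continuous_intros)
    fix b :: real assume b: "0 < b"
    obtain H where H: "C2 (\<lambda>y. kpot b ((norm (y - x))\<^sup>2)) H (\<lambda>y. klap b ((norm (y - x))\<^sup>2))"
      by (rule kpot_compact_C2[OF b]) (rule that)
    have "- (LINT y|lebesgue. \<bar>w y\<bar> * klap b ((norm (y - x))\<^sup>2)) \<le> (LINT y|lebesgue. \<bar>f y\<bar> * kpot b ((norm (y - x))\<^sup>2))"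
      by (rule wsol_abs_subsolution[OF assms(1) H compact_cball kernel_support(3)[OF b] kpot_nonneg[OF b]])
    also have "\<dots> \<le> sqrt (sq_norm lebesgue (\<lambda>y. \<bar>f y\<bar>)) * sqrt (1 / (176 * pi * b))"
      using sq_int_Cauchy_Schwarz_abs[OF sq_int_abs[OF W(2)] kpot_sq_norm(1)[OF b, of x]] kpot_sq_norm(2)[OF b, of x] by simp
    also have "sq_norm lebesgue (\<lambda>y. \<bar>f y\<bar>) = sq_norm lebesgue f" by (simp add: sq_norm_def)
    also have "sqrt (sq_norm lebesgue f) * sqrt (1 / (176 * pi * b)) = K / sqrt b"
      by (simp add: K_def real_sqrt_mult real_sqrt_divide)
    finally show "- (LINT y|lebesgue. \<bar>w y\<bar> * klap b ((norm (y - x))\<^sup>2)) \<le> K / sqrt b" .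
    show "((\<lambda>b. 2 * K * sqrt b) has_real_derivative K / sqrt b) (at b)"
      using b by (auto intro!: derivative_eq_intros simp: field_simps)
  next
    have "((\<lambda>b. 2 * K * sqrt b) \<longlongrightarrow> 2 * K * sqrt 0) (at_right 0)" by (intro tendsto_intros)
    then show "((\<lambda>b. 2 * K * sqrt b) \<longlongrightarrow> 0) (at_right 0)" by simp
  qed (rule assms(3))
  then show ?thesis using kmean_abs_le[OF sq_int_abs[OF W(3)] assms(3), of x] by (simp add: K_def sq_norm_def)
qed

text \<open>The mean of a compactly supported approximant is 0 once the disc misses its support, and
  Cauchy-Schwarz makes the approximation error uniform in \<open>x\<close>.\<close>

lemma kmean_vanishes_at_infinity:
  assumes "h10 U v g" "b > 0" "e > 0"
  obtains R where "\<And>x. norm x \<ge> R \<Longrightarrow> kmean v b x < e"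
proof -
  obtain \<phi> G where 1: "\<And>n::nat. C1c U (\<phi> n) (G n)" "sq_lim lebesgue \<phi> v" by (rule h10E[OF assms(1)]) (rule that)
  define C where "C = sqrt (25 / (9 * pi * b))"
  have "(\<lambda>n. C * sqrt (sq_norm lebesgue (\<lambda>x. \<phi> n x - v x))) \<longlonglongrightarrow> C * sqrt 0"
    by (intro tendsto_intros sq_limD(3)[OF 1(2)])
  then have "\<forall>\<^sub>F n in sequentially. C * sqrt (sq_norm lebesgue (\<lambda>x. \<phi> n x - v x)) < e"
    using order_tendstoD(2)[of _ "C * sqrt 0"] assms(3) by simp
  then obtain n where n: "C * sqrt (sq_norm lebesgue (\<lambda>x. \<phi> n x - v x)) < e" by (auto simp: eventually_sequentially)
  obtain K where K: "compact K" "\<And>x. x \<notin> K \<Longrightarrow> \<phi> n x = 0" by (rule C1cE[OF 1(1)[of n]]) (rule that)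
  obtain R where R: "\<And>x. x \<in> K \<Longrightarrow> norm x \<le> R" using compact_imp_bounded[OF K(1)] by (auto simp: bounded_iff)
  note q = C1c_sq_int(1)[OF 1(1)] h10_sq_int(1)[OF assms(1)]
  have "kmean v b x < e" if x: "norm x \<ge> R + sqrt b + 1" for x
  proof -
    have "\<phi> n y * kap b ((norm (y - x))\<^sup>2) = 0" for y
    proof (cases "y \<in> K")
      case True
      then have "norm y \<le> R" by (rule R)
      then have "norm (x - y) > sqrt b" using x norm_triangle_ineq2[of x y] by linarith
      then have "y \<notin> cball x (sqrt b)" by (simp add: dist_norm)
      from kernel_support(1)[OF assms(2) this] show ?thesis by simp
    qed (simp add: K(2))
    then have "(\<lambda>y. \<phi> n y * kap b ((norm (y - x))\<^sup>2)) = (\<lambda>y. 0)" by (rule ext)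
    then have "kmean (\<phi> n) b x = 0" unfolding kmean_def by (simp only: Bochner_Integration.integral_zero)
    then have "kmean v b x = - kmean (\<lambda>y. \<phi> n y - v y) b x" using kmean_diff[OF q assms(2), of n x] by simp
    also have "\<dots> \<le> C * sqrt (sq_norm lebesgue (\<lambda>x. \<phi> n x - v x))"
      using kmean_abs_le[OF sq_int_diff[OF q] assms(2), of n x] by (simp add: C_def)
    finally show ?thesis using n by simp
  qed
  then show ?thesis by (rule that)
qed

lemma powr_half_tendsto_0: "((\<lambda>d::real. A * d powr (1/2) * B * C + D) \<longlongrightarrow> D) (at_right 0)"
proof -
  have "((\<lambda>d::real. A * sqrt d * B * C + D) \<longlongrightarrow> A * sqrt 0 * B * C + D) (at_right 0)" by (intro tendsto_intros)
  then have "((\<lambda>d::real. A * sqrt d * B * C + D) \<longlongrightarrow> D) (at_right 0)" by simp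
  then show ?thesis
    by (rule Lim_transform_eventually) (auto simp: powr_half_sqrt eventually_at_right_less intro: eventually_mono[OF eventually_at_right_less])
qed

text \<open>The values of \<open>u\<close> outside \<open>\<Omega>\<close> are unconstrained, hence
  the extension \<open>v\<close>. Boundedness is part of the preparation, since the normalisation
  divides by the supremum \<open>S\<close>.\<close>

lemma first_eigenfunction_wsol:
  assumes "open \<Omega>" "\<Omega> \<noteq> {}" "first_eigenfunction \<Omega> u"
  defines "v \<equiv> zext \<Omega> u" and "lam \<equiv> dirichlet_bottom \<Omega>"
  obtains g S where "wsol \<Omega> (\<lambda>x. lam * v x) v g" "\<And>x. x \<in> \<Omega> \<Longrightarrow> isCont v x" "\<And>x. 0 \<le> v x"
    "lam > 0" "S > 0" "\<And>x. v x \<le> S" "\<And>t. t < S \<Longrightarrow> \<exists>x\<in>\<Omega>. t < v x"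
proof -
  have u: "weak_dirichlet_solution \<Omega> (\<lambda>x. lam * u x) u" "continuous_on \<Omega> u" "\<And>x. x \<in> \<Omega> \<Longrightarrow> u x > 0"
    using assms(3) by (auto simp: first_eigenfunction_def lam_def)
  have z: "zext \<Omega> (\<lambda>x. lam * u x) = (\<lambda>x. lam * v x)" by (auto simp: v_def zext_def)
  have "u \<in> H10 \<Omega>" using u(1) by (simp add: weak_dirichlet_solution_def)
  then have q: "sq_int lebesgue v" unfolding v_def by (rule h10_sq_int(1)[OF H10_imp_h10[OF assms(1)]])
  have s: "wsol \<Omega> (\<lambda>x. lam * v x) v (zext \<Omega> (weak_grad \<Omega> u))"
    using weak_dirichlet_solution_imp_wsol[OF assms(1) u(1)] sq_int_cmult[OF q, of lam] unfolding z v_def by simp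
  have "continuous_on \<Omega> v" using u(2) by (simp add: v_def cong: continuous_on_cong)
  then have c: "isCont v x" if "x \<in> \<Omega>" for x using that continuous_on_eq_continuous_at[OF assms(1)] by blast
  have v0: "v x > 0" if "x \<in> \<Omega>" for x using u(3)[OF that] that by (simp add: v_def)
  have vz: "v x = 0" if "x \<notin> \<Omega>" for x using that by (simp add: v_def)
  have vn: "0 \<le> v x" for x using v0[of x] vz[of x] by (cases "x \<in> \<Omega>") auto
  define C where "C B = sqrt (25 / (9 * pi * B)) * sqrt (sq_norm lebesgue v) + 2 * sqrt (sq_norm lebesgue (\<lambda>x. lam * v x) / (176 * pi)) * sqrt B" for B
  have C: "v x \<le> C B" if "B > 0" for x B
  proof (cases "x \<in> \<Omega>")
    case True
    then show ?thesis using wsol_L2_bound[OF s c[OF True] that] by (simp add: C_def)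
  next
    case False
    then show ?thesis using vz[OF False] that by (auto simp: C_def sq_norm_nonneg intro!: add_nonneg_nonneg mult_nonneg_nonneg)
  qed
  \<comment> \<open>If the bottom were 0, the right-hand side of the equation would vanish and the
    L2 bound for \<open>v x\<close> would be of order \<open>1 / sqrt B\<close> for every scale
    \<open>B\<close>, forcing \<open>v x = 0\<close>.\<close>
  have lam: "lam > 0"
  proof (rule ccontr)
    assume "\<not> lam > 0"
    then have l0: "lam = 0" using dirichlet_bottom_nonneg[OF assms(1,2)] by (simp add: lam_def)
    obtain x where x: "x \<in> \<Omega>" using assms(2) by blast
    have "((\<lambda>B. sqrt (25 / (9 * pi) * inverse B) * sqrt (sq_norm lebesgue v)) \<longlongrightarrow> sqrt (25 / (9 * pi) * 0) * sqrt (sq_norm lebesgue v)) at_top"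
      by (intro tendsto_intros tendsto_inverse_0_at_top filterlim_ident)
    moreover have "\<forall>\<^sub>F B in at_top. v x \<le> sqrt (25 / (9 * pi) * inverse B) * sqrt (sq_norm lebesgue v)"
      using eventually_gt_at_top[of "0::real"]
    proof eventually_elim
      case (elim B)
      have "25 / (9 * pi * B) = 25 / (9 * pi) * inverse B" by (simp add: inverse_eq_divide)
      moreover have "sq_norm lebesgue (\<lambda>x. lam * v x) = 0" by (simp add: l0 sq_norm_def)
      ultimately have "C B = sqrt (25 / (9 * pi) * inverse B) * sqrt (sq_norm lebesgue v)" by (simp only: C_def) simp
      then show ?case using C[OF elim, of x] by (simp only:)
    qed
    ultimately have "v x \<le> sqrt (25 / (9 * pi) * 0) * sqrt (sq_norm lebesgue v)" by (rule tendsto_lowerbound) simp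
    then show False using v0[OF x] by simp
  qed
  have bdd: "bdd_above (range v)" using C[of 1] by (intro bdd_aboveI2) auto
  define S where "S = (SUP x. v x)"
  have vS: "v x \<le> S" for x unfolding S_def by (rule cSUP_upper[OF UNIV_I bdd])
  have S0: "S > 0" using assms(2) v0 vS by (meson all_not_in_conv less_le_trans)
  have "\<exists>x\<in>\<Omega>. t < v x" if t: "t < S" for t
  proof -
    \<comment> \<open>Values above 0 are taken only in \<open>\<Omega>\<close>.\<close>
    have "max 0 t < S" using t S0 by simp
    then obtain x where "max 0 t < v x" unfolding S_def using less_cSUP_iff[OF UNIV_not_empty bdd] by blast
    then show ?thesis using vz[of x] by (cases "x \<in> \<Omega>") auto
  qed
  then show ?thesis using that[OF s c vn lam S0 vS] by blast
qed

text \<open>A maximiser over \<open>A\<close> dominates every point of the superlevel set, and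
  values above \<open>s\<close> suffice to approach the supremum \<open>S\<close>.\<close>

lemma max_over_compact_superlevel:
  fixes v :: "'a::topological_space \<Rightarrow> real"
  assumes "compact A" "continuous_on A v" "\<And>x. x \<in> \<Omega> \<Longrightarrow> s \<le> v x \<Longrightarrow> x \<in> A" "s < S"
    "\<And>x. v x \<le> S" "\<And>t. t < S \<Longrightarrow> \<exists>x\<in>\<Omega>. t < v x"
  obtains x where "x \<in> A" "v x = S"
proof -
  obtain x1 where x1: "x1 \<in> \<Omega>" "s < v x1" using assms(4,6) by blast
  then have "A \<noteq> {}" using assms(3)[of x1] by auto
  then obtain x where x: "x \<in> A" "\<And>y. y \<in> A \<Longrightarrow> v y \<le> v x" using continuous_attains_sup[OF assms(1) _ assms(2)] by blast
  have "\<not> v x < S"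
  proof
    assume "v x < S"
    then obtain y where y: "y \<in> \<Omega>" "max s (v x) < v y" using assms(4) assms(6)[of "max s (v x)"] by auto
    then show False using x(2)[OF assms(3)[of y]] by simp
  qed
  then show ?thesis using that x(1) assms(5)[of x] by (simp add: antisym_conv3)
qed

text \<open>If the essential supremum were smaller, some \<open>E < u x0\<close> would bound
  \<open>u\<close> almost everywhere, hence by continuity everywhere in
  \<open>\<Omega>\<close>.\<close>

lemma sup_norm_on_eq:
  assumes "open \<Omega>" "continuous_on \<Omega> u" "\<And>x. x \<in> \<Omega> \<Longrightarrow> 0 \<le> u x" "x0 \<in> \<Omega>" "\<And>x. x \<in> \<Omega> \<Longrightarrow> u x \<le> u x0"
  shows "sup_norm_on \<Omega> u = ereal (u x0)"
  unfolding sup_norm_on_def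
proof (rule antisym)
  have "u \<in> borel_measurable (lebesgue_on \<Omega>)"
    using assms(1,2) by (intro continuous_imp_measurable_on_sets_lebesgue) auto
  then show "esssup (lebesgue_on \<Omega>) (\<lambda>x. ereal \<bar>u x\<bar>) \<le> ereal (u x0)"
    using assms(3,5) by (intro esssup_I) (auto intro!: AE_I2 simp: space_restrict_space)
  show "ereal (u x0) \<le> esssup (lebesgue_on \<Omega>) (\<lambda>x. ereal \<bar>u x\<bar>)"
  proof (rule ccontr)
    assume "\<not> ?thesis"
    then obtain E where E: "esssup (lebesgue_on \<Omega>) (\<lambda>x. ereal \<bar>u x\<bar>) < ereal E" "E < u x0"
      using ereal_dense2[of "esssup (lebesgue_on \<Omega>) (\<lambda>x. ereal \<bar>u x\<bar>)" "ereal (u x0)"] by (auto simp: not_le)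
    have "AE x in lebesgue_on \<Omega>. u x \<le> E"
      using esssup_AE[of "\<lambda>x. ereal \<bar>u x\<bar>" "lebesgue_on \<Omega>"]
    proof eventually_elim
      case (elim x)
      then have "ereal \<bar>u x\<bar> < ereal E" using E(1) by (rule le_less_trans)
      then show ?case by simp
    qed
    then have "AE x in lebesgue. x \<in> \<Omega> \<longrightarrow> max 0 (u x - E) = 0" unfolding lebesgue_on_AE[OF assms(1)] by eventually_elim auto
    moreover have "continuous_on \<Omega> (\<lambda>x. max 0 (u x - E))" by (intro continuous_intros assms(2))
    ultimately have "max 0 (u x0 - E) = 0" by (intro continuous_AE_eq_0[OF assms(1) _ _ assms(4)])
    then show False using E(2) by simp
  qed
qed

text \<open>The set where \<open>v \<ge> 3 / 4 * S\<close> lies in a compact subset of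
  \<open>\<Omega>\<close>: the distance bound keeps it away from the boundary and the decay of means
  keeps it bounded. At a maximum the normalised function equals \<open>1 / lam\<close> exactly,
  which takes the place of \<open>torsion_max_lower\<close>.\<close>

lemma first_eigenfunction_max:
  fixes \<Omega> :: "(real^2) set"
  assumes "open \<Omega>" "\<Omega> \<noteq> {}" "simply_connected \<Omega>" "first_eigenfunction \<Omega> u"
  shows "\<exists>x\<in>\<Omega>. ereal (u x) = sup_norm_on \<Omega> u"
    "\<And>x. x \<in> \<Omega> \<Longrightarrow> ereal (u x) = sup_norm_on \<Omega> u \<Longrightarrow>
      ereal (3^2 / 2^10 * c2_const * dirichlet_bottom \<Omega> powr (-1/2)) \<le> boundary_dist \<Omega> x"
proof -
  define v where "v = zext \<Omega> u"
  define lam where "lam = dirichlet_bottom \<Omega>"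
  obtain g S where v: "wsol \<Omega> (\<lambda>x. lam * v x) v g" "\<And>x. x \<in> \<Omega> \<Longrightarrow> isCont v x" "\<And>x. 0 \<le> v x"
    and lam: "lam > 0" and S: "S > 0" "\<And>x. v x \<le> S" "\<And>t. t < S \<Longrightarrow> \<exists>x\<in>\<Omega>. t < v x"
    by (rule first_eigenfunction_wsol[OF assms(1,2,4)]) (rule that[unfolded v_def lam_def])
  \<comment> \<open>Normalised so that the right-hand side \<open>f\<close> is \<open>v / S\<close>,
    which is at most 1, and the supremum of \<open>w\<close> is \<open>1 / lam\<close>.\<close>
  define w where "w x = 1 / (lam * S) * v x" for x
  define f where "f x = 1 / (lam * S) * (lam * v x)" for x
  have w: "wsol \<Omega> f w (\<lambda>x. (1 / (lam * S)) *\<^sub>R g x)" unfolding w_def f_def by (rule wsol_scale[OF v(1)])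
  have f1: "\<bar>f x\<bar> \<le> 1" for x using v(3)[of x] S(1) S(2)[of x] lam by (simp add: f_def)
  have wb: "\<bar>w y\<bar> \<le> 304 / 81 / lam" for y
  proof -
    have "\<bar>w y\<bar> = v y / S / lam" using v(3)[of y] S(1) lam by (simp add: w_def abs_mult)
    also have "\<dots> \<le> 304 / 81 / lam" using S(1) S(2)[of y] lam by (intro divide_right_mono) (auto simp: divide_le_eq)
    finally show ?thesis .
  qed
  have bd: "v x / S / lam \<le> 32/3 * norm (x - z) powr (1/2) * lam powr (-3/4) * c powr (3/2) + inverse lam * 2 powr (9/2) * exp (- c)"
    if "x \<in> \<Omega>" "z \<notin> \<Omega>" "c > 0" for x z c
  proof -
    have "isCont w x" unfolding w_def by (intro continuous_intros v(2) that)
    moreover have "x \<noteq> z" using that by auto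
    ultimately have "w x \<le> 32/3 * norm (x - z) powr (1/2) * lam powr (-3/4) * c powr (3/2) + inverse lam * 2 powr (9/2) * exp (- c)"
      using f1 wb lam that by (intro wsol_distance_bound[OF assms(1,3) that(2) subset_refl w]) auto
    then show ?thesis by (simp add: w_def mult.commute)
  qed
  have "\<Omega> \<noteq> UNIV" using lam dirichlet_bottom_UNIV by (auto simp: lam_def)
  \<comment> \<open>In units of \<open>inverse lam\<close>, this \<open>c\<close> leaves at most 1/4
    for the exponential term, so that close to the boundary the whole bound stays below 3/4.\<close>
  obtain c :: real where c: "c > 0" "2 powr (9/2) * exp (- c) \<le> 1 / 4"
  proof -
    have "((\<lambda>c. 2 powr (9/2) * exp (- c)) \<longlongrightarrow> (2::real) powr (9/2) * 0) at_top"
      by (intro tendsto_intros filterlim_compose[OF exp_at_bot filterlim_uminus_at_bot_at_top])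
    then have "\<forall>\<^sub>F c in at_top. (2::real) powr (9/2) * exp (- c) < 1 / 4" by (intro order_tendstoD) auto
    from eventually_happens[OF eventually_conj[OF this eventually_gt_at_top[of 0]]]
    obtain c :: real where "2 powr (9/2) * exp (- c) < 1 / 4" "0 < c" by auto
    then show ?thesis by (intro that[of c]) auto
  qed
  obtain \<delta> where \<delta>: "\<delta> > 0" "\<And>d. 0 < d \<Longrightarrow> d < \<delta> \<Longrightarrow>
      32/3 * d powr (1/2) * lam powr (-3/4) * c powr (3/2) + inverse lam * (1 / 4) < inverse lam * (3 / 4)"
  proof -
    have "inverse lam * (1 / 4) < inverse lam * (3 / 4)" using lam by simp
    from order_tendstoD(2)[OF powr_half_tendsto_0 this]
    show ?thesis using that unfolding eventually_at_right_field by blast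
  qed
  have far: "\<delta> \<le> norm (x - z)" if x: "x \<in> \<Omega>" "3 / 4 * S \<le> v x" and z: "z \<notin> \<Omega>" for x z
  proof (rule ccontr)
    assume "\<not> \<delta> \<le> norm (x - z)"
    then have "32/3 * norm (x - z) powr (1/2) * lam powr (-3/4) * c powr (3/2) + inverse lam * (1 / 4) < inverse lam * (3 / 4)"
      using x z by (intro \<delta>(2)) auto
    moreover have "inverse lam * 2 powr (9/2) * exp (- c) \<le> inverse lam * (1 / 4)"
      unfolding mult.assoc using c(2) lam by (intro mult_left_mono) auto
    moreover have "inverse lam * (3 / 4) \<le> v x / S / lam"
    proof -
      have "3 / 4 \<le> v x / S" using x(2) S(1) by (simp add: pos_le_divide_eq)
      then have "3 / 4 / lam \<le> v x / S / lam" using lam by (intro divide_right_mono) auto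
      then show ?thesis by (simp add: inverse_eq_divide)
    qed
    ultimately show False using bd[OF x(1) z c(1)] by linarith
  qed
  have av: "(\<lambda>y. \<bar>v y\<bar>) = v" using v(3) by (auto simp: abs_of_nonneg)
  \<comment> \<open>At scale \<open>6 / lam\<close> the drift is
    \<open>lam * S * (6 / lam) / 24 = S / 4\<close>, so a mean below \<open>S / 2\<close> keeps
    \<open>v\<close> below \<open>3 / 4 * S\<close>.\<close>
  obtain R where R: "\<And>x. norm x \<ge> R \<Longrightarrow> kmean v (6 / lam) x < S / 2"
    by (rule kmean_vanishes_at_infinity[OF wsolD(1)[OF v(1)], of "6 / lam" "S / 2"]) (use lam S(1) that in auto)
  have near: "norm x < R" if x: "x \<in> \<Omega>" "3 / 4 * S \<le> v x" for x
  proof (rule ccontr)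
    assume "\<not> norm x < R"
    then have "kmean v (6 / lam) x < S / 2" by (intro R) simp
    moreover have "\<bar>v x\<bar> \<le> kmean (\<lambda>y. \<bar>v y\<bar>) (6 / lam) x + lam * S * (6 / lam) / 24"
    proof (rule wsol_submean[OF v(1)])
      show "AE x in lebesgue. \<bar>lam * v x\<bar> \<le> lam * S"
        using S(2) v(3) lam by (intro AE_I2) (simp add: abs_mult)
      show "isCont (\<lambda>y. \<bar>v y\<bar>) x" unfolding av by (rule v(2)[OF x(1)])
    qed (use lam in simp)
    moreover have "lam * S * (6 / lam) / 24 = S / 4" using lam by simp
    ultimately show False using x(2) unfolding av by simp
  qed
  \<comment> \<open>The distance condition is written as an intersection of closed sets, one for
    each point of the complement, so that compactness is immediate.\<close>
  define A where "A = cball 0 R \<inter> (\<Inter>z\<in>- \<Omega>. {x. \<delta> \<le> norm (x - z)})"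
  have A: "compact A" unfolding A_def
    by (intro compact_Int_closed compact_cball closed_INT ballI closed_Collect_le continuous_intros)
  have A\<Omega>: "A \<subseteq> \<Omega>"
  proof (rule subsetI, rule ccontr)
    fix x assume "x \<in> A" "x \<notin> \<Omega>"
    then have "\<delta> \<le> norm (x - x)" unfolding A_def by blast
    then show False using \<delta>(1) by simp
  qed
  obtain x0 where x0: "x0 \<in> A" "v x0 = S"
  proof (rule max_over_compact_superlevel[OF A, of v \<Omega> "3 / 4 * S" S])
    show "continuous_on A v" using A\<Omega> by (intro continuous_at_imp_continuous_on ballI v(2)) auto
    show "x \<in> A" if "x \<in> \<Omega>" "3 / 4 * S \<le> v x" for x
      using near[OF that] far[OF that] by (auto simp: A_def)
  qed (use S that in auto)
  have x0': "x0 \<in> \<Omega>" using x0(1) A\<Omega> by blast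
  have uv: "u x = v x" if "x \<in> \<Omega>" for x using that by (simp add: v_def)
  have sup: "sup_norm_on \<Omega> u = ereal S"
    using sup_norm_on_eq[OF assms(1) _ _ x0'] assms(4) S(2) v(3) x0 uv x0' by (simp add: first_eigenfunction_def)
  show "\<exists>x\<in>\<Omega>. ereal (u x) = sup_norm_on \<Omega> u" using x0' x0 uv sup by auto
  fix x assume x: "x \<in> \<Omega>" "ereal (u x) = sup_norm_on \<Omega> u"
  obtain z where z: "z \<notin> \<Omega>" "boundary_dist \<Omega> x = ereal (norm (x - z))"
    by (rule boundary_dist_attained[OF assms(1) \<open>\<Omega> \<noteq> UNIV\<close>, of x]) (rule that)
  obtain k where k: "k \<ge> 9/2 * ln 2" "c2_const = (1 - 2 powr (9/2) * exp (- k))\<^sup>2 / k ^ 3"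
    by (rule c2_const_attained) (rule that)
  have k0: "k > 0" using k(1) ln_gt_zero[of "2::real"] by linarith
  have "v x = S" using x uv sup by simp
  then have "1 \<le> lam * (v x / S / lam)" using S(1) lam by simp
  from distance_lower_bound[OF lam norm_ge_zero k(1) this bd[OF x(1) z(1) k0]]
  show "ereal (3^2 / 2^10 * c2_const * dirichlet_bottom \<Omega> powr (-1/2)) \<le> boundary_dist \<Omega> x"
    unfolding z(2) k(2) lam_def by simp
qed

lemma torsion_max_distance:
  fixes \<Omega> :: "(real^2) set"
  assumes "open \<Omega>" "simply_connected \<Omega>" "dirichlet_bottom \<Omega> > 0" "x \<in> \<Omega>"
    "\<And>y. y \<in> \<Omega> \<Longrightarrow> torsion \<Omega> y \<le> torsion \<Omega> x" "c \<ge> 9/2 * ln 2"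
  shows "ereal (3^2 / 2^10 * ((1 - 2 powr (9/2) * exp (- c))\<^sup>2 / c ^ 3) * dirichlet_bottom \<Omega> powr (-1/2)) \<le> boundary_dist \<Omega> x"
proof -
  have c: "c > 0" using assms(6) ln_gt_zero[of "2::real"] by linarith
  have "\<Omega> \<noteq> UNIV" using assms(3) dirichlet_bottom_UNIV by auto
  then obtain z where z: "z \<notin> \<Omega>" "boundary_dist \<Omega> x = ereal (norm (x - z))"
    by (rule boundary_dist_attained[OF assms(1), of x]) (rule that)
  obtain T where T: "torsion \<Omega> = (\<lambda>x. ereal (T x))" by (rule torsion_limit[OF assms(1,3)]) (rule that)
  have "1 \<le> dirichlet_bottom \<Omega> * T x"
    by (rule torsion_max_lower[OF assms(1) _ assms(3)]) (use assms(4,5) T in auto)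
  from distance_lower_bound[OF assms(3) norm_ge_zero assms(6) this]
  show ?thesis using torsion_le[OF assms(1,2,3) c assms(4)] by (simp add: z(2) T)
qed

theorem proposition2:
  fixes \<Omega> :: "(real^2) set"
  assumes "\<Omega> \<noteq> {}" and "open \<Omega>" and "simply_connected \<Omega>"
  shows "(dirichlet_bottom \<Omega> > 0 \<longrightarrow>
           (\<forall>c>0. \<forall>x\<in>\<Omega>. torsion \<Omega> x \<le> ereal
              (32/3 * real_of_ereal (boundary_dist \<Omega> x) powr (1/2)
                 * dirichlet_bottom \<Omega> powr (-3/4) * c powr (3/2)
               + inverse (dirichlet_bottom \<Omega>) * 2 powr (9/2) * exp (- c))))
       \<and> (dirichlet_bottom \<Omega> > 0 \<longrightarrow>
           (\<forall>x\<in>\<Omega>. (\<forall>y\<in>\<Omega>. torsion \<Omega> y \<le> torsion \<Omega> x) \<longrightarrow>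
              (\<forall>c\<ge>9/2 * ln 2. boundary_dist \<Omega> x \<ge> ereal
                 (3^2 / 2^10 * ((1 - 2 powr (9/2) * exp (- c))\<^sup>2 / c ^ 3)
                  * dirichlet_bottom \<Omega> powr (-1/2)))
            \<and> boundary_dist \<Omega> x \<ge> ereal
                 (3^2 / 2^10 * c2_const * dirichlet_bottom \<Omega> powr (-1/2))))
       \<and> ((\<forall>\<epsilon>::real. \<epsilon> > 0 \<longrightarrow> emeasure lebesgue {x\<in>\<Omega>. boundary_dist \<Omega> x > ereal \<epsilon>} < \<infinity>) \<longrightarrow>
           (\<forall>u. first_eigenfunction \<Omega> u \<longrightarrow>
              (\<exists>x\<in>\<Omega>. ereal (u x) = sup_norm_on \<Omega> u)
            \<and> (\<forall>x\<in>\<Omega>. ereal (u x) = sup_norm_on \<Omega> u \<longrightarrow>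
                 boundary_dist \<Omega> x \<ge> ereal
                   (3^2 / 2^10 * c2_const * dirichlet_bottom \<Omega> powr (-1/2)))))"
proof (intro conjI impI allI ballI)
  note \<Omega> = assms(2,3)
  fix c x assume pos: "dirichlet_bottom \<Omega> > 0" and "c > (0::real)" and x: "x \<in> \<Omega>"
  then show "torsion \<Omega> x \<le> ereal
              (32/3 * real_of_ereal (boundary_dist \<Omega> x) powr (1/2)
                 * dirichlet_bottom \<Omega> powr (-3/4) * c powr (3/2)
               + inverse (dirichlet_bottom \<Omega>) * 2 powr (9/2) * exp (- c))"
    by (intro torsion_le[OF \<Omega>])
next
  note \<Omega> = assms(2,3)
  fix x assume pos: "dirichlet_bottom \<Omega> > 0" and x: "x \<in> \<Omega>" "\<forall>y\<in>\<Omega>. torsion \<Omega> y \<le> torsion \<Omega> x"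
  have D: "boundary_dist \<Omega> x \<ge> ereal
      (3^2 / 2^10 * ((1 - 2 powr (9/2) * exp (- c))\<^sup>2 / c ^ 3) * dirichlet_bottom \<Omega> powr (-1/2))" if "c \<ge> 9/2 * ln 2" for c
    using torsion_max_distance[OF \<Omega> pos x(1) _ that] x(2) by blast
  show "boundary_dist \<Omega> x \<ge> ereal
      (3^2 / 2^10 * ((1 - 2 powr (9/2) * exp (- c))\<^sup>2 / c ^ 3) * dirichlet_bottom \<Omega> powr (-1/2))" if "c \<ge> 9/2 * ln 2" for c
    by (rule D[OF that])
  obtain k where k: "k \<ge> 9/2 * ln 2" "c2_const = (1 - 2 powr (9/2) * exp (- k))\<^sup>2 / k ^ 3"
    by (rule c2_const_attained) (rule that)
  show "boundary_dist \<Omega> x \<ge> ereal (3^2 / 2^10 * c2_const * dirichlet_bottom \<Omega> powr (-1/2))"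
    unfolding k(2) by (rule D[OF k(1)])
next
  fix u assume u: "first_eigenfunction \<Omega> u"
  note M = first_eigenfunction_max[OF assms(2,1,3) u]
  show "\<exists>x\<in>\<Omega>. ereal (u x) = sup_norm_on \<Omega> u" by (rule M(1))
  show "boundary_dist \<Omega> x \<ge> ereal (3^2 / 2^10 * c2_const * dirichlet_bottom \<Omega> powr (-1/2))"
    if "x \<in> \<Omega>" "ereal (u x) = sup_norm_on \<Omega> u" for x by (rule M(2)[OF that])
qed

end
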